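(* Let $n\ge1$ be an integer, let $F\in\mathbb{C}[x_1,\ldots,x_s]$ be a reduced non-constant polynomial, let $X=\mathbf{V}(F)\subset\mathbb{C}^s$, and assume that $0\in X$ is a singular point. Consider the following ideal in $\mathbb{C}[x_1,\ldots,x_s,t,u_J\mid J\in\Lambda]$: $$A=\langle F,\ u_J-t\Delta_J\mid J\in\Lambda\rangle.$$ Then the space of limits $\mathcal{L}_n(X,0)$ can be identified with the variety $$V:=\mathbf{V}\Big(\frac{A\cap\mathbb{C}[x_1,\ldots,x_s,u_J\mid J\in\Lambda]}{\langle x_1,\ldots,x_s\rangle}\Big)\subset\mathbb{C}^{\Lambda},$$ i.e. the zero set of the ideal of $\mathbb{C}[u_J\mid J\in\Lambda]$ obtained from $A\cap\mathbb{C}[x_1,\ldots,x_s,u_J\mid J\in\Lambda]$ by setting $x_1=\cdots=x_s=0$, in the following sense: $V$ is closed under multiplication by complex scalars, and the map sending $T\in\mathcal{L}_n(X,0)$ to the point of $\mathbb{P}(\mathbb{C}^\Lambda)$ given by the Plücker coordinates of $T^\perp$ is a bijection from $\mathcal{L}_n(X,0)$ onto the projectivization $\{[u]\mid u\in V\setminus\{0\}\}$ of $V$.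
   Context: $\mathbb{N}=\{0,1,2,\ldots\}$. For $\alpha,\beta\in\mathbb{N}^s$: $|\alpha|=\alpha_1+\cdots+\alpha_s$, $\alpha!=\alpha_1!\cdots\alpha_s!$, $\binom{\alpha}{\beta}=\prod_i\binom{\alpha_i}{\beta_i}$, $\alpha\le\beta$ means $\alpha_i\le\beta_i$ for all $i$, and $\partial^\alpha=\partial^{\alpha_1}_{x_1}\cdots\partial^{\alpha_s}_{x_s}$. Convention: $\partial^{\alpha-\beta}F=0$ if $\alpha_i<\beta_i$ for some $i$. Multi-indices are ordered increasingly by graded lexicographical order with $x_1<x_2<\cdots<x_s$: $\alpha<_{grlex}\beta$ iff $|\alpha|<|\beta|$, or $|\alpha|=|\beta|$ and $\alpha_i<\beta_i$ for the largest index $i$ with $\alpha_i\neq\beta_i$. Let $N=\binom{n+s}{s}$ and $M=\binom{n+s-1}{s}$. For $\beta\in\mathbb{N}^s$ with $0\le|\beta|\le n-1$ put $r_\beta:=\beta!\cdot\Big(\binom{\alpha}{\beta}\frac{\partial^{\alpha-\beta}F}{\alpha!}\ \Big|\ 1\le|\alpha|\le n\Big)$, a vector of $N-1$ polynomials with entries ordered increasingly in $\alpha$ by the graded lexicographical order $<_{grlex}$ (so its $\alpha$-entry is $\frac{\partial^{\alpha-\beta}F}{(\alpha-\beta)!}$ if $\alpha\ge\beta$ and $0$ otherwise). The Jacobian matrix of order $n$ of $F$, $\mathrm{Jac}_n(F)$, is the $M\times(N-1)$ matrix whose rows are the $M$ vectors $r_\beta$, ordered increasingly in $\beta$. Let $\Lambda=\{(\alpha_1,\ldots,\alpha_M)\mid\alpha_i\in\mathbb{N}^s,\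 1\le|\alpha_i|\le n,\ \alpha_1<_{grlex}\cdots<_{grlex}\alpha_M\}$. For $J\in\Lambda$, $\Delta_J$ is the determinant of the matrix formed by the $M$ columns of $\mathrm{Jac}_n(F)$ corresponding to $J$. For $p\in X$ let $(R_p,\mathfrak{m}_p)$ be the localization at $p$ of $\mathbb{C}[x_1,\ldots,x_s]/\langle F\rangle$ and $T^n_pX:=(\mathfrak{m}_p/\mathfrak{m}_p^{n+1})^\vee$. It is regarded as a subspace of $\mathbb{C}^{N-1}$ via $T^n_pX\subset T^n_p\mathbb{C}^s=(\mathfrak{a}_p/\mathfrak{a}_p^{n+1})^\vee\cong\mathbb{C}^{N-1}$, where $\mathfrak{a}_p\subset\mathbb{C}[x_1,\ldots,x_s]$ is the maximal ideal of $p$, $\mathfrak{a}_p/\mathfrak{a}_p^{n+1}\cong\mathbb{C}^{N-1}$ via $f\mapsto(\frac{\partial^\alpha f}{\alpha!}(p)\mid 1\le|\alpha|\le n)$, and $\mathbb{C}^{N-1}$ is identified with its dual through the standard basis. For $p$ non-singular, $T^n_pX=\ker\mathrm{Jac}_n(F)_{|p}$, of dimension $N-M-1$. Let $S(X)$ be the singular locus of $X$. The space of limits of $T^n_pX$ at $0$ is $$\mathcal{L}_n(X,0)=\{T\in Gr(N-M-1,\mathbb{C}^{N-1})\mid\exists\{p_k\}\subset X\setminus S(X)\text{ s.t. }p_k\to0\text{ and }T^n_{p_k}X\to T\},$$ with convergence in the Euclidean topology. For $T\subset\mathbb{C}^{N-1}$, $T^\perp=\{v\mid\sum_iv_it_i=0\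 \forall t\in T\}$ (bilinear pairing), giving the duality $Gr(N-M-1,\mathbb{C}^{N-1})\leftrightarrow Gr(M,\mathbb{C}^{N-1})$. The Plücker coordinates of an $M$-dimensional subspace are the $M\times M$ minors, indexed by $J\in\Lambda$, of a matrix whose rows form a basis of the subspace. *)

theory Defs
  imports
    "HOL-Analysis.Analysis"
    "HOL-Algebra.Ideal_Product"
    "HOL-Algebra.QuotRing"
    "HOL-Library.Poly_Mapping"
    "HOL-Library.Function_Algebras"
    "HOL-Computational_Algebra.Squarefree"
    "Jordan_Normal_Form.Determinant"
begin

section \<open>Complex polynomials in a set of variables\<close>

type_synonym 'v midx = "'v \<Rightarrow>\<^sub>0 nat"
type_synonym 'v mpoly = "'v midx \<Rightarrow>\<^sub>0 complex"

definition pconst :: "complex \<Rightarrow> 'v mpoly" where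
  "pconst c = Poly_Mapping.single 0 c"

definition pvar :: "'v \<Rightarrow> 'v mpoly" where
  "pvar v = Poly_Mapping.single (Poly_Mapping.single v 1) 1"

definition psubst :: "(complex \<Rightarrow> 'b::comm_ring_1) \<Rightarrow> ('v \<Rightarrow> 'b) \<Rightarrow> 'v mpoly \<Rightarrow> 'b" where
  "psubst h a f = (\<Sum>m\<in>Poly_Mapping.keys f.
     h (Poly_Mapping.lookup f m) * (\<Prod>v\<in>Poly_Mapping.keys m. a v ^ Poly_Mapping.lookup m v))"

definition peval :: "('v \<Rightarrow> complex) \<Rightarrow> 'v mpoly \<Rightarrow> complex" where
  "peval a f = psubst (\<lambda>c. c) a f"

definition polys_in :: "'v set \<Rightarrow> 'v mpoly set" where
  "polys_in V = {f. \<forall>m\<in>Poly_Mapping.keys f. Poly_Mapping.keys m \<subseteq> V}"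

definition poly_ring :: "'v set \<Rightarrow> 'v mpoly ring" where
  "poly_ring V = \<lparr>carrier = polys_in V, monoid.mult = (*), one = 1, zero = 0, add = (+)\<rparr>"

definition pderiv1 :: "'v \<Rightarrow> 'v mpoly \<Rightarrow> 'v mpoly" where
  "pderiv1 v f = (\<Sum>m\<in>Poly_Mapping.keys f.
     Poly_Mapping.single (m - Poly_Mapping.single v 1)
       (of_nat (Poly_Mapping.lookup m v) * Poly_Mapping.lookup f m))"


section \<open>Multi-indices\<close>

text \<open>The variables $x_1 < \dots < x_s$ are the elements of a finite linearly ordered type
  \<open>'s\<close>, so $s$ is \<open>CARD('s)\<close>.\<close>

definition mdeg :: "'s::finite midx \<Rightarrow> nat" where
  "mdeg \<alpha> = (\<Sum>i\<in>UNIV. Poly_Mapping.lookup \<alpha> i)"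

definition mfact :: "'s::finite midx \<Rightarrow> nat" where
  "mfact \<alpha> = (\<Prod>i\<in>UNIV. fact (Poly_Mapping.lookup \<alpha> i))"

definition mbinom :: "'s::finite midx \<Rightarrow> 's midx \<Rightarrow> nat" where
  "mbinom \<alpha> \<beta> = (\<Prod>i\<in>UNIV. Poly_Mapping.lookup \<alpha> i choose Poly_Mapping.lookup \<beta> i)"

definition mle :: "'s midx \<Rightarrow> 's midx \<Rightarrow> bool" where
  "mle \<alpha> \<beta> \<longleftrightarrow> (\<forall>i. Poly_Mapping.lookup \<alpha> i \<le> Poly_Mapping.lookup \<beta> i)"

definition grlex :: "'s::{finite,linorder} midx \<Rightarrow> 's midx \<Rightarrow> bool" where
  "grlex \<alpha> \<beta> \<longleftrightarrow> mdeg \<alpha> < mdeg \<beta> \<or>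
     mdeg \<alpha> = mdeg \<beta> \<and>
     (\<exists>i. Poly_Mapping.lookup \<alpha> i < Poly_Mapping.lookup \<beta> i \<and>
          (\<forall>j>i. Poly_Mapping.lookup \<alpha> j = Poly_Mapping.lookup \<beta> j))"

definition grlex_list :: "'s::{finite,linorder} midx set \<Rightarrow> 's midx list" where
  "grlex_list A = (THE xs. set xs = A \<and> sorted_wrt grlex xs)"

definition mderiv :: "'s::{finite,linorder} midx \<Rightarrow> 's mpoly \<Rightarrow> 's mpoly" where
  "mderiv \<alpha> f =
     foldr (\<lambda>i. pderiv1 i ^^ Poly_Mapping.lookup \<alpha> i) (sorted_list_of_set UNIV) f"

definition col_idx :: "nat \<Rightarrow> 's::finite midx set" where
  "col_idx n = {\<alpha>. 1 \<le> mdeg \<alpha> \<and> mdeg \<alpha> \<le> n}"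

definition row_idx :: "nat \<Rightarrow> 's::finite midx set" where
  "row_idx n = {\<beta>. mdeg \<beta> \<le> n - 1}"

definition numN :: "'s::finite itself \<Rightarrow> nat \<Rightarrow> nat" where
  "numN _ n = (n + CARD('s)) choose CARD('s)"

definition numM :: "'s::finite itself \<Rightarrow> nat \<Rightarrow> nat" where
  "numM _ n = (n + CARD('s) - 1) choose CARD('s)"

definition Lam :: "nat \<Rightarrow> 's::{finite,linorder} midx list set" where
  "Lam n = {J. length J = numM TYPE('s) n \<and> set J \<subseteq> col_idx n \<and> sorted_wrt grlex J}"


section \<open>The Jacobian matrix of order n and its maximal minors\<close>

text \<open>Matrices with columns indexed by multi-indices are functions of a row number and a
  multi-index. The order of the columns enters only through \<open>Lam\<close>, whose elements
  are increasing.\<close>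

definition jac_row :: "'s::{finite,linorder} mpoly \<Rightarrow> 's midx \<Rightarrow> 's midx \<Rightarrow> 's mpoly" where
  "jac_row F \<beta> \<alpha> =
     pconst (of_nat (mfact \<beta>)) *
       (pconst (of_nat (mbinom \<alpha> \<beta>) / of_nat (mfact \<alpha>)) *
         (if mle \<beta> \<alpha> then mderiv (\<alpha> - \<beta>) F else 0))"

definition Jac :: "nat \<Rightarrow> 's::{finite,linorder} mpoly \<Rightarrow> nat \<Rightarrow> 's midx \<Rightarrow> 's mpoly" where
  "Jac n F i \<alpha> = jac_row F (grlex_list (row_idx n) ! i) \<alpha>"

definition minor :: "(nat \<Rightarrow> 'i \<Rightarrow> 'a::comm_ring_1) \<Rightarrow> 'i list \<Rightarrow> 'a" where
  "minor B J = Determinant.det (Matrix.mat (length J) (length J) (\<lambda>(i, j). B i (J ! j)))"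

definition Delta :: "nat \<Rightarrow> 's::{finite,linorder} mpoly \<Rightarrow> 's midx list \<Rightarrow> 's mpoly" where
  "Delta n F J = minor (Jac n F) J"


section \<open>Coordinate spaces, Grassmannians, projective points\<close>

text \<open>For a finite set \<open>I\<close>, the space $\mathbb{C}^I$ consists of the functions
  supported in \<open>I\<close>; its Euclidean topology is the topology of pointwise
  convergence.\<close>

definition csc :: "complex \<Rightarrow> ('i \<Rightarrow> complex) \<Rightarrow> 'i \<Rightarrow> complex" where
  "csc c v = (\<lambda>i. c * v i)"

interpretation cv: vector_space csc
  by unfold_locales (auto simp: csc_def fun_eq_iff algebra_simps)

definition cspace :: "'i set \<Rightarrow> ('i \<Rightarrow> complex) set" where
  "cspace I = {v. \<forall>i. i \<notin> I \<longrightarrow> v i = 0}"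

definition Gr :: "nat \<Rightarrow> 'i set \<Rightarrow> ('i \<Rightarrow> complex) set set" where
  "Gr d I = {T. cv.subspace T \<and> T \<subseteq> cspace I \<and> cv.dim T = d}"

definition frames :: "nat \<Rightarrow> 'i set \<Rightarrow> (nat \<Rightarrow> 'i \<Rightarrow> complex) set" where
  "frames d I = {B. (\<forall>k<d. B k \<in> cspace I) \<and> (\<forall>k\<ge>d. B k = 0) \<and>
     inj_on B {..<d} \<and> cv.independent (B ` {..<d})}"

definition frame_span :: "nat \<Rightarrow> (nat \<Rightarrow> 'i \<Rightarrow> complex) \<Rightarrow> ('i \<Rightarrow> complex) set" where
  "frame_span d B = cv.span (B ` {..<d})"

text \<open>The Euclidean topology of the Grassmannian is the quotient topology of the space of
  frames (that is, of matrices of full rank) under the map sending a frame to its span.\<close>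

definition Gr_top :: "nat \<Rightarrow> 'i set \<Rightarrow> ('i \<Rightarrow> complex) set topology" where
  "Gr_top d I = topology (\<lambda>\<U>. \<U> \<subseteq> Gr d I \<and>
     openin (top_of_set (frames d I)) {B \<in> frames d I. frame_span d B \<in> \<U>})"

lemma openin_Gr_top:
  "openin (Gr_top d I) \<U> \<longleftrightarrow> \<U> \<subseteq> Gr d I \<and>
     openin (top_of_set (frames d I)) {B \<in> frames d I. frame_span d B \<in> \<U>}"
proof -
  have "istopology (\<lambda>\<U>. \<U> \<subseteq> Gr d I \<and>
     openin (top_of_set (frames d I)) {B \<in> frames d I. frame_span d B \<in> \<U>})"
    unfolding istopology_def
  proof (intro conjI allI impI; (elim conjE)?)
    fix S T :: "('a \<Rightarrow> complex) set set"
    assume "S \<subseteq> Gr d I"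
    then show "S \<inter> T \<subseteq> Gr d I" by blast
  next
    fix S T :: "('a \<Rightarrow> complex) set set"
    assume "openin (top_of_set (frames d I)) {B \<in> frames d I. frame_span d B \<in> S}"
      and "openin (top_of_set (frames d I)) {B \<in> frames d I. frame_span d B \<in> T}"
    moreover have "{B \<in> frames d I. frame_span d B \<in> S \<inter> T} =
        {B \<in> frames d I. frame_span d B \<in> S} \<inter> {B \<in> frames d I. frame_span d B \<in> T}"
      by blast
    ultimately show "openin (top_of_set (frames d I)) {B \<in> frames d I. frame_span d B \<in> S \<inter> T}"
      by (simp only: openin_Int)
  next
    fix K :: "('a \<Rightarrow> complex) set set set"
    assume K: "\<forall>S\<in>K. S \<subseteq> Gr d I \<and>
      openin (top_of_set (frames d I)) {B \<in> frames d I. frame_span d B \<in> S}"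
    then show "\<Union>K \<subseteq> Gr d I" by blast
    have "{B \<in> frames d I. frame_span d B \<in> \<Union>K} =
        \<Union>((\<lambda>S. {B \<in> frames d I. frame_span d B \<in> S}) ` K)"
      by blast
    moreover have "openin (top_of_set (frames d I))
        (\<Union>((\<lambda>S. {B \<in> frames d I. frame_span d B \<in> S}) ` K))"
      by (rule openin_Union) (use K in auto)
    ultimately show "openin (top_of_set (frames d I)) {B \<in> frames d I. frame_span d B \<in> \<Union>K}"
      by (simp only:)
  qed
  then show ?thesis by (simp add: Gr_top_def topology_inverse')
qed

definition perp :: "'i set \<Rightarrow> ('i \<Rightarrow> complex) set \<Rightarrow> ('i \<Rightarrow> complex) set" where
  "perp I T = {v \<in> cspace I. \<forall>t\<in>T. (\<Sum>i\<in>I. v i * t i) = 0}"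

definition proj_pt :: "('i \<Rightarrow> complex) \<Rightarrow> ('i \<Rightarrow> complex) set" where
  "proj_pt u = {csc c u | c. c \<noteq> 0}"

text \<open>The choice of the basis does not affect the point \<open>pluecker n W\<close>: a change of basis
  multiplies all the minors by the same nonzero number.\<close>

definition pluecker ::
    "nat \<Rightarrow> ('s::{finite,linorder} midx \<Rightarrow> complex) set \<Rightarrow> ('s midx list \<Rightarrow> complex) set" where
  "pluecker n W =
     (let d = numM TYPE('s) n;
          B = (SOME B. B \<in> frames d (col_idx n) \<and> frame_span d B = W)
      in proj_pt (\<lambda>J. if J \<in> Lam n then minor B J else 0))"


section \<open>Localization\<close>

definition loc_rel :: "('a, 'b) ring_scheme \<Rightarrow> 'a set \<Rightarrow> (('a \<times> 'a) \<times> ('a \<times> 'a)) set" where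
  "loc_rel R S = {((a, s), (b, t)). a \<in> carrier R \<and> b \<in> carrier R \<and> s \<in> S \<and> t \<in> S \<and>
     (\<exists>u\<in>S. u \<otimes>\<^bsub>R\<^esub> (a \<otimes>\<^bsub>R\<^esub> t \<ominus>\<^bsub>R\<^esub> b \<otimes>\<^bsub>R\<^esub> s) = \<zero>\<^bsub>R\<^esub>)}"

definition loc_frac :: "('a, 'b) ring_scheme \<Rightarrow> 'a set \<Rightarrow> 'a \<Rightarrow> 'a \<Rightarrow> ('a \<times> 'a) set" where
  "loc_frac R S a s = loc_rel R S `` {(a, s)}"

definition localization :: "('a, 'b) ring_scheme \<Rightarrow> 'a set \<Rightarrow> ('a \<times> 'a) set ring" where
  "localization R S =
     \<lparr>carrier = (carrier R \<times> S) // loc_rel R S,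
      monoid.mult = (\<lambda>x y. \<Union>(a, s)\<in>x. \<Union>(b, t)\<in>y. loc_frac R S (a \<otimes>\<^bsub>R\<^esub> b) (s \<otimes>\<^bsub>R\<^esub> t)),
      one = loc_frac R S \<one>\<^bsub>R\<^esub> \<one>\<^bsub>R\<^esub>,
      zero = loc_frac R S \<zero>\<^bsub>R\<^esub> \<one>\<^bsub>R\<^esub>,
      add = (\<lambda>x y. \<Union>(a, s)\<in>x. \<Union>(b, t)\<in>y.
               loc_frac R S (a \<otimes>\<^bsub>R\<^esub> t \<oplus>\<^bsub>R\<^esub> b \<otimes>\<^bsub>R\<^esub> s) (s \<otimes>\<^bsub>R\<^esub> t))\<rparr>"


section \<open>The hypersurface and its higher order tangent spaces\<close>

definition hypersurface :: "'s::finite mpoly \<Rightarrow> (complex ^ 's) set" where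
  "hypersurface F = {p. peval (vec_nth p) F = 0}"

text \<open>Jacobian criterion; this is the singular locus of the hypersurface when
  \<open>F\<close> is reduced.\<close>

definition sing_locus :: "'s::finite mpoly \<Rightarrow> (complex ^ 's) set" where
  "sing_locus F = {p \<in> hypersurface F. \<forall>i. peval (vec_nth p) (pderiv1 i F) = 0}"

definition point_ideal :: "complex ^ 's \<Rightarrow> 's::finite mpoly set" where
  "point_ideal p = {f. peval (vec_nth p) f = 0}"

definition coord_ring :: "'s mpoly \<Rightarrow> 's mpoly set ring" where
  "coord_ring F = poly_ring UNIV Quot (Idl\<^bsub>poly_ring UNIV\<^esub> {F})"

definition coord_class :: "'s mpoly \<Rightarrow> 's mpoly \<Rightarrow> 's mpoly set" where
  "coord_class F f = (Idl\<^bsub>poly_ring UNIV\<^esub> {F}) +>\<^bsub>poly_ring UNIV\<^esub> f"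

definition loc_set :: "'s::finite mpoly \<Rightarrow> complex ^ 's \<Rightarrow> 's mpoly set set" where
  "loc_set F p = carrier (coord_ring F) - coord_class F ` point_ideal p"

type_synonym 's loc_elt = "('s mpoly set \<times> 's mpoly set) set"

definition local_ring :: "'s::finite mpoly \<Rightarrow> complex ^ 's \<Rightarrow> 's loc_elt ring" where
  "local_ring F p = localization (coord_ring F) (loc_set F p)"

definition loc_class :: "'s::finite mpoly \<Rightarrow> complex ^ 's \<Rightarrow> 's mpoly \<Rightarrow> 's loc_elt" where
  "loc_class F p f = loc_frac (coord_ring F) (loc_set F p) (coord_class F f) \<one>\<^bsub>coord_ring F\<^esub>"

definition max_ideal :: "'s::finite mpoly \<Rightarrow> complex ^ 's \<Rightarrow> 's loc_elt set" where
  "max_ideal F p = {loc_frac (coord_ring F) (loc_set F p) a s | a s.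
     a \<in> coord_class F ` point_ideal p \<and> s \<in> loc_set F p}"

definition max_pow :: "nat \<Rightarrow> 's::finite mpoly \<Rightarrow> complex ^ 's \<Rightarrow> 's loc_elt set" where
  "max_pow k F p = max_ideal F p [^]\<^bsub>ideals_set (local_ring F p)\<^esub> k"

text \<open>The quotient $\mathfrak{m}_p/\mathfrak{m}_p^{n+1}$ is taken inside the
  $\mathbb{C}$-algebra $R_p/\mathfrak{m}_p^{n+1}$.\<close>

definition trunc_ring :: "nat \<Rightarrow> 's::finite mpoly \<Rightarrow> complex ^ 's \<Rightarrow> 's loc_elt set ring" where
  "trunc_ring n F p = local_ring F p Quot max_pow (n + 1) F p"

definition trunc_class :: "nat \<Rightarrow> 's::finite mpoly \<Rightarrow> complex ^ 's \<Rightarrow> 's mpoly \<Rightarrow> 's loc_elt set" where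
  "trunc_class n F p f = max_pow (n + 1) F p +>\<^bsub>local_ring F p\<^esub> loc_class F p f"

definition cotangent :: "nat \<Rightarrow> 's::finite mpoly \<Rightarrow> complex ^ 's \<Rightarrow> 's loc_elt set set" where
  "cotangent n F p = (\<lambda>a. max_pow (n + 1) F p +>\<^bsub>local_ring F p\<^esub> a) ` max_ideal F p"

definition cotangent_dual ::
    "nat \<Rightarrow> 's::finite mpoly \<Rightarrow> complex ^ 's \<Rightarrow> ('s loc_elt set \<Rightarrow> complex) set" where
  "cotangent_dual n F p = {\<phi>.
     (\<forall>x\<in>cotangent n F p. \<forall>y\<in>cotangent n F p. \<phi> (x \<oplus>\<^bsub>trunc_ring n F p\<^esub> y) = \<phi> x + \<phi> y) \<and>
     (\<forall>c. \<forall>x\<in>cotangent n F p.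
        \<phi> (trunc_class n F p (pconst c) \<otimes>\<^bsub>trunc_ring n F p\<^esub> x) = c * \<phi> x)}"

text \<open>The inclusion of the dual of $\mathfrak{m}_p/\mathfrak{m}_p^{n+1}$ in the dual of
  $\mathfrak{a}_p/\mathfrak{a}_p^{n+1}$ is composition with the map induced by
  \<open>trunc_class\<close>; a vector of coordinates represents a functional on
  $\mathfrak{a}_p/\mathfrak{a}_p^{n+1}$ by pairing it with the Taylor coefficients at $p$.\<close>

definition htangent ::
    "nat \<Rightarrow> 's::{finite,linorder} mpoly \<Rightarrow> (complex, 's) Finite_Cartesian_Product.vec \<Rightarrow>
      ('s midx \<Rightarrow> complex) set" where
  "htangent n F p = {v \<in> cspace (col_idx n). \<exists>\<phi>\<in>cotangent_dual n F p. \<forall>f\<in>point_ideal p.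
     \<phi> (trunc_class n F p f) =
       (\<Sum>\<alpha>\<in>col_idx n. v \<alpha> * (peval (vec_nth p) (mderiv \<alpha> f) / of_nat (mfact \<alpha>)))}"

definition limit_spaces :: "nat \<Rightarrow> 's::{finite,linorder} mpoly \<Rightarrow> ('s midx \<Rightarrow> complex) set set" where
  "limit_spaces n F =
     (let d = numN TYPE('s) n - numM TYPE('s) n - 1
      in {T \<in> Gr d (col_idx n). \<exists>p :: nat \<Rightarrow> (complex, 's) Finite_Cartesian_Product.vec.
            (\<forall>k. p k \<in> hypersurface F - sing_locus F) \<and> p \<longlonglongrightarrow> 0 \<and>
            limitin (Gr_top d (col_idx n)) (\<lambda>k. htangent n F (p k)) T sequentially})"


section \<open>The elimination ideal\<close>

datatype 's evar = Xvar 's | Tvar | Uvar "'s midx list"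

definition all_vars :: "nat \<Rightarrow> 's::{finite,linorder} evar set" where
  "all_vars n = Xvar ` UNIV \<union> {Tvar} \<union> Uvar ` Lam n"

definition elim_vars :: "nat \<Rightarrow> 's::{finite,linorder} evar set" where
  "elim_vars n = Xvar ` UNIV \<union> Uvar ` Lam n"

definition emb :: "'s mpoly \<Rightarrow> 's evar mpoly" where
  "emb f = psubst pconst (\<lambda>i. pvar (Xvar i)) f"

definition ideal_A :: "nat \<Rightarrow> 's::{finite,linorder} mpoly \<Rightarrow> 's evar mpoly set" where
  "ideal_A n F = Idl\<^bsub>poly_ring (all_vars n)\<^esub>
     (insert (emb F) {pvar (Uvar J) - pvar Tvar * emb (Delta n F J) | J. J \<in> Lam n})"

text \<open>The substitution $x_1 = \dots = x_s = 0$; the value at \<open>Tvar\<close> is irrelevant, as it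
  is applied to polynomials without \<open>Tvar\<close> only.\<close>

definition set_x0 :: "'s evar mpoly \<Rightarrow> 's midx list mpoly" where
  "set_x0 f = psubst pconst
     (\<lambda>v. case v of Xvar i \<Rightarrow> 0 | Tvar \<Rightarrow> 0 | Uvar J \<Rightarrow> pvar J) f"

definition limit_variety :: "nat \<Rightarrow> 's::{finite,linorder} mpoly \<Rightarrow> ('s midx list \<Rightarrow> complex) set" where
  "limit_variety n F = {u \<in> cspace (Lam n).
     \<forall>g \<in> set_x0 ` (ideal_A n F \<inter> polys_in (elim_vars n)). peval u g = 0}"

end

theory Submission
  imports Defs "Jordan_Normal_Form.Char_Poly" "HOL-Computational_Algebra.Field_as_Ring"
begin

text \<open>
  Everything rests on one description of \<open>V = limit_variety n F\<close>: a vector \<open>u\<close> belongs to \<open>V\<close>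
  exactly when it is a limit of vectors $t_k\,(\Delta_J(x_k))_J$ for scalars $t_k$ and points
  $x_k$ of the hypersurface that tend to $0$ (\<open>limit_variety_if\<close>, \<open>limit_variety_only_if\<close>).

  With this description the theorem is linear algebra and compactness. At a nonsingular point $p$
  the tangent space $T^n_pX$ is the kernel of the Jacobian matrix (\<open>htangent_perp\<close>), whose rows are
  independent (\<open>jac_at_frame\<close>). Its complement is therefore the row space, with Pluecker
  coordinates $(\Delta_J(p))_J$ up to a scalar. At a singular point all $\Delta_J$ vanish
  (\<open>Delta_singular\<close>), so a nonzero limit can only come from nonsingular points. Spaces of a fixed
  dimension have orthonormal frames, and these form a compact set; so along a subsequence both
  $T^n_{p_k}X$ and its complement converge, and so do suitable multiples of the vectors
  $(\Delta_J(p_k))_J$ (\<open>tangent_compactness\<close>). This turns limits of tangent spaces into points of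
  \<open>V\<close> and back. The map is injective because maximal minors determine the row space
  (\<open>minors_determine_span\<close>), and $T$ is recovered as the complement of its complement.

  In the description of \<open>V\<close>, the limits are in \<open>V\<close> by continuity: an element of $A$ without the
  variable $t$ vanishes at $(x, (t\Delta_J(x))_J)$ whenever $F(x) = 0$. The converse is a closure theorem, which
  needs a passage from the Zariski topology to the Euclidean topology. If $u_{J_0} \neq 0$ and
  $h = \Delta_{J_0}$, some prime ideal $Q$ contains the elimination ideal, vanishes at $(0,u)$ and
  does not contain $h$. Points of the zero set of $Q$ with $h \neq 0$ come arbitrarily close to $(0,u)$
  (\<open>prime_zero_set_dense\<close>), and at such a point \<open>t = u\<^sub>J\<^sub>0 / h\<close> solves the equations of $A$.

  The density statement comes from Noether normalization: the zero set of $Q$ is finite over an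
  affine space. A linear form \<open>g\<close> separates the points in the fibre of a given point $p$;
  the roots of the minimal polynomial of \<open>g\<close> depend continuously on the base point
  (\<open>monic_root_near\<close>), every root is taken by a point of the zero set (\<open>lying_over\<close>), and the
  fibres stay bounded (\<open>monic_root_bound\<close>). The minimal polynomial is monic because
  polynomial rings are normal, which is shown by Gauss's lemma on lines (\<open>gauss_divides\<close>).

  The kernel description of $T^n_pX$ comes from the fact that, modulo $\mathfrak{m}_p^{n+1}$,
  every denominator can be replaced by a polynomial (\<open>inverse_mod_vanishing\<close>). A functional of Taylor coefficients
  descends to $\mathfrak{m}_p/\mathfrak{m}_p^{n+1}$ exactly when it kills all multiples of $F$
  (\<open>pairing_well_defined\<close>, \<open>htangent_eq\<close>), and the monomial multiples of $F$ are the rows of the matrix.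
\<close>

section \<open>Frames, orthonormal frames and bilinear complements\<close>

lemma csc_apply [simp]: "csc c v i = c * v i" by (simp add: csc_def)

lemma csc_sum_apply: "(\<Sum>k\<in>K. csc (c k) (B k)) i = (\<Sum>k\<in>K. c k * B k i)"
  by (induction K rule: infinite_finite_induct) simp_all

lemma subspace_cspace: "cv.subspace (cspace I)"
  unfolding cv.subspace_def by (auto simp: cspace_def)

text \<open>Coordinates turn membership in a span into a finite system of equations.\<close>
lemma in_frame_span: "v \<in> frame_span d B \<longleftrightarrow> (\<exists>c. \<forall>i. v i = (\<Sum>k<d. c k * B k i))"
proof
  let ?S = "{v. \<exists>c. \<forall>i. v i = (\<Sum>k<d. c k * B k i)}"
  have "cv.subspace ?S" unfolding cv.subspace_def
  proof (intro conjI ballI allI)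
    show "0 \<in> ?S" by (auto intro!: exI[of _ "\<lambda>_. 0"])
    fix v assume "v \<in> ?S"
    then obtain a where a: "\<forall>i. v i = (\<Sum>k<d. a k * B k i)" by blast
    show "v + w \<in> ?S" if w: "w \<in> ?S" for w
    proof -
      obtain b where "\<forall>i. w i = (\<Sum>k<d. b k * B k i)" using w by blast
      then have "\<forall>i. (v + w) i = (\<Sum>k<d. (a k + b k) * B k i)" using a by (simp add: distrib_right sum.distrib)
      then show ?thesis by (intro CollectI exI[of _ "\<lambda>k. a k + b k"])
    qed
    show "csc c v \<in> ?S" for c
    proof -
      have "\<forall>i. csc c v i = (\<Sum>k<d. (c * a k) * B k i)" using a by (simp add: sum_distrib_left mult.assoc)
      then show ?thesis by (intro CollectI exI[of _ "\<lambda>k. c * a k"])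
    qed
  qed
  moreover have "B ` {..<d} \<subseteq> ?S"
  proof (rule image_subsetI)
    fix k assume "k \<in> {..<d}"
    then have "\<forall>i. B k i = (\<Sum>j<d. (if j = k then 1 else 0) * B j i)" by (simp add: if_distrib[of "\<lambda>x. x * _"] cong: if_cong)
    then show "B k \<in> ?S" by (intro CollectI exI[of _ "\<lambda>j. if j = k then 1 else 0"])
  qed
  ultimately have "frame_span d B \<subseteq> ?S" unfolding frame_span_def by (intro cv.span_minimal)
  then show "v \<in> frame_span d B \<Longrightarrow> \<exists>c. \<forall>i. v i = (\<Sum>k<d. c k * B k i)" by blast
next
  assume "\<exists>c. \<forall>i. v i = (\<Sum>k<d. c k * B k i)"
  then obtain c where "\<forall>i. v i = (\<Sum>k<d. c k * B k i)" ..
  then have "v = (\<Sum>k<d. csc (c k) (B k))" by (intro ext) (simp add: csc_sum_apply)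
  also have "\<dots> \<in> frame_span d B" unfolding frame_span_def
    by (intro cv.span_sum cv.span_scale cv.span_base) auto
  finally show "v \<in> frame_span d B" .
qed

lemma frame_in_span: "k < d \<Longrightarrow> B k \<in> frame_span d B"
  unfolding frame_span_def by (rule cv.span_base) auto

text \<open>Independence of an indexed family of rows. Together with the support conditions it characterizes
  frames (\<open>frames_iff\<close>), and it does not mention the set of the rows.\<close>
definition row_indep :: "nat \<Rightarrow> (nat \<Rightarrow> 'i \<Rightarrow> complex) \<Rightarrow> bool" where
  "row_indep d B \<longleftrightarrow> (\<forall>c. (\<forall>i. (\<Sum>k<d. c k * B k i) = 0) \<longrightarrow> (\<forall>k<d. c k = 0))"

lemma row_indepD: "row_indep d B \<Longrightarrow> (\<And>i. (\<Sum>k<d. c k * B k i) = 0) \<Longrightarrow> k < d \<Longrightarrow> c k = 0"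
  unfolding row_indep_def by simp

lemma frames_iff:
  "B \<in> frames d I \<longleftrightarrow> (\<forall>k<d. B k \<in> cspace I) \<and> (\<forall>k\<ge>d. B k = 0) \<and> row_indep d B"
proof -
  have "inj_on B {..<d} \<and> cv.independent (B ` {..<d}) \<longleftrightarrow> row_indep d B"
  proof
    assume *: "inj_on B {..<d} \<and> cv.independent (B ` {..<d})"
    show "row_indep d B" unfolding row_indep_def
    proof (intro allI impI)
      fix c k assume c: "\<forall>i. (\<Sum>k<d. c k * B k i) = 0" and k: "k < d"
      let ?u = "\<lambda>x. c (inv_into {..<d} B x)"
      have "(\<Sum>x\<in>B ` {..<d}. csc (?u x) x) = (\<Sum>k<d. csc (?u (B k)) (B k))"
        using * by (simp add: sum.reindex)
      also have "\<dots> = (\<Sum>k<d. csc (c k) (B k))" using * by (intro sum.cong refl) simp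
      also have "\<dots> = 0" by (intro ext) (simp add: csc_sum_apply c)
      finally have "?u (B k) = 0" using cv.independentD[of "B ` {..<d}" "B ` {..<d}" ?u "B k"] * k by blast
      then show "c k = 0" using * k by simp
    qed
  next
    assume r: "row_indep d B"
    have inj: "inj_on B {..<d}"
    proof (rule inj_onI, rule ccontr)
      fix j k assume jk: "j \<in> {..<d}" "k \<in> {..<d}" "B j = B k" "j \<noteq> k"
      let ?c = "\<lambda>l. (if l = j then 1 else 0) - (if l = k then 1 else (0::complex))"
      have "(\<Sum>l<d. ?c l * B l i) = 0" for i
        using jk by (simp add: left_diff_distrib sum_subtractf if_distrib[of "\<lambda>x. x * _"] cong: if_cong)
      from row_indepD[OF r this, of j] have "?c j = 0" using jk(1) by simp
      then show False using jk by simp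
    qed
    moreover have "cv.independent (B ` {..<d})"
    proof (rule cv.independent_if_scalars_zero)
      fix f x assume f: "(\<Sum>x\<in>B ` {..<d}. csc (f x) x) = 0" "x \<in> B ` {..<d}"
      have "(\<Sum>k<d. csc (f (B k)) (B k)) = 0" using f(1) inj by (simp add: sum.reindex)
      then have "(\<Sum>k<d. f (B k) * B k i) = 0" for i using csc_sum_apply[of "\<lambda>k. f (B k)" B "{..<d}" i] by simp
      then have "\<forall>k<d. f (B k) = 0" using row_indepD[OF r, of "\<lambda>k. f (B k)"] by simp
      then show "f x = 0" using f(2) by auto
    qed simp
    ultimately show "inj_on B {..<d} \<and> cv.independent (B ` {..<d})" by blast
  qed
  then show ?thesis unfolding frames_def by blast
qed

lemma frame_span_Gr: assumes "B \<in> frames d I" shows "frame_span d B \<in> Gr d I"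
proof -
  have "frame_span d B \<subseteq> cspace I" unfolding frame_span_def
    by (rule cv.span_minimal) (use assms subspace_cspace in \<open>auto simp: frames_def\<close>)
  moreover have "cv.dim (frame_span d B) = d"
    using assms unfolding frame_span_def frames_def by (subst cv.dim_span_eq_card_independent) (auto simp: card_image)
  ultimately show ?thesis unfolding Gr_def frame_span_def by (simp add: cv.subspace_span)
qed

text \<open>The Hermitian form only normalizes frames; the complement \<open>perp\<close> is taken for the
  bilinear pairing.\<close>
definition herm :: "'i set \<Rightarrow> ('i \<Rightarrow> complex) \<Rightarrow> ('i \<Rightarrow> complex) \<Rightarrow> complex" where
  "herm I v w = (\<Sum>i\<in>I. v i * cnj (w i))"

definition orthonormal :: "nat \<Rightarrow> 'i set \<Rightarrow> (nat \<Rightarrow> 'i \<Rightarrow> complex) \<Rightarrow> bool" where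
  "orthonormal d I B \<longleftrightarrow> (\<forall>k<d. B k \<in> cspace I) \<and> (\<forall>k\<ge>d. B k = 0) \<and>
     (\<forall>j<d. \<forall>k<d. herm I (B j) (B k) = (if j = k then 1 else 0))"

lemma herm_sum_left: "(\<And>i. i \<in> I \<Longrightarrow> v i = (\<Sum>k<d. c k * B k i)) \<Longrightarrow> herm I v w = (\<Sum>k<d. c k * herm I (B k) w)"
  unfolding herm_def by (simp add: sum_distrib_left sum_distrib_right mult.assoc) (rule sum.swap)

lemma herm_self: "herm I v v = of_real (\<Sum>i\<in>I. (cmod (v i))\<^sup>2)"
  unfolding herm_def by (simp add: complex_norm_square[symmetric])

lemma herm_cnj: "herm I w v = cnj (herm I v w)"
  unfolding herm_def by (simp add: mult.commute)

lemma orthonormal_frame: assumes "orthonormal d I B" shows "B \<in> frames d I"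
  unfolding frames_iff
proof (intro conjI)
  show "row_indep d B" unfolding row_indep_def
  proof (intro allI impI)
    fix c k assume c: "\<forall>i. (\<Sum>k<d. c k * B k i) = 0" and k: "k < d"
    have "0 = herm I (\<lambda>_. 0) (B k)" by (simp add: herm_def)
    also have "\<dots> = (\<Sum>j<d. c j * herm I (B j) (B k))" by (rule herm_sum_left) (use c in simp)
    also have "\<dots> = (\<Sum>j<d. if j = k then c k else 0)" using assms k by (intro sum.cong refl) (auto simp: orthonormal_def)
    finally show "c k = 0" using k by simp
  qed
qed (use assms in \<open>auto simp: orthonormal_def\<close>)

text \<open>The Gram--Schmidt step.\<close>
lemma orthonormal_extend:
  assumes I: "finite I" and B: "orthonormal d I B" and W: "cv.subspace W" "W \<subseteq> cspace I" and BW: "\<And>k. k < d \<Longrightarrow> B k \<in> W"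
    and w: "w \<in> W" "w \<notin> frame_span d B"
  shows "\<exists>b\<in>W. orthonormal (Suc d) I (B(d := b))"
proof -
  have o: "herm I (B j) (B k) = (if j = k then 1 else 0)" if "j < d" "k < d" for j k using B that by (simp add: orthonormal_def)
  define p where "p = (\<Sum>k<d. csc (herm I w (B k)) (B k))"
  define v where "v = w - p"
  have pi: "p i = (\<Sum>k<d. herm I w (B k) * B k i)" for i by (simp add: p_def csc_sum_apply)
  have pspan: "p \<in> frame_span d B" unfolding in_frame_span pi by (rule exI[of _ "\<lambda>k. herm I w (B k)"]) simp
  have "p \<in> W" unfolding p_def by (intro cv.subspace_sum cv.subspace_scale W BW) auto
  then have vW: "v \<in> W" unfolding v_def by (intro cv.subspace_diff W w)
  have "v \<noteq> 0" using w(2) pspan by (auto simp: v_def)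
  have hv: "herm I v (B k) = 0" if "k < d" for k
  proof -
    have "herm I p (B k) = (\<Sum>j<d. herm I w (B j) * herm I (B j) (B k))" by (rule herm_sum_left) (rule pi)
    also have "\<dots> = (\<Sum>j<d. if j = k then herm I w (B k) else 0)" using that by (intro sum.cong refl) (auto simp: o)
    finally have "herm I p (B k) = herm I w (B k)" using that by simp
    moreover have "herm I v (B k) = herm I w (B k) - herm I p (B k)"
      by (simp add: herm_def v_def left_diff_distrib sum_subtractf)
    ultimately show ?thesis by simp
  qed
  define N where "N = (\<Sum>i\<in>I. (cmod (v i))\<^sup>2)"
  have "N \<noteq> 0"
  proof
    assume "N = 0"
    then have "v i = 0" if "i \<in> I" for i using that I unfolding N_def by (simp add: sum_nonneg_eq_0_iff)
    moreover have "v i = 0" if "i \<notin> I" for i using that vW W(2) by (auto simp: cspace_def)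
    ultimately have "v = 0" by (intro ext) (metis zero_fun_apply)
    then show False using \<open>v \<noteq> 0\<close> by simp
  qed
  moreover have "N \<ge> 0" unfolding N_def by (intro sum_nonneg) simp
  ultimately have N: "N > 0" by simp
  define b where "b = csc (1 / of_real (sqrt N)) v"
  have bW: "b \<in> W" unfolding b_def by (intro cv.subspace_scale W vW)
  have hb: "herm I b x = (1 / of_real (sqrt N)) * herm I v x" for x
    by (simp add: herm_def b_def sum_distrib_left sum_divide_distrib)
  have bb: "herm I b b = 1"
  proof -
    have "herm I v b = cnj (herm I b v)" by (rule herm_cnj)
    also have "\<dots> = of_real (N / sqrt N)" unfolding hb[of v] herm_self[of I v] N_def[symmetric] by simp
    also have "N / sqrt N = sqrt N" using N by (simp add: real_div_sqrt)
    finally have hvb: "herm I v b = of_real (sqrt N)" .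
    show ?thesis unfolding hb[of b] hvb using N by simp
  qed
  have bB: "herm I b (B k) = 0" "herm I (B k) b = 0" if "k < d" for k
    using hb[of "B k"] hv[OF that] herm_cnj[of I "B k" b] by simp_all
  have "orthonormal (Suc d) I (B(d := b))" unfolding orthonormal_def
  proof (intro conjI allI impI)
    show "(B(d := b)) k \<in> cspace I" if "k < Suc d" for k using that B bW W(2) by (auto simp: orthonormal_def less_Suc_eq)
    show "(B(d := b)) k = 0" if "k \<ge> Suc d" for k using that B by (auto simp: orthonormal_def)
    show "herm I ((B(d := b)) j) ((B(d := b)) k) = (if j = k then 1 else 0)" if "j < Suc d" "k < Suc d" for j k
      using that bb bB o by (auto simp: less_Suc_eq)
  qed
  then show ?thesis using bW by blast
qed

lemma cspace_spanned: assumes "finite I" shows "\<exists>T. finite T \<and> card T \<le> card I \<and> cspace I \<subseteq> cv.span T"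
proof (intro exI conjI)
  let ?e = "\<lambda>i j. if j = i then 1 else (0::complex)"
  let ?T = "?e ` I"
  show "finite ?T" "card ?T \<le> card I" using assms by (auto intro: card_image_le)
  show "cspace I \<subseteq> cv.span ?T"
  proof
    fix v assume v: "v \<in> cspace I"
    have "v = (\<Sum>i\<in>I. csc (v i) (?e i))"
    proof (rule ext)
      fix j
      have "(\<Sum>i\<in>I. csc (v i) (?e i)) j = (\<Sum>i\<in>I. if i = j then v j else 0)" unfolding csc_sum_apply by (rule sum.cong) auto
      also have "\<dots> = v j" using assms v by (auto simp: cspace_def)
      finally show "v j = (\<Sum>i\<in>I. csc (v i) (?e i)) j" by simp
    qed
    also have "\<dots> \<in> cv.span ?T" by (intro cv.span_sum cv.span_scale cv.span_base) auto
    finally show "v \<in> cv.span ?T" .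
  qed
qed

lemma frame_length_le: assumes "B \<in> frames d I" "finite T" "\<And>k. k < d \<Longrightarrow> B k \<in> cv.span T" shows "d \<le> card T"
proof -
  have "card (B ` {..<d}) \<le> card T"
    using cv.independent_span_bound[of T "B ` {..<d}"] assms by (auto simp: frames_def)
  then show ?thesis using assms(1) by (simp add: frames_def card_image)
qed

text \<open>An orthonormal family of maximal length inside \<open>W\<close> spans \<open>W\<close>, because
  otherwise the Gram--Schmidt step would extend it. Lengths are bounded by
  \<open>frame_length_le\<close>.\<close>
lemma orthonormal_basis:
  assumes I: "finite I" and W: "cv.subspace W" "W \<subseteq> cspace I"
  shows "\<exists>B. orthonormal (cv.dim W) I B \<and> frame_span (cv.dim W) B = W"
proof -
  let ?P = "\<lambda>d. \<exists>B. orthonormal d I B \<and> (\<forall>k<d. B k \<in> W)"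
  obtain T where T: "finite T" "card T \<le> card I" "cspace I \<subseteq> cv.span T" using cspace_spanned[OF I] by blast
  have "?P 0" by (intro exI[of _ "\<lambda>_. 0"]) (simp add: orthonormal_def)
  moreover have "d \<le> card I" if "?P d" for d
  proof -
    from that have "\<exists>B. orthonormal d I B" by blast
    then obtain B where B: "orthonormal d I B" ..
    have "d \<le> card T"
      by (rule frame_length_le[OF orthonormal_frame[OF B] T(1)]) (use B T(3) in \<open>auto simp: orthonormal_def\<close>)
    then show ?thesis using T(2) by simp
  qed
  ultimately obtain d where d: "?P d" "\<And>e. ?P e \<Longrightarrow> e \<le> d"
    using GreatestI_nat[of ?P 0 "card I"] Greatest_le_nat[of ?P _ "card I"] by blast
  then obtain B where B: "orthonormal d I B" "\<And>k. k < d \<Longrightarrow> B k \<in> W" by blast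
  have "frame_span d B \<subseteq> W" unfolding frame_span_def by (rule cv.span_minimal[OF _ W(1)]) (use B in auto)
  moreover have "w \<in> frame_span d B" if "w \<in> W" for w
  proof (rule ccontr)
    assume "w \<notin> frame_span d B"
    from orthonormal_extend[OF I B(1) W B(2) that this] obtain b where "b \<in> W" "orthonormal (Suc d) I (B(d := b))" by blast
    then have "?P (Suc d)" using B(2) by (intro exI[of _ "B(d := b)"]) (auto simp: less_Suc_eq)
    then show False using d(2)[of "Suc d"] by simp
  qed
  ultimately have span: "frame_span d B = W" by blast
  have dim: "cv.dim W = d" using frame_span_Gr[OF orthonormal_frame[OF B(1)]] span by (simp add: Gr_def)
  show ?thesis unfolding dim using B(1) span by (intro exI[of _ B] conjI)
qed

lemma Gr_orthonormal: assumes "finite I" "T \<in> Gr d I" obtains B where "orthonormal d I B" "frame_span d B = T"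
proof -
  have T: "cv.subspace T" "T \<subseteq> cspace I" "cv.dim T = d" using assms(2) by (auto simp: Gr_def)
  from orthonormal_basis[OF assms(1) T(1,2)] obtain B where "orthonormal d I B" "frame_span d B = T" unfolding T(3) by (elim exE conjE)
  then show thesis by (rule that)
qed

text \<open>A proper inclusion would allow a longer orthonormal family inside the larger space.\<close>
lemma Gr_subset_eq: assumes I: "finite I" and T: "T \<in> Gr d I" "T' \<in> Gr d I" "T \<subseteq> T'" shows "T = T'"
proof (rule ccontr)
  assume "T \<noteq> T'"
  then obtain w where w: "w \<in> T'" "w \<notin> T" using T(3) by blast
  obtain B where B: "orthonormal d I B" "frame_span d B = T" by (rule Gr_orthonormal[OF I T(1)])
  obtain B' where B': "orthonormal d I B'" "frame_span d B' = T'" by (rule Gr_orthonormal[OF I T(2)])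
  have BT: "B k \<in> T'" if "k < d" for k using frame_in_span[OF that, of B] B(2) T(3) by blast
  have sub: "cv.subspace T'" "T' \<subseteq> cspace I" using T(2) by (auto simp: Gr_def)
  obtain b where b: "b \<in> T'" "orthonormal (Suc d) I (B(d := b))"
    using orthonormal_extend[OF I B(1) sub BT w(1)] w(2) B(2) by blast
  have "Suc d \<le> card (B' ` {..<d})"
  proof (rule frame_length_le[OF orthonormal_frame[OF b(2)]])
    show "(B(d := b)) k \<in> cv.span (B' ` {..<d})" if "k < Suc d" for k
      using that BT b(1) B'(2) unfolding frame_span_def by (auto simp: less_Suc_eq)
  qed simp
  then show False using card_image_le[of "{..<d}" B'] by simp
qed

lemma subspace_perp: "cv.subspace (perp I T)"
  unfolding cv.subspace_def perp_def using subspace_cspace[of I, unfolded cv.subspace_def]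
  by (auto simp: distrib_right sum.distrib mult.assoc simp flip: sum_distrib_left)

text \<open>An orthonormal basis of \<open>T\<close> together with the complex conjugates of an orthonormal
  basis of \<open>perp I T\<close> is an orthonormal basis of the whole space: conjugation turns
  bilinear orthogonality into Hermitian orthogonality. Counting vectors gives the dimension.\<close>
lemma perp_Gr:
  assumes I: "finite I" and T: "T \<in> Gr d I"
  shows "d \<le> card I \<and> perp I T \<in> Gr (card I - d) I"
proof -
  obtain B where B: "orthonormal d I B" "frame_span d B = T" by (rule Gr_orthonormal[OF I T])
  have PI: "perp I T \<subseteq> cspace I" by (auto simp: perp_def)
  obtain C where C: "orthonormal (cv.dim (perp I T)) I C" "frame_span (cv.dim (perp I T)) C = perp I T"
    using orthonormal_basis[OF I subspace_perp PI] by blast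
  let ?m = "cv.dim (perp I T)"
  have CP: "C k \<in> perp I T" if "k < ?m" for k using frame_in_span[OF that, of C] C(2) by simp
  define E where "E k = (if k < d then B k else if k < d + ?m then (\<lambda>i. cnj (C (k - d) i)) else 0)" for k
  have BC: "(\<Sum>i\<in>I. C j i * B k i) = 0" if "j < ?m" "k < d" for j k
    using CP[OF that(1)] frame_in_span[OF that(2), of B] B(2) by (simp add: perp_def)
  have E: "orthonormal (d + ?m) I E" unfolding orthonormal_def
  proof (intro conjI allI impI)
    show "E k \<in> cspace I" if "k < d + ?m" for k
      using that B(1) C(1) by (auto simp: E_def orthonormal_def cspace_def)
    show "E k = 0" if "k \<ge> d + ?m" for k using that by (auto simp: E_def)
    fix j k assume jk: "j < d + ?m" "k < d + ?m"
    consider "j < d" "k < d" | "j < d" "\<not> k < d" | "\<not> j < d" "k < d" | "\<not> j < d" "\<not> k < d" by blast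
    then show "herm I (E j) (E k) = (if j = k then 1 else 0)"
    proof cases
      case 1 then show ?thesis using B(1) by (simp add: E_def orthonormal_def)
    next
      case 2
      then have "herm I (E j) (E k) = (\<Sum>i\<in>I. C (k - d) i * B j i)" using jk by (simp add: herm_def E_def mult.commute)
      then show ?thesis using BC[of "k - d" j] 2 jk by auto
    next
      case 3
      then have "herm I (E j) (E k) = cnj (\<Sum>i\<in>I. C (j - d) i * B k i)" using jk by (simp add: herm_def E_def)
      then show ?thesis using BC[of "j - d" k] 3 jk by auto
    next
      case 4
      then have "herm I (E j) (E k) = cnj (herm I (C (j - d)) (C (k - d)))" using jk by (simp add: herm_def E_def)
      also have "herm I (C (j - d)) (C (k - d)) = (if j - d = k - d then 1 else 0)" using C(1) 4 jk by (simp add: orthonormal_def)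
      finally show ?thesis using 4 by (simp add: eq_diff_iff)
    qed
  qed
  have Esp: "cspace I \<subseteq> frame_span (d + ?m) E"
  proof (rule ccontr)
    assume "\<not> ?thesis"
    then obtain w where w: "w \<in> cspace I" "w \<notin> frame_span (d + ?m) E" by blast
    have Ec: "E k \<in> cspace I" if "k < d + ?m" for k using E that by (simp add: orthonormal_def)
    obtain b where b: "b \<in> cspace I" "orthonormal (Suc (d + ?m)) I (E(d + ?m := b))"
      using orthonormal_extend[OF I E subspace_cspace order.refl Ec w] by blast
    have bE: "herm I b (E k) = 0" if "k < d + ?m" for k
    proof -
      have "herm I ((E(d + ?m := b)) (d + ?m)) ((E(d + ?m := b)) k) = (if d + ?m = k then 1 else 0)"
        using b(2) that unfolding orthonormal_def by (metis lessI less_Suc_eq)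
      then show ?thesis using that by simp
    qed
    have bb: "herm I b b = 1"
    proof -
      have "herm I ((E(d + ?m := b)) (d + ?m)) ((E(d + ?m := b)) (d + ?m)) = 1"
        using b(2) unfolding orthonormal_def by (metis lessI)
      then show ?thesis by simp
    qed
    let ?b = "\<lambda>i. cnj (b i)"
    have "?b \<in> perp I T" unfolding perp_def
    proof (intro CollectI conjI ballI)
      show "?b \<in> cspace I" using b(1) by (auto simp: cspace_def)
      fix t assume "t \<in> T"
      then obtain c where c: "\<forall>i. t i = (\<Sum>k<d. c k * B k i)" using in_frame_span[of t d B] B(2) by blast
      have "herm I t b = (\<Sum>k<d. c k * herm I (B k) b)" by (rule herm_sum_left) (use c in simp)
      also have "\<dots> = 0"
      proof (rule sum.neutral, safe)
        fix k assume "k < d"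
        then show "c k * herm I (B k) b = 0" using bE[of k] herm_cnj[of I "B k" b] by (simp add: E_def)
      qed
      finally show "(\<Sum>i\<in>I. ?b i * t i) = 0" by (simp add: herm_def mult.commute)
    qed
    then obtain c where c: "\<forall>i. ?b i = (\<Sum>k<?m. c k * C k i)" using in_frame_span[of ?b ?m C] C(2) by blast
    have "herm I ?b ?b = (\<Sum>k<?m. c k * herm I (C k) ?b)" by (rule herm_sum_left) (use c in simp)
    also have "\<dots> = 0"
    proof (rule sum.neutral, safe)
      fix k assume k: "k < ?m"
      have "herm I (C k) ?b = herm I b (E (d + k))" using k by (simp add: herm_def E_def mult.commute)
      then show "c k * herm I (C k) ?b = 0" using bE[of "d + k"] k by simp
    qed
    finally have "herm I ?b ?b = 0" .
    moreover have "herm I ?b ?b = cnj (herm I b b)" by (simp add: herm_def)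
    ultimately show False using bb by simp
  qed
  have "d + ?m = card I"
  proof (rule antisym)
    obtain T where T: "finite T" "card T \<le> card I" "cspace I \<subseteq> cv.span T" using cspace_spanned[OF I] by blast
    have "d + ?m \<le> card T"
      by (rule frame_length_le[OF orthonormal_frame[OF E] T(1)]) (use E T(3) in \<open>auto simp: orthonormal_def\<close>)
    then show "d + ?m \<le> card I" using T(2) by simp
    obtain h where h: "bij_betw h {..<card I} I" using ex_bij_betw_nat_finite[OF I] by (auto simp: lessThan_atLeast0)
    define D where "D k = (if k < card I then (\<lambda>j. if j = h k then 1 else (0::complex)) else 0)" for k
    have hI: "h k \<in> I" if "k < card I" for k using h that by (auto simp: bij_betw_def)
    have "orthonormal (card I) I D" unfolding orthonormal_def
    proof (intro conjI allI impI)
      fix j k assume jk: "j < card I" "k < card I"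
      have "herm I (D j) (D k) = (\<Sum>i\<in>I. if i = h j then (if h j = h k then 1 else 0) else 0)"
        unfolding herm_def using jk by (intro sum.cong refl) (auto simp: D_def)
      also have "\<dots> = (if h j = h k then 1 else 0)" using I hI[OF jk(1)] by simp
      also have "h j = h k \<longleftrightarrow> j = k" using h jk by (auto simp: bij_betw_def inj_on_def)
      finally show "herm I (D j) (D k) = (if j = k then 1 else 0)" .
    qed (use hI in \<open>auto simp: D_def cspace_def\<close>)
    then have "card I \<le> card (E ` {..<d + ?m})"
      using frame_length_le[OF orthonormal_frame, of "card I" I D "E ` {..<d + ?m}"] Esp
      unfolding frame_span_def by (auto simp: orthonormal_def)
    then show "card I \<le> d + ?m" using card_image_le[of "{..<d + ?m}" E] by simp
  qed
  then show ?thesis using subspace_perp PI unfolding Gr_def by auto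
qed

text \<open>One inclusion is clear, and the dimensions agree by \<open>perp_Gr\<close>.\<close>
lemma perp_perp: assumes I: "finite I" and T: "T \<in> Gr d I" shows "perp I (perp I T) = T"
proof -
  have 1: "d \<le> card I" "perp I T \<in> Gr (card I - d) I" using perp_Gr[OF assms] by auto
  have "perp I (perp I T) \<in> Gr d I" using perp_Gr[OF I 1(2)] 1(1) by simp
  moreover have "T \<subseteq> perp I (perp I T)" using T by (auto simp: perp_def Gr_def mult.commute)
  ultimately show ?thesis using Gr_subset_eq[OF I T] by blast
qed

section \<open>Maximal minors\<close>

abbreviation minor_mat :: "(nat \<Rightarrow> 'i \<Rightarrow> 'a::comm_ring_1) \<Rightarrow> 'i list \<Rightarrow> 'a mat" where
  "minor_mat B J \<equiv> Matrix.mat (length J) (length J) (\<lambda>(i, j). B i (J ! j))"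

lemma minor_mat_carrier: "length J = d \<Longrightarrow> minor_mat B J \<in> carrier_mat d d"
  by simp

lemma minor_cong: "(\<And>i j. i < length J \<Longrightarrow> j < length J \<Longrightarrow> B i (J ! j) = B' i (J ! j)) \<Longrightarrow> minor B J = minor B' J"
  unfolding minor_def by (rule arg_cong[of _ _ Determinant.det]) (rule eq_matI, auto)

text \<open>The Cauchy--Binet formula in its trivial case: a change of rows multiplies the square submatrix
  on the left.\<close>
lemma minor_change_basis:
  assumes "length J = d" "\<And>i a. i < d \<Longrightarrow> B' i a = (\<Sum>k<d. g i k * B k a)"
  shows "minor B' J = Determinant.det (Matrix.mat d d (\<lambda>(i,k). g i k)) * minor B J"
proof -
  let ?G = "Matrix.mat d d (\<lambda>(i,k). g i k)"
  have "minor_mat B' J = ?G * minor_mat B J"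
    by (rule eq_matI) (use assms in \<open>auto simp: scalar_prod_def lessThan_atLeast0\<close>)
  then show ?thesis unfolding minor_def using assms(1) by (simp add: det_mult[of _ d])
qed

text \<open>Laplace expansion: the cofactors of the last column depend only on the other columns. So the
  minor is a linear function of the appended column, and the coefficient of the bottom entry is
  the minor without it.\<close>
lemma minor_expand_last_column:
  assumes J: "length J = d"
  shows "\<exists>\<kappa>. (\<forall>a. minor C (J @ [a]) = (\<Sum>i\<le>d. \<kappa> i * C i a)) \<and> \<kappa> d = minor C J"
proof -
  let ?A = "\<lambda>a. minor_mat C (J @ [a])"
  have A: "?A a \<in> carrier_mat (Suc d) (Suc d)" for a using J by simp
  define \<kappa> where "\<kappa> i = (-1) ^ (i + d) * Determinant.det (Matrix.mat d d (\<lambda>(i',j'). C (if i' < i then i' else Suc i') (J ! j')))" for i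
  have del: "mat_delete (?A a) i d = Matrix.mat d d (\<lambda>(i',j'). C (if i' < i then i' else Suc i') (J ! j'))" if "i < Suc d" for a i
    by (rule eq_matI) (use J that in \<open>auto simp: mat_delete_def nth_append\<close>)
  have "minor C (J @ [a]) = (\<Sum>i\<le>d. \<kappa> i * C i a)" for a
  proof -
    have "minor C (J @ [a]) = (\<Sum>i<Suc d. ?A a $$ (i, d) * cofactor (?A a) i d)"
      unfolding minor_def by (rule laplace_expansion_column[OF A]) simp
    also have "\<dots> = (\<Sum>i<Suc d. \<kappa> i * C i a)"
    proof (rule sum.cong[OF refl])
      fix i assume "i \<in> {..<Suc d}"
      then have i: "i < Suc d" by simp
      have "?A a $$ (i, d) = C i a" using i J by (simp add: nth_append)
      moreover have "cofactor (?A a) i d = \<kappa> i" unfolding cofactor_def del[OF i] \<kappa>_def ..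
      ultimately show "?A a $$ (i, d) * cofactor (?A a) i d = \<kappa> i * C i a" by (simp only: mult.commute)
    qed
    finally show ?thesis by (simp add: lessThan_Suc_atMost)
  qed
  moreover have "\<kappa> d = minor C J"
  proof -
    have "Matrix.mat d d (\<lambda>(i',j'). C (if i' < d then i' else Suc i') (J ! j')) = minor_mat C J"
      by (rule eq_matI) (use J in auto)
    moreover have "(-1::'b) ^ (d + d) = 1" by (simp flip: mult_2)
    ultimately show ?thesis unfolding \<kappa>_def minor_def by simp
  qed
  ultimately show ?thesis by (intro exI[of _ \<kappa>]) simp
qed

text \<open>Laplace expansion: all rows but the last enter only through minors of size \<open>d\<close>.\<close>
lemma minor_expand_last_row:
  assumes K: "length K = Suc d"
  shows "minor (B(d := v)) K = (\<Sum>j\<le>d. v (K ! j) * ((-1) ^ (d + j) * minor B (take j K @ drop (Suc j) K)))"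
proof -
  let ?A = "minor_mat (B(d := v)) K"
  have A: "?A \<in> carrier_mat (Suc d) (Suc d)" using K by simp
  have del: "mat_delete ?A d j = minor_mat B (take j K @ drop (Suc j) K)" if "j < Suc d" for j
    by (rule eq_matI) (use K that in \<open>auto simp: mat_delete_def nth_append min_def\<close>)
  have "minor (B(d := v)) K = (\<Sum>j<Suc d. ?A $$ (d, j) * cofactor ?A d j)"
    unfolding minor_def by (rule laplace_expansion_row[OF A]) simp
  also have "\<dots> = (\<Sum>j<Suc d. v (K ! j) * ((-1) ^ (d + j) * minor B (take j K @ drop (Suc j) K)))"
  proof (rule sum.cong[OF refl])
    fix j assume "j \<in> {..<Suc d}"
    then have j: "j < Suc d" by simp
    have "?A $$ (d, j) = v (K ! j)" using j K by simp
    moreover have "cofactor ?A d j = (-1) ^ (d + j) * minor B (take j K @ drop (Suc j) K)"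
      unfolding cofactor_def del[OF j] minor_def ..
    ultimately show "?A $$ (d, j) * cofactor ?A d j = v (K ! j) * ((-1) ^ (d + j) * minor B (take j K @ drop (Suc j) K))"
      by (simp only:)
  qed
  finally show ?thesis by (simp add: lessThan_Suc_atMost)
qed

text \<open>By induction on the number of rows. A nonzero minor of the first \<open>d\<close> rows, bordered
  by one more row and one more column \<open>a\<close>, is a combination of the entries in
  column \<open>a\<close> with a nonzero last coefficient. Independence of the rows forbids that
  it vanishes for all \<open>a\<close>.\<close>
lemma exists_nonzero_minor:
  assumes "\<And>k. k < d \<Longrightarrow> B k \<in> cspace I" "row_indep d B"
  shows "\<exists>J. length J = d \<and> set J \<subseteq> I \<and> minor B J \<noteq> 0"
  using assms
proof (induction d)
  case 0
  have "minor B [] = 1" unfolding minor_def by (rule det_dim_zero) simp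
  then show ?case by (intro exI[of _ "[]"]) simp
next
  case (Suc d)
  have "row_indep d B" unfolding row_indep_def
  proof (intro allI impI)
    fix c k assume c: "\<forall>i. (\<Sum>k<d. c k * B k i) = 0" and "k < d"
    have "(c(d := 0)) k = 0"
      by (rule row_indepD[OF Suc.prems(2)]) (use c \<open>k < d\<close> in simp_all)
    then show "c k = 0" using \<open>k < d\<close> by simp
  qed
  then have "\<exists>J. length J = d \<and> set J \<subseteq> I \<and> minor B J \<noteq> 0" by (intro Suc.IH) (use Suc.prems(1) in simp_all)
  then obtain J where J: "length J = d" "set J \<subseteq> I" "minor B J \<noteq> 0" by blast
  obtain \<kappa> where k: "\<forall>a. minor B (J @ [a]) = (\<Sum>i\<le>d. \<kappa> i * B i a)" "\<kappa> d = minor B J"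
    using minor_expand_last_column[OF J(1), of B] by (elim exE conjE)
  have "\<exists>a\<in>I. minor B (J @ [a]) \<noteq> 0"
  proof (rule ccontr)
    assume no: "\<not> ?thesis"
    have "(\<Sum>i<Suc d. \<kappa> i * B i a) = 0" for a
    proof (cases "a \<in> I")
      case True
      then show ?thesis using no k(1) by (simp add: lessThan_Suc_atMost)
    next
      case False
      then show ?thesis using Suc.prems(1) by (intro sum.neutral) (auto simp: cspace_def)
    qed
    from row_indepD[OF Suc.prems(2) this, of d] show False using k(2) J(3) by simp
  qed
  then obtain a where "a \<in> I" "minor B (J @ [a]) \<noteq> 0" by blast
  then show ?case using J by (intro exI[of _ "J @ [a]"]) simp
qed

lemma frame_nonzero_minor:
  assumes "B \<in> frames d I" obtains J where "length J = d" "set J \<subseteq> I" "minor B J \<noteq> 0"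
  using exists_nonzero_minor[of d B I] assms unfolding frames_iff by blast

text \<open>Two frames of the same space differ by an invertible matrix; its determinant is the factor.\<close>
lemma minors_proportional:
  assumes B: "B \<in> frames d I" "B' \<in> frames d I" and span: "frame_span d B = frame_span d B'"
  shows "\<exists>c. c \<noteq> 0 \<and> (\<forall>J. length J = d \<longrightarrow> minor B' J = c * minor B J)"
proof -
  have "\<forall>i. \<exists>c. i < d \<longrightarrow> (\<forall>a. B' i a = (\<Sum>k<d. c k * B k a))"
    using frame_in_span[of _ d B'] unfolding span[symmetric] in_frame_span by simp
  from choice[OF this] obtain g where "\<forall>i. i < d \<longrightarrow> (\<forall>a. B' i a = (\<Sum>k<d. g i k * B k a))" ..
  then have g: "\<And>i a. i < d \<Longrightarrow> B' i a = (\<Sum>k<d. g i k * B k a)" by blast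
  let ?c = "Determinant.det (Matrix.mat d d (\<lambda>(i,k). g i k))"
  have c: "minor B' J = ?c * minor B J" if "length J = d" for J by (rule minor_change_basis[OF that g])
  obtain J where J: "length J = d" "minor B' J \<noteq> 0" using frame_nonzero_minor[OF B(2)] by blast
  then have "?c \<noteq> 0" using c by auto
  then show ?thesis using c by blast
qed

text \<open>A vector \<open>v\<close> lies in the span of \<open>B\<close> as soon as all minors of
  \<open>B\<close> bordered by \<open>v\<close> vanish, and these bordered minors are
  expressions in \<open>v\<close> and the minors of \<open>B\<close>. For a row of
  \<open>B'\<close> the corresponding bordered minors of \<open>B'\<close> have two equal rows,
  hence vanish, and the minors of \<open>B\<close> and \<open>B'\<close> are proportional.\<close>
lemma minors_determine_span:
  assumes I: "finite I" and B: "B \<in> frames d I" "B' \<in> frames d I" and c: "c \<noteq> 0"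
    and minors: "\<And>J. length J = d \<Longrightarrow> set J \<subseteq> I \<Longrightarrow> minor B' J = c * minor B J"
  shows "frame_span d B = frame_span d B'"
proof -
  obtain J where J: "length J = d" "set J \<subseteq> I" "minor B J \<noteq> 0" by (rule frame_nonzero_minor[OF B(1)])
  have "B' k \<in> frame_span d B" if k: "k < d" for k
  proof -
    have Bk: "B' k \<in> cspace I" using B(2) k by (simp add: frames_def)
    obtain \<kappa> where kap: "\<forall>a. minor (B(d := B' k)) (J @ [a]) = (\<Sum>i\<le>d. \<kappa> i * (B(d := B' k)) i a)" "\<kappa> d = minor (B(d := B' k)) J"
      using minor_expand_last_column[OF J(1), of "B(d := B' k)"] by (elim exE conjE)
    have kd: "\<kappa> d = minor B J" unfolding kap(2) using J(1) by (intro minor_cong) simp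
    have z: "minor (B(d := B' k)) (J @ [a]) = 0" if a: "a \<in> I" for a
    proof -
      let ?K = "J @ [a]"
      have K: "length ?K = Suc d" "set ?K \<subseteq> I" using J a by auto
      have sub: "length (take j ?K @ drop (Suc j) ?K) = d \<and> set (take j ?K @ drop (Suc j) ?K) \<subseteq> I" if "j \<le> d" for j
        using K that by (auto simp del: append_assoc dest!: in_set_takeD in_set_dropD)
      have "minor (B'(d := B' k)) ?K = 0" unfolding minor_def
        by (rule det_identical_rows[of _ "Suc d" k d]) (use K(1) k in \<open>auto intro!: eq_vecI\<close>)
      then have "0 = (\<Sum>j\<le>d. B' k (?K ! j) * ((-1) ^ (d + j) * minor B' (take j ?K @ drop (Suc j) ?K)))"
        unfolding minor_expand_last_row[OF K(1)] by simp
      also have "\<dots> = (\<Sum>j\<le>d. c * (B' k (?K ! j) * ((-1) ^ (d + j) * minor B (take j ?K @ drop (Suc j) ?K))))"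
        by (rule sum.cong[OF refl]) (use sub minors in \<open>simp del: append_assoc\<close>)
      also have "\<dots> = c * minor (B(d := B' k)) ?K"
        unfolding minor_expand_last_row[OF K(1)] sum_distrib_left ..
      finally show ?thesis using c by simp
    qed
    have "B' k a = (\<Sum>i<d. (- \<kappa> i / \<kappa> d) * B i a)" for a
    proof (cases "a \<in> I")
      case True
      have "0 = (\<Sum>i<d. \<kappa> i * B i a) + \<kappa> d * B' k a"
        using z[OF True] kap(1) by (simp add: lessThan_Suc_atMost[symmetric])
      then have "\<kappa> d * B' k a = - (\<Sum>i<d. \<kappa> i * B i a)" by (simp add: eq_neg_iff_add_eq_0 add.commute)
      then have "B' k a = - (\<Sum>i<d. \<kappa> i * B i a) / \<kappa> d" using J(3) kd by (simp add: field_simps)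
      then show ?thesis by (simp add: sum_divide_distrib sum_negf)
    next
      case False
      then have "B' k a = 0" "\<And>i. i < d \<Longrightarrow> B i a = 0" using Bk B(1) by (auto simp: frames_def cspace_def)
      then show ?thesis by simp
    qed
    then show ?thesis unfolding in_frame_span by (intro exI[of _ "\<lambda>i. - \<kappa> i / \<kappa> d"]) simp
  qed
  then have "frame_span d B' \<subseteq> frame_span d B"
    unfolding frame_span_def by (intro cv.span_minimal) (auto simp: cv.subspace_span)
  then show ?thesis using Gr_subset_eq[OF I frame_span_Gr[OF B(2)] frame_span_Gr[OF B(1)]] by simp
qed

text \<open>At the largest index where two multi-indices of equal degree differ, one of them is smaller.\<close>
lemma grlex_total: "grlex \<alpha> \<beta> \<or> \<alpha> = \<beta> \<or> grlex \<beta> \<alpha>"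
proof (cases "mdeg \<alpha> = mdeg \<beta> \<and> \<alpha> \<noteq> \<beta>")
  case True
  let ?D = "{i. Poly_Mapping.lookup \<alpha> i \<noteq> Poly_Mapping.lookup \<beta> i}"
  have "?D \<noteq> {}" using True by (auto intro: poly_mapping_eqI)
  then have m1: "Max ?D \<in> ?D" by (intro Max_in) simp_all
  have m2: "Poly_Mapping.lookup \<alpha> j = Poly_Mapping.lookup \<beta> j" if j: "Max ?D < j" for j
  proof (rule ccontr)
    assume "Poly_Mapping.lookup \<alpha> j \<noteq> Poly_Mapping.lookup \<beta> j"
    then have "j \<le> Max ?D" by (intro Max_ge) simp_all
    then show False using j by simp
  qed
  obtain i where i: "Poly_Mapping.lookup \<alpha> i \<noteq> Poly_Mapping.lookup \<beta> i"
    "\<forall>j>i. Poly_Mapping.lookup \<alpha> j = Poly_Mapping.lookup \<beta> j"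
    using m2 CollectD[OF m1] by blast
  from i(1) show ?thesis
  proof (rule linorder_neqE_nat)
    assume "Poly_Mapping.lookup \<alpha> i < Poly_Mapping.lookup \<beta> i"
    then have "grlex \<alpha> \<beta>" unfolding grlex_def using True i(2) by blast
    then show ?thesis by blast
  next
    assume "Poly_Mapping.lookup \<beta> i < Poly_Mapping.lookup \<alpha> i"
    moreover have "\<forall>j>i. Poly_Mapping.lookup \<beta> j = Poly_Mapping.lookup \<alpha> j" using i(2) by metis
    ultimately have "grlex \<beta> \<alpha>" unfolding grlex_def using conjunct1[OF True, symmetric] by blast
    then show ?thesis by blast
  qed
next
  case False
  then have "mdeg \<alpha> < mdeg \<beta> \<or> mdeg \<beta> < mdeg \<alpha> \<or> \<alpha> = \<beta>" by (meson linorder_less_linear)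
  then show ?thesis unfolding grlex_def by (elim disjE) simp_all
qed

lemma grlex_irrefl: "\<not> grlex \<alpha> \<alpha>" by (auto simp: grlex_def)

lemma grlex_trans: assumes "grlex \<alpha> \<beta>" "grlex \<beta> \<gamma>" shows "grlex \<alpha> \<gamma>"
proof -
  consider "mdeg \<alpha> < mdeg \<gamma>" | "mdeg \<alpha> = mdeg \<beta>" "mdeg \<beta> = mdeg \<gamma>" using assms unfolding grlex_def by linarith
  then show ?thesis
  proof cases
    case 2
    obtain i where i: "Poly_Mapping.lookup \<alpha> i < Poly_Mapping.lookup \<beta> i" "\<forall>j>i. Poly_Mapping.lookup \<alpha> j = Poly_Mapping.lookup \<beta> j" using assms(1) 2 by (auto simp: grlex_def)
    obtain k where k: "Poly_Mapping.lookup \<beta> k < Poly_Mapping.lookup \<gamma> k" "\<forall>j>k. Poly_Mapping.lookup \<beta> j = Poly_Mapping.lookup \<gamma> j" using assms(2) 2 by (auto simp: grlex_def)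
    have "Poly_Mapping.lookup \<alpha> (max i k) < Poly_Mapping.lookup \<gamma> (max i k)"
      using i k by (cases i k rule: linorder_cases) (auto simp: max_def)
    moreover have "\<forall>j>max i k. Poly_Mapping.lookup \<alpha> j = Poly_Mapping.lookup \<gamma> j" using i k by auto
    ultimately show ?thesis using 2 unfolding grlex_def by auto
  qed (simp add: grlex_def)
qed

lemma exists_sorted_grlex: "finite A \<Longrightarrow> \<exists>xs. set xs = A \<and> sorted_wrt grlex xs"
proof (induction A rule: finite_induct)
  case (insert a A)
  then obtain xs where xs: "set xs = A" "sorted_wrt grlex xs" by blast
  let ?ys = "filter (\<lambda>x. grlex x a) xs @ [a] @ filter (\<lambda>x. grlex a x) xs"
  have "set ?ys = insert a A" using xs(1) insert.hyps(2) grlex_total[of a] by auto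
  moreover have "sorted_wrt grlex ?ys"
    using xs(2) by (auto simp: sorted_wrt_append sorted_wrt_filter intro: grlex_trans)
  ultimately show ?case by blast
qed simp

lemma sorted_grlex_unique:
  "sorted_wrt grlex xs \<Longrightarrow> sorted_wrt grlex ys \<Longrightarrow> set xs = set ys \<Longrightarrow> xs = ys"
proof (induction xs arbitrary: ys)
  case (Cons x xs)
  then obtain y zs where y: "ys = y # zs" by (cases ys) auto
  have "x = y"
  proof (rule ccontr)
    assume "x \<noteq> y"
    then have "x \<in> set zs" "y \<in> set xs" using Cons.prems(3) y by auto
    then have "grlex y x" "grlex x y" using Cons.prems y by auto
    then show False using grlex_trans grlex_irrefl by blast
  qed
  moreover have "x \<notin> set xs" "y \<notin> set zs" using Cons.prems y grlex_irrefl by auto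
  then have "set xs = set zs" using Cons.prems(3) y \<open>x = y\<close> by auto
  ultimately show ?case using Cons y by auto
qed simp

lemma grlex_list: assumes "finite A" shows "set (grlex_list A) = A" "sorted_wrt grlex (grlex_list A)"
proof -
  have "\<exists>!xs. set xs = A \<and> sorted_wrt grlex xs"
    using exists_sorted_grlex[OF assms] sorted_grlex_unique by blast
  from theI'[OF this] show "set (grlex_list A) = A" "sorted_wrt grlex (grlex_list A)" unfolding grlex_list_def by auto
qed

lemma distinct_sorted_grlex: "sorted_wrt grlex xs \<Longrightarrow> distinct xs"
  by (induction xs) (auto simp: grlex_irrefl)

lemma length_grlex_list: "finite A \<Longrightarrow> length (grlex_list A) = card A"
  using distinct_card[OF distinct_sorted_grlex[OF grlex_list(2)]] grlex_list(1) by metis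

text \<open>A minor with a repeated column vanishes. Otherwise sorting the columns changes it by the sign of
  a permutation, the same for all matrices. So the increasing lists in \<open>Lam n\<close>
  carry the information of all minors.\<close>
lemma minor_sort:
  fixes J :: "'s::{finite,linorder} midx list"
  assumes "length J = numM TYPE('s) n" "set J \<subseteq> col_idx n"
  shows "(\<forall>B :: nat \<Rightarrow> 's midx \<Rightarrow> complex. minor B J = 0) \<or>
    (\<exists>J'\<in>Lam n. \<exists>s. \<forall>B :: nat \<Rightarrow> 's midx \<Rightarrow> complex. minor B J = s * minor B J')"
proof (cases "distinct J")
  case False
  then obtain i j where ij: "i < length J" "j < length J" "i \<noteq> j" "J ! i = J ! j" by (auto simp: distinct_conv_nth)
  have "minor B J = 0" for B :: "nat \<Rightarrow> 's midx \<Rightarrow> complex" unfolding minor_def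
    by (rule det_identical_columns[of _ "length J" i j]) (use ij in \<open>auto intro!: eq_vecI\<close>)
  then show ?thesis by blast
next
  case True
  let ?J = "grlex_list (set J)"
  have J': "set ?J = set J" "sorted_wrt grlex ?J" "length ?J = length J"
    using grlex_list[of "set J"] length_grlex_list[of "set J"] distinct_card[OF True] by auto
  have "?J \<in> Lam n" using assms J' by (auto simp: Lam_def)
  have "mset J = mset ?J" using True distinct_sorted_grlex[OF J'(2)] J'(1) by (simp add: set_eq_iff_mset_eq_distinct[symmetric])
  then obtain p where p: "p permutes {..<length ?J}" "permute_list p ?J = J" by (rule mset_eq_permutation)
  let ?n = "length J"
  have "minor B J = of_int (sign p) * minor B ?J" for B :: "nat \<Rightarrow> 's midx \<Rightarrow> complex"
  proof -
    let ?A = "transpose_mat (minor_mat B ?J)"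
    have A: "?A \<in> carrier_mat ?n ?n" using J'(3) by simp
    have pn: "p permutes {0..<?n}" using p(1) J'(3) by (simp add: lessThan_atLeast0)
    have "Matrix.mat ?n ?n (\<lambda>(i, j). ?A $$ (p i, j)) = transpose_mat (minor_mat B J)"
    proof (rule eq_matI)
      fix i j assume "i < dim_row (transpose_mat (minor_mat B J))" "j < dim_col (transpose_mat (minor_mat B J))"
      then have ij: "i < ?n" "j < ?n" by auto
      have "p i < ?n" using permutes_in_image[OF pn, of i] ij(1) by simp
      moreover have "J ! i = ?J ! p i" using permute_list_nth[OF p(1), of i] p(2) ij(1) J'(3) by simp
      ultimately show "Matrix.mat ?n ?n (\<lambda>(i, j). ?A $$ (p i, j)) $$ (i,j) = transpose_mat (minor_mat B J) $$ (i,j)" using ij J'(3) by simp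
    qed simp_all
    then have "Determinant.det (transpose_mat (minor_mat B J)) = of_int (sign p) * Determinant.det ?A"
      using det_permute_rows[OF A pn] by simp
    then show ?thesis unfolding minor_def using det_transpose[of "minor_mat B J" ?n] det_transpose[of "minor_mat B ?J" ?n] J'(3) by simp
  qed
  then show ?thesis using \<open>?J \<in> Lam n\<close> by blast
qed

lemma Lam_nonzero_minor:
  fixes B :: "nat \<Rightarrow> 's::{finite,linorder} midx \<Rightarrow> complex"
  assumes "B \<in> frames (numM TYPE('s) n) (col_idx n)" shows "\<exists>J\<in>Lam n. minor B J \<noteq> 0"
proof -
  obtain J where J: "length J = numM TYPE('s) n" "set J \<subseteq> col_idx n" "minor B J \<noteq> 0" by (rule frame_nonzero_minor[OF assms])
  then show ?thesis using minor_sort[OF J(1,2)] by (metis mult_zero_right)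
qed

lemma Lam_minors_determine_span:
  fixes B :: "nat \<Rightarrow> 's::{finite,linorder} midx \<Rightarrow> complex"
  assumes fin: "finite (col_idx n :: 's midx set)" and B: "B \<in> frames (numM TYPE('s) n) (col_idx n)" "B' \<in> frames (numM TYPE('s) n) (col_idx n)"
    and c: "c \<noteq> 0" "\<And>J. J \<in> Lam n \<Longrightarrow> minor B' J = c * minor B J"
  shows "frame_span (numM TYPE('s) n) B = frame_span (numM TYPE('s) n) B'"
proof (rule minors_determine_span[OF fin B c(1)])
  fix J :: "'s midx list" assume J: "length J = numM TYPE('s) n" "set J \<subseteq> col_idx n"
  from minor_sort[OF J] show "minor B' J = c * minor B J"
  proof (elim disjE bexE exE)
    assume "\<forall>B :: nat \<Rightarrow> 's midx \<Rightarrow> complex. minor B J = 0"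
    then show ?thesis by simp
  next
    fix J' s assume J': "J' \<in> Lam n" "\<forall>B :: nat \<Rightarrow> 's midx \<Rightarrow> complex. minor B J = s * minor B J'"
    have "minor B' J = s * minor B' J'" "minor B J = s * minor B J'" using J'(2) by blast+
    then show ?thesis using c(2)[OF J'(1)] by simp
  qed
qed

section \<open>Convergence in the Grassmannian\<close>

lemma tendsto_fun_iff_coordinatewise:
  fixes f :: "'k \<Rightarrow> 'i \<Rightarrow> 'b::topological_space"
  shows "(f \<longlongrightarrow> l) F \<longleftrightarrow> (\<forall>i. ((\<lambda>k. f k i) \<longlongrightarrow> l i) F)"
proof -
  have "(f \<longlongrightarrow> l) F \<longleftrightarrow> limitin (product_topology (\<lambda>i. euclidean) UNIV) f l F"
    unfolding euclidean_product_topology limitin_canonical_iff ..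
  also have "\<dots> \<longleftrightarrow> (\<forall>i. ((\<lambda>k. f k i) \<longlongrightarrow> l i) F)"
    unfolding limitin_componentwise limitin_canonical_iff by simp
  finally show ?thesis .
qed

text \<open>The Leibniz formula writes a minor as a polynomial in finitely many entries.\<close>
lemma minor_tendsto:
  fixes B :: "'k \<Rightarrow> nat \<Rightarrow> 'i \<Rightarrow> complex"
  assumes "\<And>j i. ((\<lambda>k. B k j i) \<longlongrightarrow> Q j i) F"
  shows "((\<lambda>k. minor (B k) J) \<longlongrightarrow> minor Q J) F"
proof -
  have eq: "minor C J = (\<Sum>p | p permutes {0..<length J}. of_int (sign p) * (\<Prod>i = 0..<length J. C i (J ! p i)))"
    for C :: "nat \<Rightarrow> 'i \<Rightarrow> complex"
    unfolding minor_def det_def'[OF minor_mat_carrier[OF refl]]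
  proof (intro sum.cong refl)
    fix p assume "p \<in> {p. p permutes {0..<length J}}"
    then have "p i < length J" if "i < length J" for i using that permutes_in_image[of p "{0..<length J}" i] by simp
    then show "of_int (sign p) * (\<Prod>i = 0..<length J. minor_mat C J $$ (i, p i)) = of_int (sign p) * (\<Prod>i = 0..<length J. C i (J ! p i))"
      by (intro arg_cong2[of _ _ _ _ "(*)"] prod.cong refl) simp
  qed
  show ?thesis unfolding eq by (intro tendsto_intros assms)
qed

lemma continuous_minor: "continuous_on UNIV (\<lambda>B :: nat \<Rightarrow> 'i \<Rightarrow> complex. minor B J)"
  unfolding continuous_on_def
proof
  fix Q :: "nat \<Rightarrow> 'i \<Rightarrow> complex"
  have "((\<lambda>B. B) \<longlongrightarrow> Q) (at Q within UNIV)" by (rule tendsto_ident_at)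
  then have "((\<lambda>B. B j i) \<longlongrightarrow> Q j i) (at Q within UNIV)" for j i
    unfolding tendsto_fun_iff_coordinatewise[where l = Q] tendsto_fun_iff_coordinatewise[where l = "Q _"] by blast
  then show "((\<lambda>B. minor B J) \<longlongrightarrow> minor Q J) (at Q within UNIV)" by (rule minor_tendsto)
qed

lemma topspace_Gr_top: "topspace (Gr_top d I) = Gr d I"
proof
  show "topspace (Gr_top d I) \<subseteq> Gr d I" using openin_Gr_top[of d I "topspace (Gr_top d I)"] by simp
  have "{B \<in> frames d I. frame_span d B \<in> Gr d I} = frames d I" using frame_span_Gr by auto
  then have "openin (Gr_top d I) (Gr d I)" unfolding openin_Gr_top by simp
  then show "Gr d I \<subseteq> topspace (Gr_top d I)" by (rule openin_subset)
qed

text \<open>The topology is a quotient of that of frames, so convergent frames have convergent spans.\<close>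
lemma frame_span_limit:
  assumes B: "\<And>k. B k \<in> frames d I" "Q \<in> frames d I" and lim: "\<And>j i. (\<lambda>k. B k j i) \<longlonglongrightarrow> Q j i"
  shows "limitin (Gr_top d I) (\<lambda>k. frame_span d (B k)) (frame_span d Q) sequentially"
  unfolding limitin_def topspace_Gr_top
proof (intro conjI allI impI)
  show "frame_span d Q \<in> Gr d I" by (rule frame_span_Gr[OF B(2)])
  fix U assume U: "openin (Gr_top d I) U \<and> frame_span d Q \<in> U"
  then obtain O' where O': "open O'" "{B \<in> frames d I. frame_span d B \<in> U} = frames d I \<inter> O'"
    unfolding openin_Gr_top openin_open by blast
  have lim': "B \<longlonglongrightarrow> Q" unfolding tendsto_fun_iff_coordinatewise using lim by blast
  have "Q \<in> O'" using O'(2) U B(2) by blast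
  have "\<forall>\<^sub>F k in sequentially. B k \<in> O'" by (rule topological_tendstoD[OF lim' O'(1) \<open>Q \<in> O'\<close>])
  then show "\<forall>\<^sub>F k in sequentially. frame_span d (B k) \<in> U"
    by (rule eventually_mono) (use O'(2) B(1) in blast)
qed

text \<open>Bolzano--Weierstrass for finitely many coordinates, one coordinate at a time.\<close>
lemma bounded_family_subsequence:
  fixes X :: "nat \<Rightarrow> 'i \<Rightarrow> complex"
  assumes "finite K" "\<And>i n. i \<in> K \<Longrightarrow> cmod (X n i) \<le> B i"
  shows "\<exists>r l. strict_mono r \<and> (\<forall>i\<in>K. (\<lambda>n. X (r n) i) \<longlonglongrightarrow> l i)"
  using assms
proof (induction K rule: finite_induct)
  case empty
  show ?case by (rule exI[of _ "\<lambda>n. n"]) (simp add: strict_mono_def)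
next
  case (insert i K)
  then obtain r l where r: "strict_mono r" "\<forall>j\<in>K. (\<lambda>n. X (r n) j) \<longlonglongrightarrow> l j" by auto
  have "bounded (range (\<lambda>n. X (r n) i))" unfolding bounded_iff using insert(4)[of i] by auto
  then obtain s z where s: "strict_mono (s :: nat \<Rightarrow> nat)" "((\<lambda>n. X (r n) i) \<circ> s) \<longlonglongrightarrow> z"
    using bounded_imp_convergent_subsequence by blast
  have "(\<lambda>n. X ((r \<circ> s) n) j) \<longlonglongrightarrow> (l(i := z)) j" if "j \<in> insert i K" for j
  proof (cases "j = i")
    case True then show ?thesis using s(2) by (simp add: comp_def)
  next
    case False
    then have "((\<lambda>n. X (r n) j) \<circ> s) \<longlonglongrightarrow> l j" using LIMSEQ_subseq_LIMSEQ[OF _ s(1)] r(2) that by blast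
    then show ?thesis using False by (simp add: comp_def)
  qed
  then show ?case using strict_mono_o[OF r(1) s(1)] by blast
qed

text \<open>Entries of orthonormal frames are bounded by \<open>1\<close>, and the orthonormality equations
  pass to the limit.\<close>
lemma orthonormal_compact:
  assumes I: "finite I" and B: "\<And>k. orthonormal d I (B k)"
  shows "\<exists>r Q. strict_mono (r :: nat \<Rightarrow> nat) \<and> orthonormal d I Q \<and> (\<forall>j i. (\<lambda>k. B (r k) j i) \<longlonglongrightarrow> Q j i)"
proof -
  have bound: "cmod (B n j i) \<le> 1" if "j < d" "i \<in> I" for n j i
  proof -
    have "of_real (\<Sum>i\<in>I. (cmod (B n j i))\<^sup>2) = (1 :: complex)"
      using B[of n] that(1) unfolding herm_self[symmetric] orthonormal_def by simp
    then have "(\<Sum>i\<in>I. (cmod (B n j i))\<^sup>2) = 1" using of_real_eq_1_iff by blast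
    moreover have "(cmod (B n j i))\<^sup>2 \<le> (\<Sum>i\<in>I. (cmod (B n j i))\<^sup>2)" by (rule member_le_sum[OF that(2) _ I]) simp
    ultimately show ?thesis by (simp add: power2_nonneg_ge_1_iff abs_square_le_1)
  qed
  have "\<exists>r l. strict_mono r \<and> (\<forall>ji\<in>{..<d} \<times> I. (\<lambda>n. (\<lambda>(j,i). B (r n) j i) ji) \<longlonglongrightarrow> l ji)"
    by (rule bounded_family_subsequence[where X = "\<lambda>n (j,i). B n j i" and B = "\<lambda>_. 1"]) (use I bound in auto)
  then obtain r l where r: "strict_mono r" "\<forall>ji\<in>{..<d} \<times> I. (\<lambda>n. (\<lambda>(j,i). B (r n) j i) ji) \<longlonglongrightarrow> l ji" by blast
  define Q where "Q j i = (if j < d \<and> i \<in> I then l (j, i) else 0)" for j i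
  have lim: "(\<lambda>k. B (r k) j i) \<longlonglongrightarrow> Q j i" for j i
  proof (cases "j < d \<and> i \<in> I")
    case True
    then have "(\<lambda>n. (\<lambda>(j,i). B (r n) j i) (j, i)) \<longlonglongrightarrow> l (j, i)" using r(2) by blast
    then show ?thesis using True by (simp add: Q_def)
  next
    case False
    have "B k j i = 0" for k
    proof (cases "j < d")
      case True then show ?thesis using False B[of k] by (simp add: orthonormal_def cspace_def)
    next
      case False
      then have "B k j = 0" using B[of k] by (simp add: orthonormal_def)
      then show ?thesis by simp
    qed
    then show ?thesis using False by (auto simp: Q_def)
  qed
  have "orthonormal d I Q" unfolding orthonormal_def
  proof (intro conjI allI impI)
    show "Q k \<in> cspace I" if "k < d" for k by (simp add: cspace_def Q_def)
    show "Q k = 0" if "k \<ge> d" for k using that by (intro ext) (simp add: Q_def)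
    fix j k assume jk: "j < d" "k < d"
    have "(\<lambda>n. herm I (B (r n) j) (B (r n) k)) \<longlonglongrightarrow> herm I (Q j) (Q k)"
      unfolding herm_def by (intro tendsto_intros lim)
    moreover have "herm I (B (r n) j) (B (r n) k) = (if j = k then 1 else 0)" for n
      using B[of "r n"] jk by (simp add: orthonormal_def)
    ultimately show "herm I (Q j) (Q k) = (if j = k then 1 else 0)" by (simp add: LIMSEQ_const_iff)
  qed
  then show ?thesis using r(1) lim by blast
qed

text \<open>Limits in the Grassmannian are unique. If \<open>J\<close> is a list with nonzero minor of a
  frame \<open>B0\<close> of \<open>T\<close>, the inequality $|m_K(B)\,m_J(B_0) -
  m_K(B_0)\,m_J(B)| < \varepsilon\,|m_J(B)|$ between minors is invariant under a change of
  frame. It therefore defines an open neighbourhood of \<open>T\<close>. In the limit the minors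
  of \<open>Q\<close> and \<open>B0\<close> are proportional.\<close>
lemma limit_span_unique:
  assumes I: "finite I" and B: "\<And>k. orthonormal d I (B k)" "orthonormal d I Q" and lim: "\<And>j i. (\<lambda>k. B k j i) \<longlonglongrightarrow> Q j i"
    and T: "limitin (Gr_top d I) (\<lambda>k. frame_span d (B k)) T sequentially"
  shows "frame_span d Q = T"
proof -
  have TG: "T \<in> Gr d I" using T unfolding limitin_def topspace_Gr_top by blast
  obtain B0 where B0: "orthonormal d I B0" "frame_span d B0 = T" by (rule Gr_orthonormal[OF I TG])
  note fB0 = orthonormal_frame[OF B0(1)] and fB = orthonormal_frame[OF B(1)] and fQ = orthonormal_frame[OF B(2)]
  obtain J where J: "length J = d" "set J \<subseteq> I" "minor B0 J \<noteq> 0" by (rule frame_nonzero_minor[OF fB0])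
  have eq: "minor Q K * minor B0 J = minor B0 K * minor Q J" if K: "length K = d" for K
  proof -
    have le: "cmod (minor Q K * minor B0 J - minor B0 K * minor Q J) \<le> \<epsilon> * cmod (minor Q J)" if \<epsilon>: "\<epsilon> > 0" for \<epsilon>
    proof -
      define O' where "O' = {B. cmod (minor B K * minor B0 J - minor B0 K * minor B J) < \<epsilon> * cmod (minor B J)}"
      have "open O'" unfolding O'_def
        by (intro open_Collect_less continuous_intros continuous_minor)
      define U where "U = {S \<in> Gr d I. \<exists>B\<in>frames d I. frame_span d B = S \<and> B \<in> O'}"
      have inv: "B' \<in> O'" if B: "B \<in> frames d I" "B' \<in> frames d I" "frame_span d B = frame_span d B'" "B \<in> O'" for B B'
      proof -
        obtain c where c: "c \<noteq> 0" "\<forall>J. length J = d \<longrightarrow> minor B' J = c * minor B J" using minors_proportional[OF B(1-3)] by blast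
        have "minor B' K * minor B0 J - minor B0 K * minor B' J = c * (minor B K * minor B0 J - minor B0 K * minor B J)"
          using c(2) K J(1) by (simp add: algebra_simps)
        then show ?thesis using B(4) c J(1) by (simp add: O'_def norm_mult)
      qed
      have "{B \<in> frames d I. frame_span d B \<in> U} = frames d I \<inter> O'"
        using inv frame_span_Gr unfolding U_def by blast
      then have "openin (Gr_top d I) U" unfolding openin_Gr_top using \<open>open O'\<close> by (auto simp: U_def openin_open_Int)
      moreover have "B0 \<in> O'" using J(3) \<epsilon> by (simp add: O'_def)
      then have "T \<in> U" using TG fB0 B0(2) unfolding U_def by blast
      ultimately have "\<forall>\<^sub>F k in sequentially. frame_span d (B k) \<in> U" using T unfolding limitin_def by blast
      then have ev: "\<forall>\<^sub>F k in sequentially. cmod (minor (B k) K * minor B0 J - minor B0 K * minor (B k) J) \<le> \<epsilon> * cmod (minor (B k) J)"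
      proof eventually_elim
        case (elim k)
        then obtain B' where "B' \<in> frames d I" "frame_span d B' = frame_span d (B k)" "B' \<in> O'" unfolding U_def by blast
        then have "B k \<in> O'" using inv fB by blast
        then show ?case by (simp add: O'_def)
      qed
      show ?thesis
      proof (rule tendsto_le[OF _ _ _ ev])
        show "(\<lambda>k. \<epsilon> * cmod (minor (B k) J)) \<longlonglongrightarrow> \<epsilon> * cmod (minor Q J)" by (intro tendsto_intros minor_tendsto lim)
        show "(\<lambda>k. cmod (minor (B k) K * minor B0 J - minor B0 K * minor (B k) J)) \<longlonglongrightarrow> cmod (minor Q K * minor B0 J - minor B0 K * minor Q J)"
          by (intro tendsto_intros minor_tendsto lim)
      qed simp
    qed
    have "cmod (minor Q K * minor B0 J - minor B0 K * minor Q J) \<le> 0"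
    proof (rule field_le_epsilon)
      fix e :: real assume e: "e > 0"
      let ?m = "cmod (minor Q J) + 1"
      have "?m > 0" by (smt (verit) norm_ge_zero)
      have "cmod (minor Q K * minor B0 J - minor B0 K * minor Q J) \<le> e / ?m * cmod (minor Q J)" by (rule le) (use e \<open>?m > 0\<close> in simp)
      also have "\<dots> \<le> e / ?m * ?m" using e \<open>?m > 0\<close> by (intro mult_left_mono) auto
      also have "\<dots> = e" using \<open>?m > 0\<close> by simp
      finally show "cmod (minor Q K * minor B0 J - minor B0 K * minor Q J) \<le> 0 + e" by simp
    qed
    then show ?thesis by simp
  qed
  define c where "c = minor Q J / minor B0 J"
  have cK: "minor Q K = c * minor B0 K" if "length K = d" for K using eq[OF that] J(3) by (simp add: c_def field_simps)
  obtain K where K: "length K = d" "minor Q K \<noteq> 0" using frame_nonzero_minor[OF fQ] by blast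
  then have "c \<noteq> 0" using cK[OF K(1)] by auto
  from minors_determine_span[OF I fB0 fQ this cK] show ?thesis using B0(2) by simp
qed

section \<open>Ideals and integrality in a subring\<close>

text \<open>Polynomial functions in different sets of variables form nested subrings of one type; subrings,
  ideals and primes are therefore predicates on sets.\<close>
definition is_subring :: "'a::comm_ring_1 set \<Rightarrow> bool" where
  "is_subring A \<longleftrightarrow> 0 \<in> A \<and> 1 \<in> A \<and> (\<forall>a\<in>A. - a \<in> A) \<and>
     (\<forall>a\<in>A. \<forall>b\<in>A. a + b \<in> A) \<and> (\<forall>a\<in>A. \<forall>b\<in>A. a * b \<in> A)"

definition is_ideal :: "'a::comm_ring_1 set \<Rightarrow> 'a set \<Rightarrow> bool" where
  "is_ideal A Q \<longleftrightarrow> Q \<subseteq> A \<and> 0 \<in> Q \<and> (\<forall>a\<in>Q. \<forall>b\<in>Q. a + b \<in> Q) \<and> (\<forall>a\<in>A. \<forall>q\<in>Q. a * q \<in> Q)"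

definition is_prime :: "'a::comm_ring_1 set \<Rightarrow> 'a set \<Rightarrow> bool" where
  "is_prime A Q \<longleftrightarrow> is_ideal A Q \<and> 1 \<notin> Q \<and> (\<forall>a\<in>A. \<forall>b\<in>A. a * b \<in> Q \<longrightarrow> a \<in> Q \<or> b \<in> Q)"

lemma subringD:
  assumes "is_subring A"
  shows "0 \<in> A" "1 \<in> A" "a \<in> A \<Longrightarrow> - a \<in> A" "a \<in> A \<Longrightarrow> b \<in> A \<Longrightarrow> a + b \<in> A"
    "a \<in> A \<Longrightarrow> b \<in> A \<Longrightarrow> a * b \<in> A" "a \<in> A \<Longrightarrow> b \<in> A \<Longrightarrow> a - b \<in> A"
    "a \<in> A \<Longrightarrow> a ^ n \<in> A" "(\<And>i. i \<in> K \<Longrightarrow> f i \<in> A) \<Longrightarrow> sum f K \<in> A"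
    "(\<And>i. i \<in> K \<Longrightarrow> f i \<in> A) \<Longrightarrow> prod f K \<in> A"
proof -
  show *: "0 \<in> A" "1 \<in> A" "a \<in> A \<Longrightarrow> - a \<in> A" "a \<in> A \<Longrightarrow> b \<in> A \<Longrightarrow> a + b \<in> A"
    "a \<in> A \<Longrightarrow> b \<in> A \<Longrightarrow> a * b \<in> A" for a b
    using assms by (auto simp: is_subring_def)
  show "a - b \<in> A" if "a \<in> A" "b \<in> A" using *(4)[OF that(1) *(3)[OF that(2)]] by simp
  show "a ^ n \<in> A" if "a \<in> A" using that by (induction n) (auto intro: *)
  show "sum f K \<in> A" if "\<And>i. i \<in> K \<Longrightarrow> f i \<in> A"
    using that by (induction K rule: infinite_finite_induct) (auto intro: *)
  show "prod f K \<in> A" if "\<And>i. i \<in> K \<Longrightarrow> f i \<in> A"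
    using that by (induction K rule: infinite_finite_induct) (auto intro: *)
qed

lemma idealD:
  assumes "is_ideal A Q"
  shows "q \<in> Q \<Longrightarrow> q \<in> A" "0 \<in> Q" "a \<in> Q \<Longrightarrow> b \<in> Q \<Longrightarrow> a + b \<in> Q" "c \<in> A \<Longrightarrow> q \<in> Q \<Longrightarrow> c * q \<in> Q"
    "c \<in> A \<Longrightarrow> q \<in> Q \<Longrightarrow> q * c \<in> Q" "(\<And>i. i \<in> K \<Longrightarrow> f i \<in> Q) \<Longrightarrow> sum f K \<in> Q"
proof -
  show *: "q \<in> Q \<Longrightarrow> q \<in> A" "0 \<in> Q" "a \<in> Q \<Longrightarrow> b \<in> Q \<Longrightarrow> a + b \<in> Q" "c \<in> A \<Longrightarrow> q \<in> Q \<Longrightarrow> c * q \<in> Q"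
    for a b c q using assms by (auto simp: is_ideal_def)
  show "q * c \<in> Q" if "c \<in> A" "q \<in> Q" using *(4)[OF that] by (simp add: mult.commute)
  show "sum f K \<in> Q" if "\<And>i. i \<in> K \<Longrightarrow> f i \<in> Q"
    using that by (induction K rule: infinite_finite_induct) (auto intro: *)
qed

lemma ideal_uminus:
  assumes "is_subring A" "is_ideal A Q" "q \<in> Q" shows "- q \<in> Q"
  using idealD(4)[OF assms(2), of "- 1" q] assms subringD[OF assms(1)] by auto

lemma ideal_diff:
  assumes "is_subring A" "is_ideal A Q" "q \<in> Q" "r \<in> Q" shows "q - r \<in> Q"
  using idealD(3)[OF assms(2) assms(3) ideal_uminus[OF assms(1,2,4)]] by simp

lemma prime_ideal: "is_prime A Q \<Longrightarrow> is_ideal A Q"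
  by (simp add: is_prime_def)

lemma prime_dvd: "is_prime A Q \<Longrightarrow> a \<in> A \<Longrightarrow> b \<in> A \<Longrightarrow> a * b \<in> Q \<Longrightarrow> a \<in> Q \<or> b \<in> Q"
  by (auto simp: is_prime_def)

lemma prime_power_not_in:
  assumes "is_subring A" "is_prime A Q" "a \<in> A" "a \<notin> Q" shows "a ^ n \<notin> Q"
proof (induction n)
  case 0 then show ?case using assms by (auto simp: is_prime_def)
next
  case (Suc n)
  then show ?case using prime_dvd[OF assms(2,3) subringD(7)[OF assms(1,3), of n]] assms by auto
qed

text \<open>By Zorn's lemma there is an ideal maximal among those that contain \<open>I\<close> and avoid
  \<open>M\<close>. It is prime: if \<open>a\<close> and \<open>b\<close> lie outside, the
  ideals generated with \<open>a\<close> and with \<open>b\<close> meet \<open>M\<close>, hence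
  so does the one generated with \<open>a * b\<close>.\<close>
lemma exists_prime_avoiding:
  assumes A: "is_subring A" and I: "is_ideal A I" and M: "M \<subseteq> A" "1 \<in> M" "\<And>a b. a \<in> M \<Longrightarrow> b \<in> M \<Longrightarrow> a * b \<in> M"
    and disj: "M \<inter> I = {}"
  shows "\<exists>Q. is_prime A Q \<and> I \<subseteq> Q \<and> M \<inter> Q = {}"
proof -
  let ?S = "{J. is_ideal A J \<and> I \<subseteq> J \<and> M \<inter> J = {}}"
  have "\<exists>Q\<in>?S. \<forall>X\<in>?S. Q \<subseteq> X \<longrightarrow> X = Q"
  proof (rule subset_Zorn_nonempty)
    show "?S \<noteq> {}" using I disj by auto
    fix C assume C: "C \<noteq> {}" "subset.chain ?S C"
    have ch: "\<And>X Y. X \<in> C \<Longrightarrow> Y \<in> C \<Longrightarrow> X \<subseteq> Y \<or> Y \<subseteq> X"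
      and CS: "\<And>X. X \<in> C \<Longrightarrow> is_ideal A X \<and> I \<subseteq> X \<and> M \<inter> X = {}"
      using C(2) unfolding subset.chain_def by blast+
    have "is_ideal A (\<Union>C)" unfolding is_ideal_def
    proof (intro conjI ballI)
      show "\<Union>C \<subseteq> A" using CS idealD(1) by blast
      show "0 \<in> \<Union>C" using C(1) CS idealD(2) by blast
      fix a b assume "a \<in> \<Union>C" "b \<in> \<Union>C"
      then obtain X Y where "X \<in> C" "a \<in> X" "Y \<in> C" "b \<in> Y" by blast
      then show "a + b \<in> \<Union>C" using ch[of X Y] CS[of X] CS[of Y] idealD(3)[of A X a b] idealD(3)[of A Y a b] by blast
    next
      fix a q assume "a \<in> A" "q \<in> \<Union>C"
      then show "a * q \<in> \<Union>C" using CS idealD(4) by blast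
    qed
    then show "\<Union>C \<in> ?S" using C(1) CS by fastforce
  qed
  then obtain Q where Q: "is_ideal A Q" "I \<subseteq> Q" "M \<inter> Q = {}"
    and max: "\<And>X. is_ideal A X \<Longrightarrow> M \<inter> X = {} \<Longrightarrow> Q \<subseteq> X \<Longrightarrow> X = Q"
    by (smt (verit, best) mem_Collect_eq subset_trans)
  have meet: "\<exists>q r. q \<in> Q \<and> r \<in> A \<and> q + a * r \<in> M" if a: "a \<in> A" "a \<notin> Q" for a
  proof (rule ccontr)
    assume no: "\<not> ?thesis"
    let ?X = "{q + a * r |q r. q \<in> Q \<and> r \<in> A}"
    have "is_ideal A ?X" unfolding is_ideal_def
    proof (intro conjI ballI)
      show "?X \<subseteq> A" using a idealD(1)[OF Q(1)] subringD[OF A] by auto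
      show "0 \<in> ?X" using idealD(2)[OF Q(1)] subringD(1)[OF A] by force
      fix x y assume "x \<in> ?X" "y \<in> ?X"
      then obtain q r q' r' where "x = q + a * r" "y = q' + a * r'" "q \<in> Q" "r \<in> A" "q' \<in> Q" "r' \<in> A" by blast
      then have "x + y = (q + q') + a * (r + r')" "q + q' \<in> Q" "r + r' \<in> A"
        using idealD[OF Q(1)] subringD[OF A] by (auto simp: algebra_simps)
      then show "x + y \<in> ?X" by blast
    next
      fix c x assume "c \<in> A" "x \<in> ?X"
      then obtain q r where "x = q + a * r" "q \<in> Q" "r \<in> A" by blast
      then have "c * x = c * q + a * (c * r)" "c * q \<in> Q" "c * r \<in> A"
        using \<open>c \<in> A\<close> idealD[OF Q(1)] subringD[OF A] by (auto simp: algebra_simps)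
      then show "c * x \<in> ?X" by blast
    qed
    moreover have "M \<inter> ?X = {}" using no by auto
    moreover have "Q \<subseteq> ?X"
    proof
      fix q assume "q \<in> Q"
      then have "q = q + a * 0 \<and> q \<in> Q \<and> 0 \<in> A" using subringD(1)[OF A] by simp
      then show "q \<in> ?X" by blast
    qed
    ultimately have "?X = Q" by (rule max)
    moreover have "a \<in> ?X"
    proof -
      have "a = 0 + a * 1 \<and> 0 \<in> Q \<and> 1 \<in> A" using idealD(2)[OF Q(1)] subringD(2)[OF A] by simp
      then show ?thesis by blast
    qed
    ultimately show False using a by simp
  qed
  have "is_prime A Q" unfolding is_prime_def
  proof (intro conjI ballI impI)
    show "is_ideal A Q" by (fact Q)
    show "1 \<notin> Q" using M Q by auto
    fix a b assume ab: "a \<in> A" "b \<in> A" "a * b \<in> Q"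
    show "a \<in> Q \<or> b \<in> Q"
    proof (rule ccontr)
      assume "\<not> ?thesis"
      then obtain q r q' r' where *: "q \<in> Q" "r \<in> A" "q + a * r \<in> M" "q' \<in> Q" "r' \<in> A" "q' + b * r' \<in> M"
        using meet ab by meson
      have "(q + a * r) * (q' + b * r') = (q' + b * r') * q + (a * r) * q' + (r * r') * (a * b)"
        by (simp add: algebra_simps)
      also have "\<dots> \<in> Q"
        using idealD(4)[OF Q(1) subsetD[OF M(1) *(6)] *(1)] idealD(4)[OF Q(1) subringD(5)[OF A ab(1) *(2)] *(4)]
          idealD(4)[OF Q(1) subringD(5)[OF A *(2) *(5)] ab(3)] by (intro idealD(3)[OF Q(1)])
      finally show False using M(3)[OF *(3) *(6)] Q(3) by auto
    qed
  qed
  then show ?thesis using Q by blast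
qed

lemma det_in_subring:
  assumes A: "is_subring A" and X: "X \<in> carrier_mat n n" and e: "\<And>i j. i < n \<Longrightarrow> j < n \<Longrightarrow> X $$ (i,j) \<in> A"
  shows "Determinant.det X \<in> A"
proof -
  have "of_int (sign p) \<in> A" for p :: "nat \<Rightarrow> nat"
    using subringD[OF A] by (auto simp: sign_def)
  then show ?thesis
    unfolding det_def'[OF X]
    by (intro subringD(8)[OF A] subringD(5)[OF A] subringD(9)[OF A] e)
      (auto dest: permutes_in_image)
qed

text \<open>Cramer's rule modulo \<open>Q\<close>: multiply the system by the adjugate matrix.\<close>
lemma det_trick:
  assumes A: "is_subring A" and Q: "is_ideal A Q" and X: "X \<in> carrier_mat k k"
    and XA: "\<And>i j. i < k \<Longrightarrow> j < k \<Longrightarrow> X $$ (i,j) \<in> A"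
    and XQ: "\<And>i. i < k \<Longrightarrow> (\<Sum>j<k. X $$ (i,j) * e j) \<in> Q" and i: "i < k"
  shows "Determinant.det X * e i \<in> Q"
proof -
  have adjA: "adj_mat X $$ (i,l) \<in> A" if "l < k" for l
  proof -
    have "Determinant.det (mat_delete X l i) \<in> A"
    proof (rule det_in_subring[OF A])
      show "mat_delete X l i \<in> carrier_mat (k - 1) (k - 1)" using X by (rule mat_delete_carrier)
      show "mat_delete X l i $$ (a, b) \<in> A" if "a < k - 1" "b < k - 1" for a b
        using that X by (auto simp: mat_delete_def intro!: XA)
    qed
    then show ?thesis using that i X subringD[OF A]
      by (auto simp: adj_mat_def cofactor_def)
  qed
  have adj: "adj_mat X \<in> carrier_mat k k" "adj_mat X * X = Determinant.det X \<cdot>\<^sub>m 1\<^sub>m k"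
    using adj_mat[OF X] by auto
  have "(\<Sum>l<k. adj_mat X $$ (i,l) * (\<Sum>j<k. X $$ (l,j) * e j)) \<in> Q"
    by (intro idealD(6)[OF Q] idealD(4)[OF Q] XQ adjA) auto
  also have "(\<Sum>l<k. adj_mat X $$ (i,l) * (\<Sum>j<k. X $$ (l,j) * e j))
      = (\<Sum>j<k. (\<Sum>l<k. adj_mat X $$ (i,l) * X $$ (l,j)) * e j)"
    by (simp add: sum_distrib_left sum_distrib_right mult.assoc) (rule sum.swap)
  also have "\<dots> = (\<Sum>j<k. (adj_mat X * X) $$ (i,j) * e j)"
    using X adj(1) i by (intro sum.cong refl) (simp add: scalar_prod_def lessThan_atLeast0)
  also have "\<dots> = (\<Sum>j<k. (if j = i then Determinant.det X * e i else 0))"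
    unfolding adj(2) using i by (intro sum.cong refl) auto
  also have "\<dots> = Determinant.det X * e i" using i by (simp add: sum.delta)
  finally show ?thesis .
qed

definition coeffs_in :: "'a::comm_ring_1 set \<Rightarrow> 'a poly set" where
  "coeffs_in S = {p. \<forall>i. coeff p i \<in> S}"

lemma coeffs_inI: "(\<And>i. coeff p i \<in> S) \<Longrightarrow> p \<in> coeffs_in S"
  and coeffs_inD: "p \<in> coeffs_in S \<Longrightarrow> coeff p i \<in> S"
  by (auto simp: coeffs_in_def)

lemma subring_coeffs_in:
  assumes S: "is_subring S" shows "is_subring (coeffs_in S)"
  unfolding is_subring_def coeffs_in_def
  using subringD[OF S] by (auto simp: coeff_mult coeff_1 intro!: subringD(8)[OF S])

lemma coeffs_in_pCons:
  assumes S: "is_subring S" "a \<in> S" "p \<in> coeffs_in S" shows "pCons a p \<in> coeffs_in S"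
  using assms by (auto simp: coeffs_in_def coeff_pCons split: nat.splits)

lemma coeffs_in_const: assumes S: "is_subring S" "a \<in> S" shows "[:a:] \<in> coeffs_in S"
  using assms subringD(1)[OF S(1)] by (intro coeffs_in_pCons) (auto simp: coeffs_in_def)

lemma coeffs_in_monom: assumes S: "is_subring S" "a \<in> S" shows "monom a n \<in> coeffs_in S"
  using assms subringD(1)[OF S(1)] by (auto simp: coeffs_in_def)

lemma coeffs_in_mono: "S \<subseteq> T \<Longrightarrow> coeffs_in S \<subseteq> coeffs_in T"
  by (auto simp: coeffs_in_def)

lemma poly_in_subring:
  assumes A: "is_subring A" and p: "p \<in> coeffs_in A" and b: "b \<in> A" shows "poly p b \<in> A"
  unfolding poly_altdef using coeffs_inD[OF p] b by (intro subringD(8)[OF A] subringD(5)[OF A] subringD(7)[OF A])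

text \<open>The ring \<open>B / Q\<close> is generated as an \<open>S\<close>-module by the classes of
  \<open>e 0, ..., e (k - 1)\<close>.\<close>
definition fin_over :: "'a::comm_ring_1 set \<Rightarrow> 'a set \<Rightarrow> 'a set \<Rightarrow> nat \<Rightarrow> (nat \<Rightarrow> 'a) \<Rightarrow> bool" where
  "fin_over B S Q k e \<longleftrightarrow> (\<forall>i<k. e i \<in> B) \<and>
     (\<forall>b\<in>B. \<exists>s q. (\<forall>i<k. s i \<in> S) \<and> q \<in> Q \<and> b = (\<Sum>i<k. s i * e i) + q)"

text \<open>The characteristic polynomial of a matrix of multiplication by \<open>b\<close> annihilates
  \<open>b\<close> modulo \<open>Q\<close>: its value at \<open>b\<close> is a determinant that
  kills every generator (\<open>det_trick\<close>), hence kills \<open>1\<close>.\<close>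
lemma integral_of_finite:
  fixes b :: "'a::comm_ring_1"
  assumes B: "is_subring B" and S: "is_subring S" "S \<subseteq> B" and Q: "is_ideal B Q"
    and fin: "fin_over B S Q k e" and b: "b \<in> B"
  shows "\<exists>f\<in>coeffs_in S. lead_coeff f = 1 \<and> poly f b \<in> Q"
proof -
  have eB: "e i \<in> B" if "i < k" for i using fin that by (auto simp: fin_over_def)
  have "\<forall>i. \<exists>s q. i < k \<longrightarrow> (\<forall>j<k. s j \<in> S) \<and> q \<in> Q \<and> b * e i = (\<Sum>j<k. s j * e j) + q"
    using fin subringD(5)[OF B b eB] unfolding fin_over_def by blast
  then obtain m q where mq: "\<And>i. i < k \<Longrightarrow> (\<forall>j<k. m i j \<in> S) \<and> q i \<in> Q \<and> b * e i = (\<Sum>j<k. m i j * e j) + q i"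
    by metis
  define X where "X = Matrix.mat k k (\<lambda>(i,j). m i j)"
  have X: "X \<in> carrier_mat k k" by (simp add: X_def)
  let ?f = "char_poly X"
  let ?h = "\<lambda>p. poly p b"
  have h: "comm_ring_hom ?h" by unfold_locales auto
  have fS: "?f \<in> coeffs_in S" unfolding char_poly_def
  proof (rule det_in_subring[OF subring_coeffs_in[OF S(1)]])
    show "char_poly_matrix X \<in> carrier_mat k k" using X by simp
    fix i j assume ij: "i < k" "j < k"
    then have mS: "m i j \<in> S" using mq by blast
    show "char_poly_matrix X $$ (i, j) \<in> coeffs_in S"
      using ij mS subringD[OF S(1)] by (auto simp: char_poly_matrix_def X_def intro!: coeffs_in_pCons[OF S(1)] simp: coeffs_in_def[of S, symmetric])
        (auto simp: coeffs_in_def coeff_pCons subringD[OF S(1)] split: nat.splits)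
  qed
  let ?Y = "map_mat ?h (char_poly_matrix X)"
  have Y: "?Y \<in> carrier_mat k k" using X by simp
  have Yij: "?Y $$ (i,j) = (if i = j then b - m i j else - m i j)" if "i < k" "j < k" for i j
    using that by (auto simp: char_poly_matrix_def X_def)
  have YQ: "(\<Sum>j<k. ?Y $$ (i,j) * e j) \<in> Q" if "i < k" for i
  proof -
    have "(\<Sum>j<k. ?Y $$ (i,j) * e j) = (\<Sum>j<k. (if j = i then b * e i else 0) - m i j * e j)"
      using that by (intro sum.cong refl) (auto simp: Yij algebra_simps)
    also have "\<dots> = b * e i - (\<Sum>j<k. m i j * e j)" using that by (simp add: sum_subtractf)
    also have "\<dots> = q i" using mq[OF that] by simp
    finally show ?thesis using mq[OF that] by simp
  qed
  have YB: "?Y $$ (i,j) \<in> B" if "i < k" "j < k" for i j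
    unfolding Yij[OF that] using mq[OF that(1)] that(2) S(2) b subringD[OF B] by auto
  have d: "Determinant.det ?Y * e i \<in> Q" if "i < k" for i
    by (rule det_trick[OF B Q Y YB YQ that])
  obtain s r where s: "\<forall>i<k. s i \<in> S" "r \<in> Q" "1 = (\<Sum>i<k. s i * e i) + r"
    using fin subringD(2)[OF B] unfolding fin_over_def by blast
  have dB: "Determinant.det ?Y \<in> B" by (rule det_in_subring[OF B Y YB])
  have "Determinant.det ?Y = Determinant.det ?Y * ((\<Sum>i<k. s i * e i) + r)" using s(3) by simp
  also have "\<dots> = (\<Sum>i<k. s i * (Determinant.det ?Y * e i)) + Determinant.det ?Y * r"
    by (simp add: algebra_simps sum_distrib_left)
  also have "\<dots> \<in> Q" using s S(2) dB
    by (intro idealD(3)[OF Q] idealD(6)[OF Q] idealD(4)[OF Q] d) auto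
  finally have "poly ?f b \<in> Q" by (simp add: char_poly_def comm_ring_hom.hom_det[OF h])
  moreover have "lead_coeff ?f = 1" using degree_monic_char_poly[OF X] by simp
  ultimately show ?thesis using fS by blast
qed

section \<open>Polynomial functions\<close>

hide_const (open) Module.smult

type_synonym 'v pfun = "('v \<Rightarrow> complex) \<Rightarrow> complex"

text \<open>Functions on $\mathbb{C}^{V}$ instead of formal polynomials: restriction to lines, linear
  substitutions and limits are then plain operations on functions.\<close>
definition cfun :: "complex \<Rightarrow> 'v pfun" where "cfun c = (\<lambda>_. c)"
definition coord :: "'v \<Rightarrow> 'v pfun" where "coord v = (\<lambda>x. x v)"

lemma cfun_simps [simp]: "cfun 0 = 0" "cfun 1 = 1" "cfun (a + b) = cfun a + cfun b"
  "cfun (a * b) = cfun a * cfun b" "cfun (a - b) = cfun a - cfun b" "cfun (- a) = - cfun a"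
  "cfun (a ^ n) = cfun a ^ n"
proof -
  show m: "cfun (a * b) = cfun a * cfun b" for a b by (auto simp: cfun_def)
  show o: "cfun 1 = 1" by (auto simp: cfun_def)
  show "cfun (a ^ n) = cfun a ^ n" by (induction n) (simp_all add: m o)
qed (auto simp: cfun_def)

lemma cfun_apply [simp]: "cfun c x = c" and coord_apply [simp]: "coord v x = x v"
  by (simp_all add: cfun_def coord_def)

lemma cfun_inverse: "a \<noteq> 0 \<Longrightarrow> cfun a * cfun (1 / a) = 1"
  by (simp add: fun_eq_iff)

lemma power_fun_apply [simp]: "(f ^ n) x = (f x :: complex) ^ n"
  by (induction n) simp_all
lemma sum_fun_apply [simp]: "(sum f K) x = (\<Sum>i\<in>K. (f i x :: complex))"
  by (induction K rule: infinite_finite_induct) simp_all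
lemma prod_fun_apply [simp]: "(prod f K) x = (\<Prod>i\<in>K. (f i x :: complex))"
  by (induction K rule: infinite_finite_induct) simp_all
lemma minus_fun_apply' [simp]: "(f - g) x = (f x - g x :: complex)" by simp

inductive_set PF :: "'v set \<Rightarrow> 'v pfun set" for V where
  PF_const: "cfun c \<in> PF V"
| PF_coord: "v \<in> V \<Longrightarrow> coord v \<in> PF V"
| PF_add: "f \<in> PF V \<Longrightarrow> g \<in> PF V \<Longrightarrow> f + g \<in> PF V"
| PF_mult: "f \<in> PF V \<Longrightarrow> g \<in> PF V \<Longrightarrow> f * g \<in> PF V"

lemma subring_PF: "is_subring (PF V)"
proof -
  have "- f \<in> PF V" if "f \<in> PF V" for f
    using PF_mult[OF PF_const[of "-1"] that] by simp
  then show ?thesis unfolding is_subring_def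
    using PF_const[of 0] PF_const[of 1] by (auto intro: PF_add PF_mult simp del: cfun_simps simp: cfun_simps(1,2))
qed

lemmas PF_ring = subringD[OF subring_PF]

lemma PF_mono: assumes "V \<subseteq> W" "f \<in> PF V" shows "f \<in> PF W"
  using assms(2,1) by (induction rule: PF.induct) (auto intro: PF.intros)

lemma PF_cong: assumes "f \<in> PF V" "\<And>v. v \<in> V \<Longrightarrow> x v = y v" shows "f x = f y"
  using assms by (induction rule: PF.induct) auto

lemma comp_fun_simps:
  "cfun c \<circ> L = cfun c" "coord v \<circ> L = (\<lambda>x. L x v)" "(f + g) \<circ> L = (f \<circ> L) + (g \<circ> L)"
  "(f * g) \<circ> L = (f \<circ> L) * (g \<circ> L)" "0 \<circ> L = 0" "1 \<circ> L = 1" "(f - g) \<circ> L = (f \<circ> L) - (g \<circ> L)"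
  "sum F K \<circ> L = (\<Sum>i\<in>K. F i \<circ> L)" "(f ^ n) \<circ> L = (f \<circ> L) ^ n"
  for f g :: "'v pfun" and F :: "'i \<Rightarrow> 'v pfun"
  by (auto simp: fun_eq_iff)

lemma PF_comp: assumes "f \<in> PF V" "\<And>w. w \<in> V \<Longrightarrow> (\<lambda>x. L x w) \<in> PF W" shows "f \<circ> L \<in> PF W"
  using assms(1) by (induction rule: PF.induct) (simp_all only: comp_fun_simps PF.intros assms(2))

lemma PF_tendsto:
  assumes "f \<in> PF V" "\<And>v. v \<in> V \<Longrightarrow> ((\<lambda>k. x k v) \<longlongrightarrow> y v) F"
  shows "((\<lambda>k. f (x k)) \<longlongrightarrow> f y) F"
  using assms by (induction rule: PF.induct) (auto intro!: tendsto_intros)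

lemma PF_on_line:
  assumes "f \<in> PF V" shows "\<exists>p. \<forall>z. f (\<lambda>v. x v + z * y v) = poly p z"
  using assms
proof (induction rule: PF.induct)
  case (PF_const c) then show ?case by (intro exI[of _ "[:c:]"]) simp
next
  case (PF_coord v) then show ?case by (intro exI[of _ "[:x v, y v:]"]) simp
next
  case (PF_add f g)
  then obtain p q where "\<forall>z. f (\<lambda>v. x v + z * y v) = poly p z" "\<forall>z. g (\<lambda>v. x v + z * y v) = poly q z" by blast
  then show ?case by (intro exI[of _ "p + q"]) simp
next
  case (PF_mult f g)
  then obtain p q where "\<forall>z. f (\<lambda>v. x v + z * y v) = poly p z" "\<forall>z. g (\<lambda>v. x v + z * y v) = poly q z" by blast
  then show ?case by (intro exI[of _ "p * q"]) simp
qed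

text \<open>On the line from \<open>x\<close> to a point with \<open>f \<noteq> 0\<close>, \<open>f\<close>
  is a nonzero polynomial in one variable, which has finitely many zeros.\<close>
lemma PF_nonzero_near:
  assumes "f \<in> PF V" "f \<noteq> 0"
  shows "\<exists>y. \<forall>\<^sub>F k in sequentially. f (\<lambda>v. x v + of_real (1 / real (Suc k)) * y v) \<noteq> 0"
proof -
  obtain a where a: "f a \<noteq> 0" using assms(2) by (auto simp: fun_eq_iff)
  let ?y = "\<lambda>v. a v - x v"
  obtain p where p: "\<And>z. f (\<lambda>v. x v + z * ?y v) = poly p z" using PF_on_line[OF assms(1), of x ?y] by blast
  have "poly p 1 \<noteq> 0" using a p[of 1, symmetric] by simp
  then have "p \<noteq> 0" by auto
  then have fin: "finite {z. poly p z = 0}" by (rule poly_roots_finite)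
  have inj: "inj (\<lambda>k. complex_of_real (1 / real (Suc k)))" by (auto simp: inj_def)
  have "finite {k. poly p (complex_of_real (1 / real (Suc k))) = 0}"
    using finite_vimageI[OF fin inj] by (simp add: vimage_def)
  then have "\<forall>\<^sub>F k in sequentially. poly p (complex_of_real (1 / real (Suc k))) \<noteq> 0"
    unfolding cofinite_eq_sequentially[symmetric] eventually_cofinite by simp
  then show ?thesis unfolding p[symmetric] by (rule exI[of _ ?y])
qed

text \<open>Close to a point where \<open>f\<close> does not vanish there are points where \<open>g\<close>
  does not vanish.\<close>
lemma PF_no_zero_divisors:
  assumes "f \<in> PF V" "g \<in> PF V" "f * g = 0" shows "f = 0 \<or> g = 0"
proof (rule ccontr)
  assume "\<not> ?thesis"
  then obtain a where a: "f a \<noteq> 0" and g: "g \<noteq> 0" by (auto simp: fun_eq_iff)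
  obtain y where y: "\<forall>\<^sub>F k in sequentially. g (\<lambda>v. a v + of_real (1 / real (Suc k)) * y v) \<noteq> 0"
    using PF_nonzero_near[OF assms(2) g] by blast
  have lim: "(\<lambda>k. complex_of_real (1 / real (Suc k))) \<longlonglongrightarrow> of_real 0"
    by (intro tendsto_of_real) (rule LIMSEQ_Suc[OF lim_1_over_n])
  have "(\<lambda>k. f (\<lambda>v. a v + of_real (1 / real (Suc k)) * y v)) \<longlonglongrightarrow> f a"
    by (rule PF_tendsto[OF assms(1)], rule tendsto_eq_intros, rule tendsto_const,
        rule tendsto_mult[OF lim tendsto_const], simp)
  then have "\<forall>\<^sub>F k in sequentially. f (\<lambda>v. a v + of_real (1 / real (Suc k)) * y v) \<noteq> 0"
    using a by (rule tendsto_imp_eventually_ne)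
  then have "\<forall>\<^sub>F k in sequentially. (f * g) (\<lambda>v. a v + of_real (1 / real (Suc k)) * y v) \<noteq> 0"
    using y by eventually_elim simp
  then show False using assms(3) by simp
qed

lemma PF_insert_poly:
  assumes "f \<in> PF (insert v U)"
  shows "\<exists>p\<in>coeffs_in (PF U). f = poly p (coord v)"
  using assms
proof (induction rule: PF.induct)
  case (PF_const c)
  then show ?case by (intro bexI[of _ "[:cfun c:]"]) (auto intro!: coeffs_in_const subring_PF PF.intros)
next
  case (PF_coord w)
  show ?case
  proof (cases "w = v")
    case True
    then show ?thesis by (intro bexI[of _ "[:0, 1:]"])
      (auto intro!: coeffs_in_pCons coeffs_in_const subring_PF PF_ring)
  next
    case False
    then show ?thesis using PF_coord
      by (intro bexI[of _ "[:coord w:]"]) (auto intro!: coeffs_in_const subring_PF PF.intros)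
  qed
next
  case (PF_add f g)
  then show ?case using subringD(4)[OF subring_coeffs_in[OF subring_PF[of U]]] by (metis poly_add)
next
  case (PF_mult f g)
  then show ?case using subringD(5)[OF subring_coeffs_in[OF subring_PF[of U]]] by (metis poly_mult)
qed

text \<open>Homogeneous polynomial functions of degree \<open>k\<close> in the variables \<open>V\<close>.\<close>
inductive hpf :: "'v set \<Rightarrow> nat \<Rightarrow> 'v pfun \<Rightarrow> bool" for V where
  hpf_zero: "hpf V k 0"
| hpf_const: "hpf V 0 (cfun c)"
| hpf_var: "hpf V k f \<Longrightarrow> v \<in> V \<Longrightarrow> hpf V (Suc k) (coord v * f)"
| hpf_add: "hpf V k f \<Longrightarrow> hpf V k g \<Longrightarrow> hpf V k (f + g)"

lemma hpf_PF: "hpf V k f \<Longrightarrow> f \<in> PF V"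
  by (induction rule: hpf.induct) (blast intro: PF.intros PF_ring(1))+

lemma hpf_sum: "(\<And>i. i \<in> K \<Longrightarrow> hpf V k (f i)) \<Longrightarrow> hpf V k (sum f K)"
proof (induction K rule: infinite_finite_induct)
  case (insert i K)
  show ?case unfolding sum.insert[OF insert(1,2)] by (intro hpf_add insert(3) insert(4)) (rule insertI1, rule insertI2)
qed (simp_all only: sum.infinite sum.empty hpf_zero not_False_eq_True)

lemma hpf_scale:
  assumes "hpf V k f" shows "hpf V k (cfun c * f)"
  using assms
proof (induction rule: hpf.induct)
  case (hpf_const c')
  show ?case unfolding cfun_simps(4)[symmetric] by (rule hpf.hpf_const)
next
  case (hpf_var k f v)
  then show ?case unfolding mult.left_commute[of "cfun c"] by (intro hpf.hpf_var)
next
  case (hpf_zero k) show ?case unfolding mult_zero_right by (rule hpf.hpf_zero)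
next
  case (hpf_add k f g) then show ?case unfolding distrib_left by (intro hpf.hpf_add)
qed

lemma hpf_mult: assumes "hpf V k f" "hpf V l g" shows "hpf V (k + l) (f * g)"
  using assms
proof (induction rule: hpf.induct)
  case (hpf_var k f v)
  then show ?case unfolding mult.assoc add_Suc by (intro hpf.hpf_var)
next
  case (hpf_const c)
  then show ?case unfolding add_0 by (rule hpf_scale)
next
  case (hpf_zero k) show ?case unfolding mult_zero_left by (rule hpf.hpf_zero)
next
  case (hpf_add k f g') then show ?case unfolding distrib_right by (blast intro: hpf.hpf_add)
qed

lemma hpf_zero_deg: assumes "hpf V 0 f" shows "\<exists>c. f = cfun c"
proof -
  have "k = 0 \<longrightarrow> (\<exists>c. f = cfun c)" if "hpf V k f" for k
    using that
  proof (induction rule: hpf.induct)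
    case (hpf_zero k) show ?case by (metis cfun_simps(1))
  next
    case (hpf_add k f g) then show ?case by (metis cfun_simps(3))
  qed auto
  then show ?thesis using assms by blast
qed

lemma hpf_homogeneous: assumes "hpf V k f" shows "f (\<lambda>v. c * x v) = c ^ k * f x"
  using assms by (induction rule: hpf.induct) (auto simp: algebra_simps)

lemma hpf_comp:
  assumes "hpf V k f" "\<And>w. w \<in> V \<Longrightarrow> hpf W 1 (\<lambda>x. L x w)" shows "hpf W k (f \<circ> L)"
  using assms(1)
proof (induction rule: hpf.induct)
  case (hpf_var k f v)
  show ?case unfolding comp_fun_simps using hpf_mult[OF assms(2)[OF hpf_var(2)] hpf_var(3)] by (simp only: plus_1_eq_Suc)
qed (simp_all only: comp_fun_simps hpf.intros)

text \<open>The homogeneous parts are packed as the coefficients of a polynomial in an auxiliary variable,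
  so that products of polynomials handle products of decompositions; setting the variable to
  \<open>1\<close> adds the parts up.\<close>
lemma homogeneous_decomposition:
  assumes "f \<in> PF V" shows "\<exists>p. (\<forall>k. hpf V k (coeff p k)) \<and> f = poly p 1"
  using assms
proof (induction rule: PF.induct)
  case (PF_const c)
  have "poly [:cfun c:] 1 = cfun c" by simp
  moreover have "hpf V k (coeff [:cfun c:] k)" for k by (cases k) (simp_all add: hpf_const hpf_zero)
  ultimately show ?case by metis
next
  case (PF_coord v)
  have "hpf V 1 (coord v)" using hpf_var[OF hpf_const[of V 1] PF_coord] by (simp add: mult_1_right)
  then have "hpf V k (coeff [:0, coord v:] k)" for k
    by (cases k) (auto simp: coeff_pCons hpf_zero split: nat.splits)
  moreover have "poly [:0, coord v:] 1 = coord v" by simp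
  ultimately show ?case by metis
next
  case (PF_add f g)
  then obtain p q where pq: "\<forall>k. hpf V k (coeff p k)" "f = poly p 1" "\<forall>k. hpf V k (coeff q k)" "g = poly q 1" by blast
  have "hpf V k (coeff (p + q) k)" for k unfolding coeff_add using pq by (intro hpf.intros) auto
  then show ?case unfolding pq(2,4) poly_add[symmetric] by blast
next
  case (PF_mult f g)
  then obtain p q where pq: "\<forall>k. hpf V k (coeff p k)" "f = poly p 1" "\<forall>k. hpf V k (coeff q k)" "g = poly q 1" by blast
  have "hpf V k (coeff (p * q) k)" for k
    unfolding coeff_mult
  proof (rule hpf_sum)
    fix i assume "i \<in> {..k}"
    then show "hpf V k (coeff p i * coeff q (k - i))" using hpf_mult[of V i "coeff p i" "k - i" "coeff q (k - i)"] pq by simp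
  qed
  then show ?case unfolding pq(2,4) poly_mult[symmetric] by blast
qed

lemma hpf_insert_poly:
  assumes "hpf (insert v U) k f"
  shows "\<exists>p. (\<forall>i>k. coeff p i = 0) \<and> (\<forall>i\<le>k. hpf U (k - i) (coeff p i)) \<and> f = poly p (coord v)"
  using assms
proof (induction rule: hpf.induct)
  case (hpf_zero k)
  have "poly 0 (coord v) = 0" by simp
  then show ?case by (metis coeff_0 hpf.hpf_zero)
next
  case (hpf_const c)
  have "poly [:cfun c:] (coord v) = cfun c" by simp
  moreover have "\<forall>i>0. coeff [:cfun c:] i = 0" by (simp add: coeff_pCons split: nat.splits)
  moreover have "\<forall>i\<le>0. hpf U (0 - i) (coeff [:cfun c:] i)" by (simp add: hpf.hpf_const)
  ultimately show ?case by metis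
next
  case (hpf_var k f w)
  then obtain p where p: "\<forall>i>k. coeff p i = 0" "\<forall>i\<le>k. hpf U (k - i) (coeff p i)" "f = poly p (coord v)" by blast
  show ?case
  proof (cases "w = v")
    case True
    have "\<forall>i>Suc k. coeff (pCons 0 p) i = 0" using p(1) by (simp add: coeff_pCons split: nat.splits)
    moreover have "\<forall>i\<le>Suc k. hpf U (Suc k - i) (coeff (pCons 0 p) i)"
      using p(2) by (simp add: coeff_pCons hpf_zero split: nat.splits)
    moreover have "coord w * f = poly (pCons 0 p) (coord v)" unfolding True p(3) by (simp only: poly_pCons add_0)
    ultimately show ?thesis by blast
  next
    case False
    then have "w \<in> U" using hpf_var by auto
    then have "hpf U (Suc k - i) (coord w * coeff p i)" if "i \<le> Suc k" for i
    proof (cases "i = Suc k")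
      case True then show ?thesis using p(1) by (simp add: hpf_zero)
    next
      case False
      then have "hpf U (Suc (k - i)) (coord w * coeff p i)" using p(2) that \<open>w \<in> U\<close> by (intro hpf.hpf_var) auto
      then show ?thesis using that False by (simp add: Suc_diff_le)
    qed
    moreover have "\<forall>i>Suc k. coeff (smult (coord w) p) i = 0" using p(1) by simp
    moreover have "coord w * f = poly (smult (coord w) p) (coord v)" unfolding p(3) by (simp only: poly_smult)
    ultimately show ?thesis by (metis coeff_smult)
  qed
next
  case (hpf_add k f g)
  then obtain p q where pq: "\<forall>i>k. coeff p i = 0" "\<forall>i\<le>k. hpf U (k - i) (coeff p i)" "f = poly p (coord v)"
    "\<forall>i>k. coeff q i = 0" "\<forall>i\<le>k. hpf U (k - i) (coeff q i)" "g = poly q (coord v)" by blast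
  have "\<forall>i\<le>k. hpf U (k - i) (coeff (p + q) i)" unfolding coeff_add using pq by (blast intro: hpf.hpf_add)
  moreover have "\<forall>i>k. coeff (p + q) i = 0" using pq by simp
  ultimately show ?case unfolding pq(3,6) poly_add[symmetric] by blast
qed

text \<open>The map \<open>x \<mapsto> x + x\<^sub>v c\<close>. When \<open>c v = 0\<close>, it fixes the
  coordinate \<open>v\<close> and its inverse is the shear along \<open>- c\<close>.\<close>
definition shear :: "'v \<Rightarrow> ('v \<Rightarrow> complex) \<Rightarrow> ('v \<Rightarrow> complex) \<Rightarrow> 'v \<Rightarrow> complex" where
  "shear v c x = (\<lambda>w. x w + x v * c w)"

text \<open>\<open>L\<close> and \<open>M\<close> are mutually inverse polynomial maps that change only the
  coordinates in \<open>V\<close>; composition with them permutes polynomial functions.\<close>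
definition PF_aut :: "'v set \<Rightarrow> (('v \<Rightarrow> complex) \<Rightarrow> 'v \<Rightarrow> complex) \<Rightarrow> (('v \<Rightarrow> complex) \<Rightarrow> 'v \<Rightarrow> complex) \<Rightarrow> bool" where
  "PF_aut V L M \<longleftrightarrow> (\<forall>x. L (M x) = x \<and> M (L x) = x) \<and>
     (\<forall>w\<in>V. (\<lambda>x. L x w) \<in> PF V \<and> (\<lambda>x. M x w) \<in> PF V) \<and>
     (\<forall>w x. w \<notin> V \<longrightarrow> L x w = x w \<and> M x w = x w)"

lemma coord_mult_const_PF: "v \<in> V \<Longrightarrow> (\<lambda>x. x w + x v * c) \<in> PF V" if "w \<in> V"
proof -
  assume "v \<in> V"
  then have "coord w + coord v * cfun c \<in> PF V" using that by (intro PF.intros)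
  also have "coord w + coord v * cfun c = (\<lambda>x. x w + x v * c)" by auto
  finally show ?thesis .
qed

lemma PF_aut_shear:
  assumes "v \<in> V" "c v = 0" "\<And>w. w \<notin> V \<Longrightarrow> c w = 0"
  shows "PF_aut V (shear v c) (shear v (\<lambda>w. - c w))"
  using assms coord_mult_const_PF[of _ V v "- c _"] coord_mult_const_PF[of _ V v "c _"]
  by (auto simp: PF_aut_def shear_def intro: coord_mult_const_PF)

lemma PF_aut_mono: assumes "PF_aut V L M" "V \<subseteq> W" shows "PF_aut W L M"
proof -
  have "(\<lambda>x. L x w) \<in> PF W \<and> (\<lambda>x. M x w) \<in> PF W" if "w \<in> W" for w
  proof (cases "w \<in> V")
    case True
    then show ?thesis using assms PF_mono[OF assms(2)] by (auto simp: PF_aut_def)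
  next
    case False
    then have "(\<lambda>x. L x w) = coord w" "(\<lambda>x. M x w) = coord w" using assms by (auto simp: PF_aut_def coord_def)
    then show ?thesis using PF_coord[OF that] by simp
  qed
  then show ?thesis using assms by (auto simp: PF_aut_def)
qed

lemma PF_aut_pull: assumes "PF_aut V L M" "V \<subseteq> W" "f \<in> PF W" shows "f \<circ> L \<in> PF W" "f \<circ> M \<in> PF W"
  using PF_aut_mono[OF assms(1,2)] PF_comp[OF assms(3)] by (auto simp: PF_aut_def)

lemma PF_aut_comp: assumes "PF_aut V L M" "PF_aut V L' M'" shows "PF_aut V (L \<circ> L') (M' \<circ> M)"
proof -
  have "(\<lambda>x. (L \<circ> L') x w) \<in> PF V \<and> (\<lambda>x. (M' \<circ> M) x w) \<in> PF V" if w: "w \<in> V" for w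
  proof -
    have "(\<lambda>x. L x w) \<circ> L' \<in> PF V" "(\<lambda>x. M' x w) \<circ> M \<in> PF V"
      using PF_aut_pull[OF assms(2) order.refl, of "\<lambda>x. L x w"] PF_aut_pull[OF assms(1) order.refl, of "\<lambda>x. M' x w"]
        assms w by (auto simp: PF_aut_def)
    then show ?thesis by (simp add: comp_def)
  qed
  then show ?thesis using assms by (simp add: PF_aut_def)
qed

text \<open>Let \<open>f\<^sub>d\<close> be the top homogeneous part of \<open>f\<close>, nonzero at a point
  \<open>\<xi>\<close> with \<open>\<xi> v \<noteq> 0\<close>. The shear that sends the
  \<open>v\<close>-th axis to the line through \<open>\<xi>\<close> gives
  \<open>v\<^sup>d\<close> the constant coefficient \<open>f\<^sub>d \<xi> / (\<xi>
  v)\<^sup>d\<close>, and this becomes the highest power of \<open>v\<close>.\<close>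
lemma exists_shear_monic:
  assumes f: "f \<in> PF V" "f \<noteq> 0"
  shows "(\<exists>a. f = cfun a) \<or>
    (\<exists>v\<in>V. \<exists>c a p. c v = 0 \<and> (\<forall>w. w \<notin> V \<longrightarrow> c w = 0) \<and> a \<noteq> 0 \<and> p \<in> coeffs_in (PF (V - {v})) \<and>
       lead_coeff p = 1 \<and> f \<circ> shear v c = cfun a * poly p (coord v))"
proof -
  obtain P where P: "\<And>k. hpf V k (coeff P k)" "f = poly P 1" using homogeneous_decomposition[OF f(1)] by blast
  define d where "d = degree P"
  have "P \<noteq> 0" using f(2) P(2) by auto
  then have top: "coeff P d \<noteq> 0" by (simp add: d_def)
  have fsum: "f = (\<Sum>k\<le>d. coeff P k)" by (simp add: P(2) poly_altdef d_def)
  show ?thesis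
  proof (cases "d = 0")
    case True
    then show ?thesis using hpf_zero_deg[of V] P(1)[of 0] fsum by auto
  next
    case False
    obtain \<xi> where \<xi>: "coeff P d \<xi> \<noteq> 0" using top by (auto simp: fun_eq_iff)
    have "coeff P d (\<lambda>v. 0) = 0" using hpf_homogeneous[OF P(1)[of d], of 0 \<xi>] False by simp
    then obtain v where v: "v \<in> V" "\<xi> v \<noteq> 0"
      using \<xi> PF_cong[OF hpf_PF[OF P(1)[of d]], of \<xi> "\<lambda>v. 0"] by auto
    define c where "c = (\<lambda>w. if w \<in> V \<and> w \<noteq> v then \<xi> w / \<xi> v else 0)"
    let ?L = "shear v c"
    let ?e = "\<lambda>w. if w = v then 1 else (0::complex)"
    have c: "c v = 0" "\<forall>w. w \<notin> V \<longrightarrow> c w = 0" by (auto simp: c_def)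
    have "hpf V 1 (\<lambda>x. ?L x w)" if "w \<in> V" for w
    proof -
      have "hpf V 1 (coord w * cfun 1 + coord v * cfun (c w))"
        unfolding One_nat_def using that v by (intro hpf.intros)
      also have "coord w * cfun 1 + coord v * cfun (c w) = (\<lambda>x. ?L x w)" by (auto simp: shear_def fun_eq_iff)
      finally show ?thesis .
    qed
    then have hL: "hpf V k (coeff P k \<circ> ?L)" for k by (rule hpf_comp[OF P(1)])
    have V: "V = insert v (V - {v})" using v by auto
    have "\<forall>k. \<exists>p. (\<forall>i>k. coeff p i = 0) \<and> (\<forall>i\<le>k. hpf (V - {v}) (k - i) (coeff p i)) \<and>
        coeff P k \<circ> ?L = poly p (coord v)"
      using hpf_insert_poly[of v "V - {v}"] hL V by metis
    then obtain R where R: "\<And>k i. i > k \<Longrightarrow> coeff (R k) i = 0"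
      "\<And>k i. i \<le> k \<Longrightarrow> hpf (V - {v}) (k - i) (coeff (R k) i)" "\<And>k. coeff P k \<circ> ?L = poly (R k) (coord v)"
      by metis
    have RPF: "coeff (R k) i \<in> PF (V - {v})" for k i
      using R(1)[where k=k and i=i] R(2)[where k=k and i=i] hpf_PF PF_ring(1) by (cases "i \<le> k") auto
    \<comment> \<open>Only the part of degree \<open>d\<close> can contribute to the power \<open>d\<close> of the variable \<open>v\<close>.\<close>
    define p1 where "p1 = (\<Sum>k\<le>d. R k)"
    have fp1: "f \<circ> ?L = poly p1 (coord v)"
    proof -
      have "f \<circ> ?L = (\<Sum>k\<le>d. coeff P k \<circ> ?L)" unfolding fsum by (auto simp: fun_eq_iff)
      then show ?thesis by (simp add: R(3) p1_def poly_sum)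
    qed
    obtain a where a: "coeff (R d) d = cfun a" using R(2)[of d d] hpf_zero_deg by auto
    have p1d: "coeff p1 d = cfun a"
    proof -
      have "coeff p1 d = (\<Sum>k\<le>d. if k = d then coeff (R d) d else 0)"
        unfolding p1_def coeff_sum using R(1) by (intro sum.cong refl) auto
      then show ?thesis using a by simp
    qed
    have p1i: "coeff p1 i = 0" if "i > d" for i
      using that R(1) by (auto simp: p1_def coeff_sum intro!: sum.neutral)
    have "a \<noteq> 0"
    proof -
      have "(coeff P d \<circ> ?L) ?e = (\<Sum>i\<le>degree (R d). (coeff (R d) i * coord v ^ i) ?e)"
        unfolding R(3) poly_altdef by simp
      also have "\<dots> = (\<Sum>i\<le>degree (R d). if i = d then a else 0)"
      proof (intro sum.cong refl)
        fix i
        have "coeff (R d) i ?e = 0" if "i < d"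
        proof -
          have "coeff (R d) i ?e = coeff (R d) i (\<lambda>w. 0 * ?e w)" by (rule PF_cong[OF RPF]) auto
          also have "\<dots> = 0" using hpf_homogeneous[OF R(2), of i d 0 ?e] that by simp
          finally show ?thesis .
        qed
        then show "(coeff (R d) i * coord v ^ i) ?e = (if i = d then a else 0)"
          using a R(1)[of d i] by (cases i d rule: linorder_cases) auto
      qed
      also have "\<dots> = (if d \<le> degree (R d) then a else 0)" by simp
      finally have 1: "coeff P d (?L ?e) = (if d \<le> degree (R d) then a else 0)" by simp
      have "coeff P d (?L ?e) = coeff P d (\<lambda>w. (1 / \<xi> v) * \<xi> w)"
        by (rule PF_cong[OF hpf_PF[OF P(1)]]) (use v in \<open>auto simp: shear_def c_def\<close>)
      also have "\<dots> = (1 / \<xi> v) ^ d * coeff P d \<xi>" by (rule hpf_homogeneous[OF P(1)])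
      also have "\<dots> \<noteq> 0" using v \<xi> by simp
      finally show ?thesis using 1 by auto
    qed
    define p where "p = smult (cfun (1 / a)) p1"
    have pd: "coeff p d = 1"
    proof -
      have "coeff p d = cfun (1 / a) * cfun a" by (simp add: p_def p1d)
      also have "\<dots> = cfun (1 / a * a)" by (simp only: cfun_simps(4))
      also have "\<dots> = 1" using \<open>a \<noteq> 0\<close> by simp
      finally show ?thesis .
    qed
    have pi: "coeff p i = 0" if "i > d" for i using p1i[OF that] by (simp add: p_def)
    have "degree p = d"
      by (rule antisym) (use pd pi in \<open>auto intro!: degree_le le_degree\<close>)
    then have "lead_coeff p = 1" using pd by simp
    moreover have "p \<in> coeffs_in (PF (V - {v}))"
      unfolding p_def p1_def by (auto intro!: coeffs_inI PF_mult PF_const PF_ring RPF simp: coeff_sum)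
    moreover have "f \<circ> ?L = cfun a * poly p (coord v)"
      unfolding fp1 p_def poly_smult mult.assoc[symmetric] cfun_inverse[OF \<open>a \<noteq> 0\<close>] by (simp only: mult_1_left)
    ultimately show ?thesis using v c \<open>a \<noteq> 0\<close> by blast
  qed
qed

section \<open>Noether normalization\<close>

lemma fin_overI:
  assumes "finite I" "\<And>i. i \<in> I \<Longrightarrow> e i \<in> B"
    and "\<And>b. b \<in> B \<Longrightarrow> \<exists>s q. (\<forall>i\<in>I. s i \<in> S) \<and> q \<in> Q \<and> b = (\<Sum>i\<in>I. s i * e i) + q"
  shows "\<exists>k e. fin_over B S Q k e"
proof -
  obtain h where h: "bij_betw h {0..<card I} I" using ex_bij_betw_nat_finite[OF assms(1)] by blast
  then have h': "bij_betw h {..<card I} I" by (simp add: lessThan_atLeast0)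
  have hI: "h i \<in> I" if "i < card I" for i using h' that by (auto simp: bij_betw_def)
  have "fin_over B S Q (card I) (e \<circ> h)" unfolding fin_over_def
  proof (intro conjI allI impI ballI)
    show "(e \<circ> h) i \<in> B" if "i < card I" for i using hI[OF that] assms(2) by simp
    fix b assume "b \<in> B"
    then obtain s q where sq: "\<forall>i\<in>I. s i \<in> S" "q \<in> Q" "b = (\<Sum>i\<in>I. s i * e i) + q" using assms(3) by blast
    have "(\<Sum>i\<in>I. s i * e i) = (\<Sum>i<card I. (s \<circ> h) i * (e \<circ> h) i)"
      unfolding sum.reindex_bij_betw[OF h', symmetric] by (simp only: comp_apply)
    then show "\<exists>s q. (\<forall>i<card I. s i \<in> S) \<and> q \<in> Q \<and> b = (\<Sum>i<card I. s i * (e \<circ> h) i) + q"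
      using sq hI by (intro exI[of _ "s \<circ> h"] exI[of _ q]) auto
  qed
  then show ?thesis by blast
qed

text \<open>Division with remainder works over any ring after multiplying by powers of the leading
  coefficient. For monic \<open>m\<close> it is honest division.\<close>
lemma pseudo_division:
  fixes f m :: "'a::comm_ring_1 poly"
  assumes S: "is_subring S" and m: "m \<in> coeffs_in S" and f: "f \<in> coeffs_in S"
  shows "\<exists>N q r. q \<in> coeffs_in S \<and> r \<in> coeffs_in S \<and> smult (lead_coeff m ^ N) f = m * q + r \<and>
    (\<forall>i\<ge>degree m. coeff r i = 0)"
proof -
  note ring = subringD[OF subring_coeffs_in[OF S]]
  let ?l = "lead_coeff m"
  have l: "?l \<in> S" using coeffs_inD[OF m] .
  have "\<exists>N q r. q \<in> coeffs_in S \<and> r \<in> coeffs_in S \<and> smult (?l ^ N) f = m * q + r \<and>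
      (\<forall>i\<ge>degree m. coeff r i = 0)" if "\<forall>i\<ge>n. coeff f i = 0" "f \<in> coeffs_in S" for n f
    using that
  proof (induction n arbitrary: f)
    case 0
    then have "f = 0" by (auto simp: poly_eq_iff)
    then show ?case using ring(1) by (intro exI[of _ 0]) auto
  next
    case (Suc n)
    show ?case
    proof (cases "n < degree m")
      case True
      then have "\<forall>i\<ge>degree m. coeff f i = 0" using Suc(2) by auto
      then show ?thesis using Suc(3) ring(1) by (intro exI[of _ 0] exI[of _ f]) auto
    next
      case False
      let ?t = "monom (coeff f n) (n - degree m)"
      let ?f = "smult ?l f - m * ?t"
      have t: "?t \<in> coeffs_in S" by (rule coeffs_in_monom[OF S coeffs_inD[OF Suc(3)]])
      have "smult ?l f \<in> coeffs_in S"
        by (rule coeffs_inI) (simp only: coeff_smult, rule subringD(5)[OF S l coeffs_inD[OF Suc(3)]])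
      then have fS: "?f \<in> coeffs_in S" by (rule ring(6)[OF _ ring(5)[OF m t]])
      have "coeff ?f i = 0" if "i \<ge> n" for i
      proof (cases "i = n")
        case True
        have "coeff (m * ?t) n = coeff m (n - (n - degree m)) * coeff f n"
          unfolding mult.commute[of m] Polynomial.coeff_monom_mult by (simp add: mult.commute)
        then show ?thesis using True \<open>\<not> n < degree m\<close> by simp
      next
        case False
        then have "coeff f i = 0" using Suc(2) that by auto
        moreover have "coeff (m * ?t) i = 0"
          unfolding mult.commute[of m] Polynomial.coeff_monom_mult using that False \<open>\<not> n < degree m\<close> by (auto simp: coeff_eq_0)
        ultimately show ?thesis by simp
      qed
      then obtain N q r where IH: "q \<in> coeffs_in S" "r \<in> coeffs_in S" "smult (?l ^ N) ?f = m * q + r"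
        "\<forall>i\<ge>degree m. coeff r i = 0" using Suc(1)[OF _ fS] by blast
      have "smult (?l ^ N) ?f = smult (?l ^ Suc N) f - m * smult (?l ^ N) ?t"
        by (simp add: smult_diff_right mult.commute)
      then have "smult (?l ^ Suc N) f = (m * q + r) + m * smult (?l ^ N) ?t"
        unfolding IH(3) by (metis diff_eq_eq)
      then have sm: "smult (?l ^ Suc N) f = m * (q + smult (?l ^ N) ?t) + r"
        unfolding distrib_left by (simp only: ac_simps)
      have "smult (?l ^ N) ?t \<in> coeffs_in S"
        by (rule coeffs_inI) (simp only: coeff_smult, rule subringD(5)[OF S subringD(7)[OF S l] coeffs_inD[OF t]])
      then have "q + smult (?l ^ N) ?t \<in> coeffs_in S" by (rule ring(4)[OF IH(1)])
      with IH(2,4) sm show ?thesis by (intro exI conjI)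
    qed
  qed
  from this[of "Suc (degree f)" f] show ?thesis using f by (simp add: coeff_eq_0 Suc_le_eq)
qed

lemma PF_aut_inverse:
  assumes "PF_aut V L M" shows "f \<circ> M \<circ> L = f" "f \<circ> L \<circ> M = f" "L (M x) = x" "M (L x) = x"
proof -
  show *: "L (M x) = x" "M (L x) = x" for x using assms unfolding PF_aut_def by blast+
  show "f \<circ> M \<circ> L = f" "f \<circ> L \<circ> M = f" by (rule ext, simp only: comp_apply *)+
qed

lemma ideal_pull:
  assumes Q: "is_ideal (PF V) Q" and LM: "PF_aut V L M"
  shows "is_ideal (PF V) ((\<lambda>f. f \<circ> L) ` Q)"
  unfolding is_ideal_def
proof (intro conjI ballI subsetI)
  note pull = PF_aut_pull[OF LM order.refl]
  have inv: "f \<circ> M \<circ> L = f" for f :: "'a pfun" by (rule PF_aut_inverse[OF LM])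
  show "f \<in> PF V" if "f \<in> (\<lambda>f. f \<circ> L) ` Q" for f
    using that pull(1)[OF idealD(1)[OF Q]] by (elim imageE) simp
  have "0 \<circ> L \<in> (\<lambda>f. f \<circ> L) ` Q" by (rule imageI) (rule idealD(2)[OF Q])
  then show "0 \<in> (\<lambda>f. f \<circ> L) ` Q" unfolding comp_fun_simps .
  show "f + g \<in> (\<lambda>f. f \<circ> L) ` Q" if fg: "f \<in> (\<lambda>f. f \<circ> L) ` Q" "g \<in> (\<lambda>f. f \<circ> L) ` Q" for f g
  proof -
    obtain f' g' where *: "f' \<in> Q" "f = f' \<circ> L" "g' \<in> Q" "g = g' \<circ> L" using fg by blast
    have "(f' + g') \<circ> L \<in> (\<lambda>f. f \<circ> L) ` Q" by (rule imageI) (rule idealD(3)[OF Q *(1,3)])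
    then show ?thesis unfolding comp_fun_simps *(2,4) .
  qed
  fix a q assume a: "a \<in> PF V" "q \<in> (\<lambda>f. f \<circ> L) ` Q"
  then obtain q' where q': "q' \<in> Q" "q = q' \<circ> L" by blast
  have "a * q = ((a \<circ> M) * q') \<circ> L" unfolding comp_fun_simps inv q'(2) ..
  moreover have "(a \<circ> M) * q' \<in> Q" using idealD(4)[OF Q pull(2)[OF a(1)] q'(1)] .
  ultimately show "a * q \<in> (\<lambda>f. f \<circ> L) ` Q" by blast
qed

lemma prime_pull:
  assumes Q: "is_prime (PF V) Q" and LM: "PF_aut V L M"
  shows "is_prime (PF V) ((\<lambda>f. f \<circ> L) ` Q)"
  unfolding is_prime_def
proof (intro conjI ballI impI)
  note pull = PF_aut_pull[OF LM order.refl]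
  have inv: "f \<circ> L \<circ> M = f" for f :: "'a pfun" by (rule PF_aut_inverse[OF LM])
  have mem: "f \<circ> M \<in> Q" if "f \<in> (\<lambda>f. f \<circ> L) ` Q" for f
    using that by (elim imageE) (simp only: inv)
  have mem': "f \<in> (\<lambda>f. f \<circ> L) ` Q" if "f \<circ> M \<in> Q" for f
  proof -
    have "f \<circ> M \<circ> L \<in> (\<lambda>f. f \<circ> L) ` Q" using that by (rule imageI)
    then show ?thesis unfolding PF_aut_inverse(1)[OF LM] .
  qed
  show "is_ideal (PF V) ((\<lambda>f. f \<circ> L) ` Q)" by (rule ideal_pull[OF prime_ideal[OF Q] LM])
  show "1 \<notin> (\<lambda>f. f \<circ> L) ` Q" using mem[of 1] Q unfolding is_prime_def comp_fun_simps by blast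
  fix a b assume ab: "a \<in> PF V" "b \<in> PF V" "a * b \<in> (\<lambda>f. f \<circ> L) ` Q"
  have "(a \<circ> M) * (b \<circ> M) \<in> Q" using mem[OF ab(3)] unfolding comp_fun_simps .
  from prime_dvd[OF Q pull(2)[OF ab(1)] pull(2)[OF ab(2)] this]
  show "a \<in> (\<lambda>f. f \<circ> L) ` Q \<or> b \<in> (\<lambda>f. f \<circ> L) ` Q"
    by (rule disjE) (rule disjI1, erule mem', rule disjI2, erule mem')
qed

lemma prime_restrict:
  assumes Q: "is_prime (PF V) Q" and UV: "U \<subseteq> V" shows "is_prime (PF U) (Q \<inter> PF U)"
proof -
  note i = idealD[OF prime_ideal[OF Q]] and up = PF_mono[OF UV]
  have "is_ideal (PF U) (Q \<inter> PF U)" unfolding is_ideal_def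
  proof (intro conjI ballI)
    show "Q \<inter> PF U \<subseteq> PF U" by simp
    show "0 \<in> Q \<inter> PF U" using i(2) PF_ring(1) by (rule IntI)
    show "a + b \<in> Q \<inter> PF U" if "a \<in> Q \<inter> PF U" "b \<in> Q \<inter> PF U" for a b
      using that by (intro IntI i(3) PF_add) simp_all
    show "a * q \<in> Q \<inter> PF U" if "a \<in> PF U" "q \<in> Q \<inter> PF U" for a q
      using that by (intro IntI i(4) PF_mult up) simp_all
  qed
  moreover have "1 \<notin> Q \<inter> PF U" using Q unfolding is_prime_def by simp
  moreover have "a \<in> Q \<inter> PF U \<or> b \<in> Q \<inter> PF U" if "a \<in> PF U" "b \<in> PF U" "a * b \<in> Q \<inter> PF U" for a b
    using prime_dvd[OF Q up[OF that(1)] up[OF that(2)]] that by simp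
  ultimately show ?thesis unfolding is_prime_def by simp
qed

text \<open>By induction on the set of variables. A nonzero element of \<open>Q\<close> becomes, after a
  shear, monic in some variable \<open>v\<close> over the other variables. Division by it makes
  \<open>PF V\<close> finite modulo \<open>Q\<close> over \<open>PF (V - {v})\<close>, to which
  the induction hypothesis applies.\<close>
theorem noether_normalization:
  assumes "finite V" "is_prime (PF V) Q"
  shows "\<exists>L M U k e. PF_aut V L M \<and> U \<subseteq> V \<and> ((\<lambda>f. f \<circ> L) ` Q) \<inter> PF U = {0} \<and>
    fin_over (PF V) (PF U) ((\<lambda>f. f \<circ> L) ` Q) k e"
  using assms
proof (induction V arbitrary: Q rule: finite_psubset_induct)
  case (psubset V)
  note Q = psubset.prems and Qi = prime_ideal[OF psubset.prems]
  show ?case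
  proof (cases "Q \<subseteq> {0}")
    case True
    then have Q0: "Q = {0}" using idealD(2)[OF Qi] by blast
    have idQ: "(\<lambda>f. f \<circ> id) ` Q = Q" by simp
    have "PF_aut V id id" by (auto simp: PF_aut_def coord_def[symmetric] intro: PF_coord)
    moreover have "Q \<inter> PF V = {0}" using Q0 PF_ring(1) by blast
    moreover have "\<exists>k e. fin_over (PF V) (PF V) Q k e"
    proof (rule fin_overI[of "{()}" "\<lambda>_. 1"])
      fix b assume "b \<in> PF V"
      then show "\<exists>s q. (\<forall>i\<in>{()}. s i \<in> PF V) \<and> q \<in> Q \<and> b = (\<Sum>i\<in>{()}. s i * 1) + q"
        using Q0 by (intro exI[of _ "\<lambda>_. b"] exI[of _ 0]) auto
    qed (auto intro: PF_ring)
    ultimately show ?thesis using idQ by (metis order.refl)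
  next
    case False
    then obtain f where f: "f \<in> Q" "f \<noteq> 0" by blast
    have fV: "f \<in> PF V" using idealD(1)[OF Qi f(1)] .
    have nc: "f \<noteq> cfun a" for a
    proof
      assume fa: "f = cfun a"
      have "a \<noteq> 0" using f(2) fa by auto
      have "cfun (1 / a) * f \<in> Q" by (rule idealD(4)[OF Qi PF_const f(1)])
      moreover have "cfun (1 / a) * f = 1"
        unfolding fa mult.commute[of "cfun (1 / a)"] by (rule cfun_inverse[OF \<open>a \<noteq> 0\<close>])
      ultimately have "1 \<in> Q" by (simp only:)
      then show False using Q by (simp add: is_prime_def)
    qed
    obtain v c a p where v: "v \<in> V" "c v = 0" "\<forall>w. w \<notin> V \<longrightarrow> c w = 0" "a \<noteq> 0"
      "p \<in> coeffs_in (PF (V - {v}))" "lead_coeff p = 1" "f \<circ> shear v c = cfun a * poly p (coord v)"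
      using exists_shear_monic[OF fV f(2)] nc by blast
    let ?L = "shear v c" and ?M = "shear v (\<lambda>w. - c w)" and ?W = "V - {v}"
    have LM: "PF_aut V ?L ?M" using v by (intro PF_aut_shear) auto
    let ?Q1 = "(\<lambda>f. f \<circ> ?L) ` Q"
    have Q1: "is_prime (PF V) ?Q1" by (rule prime_pull[OF Q LM])
    have W: "?W \<subset> V" "?W \<subseteq> V" "insert v ?W = V" using v(1) by auto
    have fQ1: "poly p (coord v) \<in> ?Q1"
    proof -
      have "cfun (1 / a) * (f \<circ> ?L) \<in> ?Q1" by (rule idealD(4)[OF prime_ideal[OF Q1] PF_const]) (use f in blast)
      moreover have "cfun (1 / a) * (f \<circ> ?L) = (cfun a * cfun (1 / a)) * poly p (coord v)"
        unfolding v(7) by (simp only: ac_simps)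
      ultimately show ?thesis unfolding cfun_inverse[OF v(4)] by (simp only: mult_1_left)
    qed
    let ?Q' = "?Q1 \<inter> PF ?W"
    have "is_prime (PF ?W) ?Q'" by (rule prime_restrict[OF Q1 W(2)])
    from psubset.IH[OF W(1) this] obtain L' M' U k e where IH: "PF_aut ?W L' M'" "U \<subseteq> ?W" "((\<lambda>f. f \<circ> L') ` ?Q') \<inter> PF U = {0}"
      "fin_over (PF ?W) (PF U) ((\<lambda>f. f \<circ> L') ` ?Q') k e"
      by (elim exE conjE)
    have IH1: "PF_aut V L' M'" by (rule PF_aut_mono[OF IH(1) W(2)])
    let ?Q2 = "(\<lambda>f. f \<circ> (?L \<circ> L')) ` Q"
    have Q2eq: "?Q2 = (\<lambda>f. f \<circ> L') ` ?Q1" by (simp add: image_image comp_assoc)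
    have Q2: "is_prime (PF V) ?Q2" by (subst Q2eq) (rule prime_pull[OF Q1 IH1])
    note Q2i = prime_ideal[OF Q2]
    have UV: "U \<subseteq> V" using IH(2) by blast
    have sub: "((\<lambda>f. f \<circ> L') ` ?Q') \<subseteq> ?Q2" unfolding Q2eq by (rule image_mono) (rule Int_lower1)
    have zero: "?Q2 \<inter> PF U = {0}"
    proof
      show "{0} \<subseteq> ?Q2 \<inter> PF U" using idealD(2)[OF Q2i] PF_ring(1) by blast
      show "?Q2 \<inter> PF U \<subseteq> {0}"
      proof
        fix g assume g: "g \<in> ?Q2 \<inter> PF U"
        then have "g \<in> (\<lambda>f. f \<circ> L') ` ?Q1" unfolding Q2eq by (rule IntD1)
        then obtain q where q: "q \<in> ?Q1" "g = q \<circ> L'" by (rule imageE)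
        have "g \<circ> M' \<in> PF ?W" by (rule PF_aut_pull(2)[OF IH(1) order.refl PF_mono[OF IH(2)]]) (use g in blast)
        moreover have "g \<circ> M' = q" unfolding q(2) by (rule PF_aut_inverse[OF IH1])
        ultimately have "q \<in> ?Q'" using q(1) by (simp only: Int_iff)
        then have "g \<in> (\<lambda>f. f \<circ> L') ` ?Q'" unfolding q(2) by (rule imageI)
        then have "g \<in> ((\<lambda>f. f \<circ> L') ` ?Q') \<inter> PF U" using g by (intro IntI) simp_all
        then show "g \<in> {0}" unfolding IH(3) .
      qed
    qed
    let ?d = "degree p"
    have "L' x v = x v" for x using IH(1) unfolding PF_aut_def by (elim conjE) simp
    then have cv: "coord v \<circ> L' = coord v" by (intro ext) (simp only: comp_apply coord_apply)
    have xi: "coord v \<in> PF V" using PF_coord[OF v(1)] .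
    have eW: "e i \<in> PF ?W" if "i < k" for i using IH(4) that by (simp add: fin_over_def)
    have "\<exists>k e. fin_over (PF V) (PF U) ?Q2 k e"
    proof (rule fin_overI[of "{..<k} \<times> {..<?d}" "\<lambda>(i,j). e i * coord v ^ j"])
      show "finite ({..<k} \<times> {..<?d})" by simp
      show "(case ij of (i, j) \<Rightarrow> e i * coord v ^ j) \<in> PF V" if "ij \<in> {..<k} \<times> {..<?d}" for ij
        using that PF_mono[OF W(2) eW] PF_ring(7)[OF xi] by (auto intro: PF_mult)
      fix b assume b: "b \<in> PF V"
      have "b \<circ> M' \<in> PF (insert v ?W)" using PF_aut_pull(2)[OF IH1 order.refl b] W(3) by simp
      from PF_insert_poly[OF this] obtain g where g: "g \<in> coeffs_in (PF ?W)" "b \<circ> M' = poly g (coord v)" by (rule bexE)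
      from pseudo_division[OF subring_PF v(5) g(1)] obtain N h r where hr: "h \<in> coeffs_in (PF ?W)" "r \<in> coeffs_in (PF ?W)"
        "smult (lead_coeff p ^ N) g = p * h + r" "\<forall>i\<ge>?d. coeff r i = 0"
        by (elim exE conjE)
      have "g = p * h + r" using hr(3) v(6) by simp
      then have gphr: "poly g (coord v) = poly p (coord v) * poly h (coord v) + poly r (coord v)" by (simp only: poly_add poly_mult)
      have "h \<in> coeffs_in (PF V)" by (rule subsetD[OF coeffs_in_mono hr(1)], rule subsetI, rule PF_mono[OF W(2)])
      then have "poly h (coord v) \<in> PF V" by (rule poly_in_subring[OF subring_PF _ xi])
      then have "poly p (coord v) * poly h (coord v) \<in> ?Q1" by (rule idealD(5)[OF prime_ideal[OF Q1] _ fQ1])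
      then obtain q1 where q1: "q1 \<in> ?Q1" "b \<circ> M' = q1 + poly r (coord v)"
        by (rule that) (rule trans[OF g(2) gphr])
      have rd: "poly r (coord v) = (\<Sum>j<?d. coeff r j * coord v ^ j)"
      proof -
        have "poly r (coord v) = (\<Sum>j\<le>degree r. coeff r j * coord v ^ j)" by (rule poly_altdef)
        also have "\<dots> = (\<Sum>j\<in>{..<?d} \<union> {..degree r}. coeff r j * coord v ^ j)"
          by (rule sum.mono_neutral_left) (auto simp: coeff_eq_0)
        also have "\<dots> = (\<Sum>j<?d. coeff r j * coord v ^ j)"
          by (rule sum.mono_neutral_right) (use hr(4) in auto)
        finally show ?thesis .
      qed
      have "b = (b \<circ> M') \<circ> L'" by (rule PF_aut_inverse(1)[OF IH1, symmetric])
      also have "\<dots> = (q1 \<circ> L') + (\<Sum>j<?d. (coeff r j \<circ> L') * coord v ^ j)"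
        unfolding q1(2) rd comp_fun_simps(3,4,8,9) cv ..
      finally have b1: "b = (q1 \<circ> L') + (\<Sum>j<?d. (coeff r j \<circ> L') * coord v ^ j)" .
      have "\<forall>j. \<exists>s q. (\<forall>i<k. s i \<in> PF U) \<and> q \<in> ?Q2 \<and> coeff r j \<circ> L' = (\<Sum>i<k. s i * e i) + q"
      proof
        fix j
        have "coeff r j \<circ> L' \<in> PF ?W" using PF_aut_pull(1)[OF IH(1) order.refl coeffs_inD[OF hr(2)]] .
        with IH(4) have "\<exists>s q. (\<forall>i<k. s i \<in> PF U) \<and> q \<in> (\<lambda>f. f \<circ> L') ` ?Q' \<and> coeff r j \<circ> L' = (\<Sum>i<k. s i * e i) + q"
          unfolding fin_over_def by (elim conjE) (erule bspec)
        then obtain s q where "\<forall>i<k. s i \<in> PF U" "q \<in> (\<lambda>f. f \<circ> L') ` ?Q'" "coeff r j \<circ> L' = (\<Sum>i<k. s i * e i) + q"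
          by (elim exE conjE)
        then show "\<exists>s q. (\<forall>i<k. s i \<in> PF U) \<and> q \<in> ?Q2 \<and> coeff r j \<circ> L' = (\<Sum>i<k. s i * e i) + q"
          by (intro exI conjI) (assumption, erule subsetD[OF sub], assumption)
      qed
      from choice[OF this] obtain s where s: "\<forall>j. \<exists>q. (\<forall>i<k. s j i \<in> PF U) \<and> q \<in> ?Q2 \<and> coeff r j \<circ> L' = (\<Sum>i<k. s j i * e i) + q" ..
      from choice[OF s] obtain q where q: "\<forall>j. (\<forall>i<k. s j i \<in> PF U) \<and> q j \<in> ?Q2 \<and> coeff r j \<circ> L' = (\<Sum>i<k. s j i * e i) + q j" ..
      have sq: "\<And>j i. i < k \<Longrightarrow> s j i \<in> PF U" "\<And>j. q j \<in> ?Q2"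
        "\<And>j. coeff r j \<circ> L' = (\<Sum>i<k. s j i * e i) + q j" using q by blast+
      let ?q = "(q1 \<circ> L') + (\<Sum>j<?d. q j * coord v ^ j)"
      have "(\<Sum>j<?d. (coeff r j \<circ> L') * coord v ^ j)
          = (\<Sum>j<?d. (\<Sum>i<k. s j i * (e i * coord v ^ j))) + (\<Sum>j<?d. q j * coord v ^ j)"
        unfolding sq(3) by (simp only: distrib_right sum.distrib sum_distrib_right mult.assoc)
      also have "(\<Sum>j<?d. (\<Sum>i<k. s j i * (e i * coord v ^ j))) = (\<Sum>(i,j)\<in>{..<k} \<times> {..<?d}. s j i * (e i * coord v ^ j))"
        unfolding sum.cartesian_product[symmetric] by (rule sum.swap)
      finally have b2: "(\<Sum>j<?d. (coeff r j \<circ> L') * coord v ^ j) =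
        (\<Sum>(i,j)\<in>{..<k} \<times> {..<?d}. s j i * (e i * coord v ^ j)) + (\<Sum>j<?d. q j * coord v ^ j)" .
      have b3: "(\<Sum>(i,j)\<in>{..<k} \<times> {..<?d}. s j i * (e i * coord v ^ j)) =
          (\<Sum>ij\<in>{..<k} \<times> {..<?d}. (case ij of (i,j) \<Rightarrow> s j i) * (case ij of (i, j) \<Rightarrow> e i * coord v ^ j))"
        by (rule sum.cong[OF refl]) (simp only: split_def)
      have "b = (\<Sum>ij\<in>{..<k} \<times> {..<?d}. (case ij of (i,j) \<Rightarrow> s j i) * (case ij of (i, j) \<Rightarrow> e i * coord v ^ j)) + ?q"
        unfolding b1 b2 b3 by (rule add.left_commute)
      note b4 = this
      have "q1 \<circ> L' \<in> ?Q2" unfolding Q2eq using q1(1) by (rule imageI)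
      moreover have "(\<Sum>j<?d. q j * coord v ^ j) \<in> ?Q2"
        by (rule idealD(6)[OF Q2i]) (rule idealD(5)[OF Q2i PF_ring(7)[OF xi] sq(2)])
      ultimately have b5: "?q \<in> ?Q2" by (rule idealD(3)[OF Q2i])
      have b6: "\<forall>ij\<in>{..<k} \<times> {..<?d}. (case ij of (i,j) \<Rightarrow> s j i) \<in> PF U" using sq(1) by auto
      show "\<exists>s q. (\<forall>ij\<in>{..<k} \<times> {..<?d}. s ij \<in> PF U) \<and> q \<in> ?Q2 \<and>
          b = (\<Sum>ij\<in>{..<k} \<times> {..<?d}. s ij * (case ij of (i, j) \<Rightarrow> e i * coord v ^ j)) + q"
        by (rule exI, rule exI, rule conjI, rule b6, rule conjI, rule b5, rule b4)
    qed
    then obtain k' e' where fin: "fin_over (PF V) (PF U) ?Q2 k' e'" by (elim exE)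
    show ?thesis
      by (rule exI, rule exI, rule exI, rule exI, rule exI, intro conjI, rule PF_aut_comp[OF LM IH1], rule UV, rule zero, rule fin)
  qed
qed

section \<open>Gauss's lemma in several variables\<close>

text \<open>Evaluation of the coefficients at the point \<open>x\<close>.\<close>
definition evc :: "('v \<Rightarrow> complex) \<Rightarrow> 'v pfun poly \<Rightarrow> complex poly" where
  "evc x p = map_poly (\<lambda>f. f x) p"

lemma coeff_evc [simp]: "coeff (evc x p) i = coeff p i x"
  unfolding evc_def by (subst coeff_map_poly) simp_all

lemma evc_simps: "evc x 0 = 0" "evc x 1 = 1" "evc x (p + q) = evc x p + evc x q" "evc x (p * q) = evc x p * evc x q"
  "evc x (smult a p) = smult (a x) (evc x p)" "evc x (pCons a p) = pCons (a x) (evc x p)" "evc x (- p) = - evc x p"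
  by (rule poly_eqI, simp add: coeff_mult coeff_pCons split: nat.splits)+

lemma poly_evc: "poly (evc x p) (b x) = poly p b x"
proof (induction p)
  case 0 show ?case by (simp add: evc_simps)
next
  case (pCons a p) then show ?case by (simp add: evc_simps)
qed

lemma poly_evc_const: "poly (evc x p) t = poly p (cfun t) x"
  unfolding poly_evc[of x p "cfun t", symmetric] by (simp only: cfun_apply)

lemma evc_hom: "comm_ring_hom (\<lambda>p. poly (evc x p) t)"
  by unfold_locales (simp_all only: evc_simps poly_0 poly_1 poly_add poly_mult)

text \<open>The restriction of a polynomial function to the line through \<open>x\<close> in direction
  \<open>y\<close>, as a polynomial in the parameter. The choice is unique on polynomial
  functions (\<open>poly_on_line\<close>); other functions get an arbitrary value.\<close>
definition on_line :: "('v \<Rightarrow> complex) \<Rightarrow> ('v \<Rightarrow> complex) \<Rightarrow> 'v pfun \<Rightarrow> complex poly" where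
  "on_line x y f = (SOME p. \<forall>z. f (\<lambda>v. x v + z * y v) = poly p z)"

lemma poly_on_line: assumes "f \<in> PF V" shows "poly (on_line x y f) z = f (\<lambda>v. x v + z * y v)"
  unfolding on_line_def by (rule someI_ex[OF PF_on_line[OF assms, of x y], THEN spec, symmetric])

lemma on_line_eqI: assumes "f \<in> PF V" "\<And>z. f (\<lambda>v. x v + z * y v) = poly p z" shows "on_line x y f = p"
  unfolding poly_eq_poly_eq_iff[symmetric] by (rule ext) (simp only: poly_on_line[OF assms(1)] assms(2))

lemma on_line_simps:
  assumes "f \<in> PF V" "g \<in> PF V"
  shows "on_line x y (f + g) = on_line x y f + on_line x y g" "on_line x y (f * g) = on_line x y f * on_line x y g"
  by (rule on_line_eqI[OF PF_add[OF assms]] on_line_eqI[OF PF_mult[OF assms]],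
      simp add: poly_on_line[OF assms(1)] poly_on_line[OF assms(2)])+

lemma on_line_const: "on_line x y 0 = 0" "on_line x y 1 = 1"
  by (rule on_line_eqI[OF PF_ring(1)] on_line_eqI[OF PF_ring(2)], simp)+

lemma on_line_sum: "(\<And>i. i \<in> K \<Longrightarrow> f i \<in> PF V) \<Longrightarrow> on_line x y (sum f K) = (\<Sum>i\<in>K. on_line x y (f i))"
proof (induction K rule: infinite_finite_induct)
  case (insert i K)
  have 1: "f i \<in> PF V" by (rule insert(4)) simp
  have 2: "\<And>j. j \<in> K \<Longrightarrow> f j \<in> PF V" by (rule insert(4)) simp
  have 3: "sum f K \<in> PF V" by (rule PF_ring(8)) (rule 2)
  have 4: "on_line x y (sum f K) = (\<Sum>i\<in>K. on_line x y (f i))" by (rule insert.IH) (rule 2)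
  show ?case unfolding sum.insert[OF insert(1,2)] on_line_simps(1)[OF 1 3] 4 by (rule refl)
qed (simp_all only: sum.infinite sum.empty on_line_const not_False_eq_True)

lemma on_line_power: "f \<in> PF V \<Longrightarrow> on_line x y (f ^ n) = on_line x y f ^ n"
  by (induction n) (simp_all only: power_0 power_Suc on_line_const on_line_simps(2)[of f V] PF_ring(7))

text \<open>After a shear, \<open>l\<close> is a constant times a monic polynomial in one variable
  \<open>v\<close>. Divide \<open>a\<close> by it. On each line parallel to the
  \<open>v\<close>-axis the remainder is divisible by a polynomial of higher degree, so it
  vanishes.\<close>
lemma PF_dvd_of_lines:
  assumes l: "l \<in> PF V" "l \<noteq> 0" and a: "a \<in> PF V"
    and lines: "\<And>x y. on_line x y l \<noteq> 0 \<Longrightarrow> on_line x y l dvd on_line x y a"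
  shows "\<exists>c\<in>PF V. a = l * c"
  using exists_shear_monic[OF l]
proof (elim disjE bexE exE conjE)
  fix \<alpha> assume la: "l = cfun \<alpha>"
  then have "\<alpha> \<noteq> 0" using l(2) by auto
  have "a = l * (cfun (1 / \<alpha>) * a)"
    unfolding la mult.assoc[symmetric] cfun_inverse[OF \<open>\<alpha> \<noteq> 0\<close>] by (rule mult_1_left[symmetric])
  moreover have "cfun (1 / \<alpha>) * a \<in> PF V" by (rule PF_mult[OF PF_const a])
  ultimately show ?thesis by (rule bexI)
next
  fix v c \<alpha> p
  assume v: "v \<in> V" "c v = 0" "\<forall>w. w \<notin> V \<longrightarrow> c w = 0" "\<alpha> \<noteq> 0" "p \<in> coeffs_in (PF (V - {v}))"
    "lead_coeff p = 1" "l \<circ> shear v c = cfun \<alpha> * poly p (coord v)"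
  let ?L = "shear v c" and ?M = "shear v (\<lambda>w. - c w)" and ?W = "V - {v}"
  have LM: "PF_aut V ?L ?M" using v by (intro PF_aut_shear) auto
  have "a \<circ> ?L \<in> PF (insert v ?W)" using PF_aut_pull(1)[OF LM order.refl a] v(1) by (simp add: insert_absorb)
  from PF_insert_poly[OF this] obtain g where g: "g \<in> coeffs_in (PF ?W)" "a \<circ> ?L = poly g (coord v)" by (rule bexE)
  from pseudo_division[OF subring_PF v(5) g(1)] obtain N h r where hr: "h \<in> coeffs_in (PF ?W)" "r \<in> coeffs_in (PF ?W)"
    "smult (lead_coeff p ^ N) g = p * h + r" "\<forall>i\<ge>degree p. coeff r i = 0" by (elim exE conjE)
  have gr: "g = p * h + r" using hr(3) v(6) by simp
  have "evc x r = 0" for x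
  proof -
    \<comment> \<open>The image under the shear of the line through \<open>x\<close> parallel to the \<open>v\<close>-axis.\<close>
    define x0 where "x0 = ?L (x(v := 0))"
    define y where "y = (\<lambda>w. (if w = v then 1 else 0) + c w)"
    have line: "(\<lambda>w. x0 w + z * y w) = ?L (x(v := z))" for z
      by (rule ext) (auto simp: x0_def y_def shear_def v(2))
    have evc_eq: "poly (evc x f) z = poly f (coord v) (x(v := z))" if f: "f \<in> coeffs_in (PF ?W)" for f z
    proof -
      have "evc x f = evc (x(v := z)) f"
        by (rule poly_eqI, unfold coeff_evc, rule PF_cong[OF coeffs_inD[OF f]]) simp
      then show ?thesis using poly_evc[of "x(v := z)" f "coord v"] by simp
    qed
    have "on_line x0 y l = smult \<alpha> (evc x p)"
    proof (rule on_line_eqI[OF l(1)])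
      fix z
      have "l (\<lambda>w. x0 w + z * y w) = (l \<circ> ?L) (x(v := z))" unfolding line by simp
      then show "l (\<lambda>w. x0 w + z * y w) = poly (smult \<alpha> (evc x p)) z" unfolding v(7) by (simp add: evc_eq[OF v(5)])
    qed
    moreover have "on_line x0 y a = evc x g"
    proof (rule on_line_eqI[OF a])
      fix z
      have "a (\<lambda>w. x0 w + z * y w) = (a \<circ> ?L) (x(v := z))" unfolding line by simp
      then show "a (\<lambda>w. x0 w + z * y w) = poly (evc x g) z" unfolding g(2) by (simp add: evc_eq[OF g(1)])
    qed
    moreover have pd: "coeff (evc x p) (degree p) = 1" using v(6) by simp
    moreover have "evc x p \<noteq> 0" using pd by (metis coeff_0 zero_neq_one)
    ultimately have "evc x p dvd evc x g" using lines[of x0 y] v(4) by (simp add: smult_dvd_iff)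
    then have dvd: "evc x p dvd evc x r" unfolding gr evc_simps by (simp add: dvd_add_right_iff)
    show "evc x r = 0"
    proof (rule ccontr)
      assume "evc x r \<noteq> 0"
      then have "degree p \<le> degree (evc x r)"
        using dvd_imp_degree_le[OF dvd] le_degree[of "evc x p" "degree p"] pd by simp
      then have "lead_coeff (evc x r) = 0" using hr(4) by simp
      then show False using \<open>evc x r \<noteq> 0\<close> unfolding leading_coeff_0_iff by (rule notE[rotated])
    qed
  qed
  then have "coeff r i x = 0" for i x using coeff_evc[of x r i] by simp
  then have "r = 0" by (intro poly_eqI ext) simp
  then have aL: "a \<circ> ?L = poly p (coord v) * poly h (coord v)" unfolding g(2) gr by simp
  have "h \<in> coeffs_in (PF V)" by (rule subsetD[OF coeffs_in_mono hr(1)], rule subsetI, rule PF_mono[of ?W]) auto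
  then have hV: "poly h (coord v) \<in> PF V" by (rule poly_in_subring[OF subring_PF _ PF_coord[OF v(1)]])
  let ?k = "cfun (1 / \<alpha>) * poly h (coord v)"
  have "a \<circ> ?L = cfun \<alpha> * cfun (1 / \<alpha>) * (poly p (coord v) * poly h (coord v))"
    unfolding aL cfun_inverse[OF v(4)] by (rule mult_1_left[symmetric])
  also have "\<dots> = (l \<circ> ?L) * ?k" unfolding v(7) by (simp only: ac_simps)
  finally have e: "a \<circ> ?L = (l \<circ> ?L) * ?k" .
  have "a = (a \<circ> ?L) \<circ> ?M" by (rule PF_aut_inverse(2)[OF LM, symmetric])
  also have "\<dots> = l * (?k \<circ> ?M)" unfolding e comp_fun_simps PF_aut_inverse(2)[OF LM] ..
  finally have "a = l * (?k \<circ> ?M)" .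
  moreover have "?k \<circ> ?M \<in> PF V" by (rule PF_aut_pull(2)[OF LM order.refl PF_mult[OF PF_const hV]])
  ultimately show ?thesis by (rule bexI)
qed

text \<open>On a line where the leading coefficient \<open>l\<close> of \<open>m\<close> does not vanish,
  the coefficients are polynomials in one variable, and contents are multiplicative there. As
  \<open>f\<close> is monic, the contents of \<open>m\<close> and \<open>b\<close> multiply to
  \<open>l\<^sup>N\<close>. The content of \<open>b\<close> divides its leading coefficient,
  which times \<open>l\<close> is again \<open>l\<^sup>N\<close>; so \<open>l\<close> divides
  the content of \<open>m\<close>. Divisibility on lines gives divisibility by
  \<open>PF_dvd_of_lines\<close>; factorization in several variables is avoided in this way.\<close>
lemma gauss_divides:
  assumes f: "f \<in> coeffs_in (PF V)" "lead_coeff f = 1" and m: "m \<in> coeffs_in (PF V)" "m \<noteq> 0"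
    and b: "b \<in> coeffs_in (PF V)" and eq: "smult (lead_coeff m ^ N) f = m * b"
  shows "\<exists>c\<in>PF V. coeff m i = lead_coeff m * c"
proof (rule PF_dvd_of_lines)
  let ?l = "lead_coeff m"
  show l: "?l \<in> PF V" "?l \<noteq> 0" "coeff m i \<in> PF V" using m coeffs_inD[OF m(1)] by auto
  fix x y :: "'a \<Rightarrow> complex" assume nz: "on_line x y ?l \<noteq> 0"
  define P where "P q = map_poly (on_line x y) q" for q
  have cP: "coeff (P q) j = on_line x y (coeff q j)" for q j
    unfolding P_def by (subst coeff_map_poly) (simp_all add: on_line_const)
  have Pmult: "P (p * q) = P p * P q" if "p \<in> coeffs_in (PF V)" "q \<in> coeffs_in (PF V)" for p q
  proof (rule poly_eqI)
    fix n
    have "on_line x y (\<Sum>i\<le>n. coeff p i * coeff q (n - i)) = (\<Sum>i\<le>n. on_line x y (coeff p i * coeff q (n - i)))"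
      by (rule on_line_sum) (rule PF_mult[OF coeffs_inD[OF that(1)] coeffs_inD[OF that(2)]])
    also have "\<dots> = (\<Sum>i\<le>n. on_line x y (coeff p i) * on_line x y (coeff q (n - i)))"
      by (rule sum.cong[OF refl]) (rule on_line_simps(2)[OF coeffs_inD[OF that(1)] coeffs_inD[OF that(2)]])
    finally show "coeff (P (p * q)) n = coeff (P p * P q) n" by (simp only: cP coeff_mult)
  qed
  let ?L = "on_line x y ?l"
  have "P (smult (?l ^ N) f) = smult (?L ^ N) (P f)"
    by (rule poly_eqI, unfold cP coeff_smult, subst on_line_simps(2)[OF PF_ring(7)[OF l(1)] coeffs_inD[OF f(1)]])
      (simp only: on_line_power[OF l(1)])
  then have Peq: "smult (?L ^ N) (P f) = P m * P b" unfolding eq Pmult[OF m(1) b] by (rule sym)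
  have f1: "coeff (P f) (degree f) = 1" unfolding cP f(2) on_line_const ..
  have degf: "degree (P f) = degree f"
  proof (rule antisym)
    show "degree (P f) \<le> degree f" by (rule degree_le) (simp add: cP coeff_eq_0 on_line_const)
    show "degree f \<le> degree (P f)" by (rule le_degree) (simp only: f1 one_neq_zero not_False_eq_True)
  qed
  have m1: "coeff (P m) (degree m) = ?L" unfolding cP ..
  have degm: "degree (P m) = degree m"
  proof (rule antisym)
    show "degree (P m) \<le> degree m" by (rule degree_le) (simp add: cP coeff_eq_0 on_line_const)
    show "degree m \<le> degree (P m)" by (rule le_degree) (use nz in \<open>simp only: m1 not_False_eq_True\<close>)
  qed
  have cf: "content (P f) = 1" using content_dvd_coeff[of "P f" "degree f"] unfolding f1 is_unit_content_iff .
  have c: "normalize (?L ^ N) = content (P m) * content (P b)"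
    using arg_cong[OF Peq, of content] by (simp add: content_mult cf)
  have "lead_coeff (smult (?L ^ N) (P f)) = ?L ^ N" using nz f1 degf by (simp add: degree_smult_eq)
  then have lead: "?L * lead_coeff (P b) = ?L ^ N" unfolding Peq lead_coeff_mult degm m1 .
  obtain k where k: "lead_coeff (P b) = content (P b) * k" using content_dvd_coeff by (rule dvdE)
  have "P b \<noteq> 0" using lead nz by auto
  then have cb: "content (P b) \<noteq> 0" by simp
  have "content (P b) * (?L * k) dvd content (P b) * content (P m)"
  proof -
    have e1: "content (P b) * (?L * k) = ?L ^ N" unfolding lead[symmetric] k by (simp only: ac_simps)
    show ?thesis unfolding e1 mult.commute[of "content (P b)" "content (P m)"] c[symmetric] by simp
  qed
  then have "?L * k dvd content (P m)" using cb by simp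
  then have "?L dvd content (P m)" by (rule dvd_mult_left)
  also have "\<dots> dvd coeff (P m) i" by (rule content_dvd_coeff)
  finally show "?L dvd on_line x y (coeff m i)" unfolding cP .
qed

section \<open>Minimal polynomials modulo a prime ideal\<close>

text \<open>A nonzero constant is a unit.\<close>
lemma cfun_in_prime:
  assumes Q: "is_prime (PF V) Q" and c: "cfun c \<in> Q" shows "c = 0"
proof (rule ccontr)
  assume "c \<noteq> 0"
  have "cfun (1 / c) * cfun c \<in> Q" by (rule idealD(4)[OF prime_ideal[OF Q] PF_const c])
  then have "1 \<in> Q" unfolding mult.commute[of "cfun (1 / c)"] cfun_inverse[OF \<open>c \<noteq> 0\<close>] .
  then show False using Q by (simp add: is_prime_def)
qed

text \<open>Take a nonzero polynomial \<open>m0\<close> of least degree that annihilates \<open>g\<close>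
  modulo \<open>Q\<close>. Pseudo-division of the monic \<open>f0\<close> by \<open>m0\<close>
  leaves no remainder, so by Gauss's lemma the leading coefficient of \<open>m0\<close> divides
  all its coefficients; the quotient is monic and still annihilates \<open>g\<close>, because
  the leading coefficient is not in \<open>Q\<close>.\<close>
lemma minimal_polynomial:
  assumes Q: "is_prime (PF V) Q" and UV: "U \<subseteq> V" and Q0: "Q \<inter> PF U = {0}" and g: "g \<in> PF V"
    and f0: "f0 \<in> coeffs_in (PF U)" "lead_coeff f0 = 1" "poly f0 g \<in> Q"
  shows "\<exists>m\<in>coeffs_in (PF U). lead_coeff m = 1 \<and> poly m g \<in> Q \<and>
    (\<forall>f\<in>coeffs_in (PF U). poly f g \<in> Q \<longrightarrow> (\<exists>b\<in>coeffs_in (PF U). f = m * b))"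
proof -
  note Qi = prime_ideal[OF Q] and SU = subring_PF[of U] and up = PF_mono[OF UV]
  have upc: "p \<in> coeffs_in (PF V)" if "p \<in> coeffs_in (PF U)" for p
    by (rule subsetD[OF coeffs_in_mono that]) (rule subsetI, rule up)
  have pV: "poly p g \<in> PF V" if "p \<in> coeffs_in (PF U)" for p
    by (rule poly_in_subring[OF subring_PF upc[OF that] g])
  let ?K = "\<lambda>p. p \<in> coeffs_in (PF U) \<and> p \<noteq> 0 \<and> poly p g \<in> Q"
  have "f0 \<noteq> 0" using f0(2) by auto
  then have "?K f0" using f0 by blast
  then obtain m0 where m0: "?K m0" "\<And>p. ?K p \<Longrightarrow> degree m0 \<le> degree p"
    using ex_has_least_nat[of ?K f0 degree] by blast
  let ?l = "lead_coeff m0" and ?n = "degree m0"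
  have m0': "m0 \<in> coeffs_in (PF U)" "m0 \<noteq> 0" "poly m0 g \<in> Q" using m0(1) by blast+
  have l: "?l \<in> PF U" "?l \<noteq> 0" using m0' coeffs_inD[OF m0'(1)] by auto
  have lQ: "?l \<notin> Q" using l Q0 by blast
  have rem: "r = 0" if "r \<in> coeffs_in (PF U)" "poly r g \<in> Q" "\<forall>i\<ge>?n. coeff r i = 0" for r
  proof (rule ccontr)
    assume "r \<noteq> 0"
    then have "?n \<le> degree r" using m0(2) that by blast
    then have "lead_coeff r = 0" using that(3) by blast
    then show False using \<open>r \<noteq> 0\<close> by simp
  qed
  from pseudo_division[OF SU m0'(1) f0(1)] obtain N b r where b: "b \<in> coeffs_in (PF U)" "r \<in> coeffs_in (PF U)"
    "smult (?l ^ N) f0 = m0 * b + r" "\<forall>i\<ge>?n. coeff r i = 0" by (elim exE conjE)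
  have "poly r g = ?l ^ N * poly f0 g - poly b g * poly m0 g"
    using arg_cong[OF b(3), of "\<lambda>p. poly p g"] by (simp only: poly_smult poly_add poly_mult) (simp only: mult.commute add_diff_cancel_left')
  also have "\<dots> \<in> Q"
    by (intro ideal_diff[OF subring_PF Qi] idealD(4)[OF Qi] PF_ring(7) up l(1) f0(3) m0'(3) pV b(1))
  finally have "r = 0" using rem b(2,4) by blast
  then have eq: "smult (?l ^ N) f0 = m0 * b" using b(3) by (simp only: add_0_right)
  have "\<forall>i. \<exists>c. c \<in> PF U \<and> coeff m0 i = ?l * c"
    using gauss_divides[OF f0(1,2) m0'(1,2) b(1) eq] by (metis (no_types))
  from choice[OF this] obtain c where c: "\<forall>i. c i \<in> PF U \<and> coeff m0 i = ?l * c i" ..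
  define m where "m = (\<Sum>i\<le>?n. monom (c i) i)"
  have cm: "coeff m i = (if i \<le> ?n then c i else 0)" for i
    unfolding m_def coeff_sum coeff_monom by (simp add: sum.delta)
  have mU: "m \<in> coeffs_in (PF U)"
  proof (rule coeffs_inI)
    fix i
    have "c i \<in> PF U" using c by blast
    then show "coeff m i \<in> PF U" using PF_ring(1)[of U] by (cases "i \<le> ?n") (simp_all only: cm if_True if_False)
  qed
  have m0m: "m0 = smult ?l m"
  proof (rule poly_eqI)
    fix i
    have "coeff m0 i = ?l * c i" using c by blast
    then show "coeff m0 i = coeff (smult ?l m) i"
    proof (cases "i \<le> ?n")
      case True
      then show ?thesis unfolding coeff_smult cm using \<open>coeff m0 i = ?l * c i\<close> by (simp only: if_True)
    next
      case False
      then show ?thesis unfolding coeff_smult cm by (simp only: if_False mult_zero_right) (simp add: coeff_eq_0)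
    qed
  qed
  have cn: "c ?n = 1"
  proof -
    have "?l = ?l * c ?n" using c by blast
    then have "?l * (c ?n - 1) = 0" unfolding right_diff_distrib mult_1_right by (metis diff_self)
    then have "c ?n - 1 = 0"
      using PF_no_zero_divisors[OF l(1) PF_ring(6)[OF conjunct1[OF spec[OF c]] PF_ring(2)]] l(2) by blast
    then show ?thesis by (simp only: right_minus_eq)
  qed
  have degm: "degree m = ?n"
  proof (rule antisym)
    show "degree m \<le> ?n" by (rule degree_le) (simp add: cm)
    show "?n \<le> degree m" by (rule le_degree) (simp add: cm cn)
  qed
  have mon: "lead_coeff m = 1" unfolding degm cm by (simp add: cn)
  have "?l * poly m g \<in> Q" using m0'(3) by (subst (asm) m0m) (simp only: poly_smult)
  then have mg: "poly m g \<in> Q" using prime_dvd[OF Q up[OF l(1)] pV[OF mU]] lQ by blast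
  have "\<exists>b\<in>coeffs_in (PF U). f = m * b" if f: "f \<in> coeffs_in (PF U)" "poly f g \<in> Q" for f
  proof -
    from pseudo_division[OF SU mU f(1)] obtain N b r where b: "b \<in> coeffs_in (PF U)" "r \<in> coeffs_in (PF U)"
      "smult (lead_coeff m ^ N) f = m * b + r" "\<forall>i\<ge>degree m. coeff r i = 0" by (elim exE conjE)
    have fe: "f = m * b + r" using b(3) mon by (simp only: power_one smult_1_left)
    have "poly r g = poly f g - poly b g * poly m g"
      unfolding fe by (simp only: poly_add poly_mult) (simp only: mult.commute add_diff_cancel_left')
    also have "\<dots> \<in> Q"
      by (intro ideal_diff[OF subring_PF Qi] idealD(4)[OF Qi] f(2) mg pV b(1))
    finally have "r = 0" using rem b(2,4) degm by metis
    then have "f = m * b" using fe by (simp only: add_0_right)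
    then show ?thesis using b(1) by blast
  qed
  then show ?thesis using mU mon mg by blast
qed

text \<open>Over $\mathbb{C}$, \<open>c\<close> splits into linear factors, and a prime ideal contains one
  of their values at \<open>b\<close>.\<close>
lemma root_mod_prime:
  assumes n: "is_prime (PF V) n" and b: "b \<in> PF V" and c: "c \<noteq> 0" "(\<lambda>x. poly c (b x)) \<in> n"
  shows "\<exists>\<rho>. b - cfun \<rho> \<in> n"
  using c
proof (induction "degree c" arbitrary: c rule: less_induct)
  case less
  have inPF: "(\<lambda>x. poly p (b x)) \<in> PF V" for p
  proof (induction p)
    case 0
    have "(\<lambda>x. poly 0 (b x)) = cfun 0" by (rule ext) simp
    then show ?case by (simp only: PF_const)
  next
    case (pCons a p)
    have "(\<lambda>x. poly (pCons a p) (b x)) = cfun a + b * (\<lambda>x. poly p (b x))" by (rule ext) simp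
    then show ?case by (simp only: PF_add PF_mult PF_const b pCons.IH)
  qed
  show ?case
  proof (cases "degree c = 0")
    case True
    then obtain a where a: "c = [:a:]" by (rule degree_eq_zeroE)
    have "(\<lambda>x. poly c (b x)) = cfun a" unfolding a by (rule ext) simp
    then have "a = 0" using cfun_in_prime[OF n] less(3) by metis
    then show ?thesis using less(2) a by simp
  next
    case False
    then obtain \<rho> where "poly c \<rho> = 0" using fundamental_theorem_of_algebra[of c] by (auto simp: constant_degree)
    then obtain c' where c': "c = [:-\<rho>, 1:] * c'" unfolding poly_eq_0_iff_dvd by (rule dvdE)
    have "(\<lambda>x. poly c (b x)) = (b - cfun \<rho>) * (\<lambda>x. poly c' (b x))" unfolding c' by (rule ext) (simp add: algebra_simps)
    then have "(b - cfun \<rho>) * (\<lambda>x. poly c' (b x)) \<in> n" using less(3) by (simp only:)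
    from prime_dvd[OF n PF_ring(6)[OF b PF_const] inPF this]
    show ?thesis
    proof
      assume 1: "(\<lambda>x. poly c' (b x)) \<in> n"
      have "c' \<noteq> 0" using c' less(2) by auto
      then have "degree c' < degree c" unfolding c' by (subst degree_mult_eq) auto
      then show ?thesis using less(1) \<open>c' \<noteq> 0\<close> 1 by blast
    qed blast
  qed
qed

lemma poly_diff_coeffs:
  fixes f :: "'v pfun poly"
  shows "poly f b - (\<lambda>y. poly (evc x f) (b y)) = (\<Sum>i\<le>degree f. (coeff f i - cfun (coeff f i x)) * b ^ i)"
proof (rule ext)
  fix y
  have "degree (evc x f) \<le> degree f" by (rule degree_le) (simp add: coeff_eq_0)
  then have "poly (evc x f) (b y) = (\<Sum>i\<le>degree f. coeff f i x * b y ^ i)"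
    unfolding poly_altdef[of "evc x f"] coeff_evc
    by (intro sum.mono_neutral_left) (auto simp: coeff_eq_0 simp flip: coeff_evc)
  then show "(poly f b - (\<lambda>y. poly (evc x f) (b y))) y = (\<Sum>i\<le>degree f. (coeff f i - cfun (coeff f i x)) * b ^ i) y"
    by (simp add: poly_altdef[of f] sum_subtractf algebra_simps)
qed

section \<open>Lying over\<close>

lemma diff_diff_same: "x - a - (x - b) = b - (a :: 'a::ab_group_add)"
  by simp

lemma mult_diff_split: "f * h - c * d = f * (h - d) + (f - c) * (d :: 'a::comm_ring_1)"
  by (simp add: algebra_simps)

text \<open>The hypothesis \<open>ker\<close> says that \<open>f \<mapsto> f(x)(\<tau>)\<close> is well
  defined on the subring \<open>PF U [g]\<close> of \<open>PF V / Q\<close>. Its kernel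
  generates a proper ideal \<open>I\<close> of the finite extension \<open>PF V / Q\<close>:
  otherwise the determinant trick produces a matrix over \<open>PF U [g]\<close> which is the
  identity modulo the kernel but has determinant in the kernel. A prime \<open>n\<close> above
  \<open>I\<close> is the ideal of a point, because every coordinate is integral over \<open>PF
  U\<close> and elements of \<open>PF U\<close> are constants modulo \<open>n\<close>.\<close>
lemma lying_over:
  fixes Q :: "'v pfun set"
  assumes Q: "is_prime (PF V) Q" and UV: "U \<subseteq> V" and fin: "fin_over (PF V) (PF U) Q k e" and g: "g \<in> PF V"
    and ker: "\<And>f. f \<in> coeffs_in (PF U) \<Longrightarrow> poly f g \<in> Q \<Longrightarrow> poly (evc x f) \<tau> = 0"
  shows "\<exists>q. (\<forall>f\<in>Q. f q = 0) \<and> (\<forall>v\<in>U. q v = x v) \<and> (\<forall>v. v \<notin> V \<longrightarrow> q v = x v) \<and> g q = \<tau>"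
proof -
  note Qi = prime_ideal[OF Q] and SU = subring_PF[of U] and up = PF_mono[OF UV] and SV = subring_PF[of V]
  note CU = subring_coeffs_in[OF SU]
  note ringC = subringD[OF CU]
  let ?\<phi> = "\<lambda>f. poly (evc x f) \<tau>"
  note phi = comm_ring_hom.hom_det[OF evc_hom[of x \<tau>]]
  \<comment> \<open>\<open>m\<close> is the kernel of evaluation at \<open>(x, \<tau>)\<close>, and \<open>I\<close> the ideal it generates together with \<open>Q\<close>.\<close>
  define m where "m = {f \<in> coeffs_in (PF U). ?\<phi> f = 0}"
  have phis: "?\<phi> (a + b) = ?\<phi> a + ?\<phi> b" "?\<phi> (a * b) = ?\<phi> a * ?\<phi> b" for a b
    by (simp_all only: evc_simps poly_add poly_mult)
  have mC: "f \<in> coeffs_in (PF U)" if "f \<in> m" for f using that by (simp add: m_def)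
  have m_add: "a + b \<in> m" if "a \<in> m" "b \<in> m" for a b
    using that ringC(4)[of a b] unfolding m_def mem_Collect_eq phis by simp
  have m_mult: "a * b \<in> m" if "a \<in> m" "b \<in> coeffs_in (PF U)" for a b
    using that ringC(5)[of a b] unfolding m_def mem_Collect_eq phis by simp
  have m_0: "0 \<in> m" using ringC(1) by (simp add: m_def evc_simps)
  have m_sum: "sum F K \<in> m" if "\<And>i. i \<in> K \<Longrightarrow> F i \<in> m" for F and K :: "nat set"
    using that by (induction K rule: infinite_finite_induct) (auto intro: m_0 m_add)
  have upc: "p \<in> coeffs_in (PF V)" if "p \<in> coeffs_in (PF U)" for p
    by (rule subsetD[OF coeffs_in_mono that]) (rule subsetI, rule up)
  have pV: "poly p g \<in> PF V" if "p \<in> coeffs_in (PF U)" for p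
    by (rule poly_in_subring[OF SV upc[OF that] g])
  have eV: "e i \<in> PF V" if "i < k" for i using fin that unfolding fin_over_def by blast
  have span: "\<exists>s q. (\<forall>i<k. s i \<in> PF U) \<and> q \<in> Q \<and> b = (\<Sum>i<k. s i * e i) + q" if "b \<in> PF V" for b
    using fin that unfolding fin_over_def by (elim conjE) (erule bspec)
  define I where "I = {b. \<exists>M q. (\<forall>i<k. M i \<in> m) \<and> q \<in> Q \<and> b = (\<Sum>i<k. poly (M i) g * e i) + q}"
  have I_I: "b \<in> I" if "\<And>i. i < k \<Longrightarrow> M i \<in> m" "q \<in> Q" "b = (\<Sum>i<k. poly (M i) g * e i) + q" for b M q
    unfolding I_def mem_Collect_eq by (rule exI[of _ M], rule exI[of _ q]) (intro conjI allI impI that)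
  have I_E: thesis if "b \<in> I" "\<And>M q. (\<And>i. i < k \<Longrightarrow> M i \<in> m) \<Longrightarrow> q \<in> Q \<Longrightarrow> b = (\<Sum>i<k. poly (M i) g * e i) + q \<Longrightarrow> thesis" for b thesis
    using that(1) unfolding I_def mem_Collect_eq by (elim exE conjE) (rule that(2), blast+)
  have QI: "q \<in> I" if "q \<in> Q" for q
    by (rule I_I[of "\<lambda>_. 0" q]) (simp_all only: m_0 that poly_0 mult_zero_left sum.neutral_const add_0)
  have I_add: "a + b \<in> I" if ab: "a \<in> I" "b \<in> I" for a b
  proof -
    obtain M q where a: "\<And>i. i < k \<Longrightarrow> M i \<in> m" "q \<in> Q" "a = (\<Sum>i<k. poly (M i) g * e i) + q" by (rule I_E[OF ab(1)]) blast
    obtain M' q' where b: "\<And>i. i < k \<Longrightarrow> M' i \<in> m" "q' \<in> Q" "b = (\<Sum>i<k. poly (M' i) g * e i) + q'" by (rule I_E[OF ab(2)]) blast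
    show ?thesis
    proof (rule I_I[of "\<lambda>i. M i + M' i" "q + q'"])
      show "a + b = (\<Sum>i<k. poly (M i + M' i) g * e i) + (q + q')"
        unfolding a(3) b(3) by (simp only: poly_add distrib_right sum.distrib add_ac)
    qed (intro m_add a(1) b(1), assumption+, rule idealD(3)[OF Qi a(2) b(2)])
  qed
  have I_smult: "poly M g * b \<in> I" if M: "M \<in> m" and b: "b \<in> PF V" for M b
  proof -
    from span[OF b] obtain s q where s: "\<forall>i<k. s i \<in> PF U" "q \<in> Q" "b = (\<Sum>i<k. s i * e i) + q" by (elim exE conjE)
    show ?thesis
    proof (rule I_I[of "\<lambda>i. M * [:s i:]" "poly M g * q"])
      show "M * [:s i:] \<in> m" if "i < k" for i
        by (rule m_mult[OF M coeffs_in_const[OF SU]]) (use s(1) that in blast)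
      show "poly M g * q \<in> Q" by (rule idealD(4)[OF Qi pV[OF mC[OF M]] s(2)])
      have "poly (M * [:s i:]) g = poly M g * s i" for i
        by (simp only: poly_mult poly_pCons poly_0 mult_zero_right add_0_right)
      then show "poly M g * b = (\<Sum>i<k. poly (M * [:s i:]) g * e i) + poly M g * q"
        unfolding s(3) by (simp only: distrib_left sum_distrib_left mult.assoc)
    qed
  qed
  have I_sum: "sum F {..<k} \<in> I" if "\<And>i. i < k \<Longrightarrow> F i \<in> I" for F
  proof -
    have "j \<le> k \<Longrightarrow> sum F {..<j} \<in> I" for j
    proof (induction j)
      case 0
      show ?case using QI[OF idealD(2)[OF Qi]] by (simp only: lessThan_0 sum.empty)
    next
      case (Suc j)
      have "sum F {..<j} \<in> I" by (rule Suc.IH) (rule Suc_leD[OF Suc.prems])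
      moreover have "F j \<in> I" by (rule that) (use Suc.prems in linarith)
      ultimately show ?case unfolding sum.lessThan_Suc by (rule I_add)
    qed
    then show ?thesis by blast
  qed
  have II: "is_ideal (PF V) I" unfolding is_ideal_def
  proof (intro conjI ballI subsetI)
    fix b assume "b \<in> I"
    then show "b \<in> PF V"
    proof (rule I_E)
      fix M q assume *: "\<And>i. i < k \<Longrightarrow> M i \<in> m" "q \<in> Q" "b = (\<Sum>i<k. poly (M i) g * e i) + q"
      show "b \<in> PF V" unfolding *(3)
        by (intro PF_add PF_ring(8) PF_mult pV mC *(1) eV idealD(1)[OF Qi *(2)]) simp_all
    qed
  next
    show "0 \<in> I" by (rule QI[OF idealD(2)[OF Qi]])
    show "a + b \<in> I" if "a \<in> I" "b \<in> I" for a b by (rule I_add[OF that])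
    fix a b assume a: "a \<in> PF V" and b: "b \<in> I"
    show "a * b \<in> I"
    proof (rule I_E[OF b])
      fix M q assume *: "\<And>i. i < k \<Longrightarrow> M i \<in> m" "q \<in> Q" "b = (\<Sum>i<k. poly (M i) g * e i) + q"
      have "a * b = (\<Sum>i<k. poly (M i) g * (a * e i)) + a * q"
        unfolding *(3) distrib_left sum_distrib_left by (simp only: mult.left_commute)
      moreover have "(\<Sum>i<k. poly (M i) g * (a * e i)) \<in> I"
        by (rule I_sum, rule I_smult[OF *(1) PF_mult[OF a eV]])
      ultimately show ?thesis using I_add QI[OF idealD(4)[OF Qi a *(2)]] by (simp only:)
    qed
  qed
  have one: "1 \<notin> I"
  proof
    assume 1: "1 \<in> I"
    have "\<forall>i. \<exists>M q. i < k \<longrightarrow> (\<forall>j<k. M j \<in> m) \<and> q \<in> Q \<and> e i = (\<Sum>j<k. poly (M j) g * e j) + q"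
    proof
      fix i
      show "\<exists>M q. i < k \<longrightarrow> (\<forall>j<k. M j \<in> m) \<and> q \<in> Q \<and> e i = (\<Sum>j<k. poly (M j) g * e j) + q"
      proof (cases "i < k")
        case True
        then have "e i * 1 \<in> I" using idealD(4)[OF II eV 1] by blast
        then have "e i \<in> I" by (simp only: mult_1_right)
        then show ?thesis unfolding I_def mem_Collect_eq by (simp only: True simp_thms)
      qed simp
    qed
    from choice[OF this] obtain M where "\<forall>i. \<exists>q. i < k \<longrightarrow> (\<forall>j<k. M i j \<in> m) \<and> q \<in> Q \<and> e i = (\<Sum>j<k. poly (M i j) g * e j) + q" ..
    from choice[OF this] obtain r where "\<forall>i. i < k \<longrightarrow> (\<forall>j<k. M i j \<in> m) \<and> r i \<in> Q \<and> e i = (\<Sum>j<k. poly (M i j) g * e j) + r i" ..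
    then have M: "\<And>i j. i < k \<Longrightarrow> j < k \<Longrightarrow> M i j \<in> m" "\<And>i. i < k \<Longrightarrow> r i \<in> Q"
      "\<And>i. i < k \<Longrightarrow> e i = (\<Sum>j<k. poly (M i j) g * e j) + r i" by blast+
    define X where "X = Matrix.mat k k (\<lambda>(i,j). (if i = j then 1 else 0) - M i j)"
    have X: "X \<in> carrier_mat k k" by (simp add: X_def)
    have Xij: "X $$ (i,j) = (if i = j then 1 else 0) - M i j" if "i < k" "j < k" for i j
      using that by (simp add: X_def)
    have XC: "X $$ (i,j) \<in> coeffs_in (PF U)" if "i < k" "j < k" for i j
      unfolding Xij[OF that] using ringC(1,2) mC[OF M(1)[OF that]] by (intro ringC(6)) auto
    let ?h = "\<lambda>p. poly p g"
    have h: "comm_ring_hom ?h" by unfold_locales auto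
    let ?Y = "map_mat ?h X"
    have Y: "?Y \<in> carrier_mat k k" using X by simp
    have Yij: "?Y $$ (i,j) = (if i = j then 1 else 0) - poly (M i j) g" if "i < k" "j < k" for i j
      using that X by (simp add: Xij)
    have YV: "?Y $$ (i,j) \<in> PF V" if "i < k" "j < k" for i j
      using pV[OF XC[OF that]] that X by simp
    have YQ: "(\<Sum>j<k. ?Y $$ (i,j) * e j) \<in> Q" if "i < k" for i
    proof -
      have "(\<Sum>j<k. ?Y $$ (i,j) * e j) = (\<Sum>j<k. (if j = i then e i else 0) - poly (M i j) g * e j)"
        using that by (intro sum.cong refl) (auto simp: Yij left_diff_distrib)
      also have "\<dots> = e i - (\<Sum>j<k. poly (M i j) g * e j)" using that by (simp only: sum_subtractf) simp
      also have "\<dots> = r i" by (subst M(3)[OF that]) (rule add_diff_cancel_left')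
      finally show ?thesis using M(2)[OF that] by (simp only:)
    qed
    have d: "Determinant.det ?Y * e i \<in> Q" if "i < k" for i by (rule det_trick[OF SV Qi Y YV YQ that])
    from span[OF PF_ring(2)] obtain s q where s: "\<forall>i<k. s i \<in> PF U" "q \<in> Q" "1 = (\<Sum>i<k. s i * e i) + q" by (elim exE conjE)
    have dV: "Determinant.det ?Y \<in> PF V" by (rule det_in_subring[OF SV Y YV])
    have "Determinant.det ?Y = Determinant.det ?Y * ((\<Sum>i<k. s i * e i) + q)" using s(3) by simp
    also have "\<dots> = (\<Sum>i<k. s i * (Determinant.det ?Y * e i)) + Determinant.det ?Y * q"
      unfolding distrib_left sum_distrib_left by (simp only: mult.left_commute)
    also have "\<dots> \<in> Q"
      by (intro idealD(3)[OF Qi] idealD(6)[OF Qi] idealD(4)[OF Qi] d up s(2) dV) (use s(1) in auto)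
    finally have "poly (Determinant.det X) g \<in> Q" by (simp only: comm_ring_hom.hom_det[OF h])
    moreover have "Determinant.det X \<in> coeffs_in (PF U)" by (rule det_in_subring[OF CU X XC])
    ultimately have z: "?\<phi> (Determinant.det X) = 0" using ker by blast
    have "map_mat ?\<phi> X = 1\<^sub>m k"
    proof (rule eq_matI)
      fix i j assume "i < dim_row (1\<^sub>m k :: complex mat)" "j < dim_col (1\<^sub>m k :: complex mat)"
      then have ij: "i < k" "j < k" by auto
      have "?\<phi> (M i j) = 0" using M(1)[OF ij] by (simp add: m_def)
      moreover have "?\<phi> (a - b) = ?\<phi> a - ?\<phi> b" for a b
        using phis(1)[of "a - b" b] by simp
      ultimately show "map_mat ?\<phi> X $$ (i,j) = 1\<^sub>m k $$ (i,j)" using ij X by (simp add: Xij evc_simps)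
    qed (use X in auto)
    then have "?\<phi> (Determinant.det X) = 1" using phi[of X] by simp
    then show False using z by simp
  qed
  obtain n where n: "is_prime (PF V) n" "I \<subseteq> n"
    using exists_prime_avoiding[OF SV II, of "{1}"] one PF_ring(2)[of V] by auto
  note ni = prime_ideal[OF n(1)]
  have mn: "poly f g \<in> n" if "f \<in> m" for f
  proof -
    have "poly f g * 1 \<in> I" by (rule I_smult[OF that PF_ring(2)])
    then show ?thesis using n(2) by (simp only: mult_1_right) (rule subsetD)
  qed
  have Un: "a - cfun (a x) \<in> n" if "a \<in> PF U" for a
  proof -
    have a: "a - cfun (a x) \<in> PF U" by (rule PF_ring(6)[OF that PF_const])
    have "poly (evc x [:a - cfun (a x):]) \<tau> = 0" by (simp add: evc_simps)
    then have "[:a - cfun (a x):] \<in> m" unfolding m_def using coeffs_in_const[OF SU a] by simp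
    from mn[OF this] show ?thesis by (simp only: poly_pCons poly_0 mult_zero_right add_0_right)
  qed
  have "\<forall>v. \<exists>\<rho>. v \<in> V \<longrightarrow> coord v - cfun \<rho> \<in> n"
  proof
    fix v
    show "\<exists>\<rho>. v \<in> V \<longrightarrow> coord v - cfun \<rho> \<in> n"
    proof (cases "v \<in> V")
      case True
      note cV = PF_coord[OF True]
      obtain f where f: "f \<in> coeffs_in (PF U)" "lead_coeff f = 1" "poly f (coord v) \<in> Q"
        using integral_of_finite[OF SV SU _ Qi fin cV] up by blast
      let ?c = "evc x f"
      have c0: "?c \<noteq> 0"
      proof
        assume "?c = 0"
        then have "coeff ?c (degree f) = 0" by (simp only: coeff_0)
        then show False using f(2) by simp
      qed
      have "poly f (coord v) - (\<lambda>y. poly ?c (coord v y)) \<in> n" unfolding poly_diff_coeffs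
        by (intro idealD(6)[OF ni] idealD(5)[OF ni] PF_ring(7)[OF cV] Un coeffs_inD[OF f(1)])
      then have d: "poly f (coord v) - (\<lambda>y. poly ?c (coord v y)) \<in> n" .
      have "poly f (coord v) \<in> n" by (rule subsetD[OF n(2) QI[OF f(3)]])
      from ideal_diff[OF SV ni this d] have "(\<lambda>y. poly ?c (coord v y)) \<in> n" by (simp only: diff_diff_eq2 add_diff_cancel_left')
      from root_mod_prime[OF n(1) cV c0 this] show ?thesis by blast
    qed simp
  qed
  from choice[OF this] obtain \<rho> where rho: "\<forall>v. v \<in> V \<longrightarrow> coord v - cfun (\<rho> v) \<in> n" ..
  define q where "q = (\<lambda>v. if v \<in> V then \<rho> v else x v)"
  have qn: "f - cfun (f q) \<in> n" if "f \<in> PF V" for f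
    using that
  proof (induction rule: PF.induct)
    case (PF_const c)
    show ?case unfolding cfun_apply[of c q] diff_self by (rule idealD(2)[OF ni])
  next
    case (PF_coord v)
    then have qv: "q v = \<rho> v" by (simp add: q_def)
    show ?case unfolding coord_apply[of v q] qv by (rule mp[OF spec[OF rho] PF_coord])
  next
    case (PF_add f h)
    have "(f + h) - cfun ((f + h) q) = (f - cfun (f q)) + (h - cfun (h q))"
      unfolding plus_fun_apply[of f h q] cfun_simps(3) by (rule add_diff_add)
    then show ?case using idealD(3)[OF ni PF_add.IH] by (simp only:)
  next
    case (PF_mult f h)
    have "(f * h) - cfun ((f * h) q) = f * (h - cfun (h q)) + (f - cfun (f q)) * cfun (h q)"
      unfolding times_fun_apply[of f h q] cfun_simps(4) by (rule mult_diff_split)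
    then show ?case
      using idealD(3)[OF ni idealD(4)[OF ni PF_mult(1) PF_mult.IH(2)] idealD(5)[OF ni PF_const[of "h q"] PF_mult.IH(1)]]
      by (simp only:)
  qed
  have val: "f q = c" if "f \<in> PF V" "f - cfun c \<in> n" for f c
  proof -
    have "(f - cfun c) - (f - cfun (f q)) \<in> n" by (rule ideal_diff[OF SV ni that(2) qn[OF that(1)]])
    then have "cfun (f q - c) \<in> n" unfolding diff_diff_same cfun_simps(5) .
    then have "f q - c = 0" by (rule cfun_in_prime[OF n(1)])
    then show ?thesis by simp
  qed
  have "\<forall>f\<in>Q. f q = 0"
  proof
    fix f assume f: "f \<in> Q"
    have "f \<in> n" using QI[OF f] n(2) by blast
    then have "f - cfun 0 \<in> n" by (simp only: cfun_simps diff_zero)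
    then show "f q = 0" by (rule val[OF idealD(1)[OF Qi f]])
  qed
  moreover have "\<forall>v\<in>U. q v = x v"
  proof
    fix v assume v: "v \<in> U"
    have "coord v - cfun (x v) \<in> n" using Un[OF PF_coord[OF v]] unfolding coord_apply[of v x] .
    then show "q v = x v" using val[OF PF_coord[OF subsetD[OF UV v]], of "x v"] unfolding coord_apply[of v q] by blast
  qed
  moreover have "g q = \<tau>"
  proof (rule val[OF g])
    have "poly (evc x [:- cfun \<tau>, 1:]) \<tau> = 0" by (simp add: evc_simps)
    then have "[:- cfun \<tau>, 1:] \<in> m" unfolding m_def
      using coeffs_in_pCons[OF SU PF_ring(3)[OF PF_const] coeffs_in_const[OF SU PF_ring(2)]] by simp
    from mn[OF this] have "- cfun \<tau> + g \<in> n" by (simp only: poly_pCons poly_0 mult_zero_right add_0_right mult_1_right)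
    then show "g - cfun \<tau> \<in> n" by (simp only: add.commute add_uminus_conv_diff)
  qed
  moreover have "\<forall>v. v \<notin> V \<longrightarrow> q v = x v" by (simp add: q_def)
  ultimately show ?thesis by blast
qed

section \<open>Density of the nonvanishing locus in the zero set of a prime ideal\<close>

text \<open>Cauchy's bound: beyond it the leading term dominates.\<close>
lemma monic_root_bound:
  fixes c :: "complex poly"
  assumes "lead_coeff c = 1" "poly c r = 0" shows "cmod r \<le> 1 + (\<Sum>i<degree c. cmod (coeff c i))"
proof (cases "cmod r \<le> 1")
  case True
  have "0 \<le> (\<Sum>i<degree c. cmod (coeff c i))" by (intro sum_nonneg) simp
  then show ?thesis using True by linarith
next
  case False
  let ?d = "degree c"
  have "?d \<noteq> 0"
  proof
    assume "?d = 0"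
    then obtain a where "c = [:a:]" by (rule degree_eq_zeroE)
    then show False using assms by simp
  qed
  have "poly c r = r ^ ?d + (\<Sum>i<?d. coeff c i * r ^ i)"
    unfolding poly_altdef lessThan_Suc_atMost[symmetric] sum.lessThan_Suc by (simp add: assms(1))
  then have "cmod (r ^ ?d) = cmod (\<Sum>i<?d. coeff c i * r ^ i)" using assms(2)
    by (metis add_eq_0_iff norm_minus_cancel)
  also have "\<dots> \<le> (\<Sum>i<?d. cmod (coeff c i) * cmod r ^ (?d - 1))"
    by (rule sum_norm_le) (use False in \<open>auto simp: norm_mult norm_power intro!: mult_left_mono power_increasing\<close>)
  also have "\<dots> = (\<Sum>i<?d. cmod (coeff c i)) * cmod r ^ (?d - 1)" by (simp add: sum_distrib_right)
  finally have "cmod r * cmod r ^ (?d - 1) \<le> (\<Sum>i<?d. cmod (coeff c i)) * cmod r ^ (?d - 1)"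
    using \<open>?d \<noteq> 0\<close> by (simp add: norm_power flip: power_Suc)
  moreover have "0 < cmod r ^ (?d - 1)" by (rule zero_less_power) (use False in linarith)
  ultimately have "cmod r \<le> (\<Sum>i<?d. cmod (coeff c i))" by simp
  then show ?thesis by linarith
qed

text \<open>\<open>poly c t\<close> is the product of the differences from \<open>t\<close> to the roots,
  and the nearest root minimizes every factor.\<close>
lemma monic_root_near:
  fixes c :: "complex poly"
  assumes "lead_coeff c = 1" "degree c \<noteq> 0"
  shows "\<exists>r. poly c r = 0 \<and> cmod (t - r) ^ degree c \<le> cmod (poly c t)"
proof -
  obtain as where as: "smult (lead_coeff c) (\<Prod>a\<leftarrow>as. [:- a, 1:]) = c" "length as = degree c"
    using fundamental_theorem_algebra_factorized[of c] by auto
  then have c: "c = (\<Prod>a\<leftarrow>as. [:- a, 1:])" using assms(1) by simp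
  have pc: "poly (\<Prod>a\<leftarrow>bs. [:- a, 1:]) x = (\<Prod>a\<leftarrow>bs. (x - a))" for bs :: "complex list" and x
    by (induction bs) (simp_all add: left_diff_distrib)
  have "set as \<noteq> {}" using as(2) assms(2) by auto
  then obtain a where a: "a \<in> set as" "\<And>b. b \<in> set as \<Longrightarrow> cmod (t - a) \<le> cmod (t - b)"
    using ex_min_if_finite[of "(\<lambda>b. cmod (t - b)) ` set as"] by (auto simp: not_less)
  have "set bs \<subseteq> set as \<Longrightarrow> cmod (t - a) ^ length bs \<le> cmod (\<Prod>a\<leftarrow>bs. (t - a))" for bs
    by (induction bs) (auto simp: norm_mult intro!: mult_mono a(2))
  from this[of as] have "cmod (t - a) ^ degree c \<le> cmod (poly c t)" unfolding as(2)[symmetric] using pc[of as t] c by simp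
  moreover have "poly c a = 0" unfolding c pc using a(1) by (auto simp: prod_list_zero_iff)
  ultimately show ?thesis by blast
qed

text \<open>Splitting off the power of the variable leaves a nonzero constant term.\<close>
lemma first_nonzero_coeff:
  assumes "f \<noteq> 0" "f \<in> coeffs_in S"
  shows "\<exists>j c g. f = monom 1 j * pCons c g \<and> c \<in> S \<and> c \<noteq> 0 \<and> g \<in> coeffs_in S"
  using assms
proof (induction f)
  case (pCons a f)
  have fS: "f \<in> coeffs_in S" "a \<in> S"
    using coeffs_inD[OF pCons.prems(2), of "Suc _"] coeffs_inD[OF pCons.prems(2), of 0] by (auto simp: coeffs_in_def)
  show ?case
  proof (cases "a = 0")
    case False
    then show ?thesis using fS by (intro exI[of _ 0] exI[of _ a] exI[of _ f]) simp
  next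
    case True
    then have "f \<noteq> 0" using pCons.prems(1) by auto
    with pCons.IH fS obtain j c g where "f = monom 1 j * pCons c g" "c \<in> S" "c \<noteq> 0" "g \<in> coeffs_in S" by blast
    moreover have "pCons a f = monom 1 (Suc j) * pCons c g" unfolding True calculation(1) by (simp add: monom_Suc)
    ultimately show ?thesis by blast
  qed
qed simp

text \<open>The product of the finitely many nonzero linear forms \<open>c \<mapsto> \<Sum>v. c v * d
  v\<close> is a nonzero polynomial function, so it does not vanish somewhere.\<close>
lemma separating_linear_form:
  assumes V: "finite V" and "finite D" and "\<And>d. d \<in> D \<Longrightarrow> \<exists>v\<in>V. d v \<noteq> 0"
  shows "\<exists>c::'v \<Rightarrow> complex. \<forall>d\<in>D. (\<Sum>v\<in>V. c v * d v) \<noteq> 0"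
proof -
  define L where "L d = (\<Sum>v\<in>V. coord v * cfun (d v))" for d :: "'v \<Rightarrow> complex"
  have Lx: "L d x = (\<Sum>v\<in>V. x v * d v)" for d x by (simp add: L_def)
  have "\<exists>g\<in>PF V. g \<noteq> 0 \<and> (\<forall>x d. d \<in> D \<longrightarrow> g x \<noteq> 0 \<longrightarrow> L d x \<noteq> 0)"
    using assms(2,3)
  proof (induction D rule: finite_induct)
    case empty
    show ?case by (rule bexI[OF _ PF_ring(2)]) (intro conjI allI impI one_neq_zero, simp)
  next
    case (insert d D)
    have "\<exists>g\<in>PF V. g \<noteq> 0 \<and> (\<forall>x d. d \<in> D \<longrightarrow> g x \<noteq> 0 \<longrightarrow> L d x \<noteq> 0)"
      by (rule insert.IH) (rule insert.prems, erule insertI2)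
    then obtain g where g: "g \<in> PF V" "g \<noteq> 0" "\<forall>x d. d \<in> D \<longrightarrow> g x \<noteq> 0 \<longrightarrow> L d x \<noteq> 0" by (elim bexE conjE)
    obtain w where w: "w \<in> V" "d w \<noteq> 0" using insert.prems[OF insertI1] by blast
    have "L d (\<lambda>v. if v = w then 1 else 0) = (\<Sum>v\<in>V. if v = w then d w else 0)" unfolding Lx by (rule sum.cong) auto
    also have "\<dots> = d w" using V w by simp
    finally have Ldw: "L d (\<lambda>v. if v = w then 1 else 0) = d w" .
    have Ld: "L d \<noteq> 0"
    proof
      assume "L d = 0"
      from fun_cong[OF this, of "\<lambda>v. if v = w then 1 else 0"] show False using Ldw w(2) unfolding zero_fun_apply by simp
    qed
    have LV: "L d \<in> PF V" unfolding L_def by (intro PF_ring(8) PF_mult PF_coord PF_const)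
    have "L d * g \<noteq> 0" using PF_no_zero_divisors[OF LV g(1)] g(2) Ld by blast
    moreover have "L d * g \<in> PF V" by (rule PF_mult[OF LV g(1)])
    moreover have "L e x \<noteq> 0" if "e \<in> insert d D" "(L d * g) x \<noteq> 0" for e x
    proof -
      have nz: "L d x \<noteq> 0" "g x \<noteq> 0" using that(2) unfolding times_fun_apply[of "L d" g x] by simp_all
      show ?thesis using that(1) nz g(3) by (cases "e = d") simp_all
    qed
    ultimately show ?case by (intro bexI[of _ "L d * g"] conjI allI impI)
  qed
  then obtain g where "g \<in> PF V" and g: "g \<noteq> 0" "\<forall>x d. d \<in> D \<longrightarrow> g x \<noteq> 0 \<longrightarrow> L d x \<noteq> 0" by (elim bexE conjE)
  have "\<exists>x. g x \<noteq> 0"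
  proof (rule ccontr)
    assume "\<nexists>x. g x \<noteq> 0"
    then have "g = 0" by (intro ext) simp
    then show False using g(1) by (rule notE[rotated])
  qed
  then obtain x where "g x \<noteq> 0" ..
  then have "\<forall>d\<in>D. L d x \<noteq> 0" using g(2) by simp
  then show ?thesis unfolding Lx by (rule exI[of _ x])
qed

text \<open>Zeros of \<open>Q\<close> are finite over the \<open>U\<close>-coordinates. Approach
  \<open>p\<close> by base points \<open>x k\<close> at which a nonzero function
  \<open>a\<close> on the base does not vanish, where \<open>a \<noteq> 0\<close> forces
  \<open>h \<noteq> 0\<close> on the zero set. Let the linear form \<open>g\<close> separate
  \<open>p\<close> from the other points with the same \<open>U\<close>-coordinates. Choose
  roots \<open>t k\<close> of the minimal polynomial of \<open>g\<close> at \<open>x k\<close>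
  with limit \<open>g p\<close>, and lift \<open>(x k, t k)\<close> to zeros of
  \<open>Q\<close>. These are bounded, and every limit point lies over the
  \<open>U\<close>-coordinates of \<open>p\<close> and has the same value of \<open>g\<close>,
  so it is \<open>p\<close>.\<close>
lemma dense_of_normalized:
  fixes Q :: "'v pfun set"
  assumes V: "finite V" and Q: "is_prime (PF V) Q" and UV: "U \<subseteq> V" and Q0: "Q \<inter> PF U = {0}"
    and fin: "fin_over (PF V) (PF U) Q k e" and p: "\<And>f. f \<in> Q \<Longrightarrow> f p = 0" and h: "h \<in> PF V" "h \<notin> Q"
  shows "\<exists>q :: nat \<Rightarrow> 'v \<Rightarrow> complex. (\<forall>k. (\<forall>f\<in>Q. f (q k) = 0) \<and> h (q k) \<noteq> 0) \<and> (\<forall>v\<in>V. (\<lambda>k. q k v) \<longlonglongrightarrow> p v)"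
proof -
  note Qi = prime_ideal[OF Q] and SU = subring_PF[of U] and up = PF_mono[OF UV] and SV = subring_PF[of V]
  have UV': "PF U \<subseteq> PF V" by (rule subsetI) (rule up)
  note integral = integral_of_finite[OF SV SU UV' Qi fin]
  have upc: "f \<in> coeffs_in (PF V)" if "f \<in> coeffs_in (PF U)" for f
    by (rule subsetD[OF coeffs_in_mono[OF UV'] that])
  have evc_cong: "evc x f = evc y f" if "f \<in> coeffs_in (PF U)" "\<And>v. v \<in> U \<Longrightarrow> x v = y v" for x y f
    by (rule poly_eqI, unfold coeff_evc, rule PF_cong[OF coeffs_inD[OF that(1)] that(2)])
  have evc_monic: "degree (evc x f) = degree f" "lead_coeff (evc x f) = 1" if "lead_coeff f = 1" for x f
  proof -
    have *: "coeff (evc x f) (degree f) = 1" using that by (simp only: coeff_evc one_fun_apply)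
    show d: "degree (evc x f) = degree f"
    proof (rule antisym)
      show "degree (evc x f) \<le> degree f" by (rule degree_le) (simp add: coeff_eq_0)
      show "degree f \<le> degree (evc x f)" by (rule le_degree) (simp only: * one_neq_zero not_False_eq_True)
    qed
    show "lead_coeff (evc x f) = 1" unfolding d by (rule *)
  qed
  \<comment> \<open>The lowest nonzero coefficient of an integral equation of \<open>h\<close> lies in the ideal generated by \<open>h\<close> and \<open>Q\<close>.\<close>
  obtain a where a: "a \<in> PF U" "a \<noteq> 0" "\<And>q. (\<forall>f\<in>Q. f q = 0) \<Longrightarrow> a q \<noteq> 0 \<Longrightarrow> h q \<noteq> 0"
  proof -
    obtain f where f: "f \<in> coeffs_in (PF U)" "lead_coeff f = 1" "poly f h \<in> Q" using integral[OF h(1)] by blast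
    have "f \<noteq> 0" using f(2) by auto
    from first_nonzero_coeff[OF this f(1)] obtain j c g where
      jcg: "f = monom 1 j * pCons c g" "c \<in> PF U" "c \<noteq> 0" "g \<in> coeffs_in (PF U)" by (elim exE conjE)
    have "h ^ j * (c + h * poly g h) \<in> Q"
      using f(3) unfolding jcg(1) by (simp only: poly_mult poly_monom poly_pCons mult_1_left)
    moreover have "c + h * poly g h \<in> PF V"
      by (intro PF_add PF_mult up jcg(2) h(1) poly_in_subring[OF SV upc[OF jcg(4)]])
    ultimately have cQ: "c + h * poly g h \<in> Q"
      using prime_dvd[OF Q PF_ring(7)[OF h(1)]] prime_power_not_in[OF SV Q h] by blast
    show thesis
    proof (rule that[OF jcg(2,3)])
      fix q assume "\<forall>f\<in>Q. f q = 0" "c q \<noteq> 0"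
      then have "(c + h * poly g h) q = 0" using cQ by blast
      then show "h q \<noteq> 0" using \<open>c q \<noteq> 0\<close> by auto
    qed
  qed
  \<comment> \<open>Over the base point of \<open>p\<close>, each coordinate of a zero of \<open>Q\<close> is a root of a fixed monic polynomial; \<open>R\<close> collects the possible differences from the coordinates of \<open>p\<close>.\<close>
  have "\<forall>v. \<exists>f. v \<in> V \<longrightarrow> f \<in> coeffs_in (PF U) \<and> lead_coeff f = 1 \<and> poly f (coord v) \<in> Q"
    using integral[OF PF_coord] by blast
  from choice[OF this] obtain F where F': "\<forall>v. v \<in> V \<longrightarrow> F v \<in> coeffs_in (PF U) \<and> lead_coeff (F v) = 1 \<and> poly (F v) (coord v) \<in> Q" ..
  then have F: "F v \<in> coeffs_in (PF U)" "lead_coeff (F v) = 1" "poly (F v) (coord v) \<in> Q" if "v \<in> V" for v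
    using that by blast+
  have Froot: "poly (evc q (F v)) (q v) = 0" if "v \<in> V" "\<forall>f\<in>Q. f q = 0" for v q
    using poly_evc[of q "F v" "coord v"] F(3)[OF that(1)] that(2) by simp
  define R where "R = (\<Union>v\<in>V. (\<lambda>z. z - p v) ` {z. poly (evc p (F v)) z = 0})"
  have "evc p (F v) \<noteq> 0" if "v \<in> V" for v using evc_monic(2)[OF F(2)[OF that], of p] by (metis coeff_0 zero_neq_one)
  then have Rfin: "finite R" unfolding R_def using V by (intro finite_UN_I finite_imageI poly_roots_finite)
  define D where "D = {d. (\<forall>v. (v \<in> V \<longrightarrow> d v \<in> R) \<and> (v \<notin> V \<longrightarrow> d v = 0)) \<and> (\<exists>v\<in>V. d v \<noteq> 0)}"
  have "finite D"
    by (rule finite_subset[OF _ finite_set_of_finite_funs[OF V Rfin, of 0]]) (auto simp: D_def)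
  then obtain c where c: "\<forall>d\<in>D. (\<Sum>v\<in>V. c v * d v) \<noteq> 0"
    using separating_linear_form[OF V, of D] D_def by blast
  define g where "g = (\<Sum>v\<in>V. cfun (c v) * coord v)"
  have g: "g \<in> PF V" unfolding g_def by (intro PF_ring(8) PF_mult PF_coord PF_const)
  have gx: "g x = (\<Sum>v\<in>V. c v * x v)" for x by (simp add: g_def)
  obtain f0 where "f0 \<in> coeffs_in (PF U)" "lead_coeff f0 = 1" "poly f0 g \<in> Q" using integral[OF g] by blast
  from minimal_polynomial[OF Q UV Q0 g this] obtain m where m: "m \<in> coeffs_in (PF U)" "lead_coeff m = 1" "poly m g \<in> Q"
    "\<forall>f\<in>coeffs_in (PF U). poly f g \<in> Q \<longrightarrow> (\<exists>b\<in>coeffs_in (PF U). f = m * b)" by (elim bexE conjE)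
  have degm: "degree m \<noteq> 0"
  proof
    assume "degree m = 0"
    then obtain a where "m = [:a:]" by (rule degree_eq_zeroE)
    then have "poly m g = 1" using m(2) by simp
    then show False using m(3) Q by (simp add: is_prime_def)
  qed
  have mp: "poly (evc p m) (g p) = 0" using poly_evc[of p m g] p[OF m(3)] by simp
  obtain y where y: "\<forall>\<^sub>F k in sequentially. a (\<lambda>v. p v + of_real (1 / real (Suc k)) * y v) \<noteq> 0"
    using PF_nonzero_near[OF a(1,2)] by blast
  then obtain k0 where k0: "\<And>k. k \<ge> k0 \<Longrightarrow> a (\<lambda>v. p v + of_real (1 / real (Suc k)) * y v) \<noteq> 0"
    unfolding eventually_sequentially by blast
  define x where "x k = (\<lambda>v. p v + of_real (1 / real (Suc (k + k0))) * y v)" for k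
  have ax: "a (x k) \<noteq> 0" for k unfolding x_def by (rule k0) simp
  have lim0: "(\<lambda>k. complex_of_real (1 / real (Suc (k + k0)))) \<longlonglongrightarrow> of_real 0"
    by (intro tendsto_of_real LIMSEQ_ignore_initial_segment[where f="\<lambda>k. 1 / real (Suc k)"] LIMSEQ_Suc[OF lim_1_over_n])
  have xlim: "(\<lambda>k. x k v) \<longlonglongrightarrow> p v" for v
    unfolding x_def using tendsto_add[OF tendsto_const[of "p v"] tendsto_mult[OF lim0 tendsto_const[of "y v"]]] by simp
  have mono_m: "degree (evc x m) = degree m" "lead_coeff (evc x m) = 1" for x using evc_monic[OF m(2)] by auto
  have "\<forall>k. \<exists>t. poly (evc (x k) m) t = 0 \<and> cmod (g p - t) ^ degree m \<le> cmod (poly (evc (x k) m) (g p))"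
    using monic_root_near[OF mono_m(2)] degm unfolding mono_m(1) by blast
  from choice[OF this] obtain t where t: "\<forall>k. poly (evc (x k) m) (t k) = 0 \<and> cmod (g p - t k) ^ degree m \<le> cmod (poly (evc (x k) m) (g p))" ..
  have "(\<lambda>k. poly m (cfun (g p)) (x k)) \<longlonglongrightarrow> poly m (cfun (g p)) p"
    by (rule PF_tendsto[OF poly_in_subring[OF SU m(1) PF_const] xlim])
  then have "(\<lambda>k. poly (evc (x k) m) (g p)) \<longlonglongrightarrow> 0" unfolding poly_evc_const[symmetric] mp .
  then have pm0: "(\<lambda>k. cmod (poly (evc (x k) m) (g p))) \<longlonglongrightarrow> 0" by (rule tendsto_norm_zero)
  have "(\<lambda>k. cmod (g p - t k) ^ degree m) \<longlonglongrightarrow> 0"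
  proof (rule real_tendsto_sandwich[OF _ _ tendsto_const pm0])
    show "\<forall>\<^sub>F k in sequentially. 0 \<le> cmod (g p - t k) ^ degree m" by simp
    show "\<forall>\<^sub>F k in sequentially. cmod (g p - t k) ^ degree m \<le> cmod (poly (evc (x k) m) (g p))"
      using t by (intro always_eventually allI) blast
  qed
  then have "(\<lambda>k. root (degree m) (cmod (g p - t k) ^ degree m)) \<longlonglongrightarrow> root (degree m) 0" by (rule tendsto_real_root)
  then have "(\<lambda>k. cmod (g p - t k)) \<longlonglongrightarrow> 0" using degm by (simp add: real_root_power_cancel)
  then have "(\<lambda>k. g p - t k) \<longlonglongrightarrow> 0" by (rule tendsto_norm_zero_cancel)
  from tendsto_diff[OF tendsto_const[of "g p"] this] have tlim: "t \<longlonglongrightarrow> g p" by simp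
  have "\<forall>k. \<exists>q. (\<forall>f\<in>Q. f q = 0) \<and> (\<forall>v\<in>U. q v = x k v) \<and> (\<forall>v. v \<notin> V \<longrightarrow> q v = x k v) \<and> g q = t k"
  proof
    fix k
    show "\<exists>q. (\<forall>f\<in>Q. f q = 0) \<and> (\<forall>v\<in>U. q v = x k v) \<and> (\<forall>v. v \<notin> V \<longrightarrow> q v = x k v) \<and> g q = t k"
    proof (rule lying_over[OF Q UV fin g])
      fix f assume "f \<in> coeffs_in (PF U)" "poly f g \<in> Q"
      then obtain b where "f = m * b" using m(4) by blast
      then have "poly (evc (x k) f) (t k) = poly (evc (x k) m) (t k) * poly (evc (x k) b) (t k)" by (simp only: evc_simps poly_mult)
      then show "poly (evc (x k) f) (t k) = 0" using t by simp
    qed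
  qed
  from choice[OF this] obtain q where q': "\<forall>k. (\<forall>f\<in>Q. f (q k) = 0) \<and> (\<forall>v\<in>U. q k v = x k v) \<and> (\<forall>v. v \<notin> V \<longrightarrow> q k v = x k v) \<and> g (q k) = t k" ..
  then have q: "\<And>k f. f \<in> Q \<Longrightarrow> f (q k) = 0" "\<And>k v. v \<in> U \<Longrightarrow> q k v = x k v" "\<And>k. g (q k) = t k" by blast+
  have "\<exists>B. \<forall>k. cmod (q k v) \<le> B" if v: "v \<in> V" for v
  proof -
    let ?b = "\<lambda>k. \<Sum>i<degree (F v). cmod (coeff (F v) i (x k))"
    have "?b \<longlonglongrightarrow> (\<Sum>i<degree (F v). cmod (coeff (F v) i p))"
      by (intro tendsto_sum tendsto_norm PF_tendsto[OF coeffs_inD[OF F(1)[OF v]] xlim])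
    then have "Bseq ?b" by (intro convergent_imp_Bseq convergentI)
    then obtain B where B: "\<And>k. norm (?b k) \<le> B" unfolding Bseq_def by blast
    have "cmod (q k v) \<le> 1 + B" for k
    proof -
      have eq: "evc (q k) (F v) = evc (x k) (F v)" by (rule evc_cong[OF F(1)[OF v] q(2)])
      have "poly (evc (x k) (F v)) (q k v) = 0" using Froot[OF v, of "q k"] q(1) unfolding eq by blast
      from monic_root_bound[OF evc_monic(2)[OF F(2)[OF v]] this]
      have "cmod (q k v) \<le> 1 + ?b k" unfolding evc_monic(1)[OF F(2)[OF v]] coeff_evc .
      moreover have "?b k \<le> B" using B[of k] by simp
      ultimately show ?thesis by linarith
    qed
    then show ?thesis by blast
  qed
  then obtain B where B: "\<And>v k. v \<in> V \<Longrightarrow> cmod (q k v) \<le> B v" by metis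
  from bounded_family_subsequence[of V q B, OF V B] obtain r l where r: "strict_mono r" "\<And>v. v \<in> V \<Longrightarrow> (\<lambda>k. q (r k) v) \<longlonglongrightarrow> l v" by blast
  have lQ: "f l = 0" if "f \<in> Q" for f
  proof -
    have "(\<lambda>k. f (q (r k))) \<longlonglongrightarrow> f l" by (rule PF_tendsto[OF idealD(1)[OF Qi that] r(2)])
    then show ?thesis unfolding q(1)[OF that] by (simp add: LIMSEQ_const_iff)
  qed
  have lU: "l v = p v" if "v \<in> U" for v
  proof -
    have "(\<lambda>k. x (r k) v) \<longlonglongrightarrow> p v" using LIMSEQ_subseq_LIMSEQ[OF xlim r(1), of v] by (simp add: comp_def)
    then show ?thesis using r(2)[of v] UV that unfolding q(2)[OF that] by (blast intro: LIMSEQ_unique)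
  qed
  have "g l = g p"
  proof -
    have "(\<lambda>k. g (q (r k))) \<longlonglongrightarrow> g l" by (rule PF_tendsto[OF g r(2)])
    moreover have "(\<lambda>k. g (q (r k))) \<longlonglongrightarrow> g p" unfolding q(3) using LIMSEQ_subseq_LIMSEQ[OF tlim r(1)] by (simp add: comp_def)
    ultimately show ?thesis by (rule LIMSEQ_unique)
  qed
  have lp: "l v = p v" if "v \<in> V" for v
  proof (rule ccontr)
    assume ne: "l v \<noteq> p v"
    define d where "d = (\<lambda>w. if w \<in> V then l w - p w else 0)"
    have "d w \<in> R" if "w \<in> V" for w
    proof -
      have eq: "evc l (F w) = evc p (F w)" by (rule evc_cong[OF F(1)[OF that] lU])
      have "poly (evc p (F w)) (l w) = 0" using Froot[OF that, of l] lQ unfolding eq by blast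
      then show ?thesis using that by (auto simp: R_def d_def)
    qed
    then have "d \<in> D" using that ne by (auto simp: D_def d_def)
    moreover have "(\<Sum>v\<in>V. c v * d v) = g l - g p"
      unfolding gx sum_subtractf[symmetric] by (rule sum.cong) (auto simp: d_def right_diff_distrib)
    ultimately show False using c \<open>g l = g p\<close> by auto
  qed
  have "h (q (r k)) \<noteq> 0" for k
  proof (rule a(3))
    show "\<forall>f\<in>Q. f (q (r k)) = 0" using q(1) by blast
    have "a (q (r k)) = a (x (r k))" by (rule PF_cong[OF a(1) q(2)])
    then show "a (q (r k)) \<noteq> 0" using ax by simp
  qed
  then show ?thesis using q(1) r(2) lp by (intro exI[of _ "\<lambda>k. q (r k)"]) auto
qed

text \<open>Zariski open dense subsets of an irreducible variety are dense in the Euclidean topology. A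
  polynomial change of coordinates reduces this to a normalized ideal.\<close>
theorem prime_zero_set_dense:
  fixes Q :: "'v pfun set"
  assumes V: "finite V" and Q: "is_prime (PF V) Q" and p: "\<And>f. f \<in> Q \<Longrightarrow> f p = 0" and h: "h \<in> PF V" "h \<notin> Q"
  shows "\<exists>q :: nat \<Rightarrow> 'v \<Rightarrow> complex. (\<forall>k. (\<forall>f\<in>Q. f (q k) = 0) \<and> h (q k) \<noteq> 0) \<and> (\<forall>v\<in>V. (\<lambda>k. q k v) \<longlonglongrightarrow> p v)"
proof -
  from noether_normalization[OF V Q] obtain L M U k e where N: "PF_aut V L M" "U \<subseteq> V" "((\<lambda>f. f \<circ> L) ` Q) \<inter> PF U = {0}"
    "fin_over (PF V) (PF U) ((\<lambda>f. f \<circ> L) ` Q) k e" by (elim exE conjE)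
  note inv = PF_aut_inverse[OF N(1)]
  have 1: "f (M p) = 0" if f: "f \<in> (\<lambda>f. f \<circ> L) ` Q" for f
    using f by (rule imageE) (simp add: inv(3) p)
  have 2: "h \<circ> L \<notin> (\<lambda>f. f \<circ> L) ` Q"
  proof
    assume "h \<circ> L \<in> (\<lambda>f. f \<circ> L) ` Q"
    then obtain f where f: "h \<circ> L = f \<circ> L" "f \<in> Q" by (rule imageE)
    have "h \<circ> L \<circ> M = f \<circ> L \<circ> M" by (simp only: f(1))
    then show False using f(2) h(2) unfolding inv(2) by simp
  qed
  have "\<exists>q :: nat \<Rightarrow> 'v \<Rightarrow> complex. (\<forall>k. (\<forall>f\<in>(\<lambda>f. f \<circ> L) ` Q. f (q k) = 0) \<and> (h \<circ> L) (q k) \<noteq> 0) \<and>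
      (\<forall>v\<in>V. (\<lambda>k. q k v) \<longlonglongrightarrow> M p v)"
  proof (rule dense_of_normalized[OF V prime_pull[OF Q N(1)] N(2,3,4)])
    show "h \<circ> L \<in> PF V" by (rule PF_aut_pull(1)[OF N(1) order.refl h(1)])
  qed (use 1 2 in blast)+
  then obtain q where q: "\<forall>k. (\<forall>f\<in>(\<lambda>f. f \<circ> L) ` Q. f (q k) = 0) \<and> (h \<circ> L) (q k) \<noteq> 0" "\<forall>v\<in>V. (\<lambda>k. q k v) \<longlonglongrightarrow> M p v" by (elim exE conjE)
  have "(\<lambda>k. L (q k) v) \<longlonglongrightarrow> p v" if v: "v \<in> V" for v
  proof -
    have "(\<lambda>x. L x v) \<in> PF V" using N(1) v unfolding PF_aut_def by blast
    from PF_tendsto[OF this, of q "M p"] q(2) show ?thesis unfolding inv(3) by blast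
  qed
  then show ?thesis using q(1) by (intro exI[of _ "\<lambda>k. L (q k)"]) simp
qed

section \<open>Evaluation of formal polynomials\<close>

abbreviation "lkp \<equiv> Poly_Mapping.lookup"
abbreviation "kys \<equiv> Poly_Mapping.keys"
abbreviation "sng \<equiv> Poly_Mapping.single"

lemma mpoly_induct [case_names zero single add]:
  assumes "P 0" "\<And>m c. P (sng m c)" "\<And>f g. P f \<Longrightarrow> P g \<Longrightarrow> P (f + g)" shows "P (f :: 'a \<Rightarrow>\<^sub>0 'b::comm_monoid_add)"
proof (induction f rule: update_induct)
  case const show ?case by (rule assms(1))
next
  case (update f a b)
  have "Poly_Mapping.update a b f = f + sng a b"
    by (rule poly_mapping_eqI) (use update(1) in \<open>auto simp: lookup_update lookup_add lookup_single when_def in_keys_iff\<close>)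
  then show ?case using assms(2,3) update by metis
qed

text \<open>The value of a monomial.\<close>
definition mev :: "('v \<Rightarrow> 'b::comm_ring_1) \<Rightarrow> 'v midx \<Rightarrow> 'b" where
  "mev a m = (\<Prod>v\<in>kys m. a v ^ lkp m v)"

lemma mev_superset: "finite K \<Longrightarrow> kys m \<subseteq> K \<Longrightarrow> mev a m = (\<Prod>v\<in>K. a v ^ lkp m v)"
  unfolding mev_def by (rule prod.mono_neutral_left) (auto simp: in_keys_iff)

lemma mev_add: "mev a (m + m') = mev a m * mev a m'"
proof -
  let ?K = "kys m \<union> kys m'"
  have "mev a (m + m') = (\<Prod>v\<in>?K. a v ^ lkp (m + m') v)" by (rule mev_superset) (auto simp: keys_add)
  also have "\<dots> = (\<Prod>v\<in>?K. a v ^ lkp m v) * (\<Prod>v\<in>?K. a v ^ lkp m' v)"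
    by (simp add: lookup_add power_add prod.distrib)
  also have "(\<Prod>v\<in>?K. a v ^ lkp m v) = mev a m" by (rule mev_superset[symmetric]) auto
  also have "(\<Prod>v\<in>?K. a v ^ lkp m' v) = mev a m'" by (rule mev_superset[symmetric]) auto
  finally show ?thesis .
qed

lemma mev_0 [simp]: "mev a 0 = 1" by (simp add: mev_def)
lemma mev_single [simp]: "mev a (sng v k) = a v ^ k" by (cases "k = 0") (simp_all add: mev_def)

lemma psubst_superset:
  assumes "h 0 = 0" "finite K" "kys f \<subseteq> K" shows "psubst h a f = (\<Sum>m\<in>K. h (lkp f m) * mev a m)"
  unfolding psubst_def mev_def[symmetric] using assms by (intro sum.mono_neutral_left) (auto simp: in_keys_iff)

locale complex_hom = comm_ring_hom hom for hom :: "complex \<Rightarrow> 'b::comm_ring_1"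
begin

lemma psubst_single: "psubst hom a (sng m c) = hom c * mev a m"
  by (subst psubst_superset[of _ "{m}"]) auto

lemma psubst_add: "psubst hom a (f + g) = psubst hom a f + psubst hom a g"
proof -
  let ?K = "kys f \<union> kys g"
  have "psubst hom a (f + g) = (\<Sum>m\<in>?K. hom (lkp (f + g) m) * mev a m)" by (rule psubst_superset) (auto simp: keys_add)
  also have "\<dots> = (\<Sum>m\<in>?K. hom (lkp f m) * mev a m) + (\<Sum>m\<in>?K. hom (lkp g m) * mev a m)"
    by (simp add: lookup_add hom_add distrib_right sum.distrib)
  also have "(\<Sum>m\<in>?K. hom (lkp f m) * mev a m) = psubst hom a f" by (rule psubst_superset[symmetric]) auto
  also have "(\<Sum>m\<in>?K. hom (lkp g m) * mev a m) = psubst hom a g" by (rule psubst_superset[symmetric]) auto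
  finally show ?thesis .
qed

lemma psubst_0: "psubst hom a 0 = 0" by (simp add: psubst_def)

lemma psubst_mult: "psubst hom a (f * g) = psubst hom a f * psubst hom a g"
proof (induction f rule: mpoly_induct)
  case zero show ?case by (simp add: psubst_0)
next
  case (single m c)
  show ?case
  proof (induction g rule: mpoly_induct)
    case zero show ?case by (simp add: psubst_0)
  next
    case (single m' c') show ?case by (simp add: mult_single psubst_single mev_add hom_mult ac_simps)
  next
    case (add f g) then show ?case by (simp add: distrib_left psubst_add)
  qed
next
  case (add f g) then show ?case by (simp add: distrib_right psubst_add)
qed

lemma psubst_const: "psubst hom a (pconst c) = hom c" by (simp add: pconst_def psubst_single)
lemma psubst_var: "psubst hom a (pvar v) = a v" by (simp add: pvar_def psubst_single)
lemma psubst_1: "psubst hom a 1 = 1" using psubst_const[of a 1] by (simp add: pconst_def)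

end

lemma id_hom: "complex_hom (\<lambda>c. c)" by unfold_locales simp_all
lemma pconst_hom: "complex_hom pconst"
  by unfold_locales (simp_all add: pconst_def single_add mult_single)

lemma pconst_simps: "pconst 0 = 0" "pconst 1 = 1" "pconst (a + b) = pconst a + pconst b"
  "pconst (a * b) = pconst a * pconst b"
  by (simp_all add: pconst_def single_add mult_single)

lemma peval_simps: "peval a 0 = 0" "peval a 1 = 1" "peval a (f + g) = peval a f + peval a g" "peval a (f * g) = peval a f * peval a g"
  "peval a (pconst c) = c" "peval a (pvar v) = a v"
  unfolding peval_def by (rule complex_hom.psubst_0[OF id_hom] complex_hom.psubst_1[OF id_hom] complex_hom.psubst_add[OF id_hom]
    complex_hom.psubst_mult[OF id_hom] complex_hom.psubst_const[OF id_hom] complex_hom.psubst_var[OF id_hom])+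

lemma peval_hom: "comm_ring_hom (peval a)"
  by unfold_locales (simp_all only: peval_simps)

lemma peval_more: "peval a (- f) = - peval a f" "peval a (f - g) = peval a f - peval a g" "peval a (f ^ n) = peval a f ^ n"
  "peval a (sum F K) = (\<Sum>i\<in>K. peval a (F i))" "peval a (prod F K) = (\<Prod>i\<in>K. peval a (F i))"
proof -
  show u: "peval a (- f) = - peval a f" for f using peval_simps(3)[of a f "- f"] by (simp add: peval_simps(1) eq_neg_iff_add_eq_0 add.commute)
  show "peval a (f - g) = peval a f - peval a g" using peval_simps(3)[of a f "- g"] by (simp add: u)
  show "peval a (f ^ n) = peval a f ^ n" by (induction n) (simp_all add: peval_simps)
  show "peval a (sum F K) = (\<Sum>i\<in>K. peval a (F i))" by (induction K rule: infinite_finite_induct) (simp_all add: peval_simps)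
  show "peval a (prod F K) = (\<Prod>i\<in>K. peval a (F i))" by (induction K rule: infinite_finite_induct) (simp_all add: peval_simps)
qed

lemma mpoly_induct_vars [case_names const var add mult]:
  assumes c: "\<And>c. P (pconst c)" and v: "\<And>v. P (pvar v)" and a: "\<And>f g. P f \<Longrightarrow> P g \<Longrightarrow> P (f + g)"
    and m: "\<And>f g. P f \<Longrightarrow> P g \<Longrightarrow> P (f * g)"
  shows "P (f :: 'v mpoly)"
proof (induction f rule: mpoly_induct)
  case zero show ?case using c[of 0] by (simp add: pconst_def)
next
  case (single k c)
  have pw: "P (pvar v ^ n)" for v n
    by (induction n) (use assms(1)[of 1] in \<open>auto simp: pconst_def intro: v m\<close>)
  have pv: "pvar v ^ n = sng (sng v n) 1" for v :: 'v and n
    by (induction n) (simp_all add: pvar_def mult_single flip: single_add)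
  have "\<forall>c. P (sng k c)"
  proof (induction k rule: mpoly_induct)
    case zero show ?case using c by (simp add: pconst_def)
  next
    case (single v n)
    have "sng (sng v n) c = pconst c * pvar v ^ n" for c by (simp add: pv pconst_def mult_single)
    then show ?case using m[OF c pw] by simp
  next
    case (add k l)
    have "sng (k + l) c = sng k c * sng l 1" for c :: complex by (simp add: mult_single)
    then show ?case using add m by simp
  qed
  then show ?case by blast
next
  case (add f g) then show ?case by (rule a)
qed

lemma psubst_psubst:
  assumes "complex_hom h" shows "psubst h b (psubst pconst \<theta> f) = psubst h (\<lambda>v. psubst h b (\<theta> v)) f"
proof (induction f rule: mpoly_induct_vars)
  case (const c) show ?case by (simp add: complex_hom.psubst_const[OF assms] complex_hom.psubst_const[OF pconst_hom])
next
  case (var v) show ?case by (simp add: complex_hom.psubst_var[OF assms] complex_hom.psubst_var[OF pconst_hom])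
next
  case (add f g) then show ?case by (simp add: complex_hom.psubst_add[OF assms] complex_hom.psubst_add[OF pconst_hom])
next
  case (mult f g) then show ?case by (simp add: complex_hom.psubst_mult[OF assms] complex_hom.psubst_mult[OF pconst_hom])
qed

lemma peval_psubst: "peval b (psubst pconst \<theta> f) = peval (\<lambda>v. peval b (\<theta> v)) f"
  unfolding peval_def by (rule psubst_psubst[OF id_hom])

lemma polys_in_closed:
  "pconst c \<in> polys_in V" "v \<in> V \<Longrightarrow> pvar v \<in> polys_in V" "f \<in> polys_in V \<Longrightarrow> g \<in> polys_in V \<Longrightarrow> f + g \<in> polys_in V"
  "f \<in> polys_in V \<Longrightarrow> g \<in> polys_in V \<Longrightarrow> f * g \<in> polys_in V" "f \<in> polys_in V \<Longrightarrow> - f \<in> polys_in V"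
  "0 \<in> polys_in V" "1 \<in> polys_in V"
proof -
  show "pconst c \<in> polys_in V" for c by (auto simp: polys_in_def pconst_def split: if_splits)
  show "v \<in> V \<Longrightarrow> pvar v \<in> polys_in V" by (auto simp: polys_in_def pvar_def)
  show "f \<in> polys_in V \<Longrightarrow> g \<in> polys_in V \<Longrightarrow> f + g \<in> polys_in V" using keys_add[of f g] by (auto simp: polys_in_def)
  show "f \<in> polys_in V \<Longrightarrow> g \<in> polys_in V \<Longrightarrow> f * g \<in> polys_in V"
  proof (unfold polys_in_def mem_Collect_eq, intro ballI)
    fix k assume *: "\<forall>m\<in>kys f. kys m \<subseteq> V" "\<forall>m\<in>kys g. kys m \<subseteq> V" "k \<in> kys (f * g)"
    then obtain a b where "k = a + b" "a \<in> kys f" "b \<in> kys g" using keys_mult[of f g] by blast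
    then show "kys k \<subseteq> V" using keys_add[of a b] * by blast
  qed
  show "f \<in> polys_in V \<Longrightarrow> - f \<in> polys_in V" by (simp add: polys_in_def in_keys_iff)
qed (auto simp: polys_in_def)

lemma polys_in_mono: "V \<subseteq> W \<Longrightarrow> polys_in V \<subseteq> polys_in W"
  by (auto simp: polys_in_def)

lemma polys_in_UNIV [simp]: "polys_in UNIV = UNIV" by (auto simp: polys_in_def)

lemma polys_in_power: "f \<in> polys_in V \<Longrightarrow> f ^ n \<in> polys_in V"
  by (induction n) (auto intro: polys_in_closed)

lemma peval_PF: assumes "f \<in> polys_in V" shows "(\<lambda>x. peval x f) \<in> PF V"
proof -
  have "(\<lambda>x. peval x f) = (\<Sum>m\<in>kys f. cfun (lkp f m) * (\<Prod>v\<in>kys m. coord v ^ lkp m v))"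
    by (rule ext) (simp add: peval_def psubst_def)
  also have "\<dots> \<in> PF V" using assms unfolding polys_in_def
    by (intro PF_ring(8) PF_mult PF_const PF_ring(9) PF_ring(7) PF_coord) blast
  finally show ?thesis .
qed

text \<open>Polynomial functions are exactly the functions of formal polynomials; with
  \<open>peval_inj\<close> this identifies ideals of formal polynomials with ideals of
  functions.\<close>
lemma PF_peval: assumes "F \<in> PF V" shows "\<exists>f\<in>polys_in V. \<forall>x. F x = peval x f"
  using assms
proof (induction rule: PF.induct)
  case (PF_const c) show ?case by (rule bexI[OF _ polys_in_closed(1)[of c]]) (simp add: peval_simps)
next
  case (PF_coord v) show ?case by (rule bexI[OF _ polys_in_closed(2)[OF PF_coord]]) (simp add: peval_simps)
next
  case (PF_add F G)
  from PF_add.IH(1) obtain f where f: "f \<in> polys_in V" "\<forall>x. F x = peval x f" by (elim bexE)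
  from PF_add.IH(2) obtain g where g: "g \<in> polys_in V" "\<forall>x. G x = peval x g" by (elim bexE)
  have "(F + G) x = peval x (f + g)" for x
    unfolding plus_fun_apply[of F G x] peval_simps(3) using f(2) g(2) by metis
  then show ?case using polys_in_closed(3)[OF f(1) g(1)] by (intro bexI[of _ "f + g"] allI)
next
  case (PF_mult F G)
  from PF_mult.IH(1) obtain f where f: "f \<in> polys_in V" "\<forall>x. F x = peval x f" by (elim bexE)
  from PF_mult.IH(2) obtain g where g: "g \<in> polys_in V" "\<forall>x. G x = peval x g" by (elim bexE)
  have "(F * G) x = peval x (f * g)" for x
    unfolding times_fun_apply[of F G x] peval_simps(4) using f(2) g(2) by metis
  then show ?case using polys_in_closed(4)[OF f(1) g(1)] by (intro bexI[of _ "f * g"] allI)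
qed

text \<open>If two monomials differ in the exponent of \<open>v\<close>, doubling the \<open>v\<close>-th
  coordinate multiplies them by different powers of \<open>2\<close>. Subtracting a multiple of
  the relation from its scaled version eliminates one monomial.\<close>
lemma monomials_independent:
  assumes "finite K" "\<And>x :: 'v \<Rightarrow> complex. (\<Sum>m\<in>K. c m * mev x m) = 0"
  shows "\<forall>m\<in>K. c m = 0"
  using assms
proof (induction K arbitrary: c rule: finite_induct)
  case (insert m0 K)
  have mult: "mev (\<lambda>v. x v * y v) m = mev x m * mev y m" for x y :: "'v \<Rightarrow> complex" and m
    by (simp add: mev_def power_mult_distrib prod.distrib)
  have K: "c m = 0" if m: "m \<in> K" for m
  proof -
    have "m \<noteq> m0" using insert.hyps(2) m by auto
    then obtain v where v: "lkp m v \<noteq> lkp m0 v" by (meson poly_mapping_eqI)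
    define y where "y = (\<lambda>w. if w = v then 2 else (1::complex))"
    have my: "mev y k = 2 ^ lkp k v" for k
    proof -
      have "mev y k = (\<Prod>w\<in>insert v (kys k). y w ^ lkp k w)" by (rule mev_superset) auto
      also have "\<dots> = (\<Prod>w\<in>insert v (kys k). if w = v then 2 ^ lkp k v else 1)" by (rule prod.cong) (auto simp: y_def)
      also have "\<dots> = 2 ^ lkp k v" by simp
      finally show ?thesis .
    qed
    have ne: "mev y m - mev y m0 \<noteq> 0"
    proof
      assume "mev y m - mev y m0 = 0"
      then have "(2::complex) ^ lkp m v = 2 ^ lkp m0 v" by (simp add: my)
      then have "norm ((2::complex) ^ lkp m v) = norm ((2::complex) ^ lkp m0 v)" by simp
      then have "(2::real) ^ lkp m v = 2 ^ lkp m0 v" by (simp add: norm_power)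
      then show False using v by simp
    qed
    have "(\<Sum>k\<in>K. (c k * (mev y k - mev y m0)) * mev x k) = 0" for x
    proof -
      have "0 = (\<Sum>k\<in>insert m0 K. c k * mev (\<lambda>v. x v * y v) k) - mev y m0 * (\<Sum>k\<in>insert m0 K. c k * mev x k)"
        using insert.prems by simp
      also have "\<dots> = (\<Sum>k\<in>insert m0 K. (c k * (mev y k - mev y m0)) * mev x k)"
        by (simp only: mult sum_distrib_left sum_subtractf[symmetric]) (simp add: algebra_simps)
      also have "\<dots> = (\<Sum>k\<in>K. (c k * (mev y k - mev y m0)) * mev x k)" using insert.hyps by simp
      finally show ?thesis by simp
    qed
    from bspec[OF insert.IH[of "\<lambda>k. c k * (mev y k - mev y m0)", OF this] m] ne show ?thesis
      by (simp only: mult_eq_0_iff) blast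
  qed
  have "c m0 * mev (\<lambda>_. 1) m0 = 0" using insert.prems[of "\<lambda>_. 1"] insert.hyps K by simp
  then have "c m0 = 0" by (simp add: mev_def)
  then show ?case using K by simp
qed simp

lemma peval_inj: assumes "\<And>x. peval x f = peval x g" shows "f = g"
proof -
  have z: "h = 0" if "\<And>x. peval x h = 0" for h :: "'a mpoly"
  proof -
    have "\<forall>m\<in>kys h. lkp h m = 0"
      by (rule monomials_independent) (use that in \<open>simp_all add: peval_def psubst_def mev_def\<close>)
    then show ?thesis by (auto intro: poly_mapping_eqI simp: in_keys_iff)
  qed
  have "f - g = 0" by (rule z) (simp add: peval_more assms)
  then show ?thesis by simp
qed

section \<open>The elimination ideal\<close>

lemma poly_ring_simps [simp]: "carrier (poly_ring V) = polys_in V" "f \<otimes>\<^bsub>poly_ring V\<^esub> g = f * g"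
  "\<one>\<^bsub>poly_ring V\<^esub> = 1" "\<zero>\<^bsub>poly_ring V\<^esub> = 0" "f \<oplus>\<^bsub>poly_ring V\<^esub> g = f + g"
  by (simp_all add: poly_ring_def)

lemma cring_poly_ring: "cring (poly_ring V)"
proof (rule cringI)
  show "abelian_group (poly_ring V)"
    by (rule abelian_groupI) (auto intro: polys_in_closed simp: ac_simps intro!: bexI[of _ "- _"])
  show "Group.comm_monoid (poly_ring V)"
    by (rule comm_monoidI) (auto intro: polys_in_closed simp: ac_simps)
qed (simp add: distrib_right)

lemma a_inv_poly_ring: assumes "f \<in> polys_in V" shows "\<ominus>\<^bsub>poly_ring V\<^esub> f = - f"
proof -
  interpret cring "poly_ring V" by (rule cring_poly_ring)
  show ?thesis by (rule minus_equality) (use assms in \<open>auto intro: polys_in_closed\<close>)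
qed

lemma ideal_poly_ring_iff: "ideal Q (poly_ring V) \<longleftrightarrow> is_ideal (polys_in V) Q"
proof
  interpret R: cring "poly_ring V" by (rule cring_poly_ring)
  assume "ideal Q (poly_ring V)"
  then interpret ideal Q "poly_ring V" .
  show "is_ideal (polys_in V) Q" unfolding is_ideal_def
    using a_subset a_closed zero_closed I_l_closed by (simp add: subset_eq)
next
  interpret R: cring "poly_ring V" by (rule cring_poly_ring)
  assume Q: "is_ideal (polys_in V) Q"
  note i = idealD(1-5)[OF Q]
  show "ideal Q (poly_ring V)"
  proof (rule idealI)
    show "ring (poly_ring V)" by (rule R.ring_axioms)
    show "subgroup Q (add_monoid (poly_ring V))"
    proof (rule R.add.subgroupI)
      show "Q \<subseteq> carrier (poly_ring V)" using i(1) by auto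
      show "Q \<noteq> {}" using i(2) by auto
      show "\<ominus>\<^bsub>poly_ring V\<^esub> a \<in> Q" if "a \<in> Q" for a
        using i(4)[OF polys_in_closed(5)[OF polys_in_closed(7)] that] i(1)[OF that] by (simp add: a_inv_poly_ring)
      show "a \<oplus>\<^bsub>poly_ring V\<^esub> b \<in> Q" if "a \<in> Q" "b \<in> Q" for a b using i(3)[OF that] by simp
    qed
  qed (use i(4,5) in simp_all)
qed

lemma genideal_poly_ring:
  assumes "S \<subseteq> polys_in V"
  shows "is_ideal (polys_in V) (Idl\<^bsub>poly_ring V\<^esub> S)" "S \<subseteq> Idl\<^bsub>poly_ring V\<^esub> S"
    "is_ideal (polys_in V) Q \<Longrightarrow> S \<subseteq> Q \<Longrightarrow> Idl\<^bsub>poly_ring V\<^esub> S \<subseteq> Q"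
proof -
  interpret R: cring "poly_ring V" by (rule cring_poly_ring)
  show "is_ideal (polys_in V) (Idl\<^bsub>poly_ring V\<^esub> S)"
    unfolding ideal_poly_ring_iff[symmetric] by (rule R.genideal_ideal) (use assms in simp)
  show "S \<subseteq> Idl\<^bsub>poly_ring V\<^esub> S" by (rule R.genideal_self) (use assms in simp)
  show "Idl\<^bsub>poly_ring V\<^esub> S \<subseteq> Q" if "is_ideal (polys_in V) Q" "S \<subseteq> Q"
    by (rule R.genideal_minimal) (use that ideal_poly_ring_iff in blast)+
qed

lemma finite_multi_indices: "finite {\<alpha> :: 's::finite midx. mdeg \<alpha> \<le> n}"
proof -
  have "lkp ` {\<alpha> :: 's midx. mdeg \<alpha> \<le> n} \<subseteq> {f. \<forall>i. (i \<in> UNIV \<longrightarrow> f i \<in> {..n}) \<and> (i \<notin> UNIV \<longrightarrow> f i = 0)}"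
  proof safe
    fix \<alpha> :: "'s midx" and i assume "mdeg \<alpha> \<le> n"
    moreover have "lkp \<alpha> i \<le> mdeg \<alpha>" unfolding mdeg_def by (rule member_le_sum) auto
    ultimately show "lkp \<alpha> i \<le> n" by simp
  qed simp
  moreover have "finite {f. \<forall>i::'s. (i \<in> UNIV \<longrightarrow> f i \<in> {..n}) \<and> (i \<notin> UNIV \<longrightarrow> f i = 0)}"
    by (rule finite_set_of_finite_funs) auto
  ultimately have "finite (lkp ` {\<alpha> :: 's midx. mdeg \<alpha> \<le> n})" by (rule finite_subset)
  then show ?thesis by (rule finite_imageD) (auto simp: inj_on_def intro: poly_mapping_eqI)
qed

lemma finite_col_idx [simp]: "finite (col_idx n)"
  by (rule finite_subset[OF _ finite_multi_indices[of n]]) (auto simp: col_idx_def)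
lemma finite_row_idx [simp]: "finite (row_idx n)"
  unfolding row_idx_def by (rule finite_multi_indices)

lemma finite_Lam [simp]: "finite (Lam n)"
  by (rule finite_subset[OF _ finite_lists_length_eq[OF finite_col_idx]]) (auto simp: Lam_def)

lemma finite_elim_vars: "finite (elim_vars n)" by (simp add: elim_vars_def)

lemma emb_in: "emb f \<in> polys_in (Xvar ` UNIV)"
  by (induction f rule: mpoly_induct_vars)
    (simp_all add: emb_def complex_hom.psubst_const[OF pconst_hom] complex_hom.psubst_var[OF pconst_hom]
      complex_hom.psubst_add[OF pconst_hom] complex_hom.psubst_mult[OF pconst_hom] polys_in_closed)

lemma peval_emb: "peval a (emb f) = peval (\<lambda>i. a (Xvar i)) f"
  unfolding emb_def peval_psubst peval_simps ..

text \<open>Points of the affine space with coordinates $x_i$, $t$, $u_J$.\<close>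
definition pt :: "('s \<Rightarrow> complex) \<Rightarrow> complex \<Rightarrow> ('s midx list \<Rightarrow> complex) \<Rightarrow> 's evar \<Rightarrow> complex" where
  "pt x t u = (\<lambda>v. case v of Xvar i \<Rightarrow> x i | Tvar \<Rightarrow> t | Uvar J \<Rightarrow> u J)"

lemma peval_set_x0: "peval u (set_x0 f) = peval (pt (\<lambda>_. 0) 0 u) f"
proof -
  have "(\<lambda>v. peval u (case v of Xvar i \<Rightarrow> 0 | Tvar \<Rightarrow> 0 | Uvar J \<Rightarrow> pvar J)) = pt (\<lambda>_. 0) 0 u"
    by (rule ext) (simp add: pt_def peval_simps split: evar.split)
  then show ?thesis unfolding set_x0_def peval_psubst by simp
qed

context
  fixes F :: "'s::{finite,linorder} mpoly" and n :: nat
begin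

lemma gens_in: "insert (emb F) {pvar (Uvar J) - pvar Tvar * emb (Delta n F J) | J. J \<in> Lam n} \<subseteq> polys_in (all_vars n)"
proof -
  have e: "emb f \<in> polys_in (all_vars n)" for f :: "'s mpoly"
    by (rule subsetD[OF polys_in_mono emb_in]) (auto simp: all_vars_def)
  have "pvar (Uvar J) - pvar Tvar * emb (Delta n F J) \<in> polys_in (all_vars n)" if "J \<in> Lam n" for J
    unfolding diff_conv_add_uminus using that by (intro polys_in_closed e) (auto simp: all_vars_def)
  then show ?thesis using e by blast
qed

lemmas A_ideal = genideal_poly_ring[OF gens_in, folded ideal_A_def]

text \<open>The functions vanishing at such a point form an ideal that contains the generators of $A$.\<close>
lemma ideal_A_vanishes:
  assumes "g \<in> ideal_A n F" "peval x F = 0" shows "peval (pt x t (\<lambda>J. t * peval x (Delta n F J))) g = 0"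
proof -
  let ?p = "pt x t (\<lambda>J. t * peval x (Delta n F J))"
  have px: "(\<lambda>i. ?p (Xvar i)) = x" by (simp add: pt_def)
  have "ideal_A n F \<subseteq> {f \<in> polys_in (all_vars n). peval ?p f = 0}"
  proof (rule A_ideal(3))
    show "is_ideal (polys_in (all_vars n)) {f \<in> polys_in (all_vars n). peval ?p f = 0}"
      by (auto simp: is_ideal_def peval_simps intro: polys_in_closed)
    show "insert (emb F) {pvar (Uvar J) - pvar Tvar * emb (Delta n F J) |J. J \<in> Lam n} \<subseteq> {f \<in> polys_in (all_vars n). peval ?p f = 0}"
      using gens_in assms(2) by (auto simp: peval_simps peval_more peval_emb px) (simp_all add: pt_def)
  qed
  then show ?thesis using assms(1) by blast
qed

text \<open>An element of the elimination ideal vanishes at the points \<open>(x k, (t k * \<Delta>\<^sub>J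
  (x k))\<^sub>J)\<close>, hence by continuity at their limit \<open>(0, u)\<close>.\<close>
lemma limit_variety_if:
  assumes u: "u \<in> cspace (Lam n)" and x: "\<And>k. peval (x k) F = 0" "\<And>i. (\<lambda>k. x k i) \<longlonglongrightarrow> 0"
    and lim: "\<And>J. J \<in> Lam n \<Longrightarrow> (\<lambda>k. t k * peval (x k) (Delta n F J)) \<longlonglongrightarrow> u J"
  shows "u \<in> limit_variety n F"
proof -
  have "peval u (set_x0 g) = 0" if g: "g \<in> ideal_A n F" "g \<in> polys_in (elim_vars n)" for g
  proof -
    let ?q = "\<lambda>k. pt (x k) (t k) (\<lambda>J. t k * peval (x k) (Delta n F J))"
    have "(\<lambda>k. peval (?q k) g) \<longlonglongrightarrow> peval (pt (\<lambda>_. 0) 0 u) g"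
    proof (rule PF_tendsto[OF peval_PF[OF g(2)]])
      fix v :: "'s evar" assume "v \<in> elim_vars n"
      then show "(\<lambda>k. ?q k v) \<longlonglongrightarrow> pt (\<lambda>_. 0) 0 u v"
        using x(2) lim by (auto simp: elim_vars_def pt_def)
    qed
    moreover have "peval (?q k) g = 0" for k by (rule ideal_A_vanishes[OF g(1) x(1)])
    ultimately show ?thesis unfolding peval_set_x0 by (simp add: LIMSEQ_const_iff)
  qed
  then show ?thesis unfolding limit_variety_def using u by blast
qed

text \<open>Let \<open>u J0 \<noteq> 0\<close> and \<open>h = \<Delta>\<^sub>J\<^sub>0\<close>. The
  elimination ideal avoids all products \<open>s * h ^ j\<close> with \<open>s(0,u) \<noteq>
  0\<close>: modulo $A$ one has $u_{J_0} = t h$, so from $s h^j \in A$ follows $s u_{J_0}^j \in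
  A$, which does not vanish at \<open>(0,u)\<close>. A prime ideal that avoids these products
  vanishes at \<open>(0,u)\<close> and does not contain \<open>h\<close>, and
  \<open>prime_zero_set_dense\<close> supplies zeros \<open>q k\<close> with \<open>h \<noteq>
  0\<close> that tend to \<open>(0,u)\<close>. There $u_J h = u_{J_0} \Delta_J$, which also lies
  in the elimination ideal, so \<open>t = u\<^sub>J\<^sub>0 / h\<close> works.\<close>
lemma limit_variety_only_if:
  assumes u: "u \<in> limit_variety n F" and F0: "peval (\<lambda>_. 0) F = 0"
  shows "\<exists>x t. (\<forall>k. peval (x k) F = 0) \<and> (\<forall>i. (\<lambda>k. x k i) \<longlonglongrightarrow> 0) \<and>
    (\<forall>J\<in>Lam n. (\<lambda>k. t k * peval (x k) (Delta n F J)) \<longlonglongrightarrow> u J)"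
proof (cases "u = 0")
  case True
  have "u J = 0" for J unfolding True by simp
  then show ?thesis using F0 by (intro exI[of _ "\<lambda>_ _. 0"] exI[of _ "\<lambda>_. 0"]) simp
next
  case False
  have uc: "u \<in> cspace (Lam n)" using u by (simp add: limit_variety_def)
  obtain J0 where J0: "J0 \<in> Lam n" "u J0 \<noteq> 0"
  proof -
    obtain J where "u J \<noteq> 0"
    proof (rule ccontr)
      assume "\<not> thesis"
      then have "u = 0" using that by (intro ext) auto
      then show False using False by simp
    qed
    then show thesis using that uc unfolding cspace_def by blast
  qed
  let ?V = "elim_vars n :: 's evar set" and ?p = "pt (\<lambda>_. 0) 0 u" and ?A = "ideal_A n F \<inter> polys_in (elim_vars n)"
  have pA: "peval ?p g = 0" if "g \<in> ?A" for g
    using u that unfolding limit_variety_def peval_set_x0[symmetric] by blast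
  have Vall: "polys_in ?V \<subseteq> polys_in (all_vars n)" by (rule polys_in_mono) (auto simp: elim_vars_def all_vars_def)
  have embV: "emb f \<in> polys_in ?V" for f :: "'s mpoly" by (rule subsetD[OF polys_in_mono emb_in]) (auto simp: elim_vars_def)
  have UV: "pvar (Uvar J) \<in> polys_in ?V" if "J \<in> Lam n" for J using that by (intro polys_in_closed) (auto simp: elim_vars_def)
  have TV: "pvar Tvar \<in> polys_in (all_vars n)" by (intro polys_in_closed) (auto simp: all_vars_def)
  note Ai = idealD[OF A_ideal(1)]
  have gU: "pvar (Uvar J) - pvar Tvar * emb (Delta n F J) \<in> ideal_A n F" if "J \<in> Lam n" for J
    using A_ideal(2) that by blast
  have SA: "is_subring (polys_in W)" for W :: "'s evar set" unfolding is_subring_def by (auto intro: polys_in_closed)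
  define I where "I = (\<lambda>g x. peval x g) ` ?A"
  have I: "is_ideal (PF ?V) I" unfolding is_ideal_def
  proof (intro conjI ballI subsetI)
    show "f \<in> PF ?V" if "f \<in> I" for f using that peval_PF unfolding I_def by blast
    have "(\<lambda>x. peval x 0) \<in> I" unfolding I_def by (rule imageI) (intro IntI Ai(2) polys_in_closed)
    moreover have "(\<lambda>x. peval x 0) = (0 :: 's evar pfun)" by (rule ext) (simp add: peval_simps)
    ultimately show "0 \<in> I" by simp
    fix a b assume b: "b \<in> I"
    then obtain g where g: "g \<in> ?A" "b = (\<lambda>x. peval x g)" unfolding I_def by (rule imageE)
    show "a + b \<in> I" if a: "a \<in> I"
    proof -
      obtain f where f: "f \<in> ?A" "a = (\<lambda>x. peval x f)" using a unfolding I_def by (rule imageE)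
      have "(\<lambda>x. peval x (f + g)) \<in> I" unfolding I_def by (rule imageI) (use f g Ai(3) polys_in_closed(3) in blast)
      moreover have "(\<lambda>x. peval x (f + g)) = a + b" unfolding f(2) g(2) by (rule ext) (simp only: peval_simps plus_fun_apply)
      ultimately show ?thesis by (simp only:)
    qed
    show "a * b \<in> I" if "a \<in> PF ?V"
    proof -
      obtain f where f: "f \<in> polys_in ?V" "\<forall>x. a x = peval x f" using PF_peval[OF \<open>a \<in> PF ?V\<close>] by blast
      have "(\<lambda>x. peval x (f * g)) \<in> I" unfolding I_def
        by (rule imageI) (use f g Ai(4) Vall polys_in_closed(4) in blast)
      moreover have "(\<lambda>x. peval x (f * g)) = a * b"
        unfolding g(2) by (rule ext) (simp only: peval_simps times_fun_apply spec[OF f(2), symmetric])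
      ultimately show ?thesis by simp
    qed
  qed
  let ?H = "emb (Delta n F J0)" and ?U = "pvar (Uvar J0)" and ?T = "pvar Tvar"
  define h where "h = (\<lambda>x. peval x ?H)"
  have hV: "h \<in> PF ?V" unfolding h_def by (rule peval_PF[OF embV])
  define M where "M = {s * h ^ j | s j. s \<in> PF ?V \<and> s ?p \<noteq> 0}"
  have MI: "M \<inter> I = {}"
  proof (rule ccontr)
    assume "M \<inter> I \<noteq> {}"
    then obtain f where f: "f \<in> M" "f \<in> I" by blast
    from f(1) obtain s j where s12: "f = s * h ^ j" "s \<in> PF ?V" "s ?p \<noteq> 0" unfolding M_def by (elim CollectE exE conjE)
    from f(2) obtain g where g: "f = (\<lambda>x. peval x g)" "g \<in> ?A" unfolding I_def by (rule imageE)
    note s = s12(2,3) g(2) trans[OF s12(1)[symmetric] g(1)]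
    obtain s' where s': "s' \<in> polys_in ?V" "\<forall>x. s x = peval x s'" using PF_peval[OF s(1)] by blast
    have "s' * ?H ^ j = g"
    proof (rule peval_inj)
      fix x
      have "peval x (s' * ?H ^ j) = (s * h ^ j) x" using s'(2) by (simp add: peval_simps peval_more h_def)
      also have "\<dots> = peval x g" unfolding s(4) ..
      finally show "peval x (s' * ?H ^ j) = peval x g" .
    qed
    then have 1: "s' * ?H ^ j \<in> ideal_A n F" using s(3) by simp
    have UA: "?U \<in> polys_in (all_vars n)" "?H \<in> polys_in (all_vars n)" using UV[OF J0(1)] embV Vall by blast+
    have 2: "?U ^ j - (?T * ?H) ^ j \<in> ideal_A n F" for j
    proof (induction j)
      case 0 then show ?case using Ai(2) by simp
    next
      case (Suc j)
      have "?U ^ Suc j - (?T * ?H) ^ Suc j = ?U ^ j * (?U - ?T * ?H) + (?T * ?H) * (?U ^ j - (?T * ?H) ^ j)"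
        by (simp add: algebra_simps)
      also have "\<dots> \<in> ideal_A n F"
        by (intro Ai(3) Ai(4) gU[OF J0(1)] Suc polys_in_power polys_in_closed(4) UA TV)
      finally show ?case .
    qed
    have "s' * ?U ^ j = s' * (?U ^ j - (?T * ?H) ^ j) + ?T ^ j * (s' * ?H ^ j)"
      by (simp add: algebra_simps power_mult_distrib)
    also have "\<dots> \<in> ideal_A n F"
      by (intro Ai(3) Ai(4) 1 2 polys_in_power TV) (use s'(1) Vall in blast)
    finally have "s' * ?U ^ j \<in> ?A" using s'(1) UV[OF J0(1)] by (simp add: polys_in_closed(4) polys_in_power)
    from pA[OF this] have "s ?p * u J0 ^ j = 0" using s'(2) by (simp add: peval_simps peval_more pt_def)
    then show False using s(2) J0(2) by simp
  qed
  have "\<exists>Q. is_prime (PF ?V) Q \<and> I \<subseteq> Q \<and> M \<inter> Q = {}"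
  proof (rule exists_prime_avoiding[OF subring_PF I _ _ _ MI])
    show "M \<subseteq> PF ?V" unfolding M_def using hV by (auto intro: PF_mult PF_ring(7))
    have "(1 :: 's evar pfun) = 1 * h ^ 0" by (simp only: power_0 mult_1_right)
    moreover have "(1 :: 's evar pfun) \<in> PF ?V" by (rule PF_ring(2))
    moreover have "(1 :: 's evar pfun) ?p \<noteq> 0" by simp
    ultimately show "1 \<in> M" unfolding M_def by blast
    fix a b assume "a \<in> M" "b \<in> M"
    then obtain s j r i where *: "a = s * h ^ j" "s \<in> PF ?V" "s ?p \<noteq> 0" "b = r * h ^ i" "r \<in> PF ?V" "r ?p \<noteq> 0"
      unfolding M_def by (elim CollectE exE conjE)
    have "a * b = (s * r) * h ^ (j + i)" unfolding *(1,4) power_add by (simp only: ac_simps)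
    moreover have "(s * r) ?p \<noteq> 0" using * by simp
    moreover have "s * r \<in> PF ?V" by (rule PF_mult[OF *(2,5)])
    ultimately show "a * b \<in> M" unfolding M_def by blast
  qed
  then obtain Q where Q: "is_prime (PF ?V) Q" "I \<subseteq> Q" "M \<inter> Q = {}" by blast
  have Qp: "f ?p = 0" if "f \<in> Q" for f
  proof (rule ccontr)
    assume "f ?p \<noteq> 0"
    moreover have "f \<in> PF ?V" by (rule idealD(1)[OF prime_ideal[OF Q(1)] that])
    moreover have "f = f * h ^ 0" by (simp only: power_0 mult_1_right)
    ultimately have "f \<in> M" unfolding M_def by blast
    then show False using that Q(3) by blast
  qed
  have hQ: "h \<notin> Q"
  proof
    assume hq: "h \<in> Q"
    have "h = 1 * h ^ 1" by (simp only: power_one_right mult_1_left)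
    moreover have "(1 :: 's evar pfun) \<in> PF ?V" by (rule PF_ring(2))
    moreover have "(1 :: 's evar pfun) ?p \<noteq> 0" by simp
    ultimately have "h \<in> M" unfolding M_def by blast
    then show False using hq Q(3) by blast
  qed
  have "\<exists>q :: nat \<Rightarrow> 's evar \<Rightarrow> complex. (\<forall>k. (\<forall>f\<in>Q. f (q k) = 0) \<and> h (q k) \<noteq> 0) \<and> (\<forall>v\<in>?V. (\<lambda>k. q k v) \<longlonglongrightarrow> ?p v)"
    by (rule prime_zero_set_dense[OF finite_elim_vars Q(1) _ hV hQ]) (rule Qp)
  then obtain q where
    q: "\<forall>k. (\<forall>f\<in>Q. f (q k) = 0) \<and> h (q k) \<noteq> 0" "\<forall>v\<in>?V. (\<lambda>k. q k v) \<longlonglongrightarrow> ?p v" by (elim exE conjE)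
  have qA: "peval (q k) g = 0" if "g \<in> ?A" for g k
  proof -
    have "(\<lambda>x. peval x g) \<in> Q" by (rule subsetD[OF Q(2)], unfold I_def, rule imageI, rule that)
    then show ?thesis by (rule bspec[OF conjunct1[OF spec[OF q(1)]]])
  qed
  define x where "x k i = q k (Xvar i)" for k i
  have px: "peval (q k) (emb f) = peval (x k) f" for k and f :: "'s mpoly" unfolding peval_emb x_def ..
  define t where "t k = q k (Uvar J0) / h (q k)" for k
  have "peval (x k) F = 0" for k
    unfolding px[symmetric] by (rule qA) (use A_ideal(2) embV in blast)
  moreover have "(\<lambda>k. x k i) \<longlonglongrightarrow> 0" for i
    using bspec[OF q(2), of "Xvar i"] unfolding x_def by (simp add: elim_vars_def pt_def)
  moreover have "(\<lambda>k. t k * peval (x k) (Delta n F J)) \<longlonglongrightarrow> u J" if J: "J \<in> Lam n" for J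
  proof -
    let ?D = "emb (Delta n F J)"
    have "pvar (Uvar J) * ?H - ?U * ?D = ?H * (pvar (Uvar J) - ?T * ?D) + (- ?D) * (?U - ?T * ?H)"
      by (simp add: algebra_simps)
    also have "\<dots> \<in> ideal_A n F"
      by (intro Ai(3) Ai(4) gU J J0(1) polys_in_closed(5)) (use embV Vall in blast)+
    finally have "pvar (Uvar J) * ?H - ?U * ?D \<in> ?A"
      using UV[OF J] UV[OF J0(1)] embV subringD(5,6)[OF SA[of ?V]] by blast
    from qA[OF this] have "t k * peval (x k) (Delta n F J) = q k (Uvar J)" for k
      using q(1) by (simp add: peval_more peval_simps px t_def h_def field_simps)
    then show ?thesis using bspec[OF q(2), of "Uvar J"] J by (simp add: elim_vars_def pt_def)
  qed
  ultimately show ?thesis by blast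
qed

end

section \<open>Taylor expansion\<close>

text \<open>Only the monomial one step above \<open>m\<close> in direction \<open>v\<close> contributes.\<close>
lemma lookup_pderiv1: "lkp (pderiv1 v f) m = of_nat (lkp m v + 1) * lkp f (m + sng v 1)"
proof -
  have key: "lkp (sng (k - sng v 1) (of_nat (lkp k v) * lkp f k)) m =
      (if k = m + sng v 1 then of_nat (lkp m v + 1) * lkp f (m + sng v 1) else 0)" for k
  proof (cases "k = m + sng v 1")
    case True
    then show ?thesis by (simp add: lookup_add)
  next
    case False
    show ?thesis
    proof (cases "lkp k v = 0")
      case True then show ?thesis using False by simp
    next
      case nz: False
      have "k - sng v 1 \<noteq> m"
      proof
        assume m: "k - sng v 1 = m"
        have "k = m + sng v 1" unfolding m[symmetric]
          by (rule poly_mapping_eqI) (use nz in \<open>auto simp: lookup_add lookup_minus lookup_single when_def\<close>)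
        then show False using False by simp
      qed
      then show ?thesis using False by (simp add: lookup_single)
    qed
  qed
  have "lkp (pderiv1 v f) m = (\<Sum>k\<in>kys f. if k = m + sng v 1 then of_nat (lkp m v + 1) * lkp f (m + sng v 1) else 0)"
    unfolding pderiv1_def lookup_sum key ..
  also have "\<dots> = of_nat (lkp m v + 1) * lkp f (m + sng v 1)" by (auto simp: in_keys_iff)
  finally show ?thesis .
qed

lemma pderiv1_add: "pderiv1 v (f + g) = pderiv1 v f + pderiv1 v g"
  by (rule poly_mapping_eqI) (simp add: lookup_pderiv1 lookup_add distrib_left)

lemma pderiv1_0 [simp]: "pderiv1 v 0 = 0"
  by (rule poly_mapping_eqI) (simp add: lookup_pderiv1)

lemma pderiv1_single: "pderiv1 v (sng m c) = sng (m - sng v 1) (of_nat (lkp m v) * c)"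
  unfolding pderiv1_def by (cases "c = 0") simp_all

lemma pderiv1_mult: "pderiv1 v (f * g) = pderiv1 v f * g + f * pderiv1 v g"
proof (induction f rule: mpoly_induct)
  case (single m c)
  show ?case
  proof (induction g rule: mpoly_induct)
    case (single m' c')
    have 1: "sng ((m - sng v 1) + m') (of_nat (lkp m v) * c * c') = sng (m + m' - sng v 1) (of_nat (lkp m v) * c * c')"
    proof (cases "lkp m v = 0")
      case False
      then have "(m - sng v 1) + m' = m + m' - sng v 1"
        by (intro poly_mapping_eqI) (auto simp: lookup_add lookup_minus lookup_single when_def)
      then show ?thesis by simp
    qed simp
    have 2: "sng (m + (m' - sng v 1)) (c * (of_nat (lkp m' v) * c')) = sng (m + m' - sng v 1) (c * (of_nat (lkp m' v) * c'))"
    proof (cases "lkp m' v = 0")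
      case False
      then have "m + (m' - sng v 1) = m + m' - sng v 1"
        by (intro poly_mapping_eqI) (auto simp: lookup_add lookup_minus lookup_single when_def)
      then show ?thesis by simp
    qed simp
    show ?case unfolding mult_single pderiv1_single 1 2 single_add[symmetric]
      by (rule arg_cong[of _ _ "sng (m + m' - sng v 1)"]) (simp add: lookup_add algebra_simps)
  next
    case (add f g) then show ?case by (simp add: pderiv1_add distrib_left)
  qed simp
next
  case (add f g) then show ?case by (simp add: pderiv1_add distrib_right)
qed simp

text \<open>The expansion of \<open>f\<close> at \<open>p\<close>: the polynomial \<open>f(x + p)\<close>,
  whose coefficients are the Taylor coefficients (\<open>taylor_coeff\<close>).\<close>
definition shift :: "('v \<Rightarrow> complex) \<Rightarrow> 'v mpoly \<Rightarrow> 'v mpoly" where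
  "shift p = psubst pconst (\<lambda>i. pvar i + pconst (p i))"

lemma shift_simps: "shift p (f + g) = shift p f + shift p g" "shift p (f * g) = shift p f * shift p g"
  "shift p (pconst c) = pconst c" "shift p (pvar i) = pvar i + pconst (p i)" "shift p 0 = 0" "shift p 1 = 1"
  unfolding shift_def by (rule complex_hom.psubst_add[OF pconst_hom] complex_hom.psubst_mult[OF pconst_hom]
    complex_hom.psubst_const[OF pconst_hom] complex_hom.psubst_var[OF pconst_hom] complex_hom.psubst_0[OF pconst_hom] complex_hom.psubst_1[OF pconst_hom])+

lemma shift_uminus: "shift p (- f) = - shift p f"
  using shift_simps(1)[of p f "- f"] by (simp add: shift_simps(5) eq_neg_iff_add_eq_0 add.commute)

lemma peval_zero_lookup: "peval (\<lambda>_. 0) g = lkp g 0"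
proof (induction g rule: mpoly_induct)
  case zero show ?case by (simp add: peval_simps)
next
  case (single m c)
  have "mev (\<lambda>_. 0) m = (if m = 0 then 1 else (0::complex))"
  proof (cases "m = 0")
    case False
    then obtain v where "lkp m v \<noteq> 0" by (metis lookup_zero poly_mapping_eqI)
    then have "(\<Prod>v\<in>kys m. (0::complex) ^ lkp m v) = 0" by (intro prod_zero) (auto simp: in_keys_iff)
    then show ?thesis using False by (simp add: mev_def)
  qed simp
  then show ?case unfolding peval_def complex_hom.psubst_single[OF id_hom] by (auto simp: lookup_single when_def)
next
  case (add f g) then show ?case by (simp add: peval_simps lookup_add)
qed

lemma peval_shift: "peval p f = lkp (shift p f) 0"
  unfolding peval_zero_lookup[symmetric] shift_def peval_psubst by (simp add: peval_simps)

text \<open>Both sides are derivations along the homomorphism \<open>shift p\<close> and agree on variables.\<close>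
lemma pderiv1_shift: "pderiv1 i (shift p f) = shift p (pderiv1 i f)"
proof (induction f rule: mpoly_induct_vars)
  case (const c)
  have "pderiv1 i (pconst c) = 0" for c by (simp add: pconst_def pderiv1_single)
  then show ?case by (simp add: shift_simps)
next
  case (var v)
  have 1: "pderiv1 i (pconst c) = 0" for c :: complex by (simp add: pconst_def pderiv1_single)
  have "pderiv1 i (pvar v) = pconst (if i = v then 1 else 0)"
    by (simp add: pvar_def pderiv1_single pconst_def lookup_single when_def)
  then show ?case by (simp add: shift_simps pderiv1_add 1)
next
  case (add f g) then show ?case by (simp add: shift_simps pderiv1_add)
next
  case (mult f g) then show ?case by (simp add: shift_simps pderiv1_mult pderiv1_add)
qed

lemma pderiv1_pow_shift: "(pderiv1 i ^^ k) (shift p f) = shift p ((pderiv1 i ^^ k) f)"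
  by (induction k) (simp_all add: pderiv1_shift)

lemma mderiv_shift: "mderiv \<alpha> (shift p f) = shift p (mderiv \<alpha> f)"
proof -
  have "foldr (\<lambda>i. pderiv1 i ^^ lkp \<alpha> i) is (shift p f) = shift p (foldr (\<lambda>i. pderiv1 i ^^ lkp \<alpha> i) is f)" for "is"
    by (induction "is") (simp_all add: pderiv1_pow_shift)
  then show ?thesis unfolding mderiv_def by blast
qed

lemma lookup_pderiv1_pow: "lkp m i = 0 \<Longrightarrow> lkp ((pderiv1 i ^^ k) f) m = fact k * lkp f (m + sng i k)"
proof -
  have "lkp ((pderiv1 i ^^ k) f) m * fact (lkp m i) = fact (lkp m i + k) * lkp f (m + sng i k)" for m
  proof (induction k arbitrary: m)
    case 0 show ?case by simp
  next
    case (Suc k)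
    have e: "m + sng i 1 + sng i k = m + sng i (Suc k)" by (simp add: add.assoc single_add[symmetric])
    have "lkp ((pderiv1 i ^^ Suc k) f) m * fact (lkp m i) = lkp ((pderiv1 i ^^ k) f) (m + sng i 1) * fact (lkp (m + sng i 1) i)"
      by (simp add: lookup_pderiv1 lookup_add algebra_simps)
    also have "\<dots> = fact (lkp (m + sng i 1) i + k) * lkp f (m + sng i 1 + sng i k)" by (rule Suc.IH)
    finally show ?case unfolding e by (simp add: lookup_add)
  qed
  from this[of m] show "lkp m i = 0 \<Longrightarrow> ?thesis" by simp
qed

text \<open>Each variable is differentiated separately, and the condition \<open>lkp m i = 0\<close> for the
  variables still to come keeps the factors equal to factorials.\<close>
lemma lookup_mderiv_0: "lkp (mderiv \<alpha> f) 0 = of_nat (mfact \<alpha>) * lkp f \<alpha>"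
proof -
  have "distinct is \<Longrightarrow> (\<And>i. i \<in> set is \<Longrightarrow> lkp m i = 0) \<Longrightarrow>
      lkp (foldr (\<lambda>i. pderiv1 i ^^ lkp \<alpha> i) is f) m = (\<Prod>i\<in>set is. fact (lkp \<alpha> i)) * lkp f (m + (\<Sum>i\<in>set is. sng i (lkp \<alpha> i)))" for "is" m
  proof (induction "is" arbitrary: m)
    case (Cons i "is")
    have "lkp (foldr (\<lambda>i. pderiv1 i ^^ lkp \<alpha> i) (i # is) f) m
        = fact (lkp \<alpha> i) * lkp (foldr (\<lambda>i. pderiv1 i ^^ lkp \<alpha> i) is f) (m + sng i (lkp \<alpha> i))"
      using Cons.prems by (simp add: lookup_pderiv1_pow)
    also have "lkp (foldr (\<lambda>i. pderiv1 i ^^ lkp \<alpha> i) is f) (m + sng i (lkp \<alpha> i))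
        = (\<Prod>i\<in>set is. fact (lkp \<alpha> i)) * lkp f (m + sng i (lkp \<alpha> i) + (\<Sum>i\<in>set is. sng i (lkp \<alpha> i)))"
    proof (rule Cons.IH)
      show "distinct is" using Cons.prems by simp
      fix j assume "j \<in> set is"
      then show "lkp (m + sng i (lkp \<alpha> i)) j = 0" using Cons.prems by (auto simp: lookup_add lookup_single when_def)
    qed
    finally show ?case using Cons.prems(1) by (simp add: add.assoc)
  qed simp
  from this[of "sorted_list_of_set UNIV" 0]
  have "lkp (mderiv \<alpha> f) 0 = (\<Prod>i\<in>UNIV. fact (lkp \<alpha> i)) * lkp f (\<Sum>i\<in>UNIV. sng i (lkp \<alpha> i))" by (simp add: mderiv_def)
  moreover have "(\<Sum>i\<in>UNIV. sng i (lkp \<alpha> i)) = \<alpha>"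
    by (rule poly_mapping_eqI) (simp add: lookup_sum lookup_single when_def)
  moreover have "(\<Prod>i\<in>UNIV. fact (lkp \<alpha> i)) = (of_nat (mfact \<alpha>) :: complex)" by (simp add: mfact_def)
  ultimately show ?thesis by simp
qed

lemma mfact_nz: "mfact \<alpha> \<noteq> 0" by (simp add: mfact_def)

text \<open>Translation commutes with differentiation, so it suffices to look at the origin.\<close>
lemma taylor_coeff: "peval p (mderiv \<alpha> f) / of_nat (mfact \<alpha>) = lkp (shift p f) \<alpha>"
  unfolding peval_shift mderiv_shift[symmetric] lookup_mderiv_0 by (simp add: mfact_nz)

lemma mle_add: "mle \<beta> \<alpha> \<Longrightarrow> \<beta> + (\<alpha> - \<beta>) = \<alpha>"
  unfolding mle_def by (intro poly_mapping_eqI) (simp add: lookup_add lookup_minus)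

lemma mdeg_add: "mdeg (\<alpha> + \<beta>) = mdeg \<alpha> + mdeg \<beta>"
  by (simp add: mdeg_def lookup_add sum.distrib)

lemma mdeg_0 [simp]: "mdeg 0 = 0" by (simp add: mdeg_def)
lemma mdeg_single [simp]: "mdeg (sng i k) = k" by (simp add: mdeg_def lookup_single when_def)
lemma mdeg_eq_0: "mdeg \<alpha> = 0 \<longleftrightarrow> \<alpha> = 0"
  by (auto simp: mdeg_def intro: poly_mapping_eqI)

text \<open>The factorials cancel: $\beta!\binom{\alpha}{\beta}/\alpha! = 1/(\alpha-\beta)!$.\<close>
lemma peval_jac_row: "peval p (jac_row F \<beta> \<alpha>) = (if mle \<beta> \<alpha> then lkp (shift p F) (\<alpha> - \<beta>) else 0)"
proof (cases "mle \<beta> \<alpha>")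
  case True
  have "fact (lkp \<alpha> i) = fact (lkp \<beta> i) * fact (lkp (\<alpha> - \<beta>) i) * (lkp \<alpha> i choose lkp \<beta> i)" for i
    using binomial_fact_lemma[of "lkp \<beta> i" "lkp \<alpha> i"] True by (simp add: mle_def lookup_minus)
  then have "mfact \<alpha> = mfact \<beta> * mfact (\<alpha> - \<beta>) * mbinom \<alpha> \<beta>"
    unfolding mfact_def mbinom_def prod.distrib[symmetric] by (intro prod.cong refl)
  moreover have "mbinom \<alpha> \<beta> \<noteq> 0" using True by (simp add: mbinom_def mle_def not_less)
  ultimately have e: "of_nat (mfact \<beta>) * (of_nat (mbinom \<alpha> \<beta>) / of_nat (mfact \<alpha>)) = (1 / of_nat (mfact (\<alpha> - \<beta>)) :: complex)"
    using mfact_nz[of \<beta>] mfact_nz[of "\<alpha> - \<beta>"] by (simp add: field_simps)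
  have "of_nat (mfact \<beta>) * (of_nat (mbinom \<alpha> \<beta>) / of_nat (mfact \<alpha>) * peval p (mderiv (\<alpha> - \<beta>) F)) =
      peval p (mderiv (\<alpha> - \<beta>) F) / of_nat (mfact (\<alpha> - \<beta>))" unfolding mult.assoc[symmetric] e by simp
  then show ?thesis unfolding taylor_coeff jac_row_def using True by (simp only: peval_simps if_True)
qed (simp add: jac_row_def peval_simps)

text \<open>Compared with \<open>peval_jac_row\<close>: the row \<open>\<beta>\<close> of the Jacobian
  matrix lists the Taylor coefficients of $(x-p)^\beta F$.\<close>
lemma lookup_single_mult: "lkp (sng \<beta> 1 * g) \<alpha> = (if mle \<beta> \<alpha> then lkp g (\<alpha> - \<beta>) else (0::complex))"
proof (induction g rule: mpoly_induct)
  case zero show ?case by simp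
next
  case (single m c)
  have "\<beta> + m = \<alpha> \<longleftrightarrow> mle \<beta> \<alpha> \<and> m = \<alpha> - \<beta>"
  proof
    assume "\<beta> + m = \<alpha>" then show "mle \<beta> \<alpha> \<and> m = \<alpha> - \<beta>" by (auto simp: mle_def lookup_add)
  qed (use mle_add in auto)
  then show ?case by (simp add: mult_single lookup_single when_def)
next
  case (add f g) then show ?case by (simp add: distrib_left lookup_add)
qed

section \<open>The local ring of the hypersurface at a point\<close>

locale hypersurface_point =
  fixes F :: "'s::{finite,linorder} mpoly" and p :: "(complex, 's) Finite_Cartesian_Product.vec"
  assumes on_hypersurface: "peval (vec_nth p) F = 0"
begin

abbreviation ev :: "'s mpoly \<Rightarrow> complex" where "ev \<equiv> peval (vec_nth p)"
abbreviation cls :: "'s mpoly \<Rightarrow> 's mpoly set" where "cls \<equiv> coord_class F"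
abbreviation frac :: "'s mpoly \<Rightarrow> 's mpoly \<Rightarrow> 's loc_elt" where
  "frac a s \<equiv> loc_frac (coord_ring F) (loc_set F p) (cls a) (cls s)"
abbreviation Rp :: "'s loc_elt ring" where "Rp \<equiv> local_ring F p"

lemma ev_uminus: "ev (- f) = - ev f"
  using peval_simps(3)[of "vec_nth p" f "- f"] by (simp add: peval_simps eq_neg_iff_add_eq_0 add.commute)
lemma ev_diff: "ev (f - g) = ev f - ev g"
  using peval_simps(3)[of "vec_nth p" f "- g"] by (simp add: ev_uminus)

lemma ideal_F: "ideal (Idl\<^bsub>poly_ring UNIV\<^esub> {F}) (poly_ring UNIV)"
  by (rule ring.genideal_ideal[OF cring.axioms(1)[OF cring_poly_ring]]) simp

lemma in_ideal_F: "f \<in> Idl\<^bsub>poly_ring UNIV\<^esub> {F} \<longleftrightarrow> F dvd f"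
proof -
  have "Idl\<^bsub>poly_ring UNIV\<^esub> {F} = PIdl\<^bsub>poly_ring UNIV\<^esub> F"
    by (rule cring.cgenideal_eq_genideal[OF cring_poly_ring, symmetric]) simp
  then show ?thesis by (auto simp: cgenideal_def dvd_def mult.commute)
qed

lemma cls_eq: "cls f = cls g \<longleftrightarrow> F dvd f - g"
proof -
  interpret cring "poly_ring (UNIV :: 's set)" by (rule cring_poly_ring)
  have "f \<ominus>\<^bsub>poly_ring UNIV\<^esub> g = f - g" by (simp add: minus_eq a_inv_poly_ring)
  then show ?thesis unfolding coord_class_def in_ideal_F[symmetric]
    using quotient_eq_iff_same_a_r_cos[OF ideal_F, of f g] by simp
qed

lemma coord_ring_simps: "carrier (coord_ring F) = range cls" "cls f \<otimes>\<^bsub>coord_ring F\<^esub> cls g = cls (f * g)"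
  "cls f \<oplus>\<^bsub>coord_ring F\<^esub> cls g = cls (f + g)" "\<one>\<^bsub>coord_ring F\<^esub> = cls 1" "\<zero>\<^bsub>coord_ring F\<^esub> = cls 0"
proof -
  interpret ideal "Idl\<^bsub>poly_ring UNIV\<^esub> {F}" "poly_ring (UNIV :: 's set)" by (rule ideal_F)
  show "carrier (coord_ring F) = range cls" unfolding coord_ring_def FactRing_def coord_class_def by (auto simp: A_RCOSETS_def')
  show "cls f \<otimes>\<^bsub>coord_ring F\<^esub> cls g = cls (f * g)" unfolding coord_ring_def FactRing_def coord_class_def
    using rcoset_mult_add[of f g] by simp
  show "cls f \<oplus>\<^bsub>coord_ring F\<^esub> cls g = cls (f + g)" unfolding coord_ring_def FactRing_def coord_class_def
    using a_rcos_sum[of f g] by simp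
  show "\<one>\<^bsub>coord_ring F\<^esub> = cls 1" unfolding coord_ring_def FactRing_def coord_class_def by simp
  have "0 \<in> Idl\<^bsub>poly_ring UNIV\<^esub> {F}" by (simp add: in_ideal_F)
  then show "\<zero>\<^bsub>coord_ring F\<^esub> = cls 0" unfolding coord_ring_def FactRing_def coord_class_def
    using a_rcos_zero[OF ideal_F] by simp
qed

lemma coord_ring_diff: "cls f \<ominus>\<^bsub>coord_ring F\<^esub> cls g = cls (f - g)"
proof -
  interpret ring "coord_ring F" unfolding coord_ring_def by (rule ideal.quotient_is_ring[OF ideal_F])
  have "\<ominus>\<^bsub>coord_ring F\<^esub> cls g = cls (- g)"
    by (rule minus_equality) (simp_all add: coord_ring_simps)
  then show ?thesis unfolding a_minus_def by (simp add: coord_ring_simps)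
qed

lemma ev_dvd: "F dvd f \<Longrightarrow> ev f = 0"
  using on_hypersurface by (auto simp: dvd_def peval_simps)

lemma in_point_classes: "cls g \<in> cls ` point_ideal p \<longleftrightarrow> ev g = 0"
proof
  assume "cls g \<in> cls ` point_ideal p"
  then obtain h where "ev h = 0" "cls g = cls h" by (auto simp: point_ideal_def)
  then have "ev (g - h) = 0" using ev_dvd cls_eq by blast
  then show "ev g = 0" using \<open>ev h = 0\<close> by (simp add: ev_diff)
qed (auto simp: point_ideal_def)

lemma in_loc_set: "x \<in> loc_set F p \<longleftrightarrow> (\<exists>s. x = cls s \<and> ev s \<noteq> 0)"
  unfolding loc_set_def coord_ring_simps(1) using in_point_classes by blast

lemma cls_in_loc_set: "cls s \<in> loc_set F p \<longleftrightarrow> ev s \<noteq> 0"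
  unfolding loc_set_def coord_ring_simps(1) using in_point_classes by blast

text \<open>All computations in the localization reduce to divisibility by \<open>F\<close> of polynomials.\<close>
lemma loc_rel_iff: "((cls a, cls s), (cls b, cls t)) \<in> loc_rel (coord_ring F) (loc_set F p) \<longleftrightarrow>
   ev s \<noteq> 0 \<and> ev t \<noteq> 0 \<and> (\<exists>u. ev u \<noteq> 0 \<and> F dvd u * (a * t - b * s))"
proof -
  have "(\<exists>u\<in>loc_set F p. u \<otimes>\<^bsub>coord_ring F\<^esub> (cls a \<otimes>\<^bsub>coord_ring F\<^esub> cls t \<ominus>\<^bsub>coord_ring F\<^esub> cls b \<otimes>\<^bsub>coord_ring F\<^esub> cls s) = \<zero>\<^bsub>coord_ring F\<^esub>)
    \<longleftrightarrow> (\<exists>u. ev u \<noteq> 0 \<and> cls (u * (a * t - b * s)) = cls 0)" (is "?l \<longleftrightarrow> ?r")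
  proof
    assume ?l
    then obtain u where u: "u \<in> loc_set F p" "u \<otimes>\<^bsub>coord_ring F\<^esub> (cls a \<otimes>\<^bsub>coord_ring F\<^esub> cls t \<ominus>\<^bsub>coord_ring F\<^esub> cls b \<otimes>\<^bsub>coord_ring F\<^esub> cls s) = \<zero>\<^bsub>coord_ring F\<^esub>" by blast
    obtain v where v: "u = cls v" "ev v \<noteq> 0" using u(1) unfolding in_loc_set by blast
    show ?r using u(2) v(2) unfolding v(1) coord_ring_simps coord_ring_diff by blast
  next
    assume ?r
    then obtain v where v: "ev v \<noteq> 0" "cls (v * (a * t - b * s)) = cls 0" by blast
    show ?l by (rule bexI[of _ "cls v"]) (use v in \<open>simp_all only: coord_ring_simps coord_ring_diff cls_in_loc_set not_False_eq_True\<close>)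
  qed
  then show ?thesis unfolding loc_rel_def by (simp add: cls_in_loc_set coord_ring_simps(1) cls_eq rangeI)
qed

lemma equiv_loc_rel: "equiv (carrier (coord_ring F) \<times> loc_set F p) (loc_rel (coord_ring F) (loc_set F p))"
proof (rule equivI)
  let ?r = "loc_rel (coord_ring F) (loc_set F p)"
  show sub: "?r \<subseteq> (carrier (coord_ring F) \<times> loc_set F p) \<times> (carrier (coord_ring F) \<times> loc_set F p)"
    by (auto simp: loc_rel_def)
  show "refl_on (carrier (coord_ring F) \<times> loc_set F p) ?r"
  proof (rule refl_onI)
    fix x assume "x \<in> carrier (coord_ring F) \<times> loc_set F p"
    then obtain a s where x: "x = (cls a, cls s)" "ev s \<noteq> 0" by (auto simp: coord_ring_simps(1) in_loc_set)
    show "(x, x) \<in> ?r" unfolding x(1) loc_rel_iff using x(2) by (auto intro!: exI[of _ 1] simp: peval_simps)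
  qed
  show "sym ?r"
  proof (rule symI)
    fix x y assume xy: "(x, y) \<in> ?r"
    then have "x \<in> carrier (coord_ring F) \<times> loc_set F p" "y \<in> carrier (coord_ring F) \<times> loc_set F p" using sub by auto
    then obtain a s b t where e: "x = (cls a, cls s)" "y = (cls b, cls t)" by (auto simp: coord_ring_simps(1) in_loc_set)
    obtain u where u: "ev s \<noteq> 0" "ev t \<noteq> 0" "ev u \<noteq> 0" "F dvd u * (a * t - b * s)" using xy unfolding e loc_rel_iff by blast
    have "u * (b * s - a * t) = - (u * (a * t - b * s))" by (simp add: algebra_simps)
    then have "F dvd u * (b * s - a * t)" using u(4) by (simp only: dvd_minus_iff)
    then show "(y, x) \<in> ?r" unfolding e loc_rel_iff using u by blast
  qed
  show "trans ?r"
  proof (rule transI)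
    fix x y z assume xy: "(x, y) \<in> ?r" and yz: "(y, z) \<in> ?r"
    then have "x \<in> carrier (coord_ring F) \<times> loc_set F p" "y \<in> carrier (coord_ring F) \<times> loc_set F p" "z \<in> carrier (coord_ring F) \<times> loc_set F p" using sub by auto
    then obtain a s b t c w where e: "x = (cls a, cls s)" "y = (cls b, cls t)" "z = (cls c, cls w)" by (auto simp: coord_ring_simps(1) in_loc_set)
    obtain u where u: "ev s \<noteq> 0" "ev t \<noteq> 0" "ev u \<noteq> 0" "F dvd u * (a * t - b * s)" using xy unfolding e loc_rel_iff by blast
    obtain v where v: "ev w \<noteq> 0" "ev v \<noteq> 0" "F dvd v * (b * w - c * t)" using yz unfolding e loc_rel_iff by blast
    have "(t * u * v) * (a * w - c * s) = (v * w) * (u * (a * t - b * s)) + (u * s) * (v * (b * w - c * t))"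
      by (simp add: algebra_simps)
    then have "F dvd (t * u * v) * (a * w - c * s)" using u(4) v(3) by (simp only: dvd_add dvd_mult)
    moreover have "ev (t * u * v) \<noteq> 0" using u v by (simp add: peval_simps)
    ultimately show "(x, z) \<in> ?r" unfolding e loc_rel_iff using u v by blast
  qed
qed

lemma frac_eq_iff: assumes "ev s \<noteq> 0" "ev t \<noteq> 0"
  shows "frac a s = frac b t \<longleftrightarrow> (\<exists>u. ev u \<noteq> 0 \<and> F dvd u * (a * t - b * s))"
proof -
  have "frac a s = frac b t \<longleftrightarrow> ((cls a, cls s), (cls b, cls t)) \<in> loc_rel (coord_ring F) (loc_set F p)"
    unfolding loc_frac_def by (rule eq_equiv_class_iff[OF equiv_loc_rel]) (use assms in \<open>auto simp: cls_in_loc_set coord_ring_simps(1)\<close>)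
  then show ?thesis unfolding loc_rel_iff using assms by simp
qed

lemma frac_eqI: assumes "ev s \<noteq> 0" "ev t \<noteq> 0" "a * t = b * s" shows "frac a s = frac b t"
  unfolding frac_eq_iff[OF assms(1,2)] by (rule exI[of _ 1]) (simp add: peval_simps assms(3))

lemma in_fracE: assumes "x \<in> frac a s" "ev s \<noteq> 0"
  obtains a' s' u where "x = (cls a', cls s')" "ev s' \<noteq> 0" "ev u \<noteq> 0" "F dvd u * (a * s' - a' * s)"
proof -
  have r: "((cls a, cls s), x) \<in> loc_rel (coord_ring F) (loc_set F p)" using assms(1) by (simp add: loc_frac_def)
  then have "x \<in> carrier (coord_ring F) \<times> loc_set F p" by (auto simp: loc_rel_def)
  then obtain a' s' where e: "x = (cls a', cls s')" by (auto simp: coord_ring_simps(1) in_loc_set)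
  show thesis using r unfolding e loc_rel_iff using that[OF e] by blast
qed

lemma frac_self: "ev s \<noteq> 0 \<Longrightarrow> (cls a, cls s) \<in> frac a s"
  unfolding loc_frac_def Image_singleton_iff loc_rel_iff by (auto intro!: exI[of _ 1] simp: peval_simps)

lemma Rp_carrier: "x \<in> carrier Rp \<longleftrightarrow> (\<exists>a s. ev s \<noteq> 0 \<and> x = frac a s)"
proof -
  have c: "carrier Rp = (carrier (coord_ring F) \<times> loc_set F p) // loc_rel (coord_ring F) (loc_set F p)"
    by (simp add: local_ring_def localization_def)
  show ?thesis
  proof
    assume "x \<in> carrier Rp"
    then obtain y where y: "y \<in> carrier (coord_ring F) \<times> loc_set F p" "x = loc_rel (coord_ring F) (loc_set F p) `` {y}"
      unfolding c by (rule quotientE)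
    then obtain a s where "y = (cls a, cls s)" "ev s \<noteq> 0" by (auto simp: coord_ring_simps(1) in_loc_set)
    then show "\<exists>a s. ev s \<noteq> 0 \<and> x = frac a s" unfolding y(2) loc_frac_def by blast
  next
    assume "\<exists>a s. ev s \<noteq> 0 \<and> x = frac a s"
    then obtain a s where "ev s \<noteq> 0" "x = frac a s" by blast
    then show "x \<in> carrier Rp" unfolding c
      by (simp add: loc_frac_def) (rule quotientI, simp add: cls_in_loc_set coord_ring_simps(1) rangeI)
  qed
qed

text \<open>The operations of the localization are unions over representatives; they are well defined when
  all representatives give the same class.\<close>
lemma constant_double_UN:
  assumes "x \<noteq> {}" "y \<noteq> {}" "\<And>a s b t. (a, s) \<in> x \<Longrightarrow> (b, t) \<in> y \<Longrightarrow> f a s b t = c"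
  shows "(\<Union>(a, s)\<in>x. \<Union>(b, t)\<in>y. f a s b t) = c"
proof -
  have inner: "(\<Union>(b, t)\<in>y. f a s b t) = c" if as: "(a, s) \<in> x" for a s
  proof -
    have "(\<Union>z\<in>y. case z of (b, t) \<Rightarrow> f a s b t) = (\<Union>z\<in>y. c)"
      by (rule SUP_cong[OF refl]) (clarsimp simp: assms(3)[OF as])
    then show ?thesis using assms(2) by simp
  qed
  have "(\<Union>z\<in>x. case z of (a, s) \<Rightarrow> \<Union>(b, t)\<in>y. f a s b t) = (\<Union>z\<in>x. c)"
    by (rule SUP_cong[OF refl]) (clarsimp simp: inner)
  then show ?thesis using assms(1) by simp
qed

lemma Rp_mult: assumes "ev s \<noteq> 0" "ev t \<noteq> 0" shows "frac a s \<otimes>\<^bsub>Rp\<^esub> frac b t = frac (a * b) (s * t)"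
proof -
  have "(\<Union>(a, s)\<in>frac a s. \<Union>(b, t)\<in>frac b t. loc_frac (coord_ring F) (loc_set F p) (a \<otimes>\<^bsub>coord_ring F\<^esub> b) (s \<otimes>\<^bsub>coord_ring F\<^esub> t)) = frac (a * b) (s * t)"
  proof (rule constant_double_UN)
    show "frac a s \<noteq> {}" "frac b t \<noteq> {}" using frac_self assms by blast+
    fix x1 x2 y1 y2 assume "(x1, x2) \<in> frac a s" "(y1, y2) \<in> frac b t"
    then obtain a' s' u b' t' v where e: "x1 = cls a'" "x2 = cls s'" "y1 = cls b'" "y2 = cls t'"
      and u: "ev s' \<noteq> 0" "ev u \<noteq> 0" "F dvd u * (a * s' - a' * s)" and v: "ev t' \<noteq> 0" "ev v \<noteq> 0" "F dvd v * (b * t' - b' * t)"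
      using assms by (elim in_fracE) auto
    have st: "ev (s * t) \<noteq> 0" "ev (s' * t') \<noteq> 0" "ev (u * v) \<noteq> 0" using assms u v by (simp_all add: peval_simps)
    have "(u * v) * ((a * b) * (s' * t') - (a' * b') * (s * t)) = (v * b * t') * (u * (a * s' - a' * s)) + (u * a' * s) * (v * (b * t' - b' * t))"
      by (simp add: algebra_simps)
    then have "F dvd (u * v) * ((a * b) * (s' * t') - (a' * b') * (s * t))" using u(3) v(3) by (simp only: dvd_add dvd_mult)
    then have "frac (a * b) (s * t) = frac (a' * b') (s' * t')" unfolding frac_eq_iff[OF st(1,2)] using st(3) by blast
    then show "loc_frac (coord_ring F) (loc_set F p) (x1 \<otimes>\<^bsub>coord_ring F\<^esub> y1) (x2 \<otimes>\<^bsub>coord_ring F\<^esub> y2) = frac (a * b) (s * t)"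
      unfolding e coord_ring_simps by (rule sym)
  qed
  then show ?thesis unfolding local_ring_def localization_def by simp
qed

lemma Rp_add: assumes "ev s \<noteq> 0" "ev t \<noteq> 0" shows "frac a s \<oplus>\<^bsub>Rp\<^esub> frac b t = frac (a * t + b * s) (s * t)"
proof -
  have "(\<Union>(a, s)\<in>frac a s. \<Union>(b, t)\<in>frac b t. loc_frac (coord_ring F) (loc_set F p) (a \<otimes>\<^bsub>coord_ring F\<^esub> t \<oplus>\<^bsub>coord_ring F\<^esub> b \<otimes>\<^bsub>coord_ring F\<^esub> s) (s \<otimes>\<^bsub>coord_ring F\<^esub> t)) = frac (a * t + b * s) (s * t)"
  proof (rule constant_double_UN)
    show "frac a s \<noteq> {}" "frac b t \<noteq> {}" using frac_self assms by blast+
    fix x1 x2 y1 y2 assume "(x1, x2) \<in> frac a s" "(y1, y2) \<in> frac b t"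
    then obtain a' s' u b' t' v where e: "x1 = cls a'" "x2 = cls s'" "y1 = cls b'" "y2 = cls t'"
      and u: "ev s' \<noteq> 0" "ev u \<noteq> 0" "F dvd u * (a * s' - a' * s)" and v: "ev t' \<noteq> 0" "ev v \<noteq> 0" "F dvd v * (b * t' - b' * t)"
      using assms by (elim in_fracE) auto
    have st: "ev (s * t) \<noteq> 0" "ev (s' * t') \<noteq> 0" "ev (u * v) \<noteq> 0" using assms u v by (simp_all add: peval_simps)
    have "(u * v) * ((a * t + b * s) * (s' * t') - (a' * t' + b' * s') * (s * t)) = (v * t * t') * (u * (a * s' - a' * s)) + (u * s * s') * (v * (b * t' - b' * t))"
      by (simp add: algebra_simps)
    then have "F dvd (u * v) * ((a * t + b * s) * (s' * t') - (a' * t' + b' * s') * (s * t))" using u(3) v(3) by (simp only: dvd_add dvd_mult)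
    then have "frac (a * t + b * s) (s * t) = frac (a' * t' + b' * s') (s' * t')" unfolding frac_eq_iff[OF st(1,2)] using st(3) by blast
    then show "loc_frac (coord_ring F) (loc_set F p) (x1 \<otimes>\<^bsub>coord_ring F\<^esub> y2 \<oplus>\<^bsub>coord_ring F\<^esub> y1 \<otimes>\<^bsub>coord_ring F\<^esub> x2) (x2 \<otimes>\<^bsub>coord_ring F\<^esub> y2) = frac (a * t + b * s) (s * t)"
      unfolding e coord_ring_simps by (rule sym)
  qed
  then show ?thesis unfolding local_ring_def localization_def by simp
qed

lemma Rp_one: "\<one>\<^bsub>Rp\<^esub> = frac 1 1" and Rp_zero: "\<zero>\<^bsub>Rp\<^esub> = frac 0 1"
  unfolding local_ring_def localization_def by (simp_all add: coord_ring_simps)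

lemma ev_1: "ev 1 \<noteq> 0" by (simp add: peval_simps)
lemma ev_mult_nz: "ev s \<noteq> 0 \<Longrightarrow> ev t \<noteq> 0 \<Longrightarrow> ev (s * t) \<noteq> 0" by (simp add: peval_simps)

lemma cring_Rp: "cring Rp"
proof (rule cringI)
  note simps = Rp_add Rp_mult Rp_one Rp_zero ev_1 ev_mult_nz
  show "abelian_group Rp"
  proof (rule abelian_groupI; (unfold Rp_carrier Rp_zero)?; (elim exE conjE)?)
    fix x y a s b t assume e: "ev s \<noteq> 0" "x = frac a s" "ev t \<noteq> 0" "y = frac b t"
    show "\<exists>c r. ev r \<noteq> 0 \<and> x \<oplus>\<^bsub>Rp\<^esub> y = frac c r"
      unfolding e(2,4) Rp_add[OF e(1,3)] using ev_mult_nz[OF e(1,3)] by blast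
    show "x \<oplus>\<^bsub>Rp\<^esub> y = y \<oplus>\<^bsub>Rp\<^esub> x"
      using e by (simp add: simps) (rule frac_eqI, simp_all add: ev_mult_nz algebra_simps)
    fix z c r assume z: "ev r \<noteq> 0" "z = frac c r"
    show "x \<oplus>\<^bsub>Rp\<^esub> y \<oplus>\<^bsub>Rp\<^esub> z = x \<oplus>\<^bsub>Rp\<^esub> (y \<oplus>\<^bsub>Rp\<^esub> z)"
      using e z by (simp add: simps) (rule frac_eqI, simp_all add: ev_mult_nz algebra_simps)
  next
    show "\<exists>a s. ev s \<noteq> 0 \<and> frac 0 1 = frac a s" using ev_1 by blast
  next
    fix x a s assume e: "ev s \<noteq> 0" "x = frac a s"
    show "frac 0 1 \<oplus>\<^bsub>Rp\<^esub> x = x"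
      using e by (simp add: simps)
    show "\<exists>y\<in>carrier Rp. y \<oplus>\<^bsub>Rp\<^esub> x = frac 0 1"
    proof (rule bexI[of _ "frac (- a) s"])
      show "frac (- a) s \<oplus>\<^bsub>Rp\<^esub> x = frac 0 1" using e by (simp add: simps) (rule frac_eqI, simp_all add: ev_mult_nz ev_1)
      show "frac (- a) s \<in> carrier Rp" using e unfolding Rp_carrier by blast
    qed
  qed
  show "Group.comm_monoid Rp"
  proof (rule comm_monoidI; (unfold Rp_carrier Rp_one)?; (elim exE conjE)?)
    fix x y a s b t assume e: "ev s \<noteq> 0" "x = frac a s" "ev t \<noteq> 0" "y = frac b t"
    show "\<exists>c r. ev r \<noteq> 0 \<and> x \<otimes>\<^bsub>Rp\<^esub> y = frac c r"
      unfolding e(2,4) Rp_mult[OF e(1,3)] using ev_mult_nz[OF e(1,3)] by blast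
    show "x \<otimes>\<^bsub>Rp\<^esub> y = y \<otimes>\<^bsub>Rp\<^esub> x"
      using e by (simp add: simps mult.commute)
    fix z c r assume z: "ev r \<noteq> 0" "z = frac c r"
    show "x \<otimes>\<^bsub>Rp\<^esub> y \<otimes>\<^bsub>Rp\<^esub> z = x \<otimes>\<^bsub>Rp\<^esub> (y \<otimes>\<^bsub>Rp\<^esub> z)"
      using e z by (simp add: simps mult.assoc)
  next
    show "\<exists>a s. ev s \<noteq> 0 \<and> frac 1 1 = frac a s" using ev_1 by blast
  next
    fix x a s assume e: "ev s \<noteq> 0" "x = frac a s"
    show "frac 1 1 \<otimes>\<^bsub>Rp\<^esub> x = x" using e by (simp add: simps)
  qed
  fix x y z assume "x \<in> carrier Rp" "y \<in> carrier Rp" "z \<in> carrier Rp"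
  then obtain a s b t c r where e: "ev s \<noteq> 0" "x = frac a s" "ev t \<noteq> 0" "y = frac b t" "ev r \<noteq> 0" "z = frac c r"
    unfolding Rp_carrier by blast
  show "(x \<oplus>\<^bsub>Rp\<^esub> y) \<otimes>\<^bsub>Rp\<^esub> z = x \<otimes>\<^bsub>Rp\<^esub> z \<oplus>\<^bsub>Rp\<^esub> y \<otimes>\<^bsub>Rp\<^esub> z"
    using e by (simp add: simps) (rule frac_eqI, simp_all add: ev_mult_nz algebra_simps)
qed

lemma Rp_uminus: assumes "ev s \<noteq> 0" shows "\<ominus>\<^bsub>Rp\<^esub> frac a s = frac (- a) s"
proof -
  interpret cring Rp by (rule cring_Rp)
  show ?thesis
  proof (rule minus_equality)
    show "frac (- a) s \<oplus>\<^bsub>Rp\<^esub> frac a s = \<zero>\<^bsub>Rp\<^esub>" unfolding Rp_zero Rp_add[OF assms assms]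
      by (rule frac_eqI) (simp_all add: assms ev_mult_nz ev_1)
  qed (use assms Rp_carrier in blast)+
qed

lemma Rp_diff: assumes "ev s \<noteq> 0" "ev t \<noteq> 0" shows "frac a s \<ominus>\<^bsub>Rp\<^esub> frac b t = frac (a * t - b * s) (s * t)"
  unfolding a_minus_def Rp_uminus[OF assms(2)] Rp_add[OF assms] by simp

lemma in_max_ideal: "x \<in> max_ideal F p \<longleftrightarrow> (\<exists>a s. ev a = 0 \<and> ev s \<noteq> 0 \<and> x = frac a s)"
  unfolding max_ideal_def in_loc_set point_ideal_def by blast

lemma ideal_max_ideal: "ideal (max_ideal F p) Rp"
proof -
  interpret cring Rp by (rule cring_Rp)
  show ?thesis
  proof (rule idealI)
    show "ring Rp" by (rule ring_axioms)
    show "subgroup (max_ideal F p) (add_monoid Rp)"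
    proof (rule add.subgroupI)
      show "max_ideal F p \<subseteq> carrier Rp" unfolding subset_eq Ball_def in_max_ideal Rp_carrier by blast
      have "frac 0 1 \<in> max_ideal F p" unfolding in_max_ideal using ev_1 peval_simps(1) by blast
      then show "max_ideal F p \<noteq> {}" by blast
      fix x assume "x \<in> max_ideal F p"
      then obtain a s where x: "ev a = 0" "ev s \<noteq> 0" "x = frac a s" unfolding in_max_ideal by blast
      have "ev (- a) = 0" using x by (simp add: ev_uminus)
      then show "\<ominus>\<^bsub>Rp\<^esub> x \<in> max_ideal F p" unfolding x(3) Rp_uminus[OF x(2)] in_max_ideal using x(2) by blast
      fix y assume "y \<in> max_ideal F p"
      then obtain b t where y: "ev b = 0" "ev t \<noteq> 0" "y = frac b t" unfolding in_max_ideal by blast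
      have "ev (a * t + b * s) = 0" using x y by (simp add: peval_simps)
      then show "x \<oplus>\<^bsub>Rp\<^esub> y \<in> max_ideal F p" unfolding x(3) y(3) Rp_add[OF x(2) y(2)] in_max_ideal
        using ev_mult_nz[OF x(2) y(2)] by blast
    qed
    fix x y assume "x \<in> max_ideal F p" "y \<in> carrier Rp"
    then obtain a s b t where x: "ev a = 0" "ev s \<noteq> 0" "x = frac a s" and y: "ev t \<noteq> 0" "y = frac b t" unfolding in_max_ideal Rp_carrier by blast
    have "ev (a * b) = 0" "ev (b * a) = 0" using x by (simp_all add: peval_simps)
    then show "y \<otimes>\<^bsub>Rp\<^esub> x \<in> max_ideal F p" "x \<otimes>\<^bsub>Rp\<^esub> y \<in> max_ideal F p"
      unfolding x(3) y(2) Rp_mult[OF x(2) y(1)] Rp_mult[OF y(1) x(2)] in_max_ideal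
      using ev_mult_nz[OF x(2) y(1)] ev_mult_nz[OF y(1) x(2)] by blast+
  qed
qed

lemma max_pow_0: "max_pow 0 F p = carrier Rp" and max_pow_Suc: "max_pow (Suc k) F p = max_pow k F p \<cdot>\<^bsub>Rp\<^esub> max_ideal F p"
  unfolding max_pow_def by (simp_all add: ideals_set_def nat_pow_def)

lemma ideal_max_pow: "ideal (max_pow k F p) Rp"
proof -
  interpret cring Rp by (rule cring_Rp)
  show ?thesis
    by (induction k) (simp_all only: max_pow_0 max_pow_Suc oneideal ideal_prod_is_ideal ideal_max_ideal)
qed

text \<open>Polynomials of order at least \<open>k\<close> at \<open>p\<close>.\<close>
definition vanishing :: "nat \<Rightarrow> 's mpoly set" where
  "vanishing k = {f. \<forall>\<alpha>. mdeg \<alpha> < k \<longrightarrow> lkp (shift (vec_nth p) f) \<alpha> = 0}"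

lemma vanishing_add: "f \<in> vanishing k \<Longrightarrow> g \<in> vanishing k \<Longrightarrow> f + g \<in> vanishing k"
  by (simp add: vanishing_def shift_simps lookup_add)

lemma vanishing_uminus: "f \<in> vanishing k \<Longrightarrow> - f \<in> vanishing k"
  by (simp add: vanishing_def shift_uminus)

lemma vanishing_mult: assumes "f \<in> vanishing k" "g \<in> vanishing l" shows "f * g \<in> vanishing (k + l)"
  unfolding vanishing_def mem_Collect_eq
proof (intro allI impI)
  fix \<alpha> :: "'s midx" assume a: "mdeg \<alpha> < k + l"
  show "lkp (shift (vec_nth p) (f * g)) \<alpha> = 0"
  proof (rule ccontr)
    assume "lkp (shift (vec_nth p) (f * g)) \<alpha> \<noteq> 0"
    then have "\<alpha> \<in> kys (shift (vec_nth p) f * shift (vec_nth p) g)" by (simp add: in_keys_iff shift_simps)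
    then obtain b c where bc: "\<alpha> = b + c" "b \<in> kys (shift (vec_nth p) f)" "c \<in> kys (shift (vec_nth p) g)"
      by (elim subsetD[OF keys_mult, THEN CollectE] exE conjE)
    have "\<not> mdeg b < k"
    proof
      assume "mdeg b < k"
      then have "lkp (shift (vec_nth p) f) b = 0" using assms(1) unfolding vanishing_def by simp
      then show False using bc(2) by (simp add: in_keys_iff)
    qed
    moreover have "\<not> mdeg c < l"
    proof
      assume "mdeg c < l"
      then have "lkp (shift (vec_nth p) g) c = 0" using assms(2) unfolding vanishing_def by simp
      then show False using bc(3) by (simp add: in_keys_iff)
    qed
    ultimately show False using a bc(1) by (simp add: mdeg_add)
  qed
qed

lemma vanishing_0: "f \<in> vanishing 0" by (simp add: vanishing_def)
lemma vanishing_mult_any: "f \<in> vanishing k \<Longrightarrow> f * g \<in> vanishing k" using vanishing_mult[OF _ vanishing_0, of f k g] by simp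
lemma vanishing_1: "f \<in> vanishing 1 \<longleftrightarrow> ev f = 0"
  by (auto simp: vanishing_def peval_shift mdeg_eq_0)

text \<open>Numerators in $\mathfrak{m}_p^k$ can be chosen to vanish to order \<open>k\<close>, since orders
  add under multiplication.\<close>
lemma max_pow_vanishing: "x \<in> max_pow k F p \<Longrightarrow> \<exists>a s. a \<in> vanishing k \<and> ev s \<noteq> 0 \<and> x = frac a s"
proof (induction k arbitrary: x)
  case 0
  then show ?case unfolding max_pow_0 Rp_carrier using vanishing_0 by blast
next
  case (Suc k)
  from Suc.prems show ?case unfolding max_pow_Suc
  proof (induction rule: ideal_prod.induct)
    case (prod i j)
    obtain a s where i: "a \<in> vanishing k" "ev s \<noteq> 0" "i = frac a s" using Suc.IH[OF prod(1)] by blast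
    obtain b t where j: "ev b = 0" "ev t \<noteq> 0" "j = frac b t" using prod(2) unfolding in_max_ideal by blast
    have "a * b \<in> vanishing (Suc k)" using vanishing_mult[OF i(1), of b 1] j(1) vanishing_1 by simp
    then show ?case unfolding i(3) j(3) Rp_mult[OF i(2) j(2)] using ev_mult_nz[OF i(2) j(2)] by blast
  next
    case (sum x y)
    obtain a s where i: "a \<in> vanishing (Suc k)" "ev s \<noteq> 0" "x = frac a s" using sum.IH(1) by blast
    obtain b t where j: "b \<in> vanishing (Suc k)" "ev t \<noteq> 0" "y = frac b t" using sum.IH(2) by blast
    have "a * t + b * s \<in> vanishing (Suc k)" by (intro vanishing_add vanishing_mult_any i(1) j(1))
    then show ?case unfolding i(3) j(3) Rp_add[OF i(2) j(2)] using ev_mult_nz[OF i(2) j(2)] by blast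
  qed
qed

text \<open>Newton iteration: from the constant \<open>1 / g(p)\<close>, each step multiplies the error
  \<open>1 - g * h\<close> by another function vanishing at \<open>p\<close>.\<close>
lemma inverse_mod_vanishing: assumes "ev g \<noteq> 0" shows "\<exists>h. 1 - g * h \<in> vanishing k"
proof (induction k)
  case 0 show ?case using vanishing_0 by blast
next
  case (Suc k)
  then obtain h where h: "1 - g * h \<in> vanishing k" by blast
  define c :: "'s mpoly" where "c = pconst (1 / ev g)"
  have 1: "1 - g * c \<in> vanishing 1" unfolding vanishing_1 using assms by (simp add: c_def ev_diff peval_simps)
  have "1 - g * (h + c * (1 - g * h)) = (1 - g * h) * (1 - g * c)" by (simp add: algebra_simps)
  then have "1 - g * (h + c * (1 - g * h)) \<in> vanishing (Suc k)" using vanishing_mult[OF h 1] by simp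
  then show ?case by blast
qed

end

section \<open>The higher order tangent space\<close>

lemma lookup_const_mult: "lkp (sng 0 c * g) \<alpha> = c * lkp g \<alpha>" for c :: complex
proof (induction g rule: mpoly_induct)
  case (single m d)
  show ?case by (simp add: mult_single lookup_single when_def)
next
  case (add f g) then show ?case by (simp add: distrib_left lookup_add)
qed simp

lemma shift_shift_neg: "shift p (shift (\<lambda>i. - p i) g) = g"
proof (induction g rule: mpoly_induct_vars)
  case (var v)
  have "pconst (p v) + pconst (- p v) = (0 :: 'a mpoly)" by (simp add: pconst_simps(3)[symmetric] pconst_simps(1))
  then show ?case by (simp add: shift_simps add.assoc)
qed (simp_all add: shift_simps)

context hypersurface_point
begin

text \<open>The functional on polynomials that the coordinate vector \<open>v\<close> represents.\<close>
definition pairing :: "nat \<Rightarrow> ('s midx \<Rightarrow> complex) \<Rightarrow> 's mpoly \<Rightarrow> complex" where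
  "pairing n v f = (\<Sum>\<alpha>\<in>col_idx n. v \<alpha> * lkp (shift (vec_nth p) f) \<alpha>)"

lemma pairing_add: "pairing n v (f + g) = pairing n v f + pairing n v g"
  by (simp add: pairing_def shift_simps lookup_add distrib_left sum.distrib)

lemma pairing_0: "pairing n v 0 = 0" by (simp add: pairing_def shift_simps)

lemma pairing_const: "pairing n v (pconst c * f) = c * pairing n v f"
  unfolding pairing_def shift_simps(2,3) sum_distrib_left
  unfolding pconst_def lookup_const_mult by (simp only: mult.left_commute)

lemma pairing_vanishing: "f \<in> vanishing (n + 1) \<Longrightarrow> pairing n v f = 0"
  unfolding pairing_def by (intro sum.neutral ballI) (simp add: vanishing_def col_idx_def)

lemma pairing_cong: assumes "f - g \<in> vanishing (n + 1)" shows "pairing n v f = pairing n v g"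
  using pairing_add[of n v "f - g" g] pairing_vanishing[OF assms, of v] by simp

lemma pairing_jac_row:
  "(\<Sum>\<alpha>\<in>col_idx n. v \<alpha> * peval (vec_nth p) (jac_row F \<beta> \<alpha>)) =
     (\<Sum>\<alpha>\<in>col_idx n. v \<alpha> * lkp (sng \<beta> 1 * shift (vec_nth p) F) \<alpha>)"
  unfolding peval_jac_row lookup_single_mult ..

text \<open>Expand \<open>h\<close> at \<open>p\<close> in monomials $(x-p)^\beta$. For degree of
  \<open>\<beta>\<close> below \<open>n\<close> the contribution is a row of the Jacobian
  matrix; for higher degree it involves only Taylor coefficients of order above
  \<open>n\<close>, because \<open>F\<close> vanishes at \<open>p\<close>.\<close>
lemma pairing_multiple:
  assumes rows: "\<And>\<beta>. \<beta> \<in> row_idx n \<Longrightarrow> (\<Sum>\<alpha>\<in>col_idx n. v \<alpha> * peval (vec_nth p) (jac_row F \<beta> \<alpha>)) = 0"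
  shows "pairing n v (F * h) = 0"
proof -
  let ?G = "shift (vec_nth p) F"
  have "(\<Sum>\<alpha>\<in>col_idx n. v \<alpha> * lkp (q * ?G) \<alpha>) = 0" for q
  proof (induction q rule: mpoly_induct)
    case (single m c)
    have m: "(\<Sum>\<alpha>\<in>col_idx n. v \<alpha> * lkp (sng m 1 * ?G) \<alpha>) = 0"
    proof (cases "m \<in> row_idx n")
      case True
      then show ?thesis using rows pairing_jac_row by simp
    next
      case False
      show ?thesis
      proof (rule sum.neutral, rule ballI)
        fix \<alpha> :: "'s midx" assume a: "\<alpha> \<in> col_idx n"
        have "lkp (sng m 1 * ?G) \<alpha> = 0"
        proof (cases "mle m \<alpha>")
          case True
          have "mdeg \<alpha> = mdeg m + mdeg (\<alpha> - m)" using mle_add[OF True] mdeg_add by metis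
          then have "mdeg (\<alpha> - m) = 0" using a False by (simp add: col_idx_def row_idx_def)
          then have "\<alpha> - m = 0" by (simp only: mdeg_eq_0)
          then show ?thesis unfolding lookup_single_mult using on_hypersurface by (simp add: peval_shift)
        qed (simp add: lookup_single_mult)
        then show "v \<alpha> * lkp (sng m 1 * ?G) \<alpha> = 0" by simp
      qed
    qed
    have "sng m c = sng 0 c * sng m 1" by (simp add: mult_single)
    then have e: "sng m c * ?G = sng 0 c * (sng m 1 * ?G)" by (simp only: mult.assoc)
    have "(\<Sum>\<alpha>\<in>col_idx n. v \<alpha> * lkp (sng m c * ?G) \<alpha>) = c * (\<Sum>\<alpha>\<in>col_idx n. v \<alpha> * lkp (sng m 1 * ?G) \<alpha>)"
      unfolding e lookup_const_mult sum_distrib_left by (simp only: mult.left_commute)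
    then show ?case using m by simp
  next
    case (add f g)
    then show ?case by (simp add: distrib_right lookup_add distrib_left sum.distrib)
  qed simp
  then show ?thesis unfolding pairing_def shift_simps by (simp only: mult.commute[of ?G])
qed

abbreviation jet :: "nat \<Rightarrow> 's loc_elt \<Rightarrow> 's loc_elt set" where
  "jet n x \<equiv> max_pow (n + 1) F p +>\<^bsub>Rp\<^esub> x"

lemma loc_class_frac: "loc_class F p f = frac f 1"
  unfolding loc_class_def coord_ring_simps ..

lemma trunc_class_jet: "trunc_class n F p f = jet n (frac f 1)"
  unfolding trunc_class_def loc_class_frac ..

lemma frac_carrier: "ev s \<noteq> 0 \<Longrightarrow> frac a s \<in> carrier Rp" using Rp_carrier by blast

lemma trunc_ring_simps: assumes "x \<in> carrier Rp" "y \<in> carrier Rp"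
  shows "jet n x \<oplus>\<^bsub>trunc_ring n F p\<^esub> jet n y = jet n (x \<oplus>\<^bsub>Rp\<^esub> y)" "jet n x \<otimes>\<^bsub>trunc_ring n F p\<^esub> jet n y = jet n (x \<otimes>\<^bsub>Rp\<^esub> y)"
proof -
  interpret ideal "max_pow (n + 1) F p" Rp by (rule ideal_max_pow)
  show "jet n x \<oplus>\<^bsub>trunc_ring n F p\<^esub> jet n y = jet n (x \<oplus>\<^bsub>Rp\<^esub> y)" "jet n x \<otimes>\<^bsub>trunc_ring n F p\<^esub> jet n y = jet n (x \<otimes>\<^bsub>Rp\<^esub> y)"
    unfolding trunc_ring_def FactRing_def using a_rcos_sum[OF assms] rcoset_mult_add[OF assms] by simp_all
qed

text \<open>If \<open>f / g\<close> and \<open>f' / g'\<close> have the same jet, then \<open>f * g' - f' *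
  g\<close> is a multiple of \<open>F\<close> plus a polynomial of order above \<open>n\<close>,
  after inverting the denominators modulo order \<open>n + 1\<close>. Multiplication by \<open>h
  * h'\<close> gives the same for \<open>f * h - f' * h'\<close>.\<close>
lemma pairing_well_defined:
  assumes zero: "\<And>h. pairing n v (F * h) = 0"
    and nz: "ev g \<noteq> 0" "ev g' \<noteq> 0" and jets: "jet n (frac f g) = jet n (frac f' g')"
    and h: "1 - g * h \<in> vanishing (n + 1)" "1 - g' * h' \<in> vanishing (n + 1)"
  shows "pairing n v (f * h) = pairing n v (f' * h')"
proof -
  interpret cring Rp by (rule cring_Rp)
  define w where "w = f * g' - f' * g"
  have "frac f g \<ominus>\<^bsub>Rp\<^esub> frac f' g' \<in> max_pow (n + 1) F p"
    using jets quotient_eq_iff_same_a_r_cos[OF ideal_max_pow frac_carrier[OF nz(1)] frac_carrier[OF nz(2)]] by blast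
  then have "frac w (g * g') \<in> max_pow (n + 1) F p" unfolding Rp_diff[OF nz] w_def .
  then obtain a b where ab: "a \<in> vanishing (n + 1)" "ev b \<noteq> 0" "frac w (g * g') = frac a b" using max_pow_vanishing by blast
  then obtain u where u: "ev u \<noteq> 0" "F dvd u * (w * b - a * (g * g'))" unfolding frac_eq_iff[OF ev_mult_nz[OF nz] ab(2)] by blast
  then obtain q where q: "u * (w * b - a * (g * g')) = F * q" by (elim dvdE)
  obtain e where e: "1 - (u * b) * e \<in> vanishing (n + 1)" using inverse_mod_vanishing[OF ev_mult_nz[OF u(1) ab(2)]] by blast
  have "f * h - f' * h' - F * (q * e * h * h')
      = a * (u * g * g' * e * h * h') + (1 - (u * b) * e) * (w * h * h') + (1 - g' * h') * (f * h) + - ((1 - g * h) * (f' * h'))"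
    unfolding mult.assoc[symmetric] q[symmetric] w_def by (simp add: algebra_simps)
  also have "\<dots> \<in> vanishing (n + 1)"
    by (intro vanishing_add vanishing_uminus vanishing_mult_any ab(1) e h)
  finally have "f * h - (f' * h' + F * (q * e * h * h')) \<in> vanishing (n + 1)" by (simp add: algebra_simps)
  from pairing_cong[OF this, of v] show ?thesis unfolding pairing_add zero by simp
qed

text \<open>A functional on the cotangent space kills the jets of the multiples of \<open>F\<close>, and
  $(x-p)^\beta F$ gives the row \<open>\<beta>\<close>. Conversely, if the rows are killed, send
  the jet of \<open>f / g\<close> to \<open>pairing n v (f * h)\<close>, where \<open>h\<close>
  inverts \<open>g\<close> modulo order \<open>n + 1\<close>.\<close>
lemma htangent_eq:
  "htangent n F p = {v \<in> cspace (col_idx n). \<forall>\<beta>\<in>row_idx n. (\<Sum>\<alpha>\<in>col_idx n. v \<alpha> * peval (vec_nth p) (jac_row F \<beta> \<alpha>)) = 0}"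
proof -
  have dual: "(\<exists>\<phi>\<in>cotangent_dual n F p. \<forall>f\<in>point_ideal p. \<phi> (trunc_class n F p f) = pairing n v f) \<longleftrightarrow>
      (\<forall>\<beta>\<in>row_idx n. (\<Sum>\<alpha>\<in>col_idx n. v \<alpha> * peval (vec_nth p) (jac_row F \<beta> \<alpha>)) = 0)" (is "?L \<longleftrightarrow> ?R") for v
  proof
    assume ?L
    then obtain \<phi> where \<phi>: "\<forall>f\<in>point_ideal p. \<phi> (trunc_class n F p f) = pairing n v f" by (elim bexE)
    show ?R
    proof
      fix \<beta> :: "'s midx" assume "\<beta> \<in> row_idx n"
      \<comment> \<open>This is $(x-p)^\beta F$.\<close>
      define f where "f = shift (\<lambda>i. - p $ i) (sng \<beta> 1) * F"
      have ev: "ev f = 0" using ev_dvd[of f] by (simp add: f_def)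
      have "frac f 1 = frac 0 1" unfolding frac_eq_iff[OF ev_1 ev_1] using ev_1 by (intro exI[of _ 1]) (simp add: f_def)
      then have "trunc_class n F p f = trunc_class n F p 0" unfolding trunc_class_jet by (rule arg_cong)
      moreover have "\<phi> (trunc_class n F p f) = pairing n v f" by (rule bspec[OF \<phi>]) (simp add: point_ideal_def ev)
      moreover have "\<phi> (trunc_class n F p 0) = pairing n v 0" by (rule bspec[OF \<phi>]) (simp add: point_ideal_def peval_simps)
      ultimately have "pairing n v f = 0" by (simp only: pairing_0)
      then show "(\<Sum>\<alpha>\<in>col_idx n. v \<alpha> * peval (vec_nth p) (jac_row F \<beta> \<alpha>)) = 0"
        unfolding pairing_jac_row pairing_def f_def shift_simps shift_shift_neg .
    qed
  next
    assume R: ?R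
    have zero: "pairing n v (F * h) = 0" for h by (rule pairing_multiple) (use R in blast)
    \<comment> \<open>A polynomial \<open>r\<close> represents \<open>x\<close> when it arises from some fraction in the class \<open>x\<close> by inverting the denominator.\<close>
    define rep where "rep x r \<longleftrightarrow> (\<exists>f g h. ev g \<noteq> 0 \<and> x = jet n (frac f g) \<and> 1 - g * h \<in> vanishing (n + 1) \<and> r = f * h)" for x r
    define \<phi> where "\<phi> x = pairing n v (SOME r. rep x r)" for x
    have rep: "\<phi> x = pairing n v r" if r: "rep x r" for x r
    proof -
      have "rep x (SOME r. rep x r)" by (rule someI[of "rep x", OF r])
      then obtain f g h where 1: "ev g \<noteq> 0" "x = jet n (frac f g)" "1 - g * h \<in> vanishing (n + 1)" "(SOME r. rep x r) = f * h"
        unfolding rep_def by (elim exE conjE)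
      obtain f' g' h' where 2: "ev g' \<noteq> 0" "x = jet n (frac f' g')" "1 - g' * h' \<in> vanishing (n + 1)" "r = f' * h'"
        using r unfolding rep_def by (elim exE conjE)
      show ?thesis unfolding \<phi>_def 1(4) 2(4)
        by (rule pairing_well_defined[OF zero 1(1) 2(1) _ 1(3) 2(3)]) (use 1(2) 2(2) in simp)
    qed
    have cot: "\<exists>f g h. ev g \<noteq> 0 \<and> x = jet n (frac f g) \<and> 1 - g * h \<in> vanishing (n + 1)" if x: "x \<in> cotangent n F p" for x
    proof -
      obtain y where y: "y \<in> max_ideal F p" "x = jet n y" using x unfolding cotangent_def by blast
      obtain f g where fg: "ev g \<noteq> 0" "y = frac f g" using y(1) unfolding in_max_ideal by blast
      obtain h where h: "1 - g * h \<in> vanishing (n + 1)" using inverse_mod_vanishing[OF fg(1)] by blast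
      show ?thesis by (intro exI[of _ f] exI[of _ g] exI[of _ h] conjI fg(1) h) (simp only: y(2) fg(2))
    qed
    have "\<phi> \<in> cotangent_dual n F p" unfolding cotangent_dual_def mem_Collect_eq
    proof (intro conjI ballI allI)
      fix x y assume x: "x \<in> cotangent n F p" and y: "y \<in> cotangent n F p"
      obtain f g h where 1: "ev g \<noteq> 0" "x = jet n (frac f g)" "1 - g * h \<in> vanishing (n + 1)" using cot[OF x] by (elim exE conjE)
      obtain f' g' h' where 2: "ev g' \<noteq> 0" "y = jet n (frac f' g')" "1 - g' * h' \<in> vanishing (n + 1)" using cot[OF y] by (elim exE conjE)
      have xy: "x \<oplus>\<^bsub>trunc_ring n F p\<^esub> y = jet n (frac (f * g' + f' * g) (g * g'))"
        unfolding 1(2) 2(2) trunc_ring_simps[OF frac_carrier[OF 1(1)] frac_carrier[OF 2(1)]] Rp_add[OF 1(1) 2(1)] ..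
      have "1 - (g * g') * (h * h') = (1 - g * h) * 1 + (1 - g' * h') * (g * h)" by (simp add: algebra_simps)
      then have v: "1 - (g * g') * (h * h') \<in> vanishing (n + 1)" by (simp only: vanishing_add vanishing_mult_any 1(3) 2(3))
      have "rep (x \<oplus>\<^bsub>trunc_ring n F p\<^esub> y) ((f * g' + f' * g) * (h * h'))"
        unfolding rep_def by (intro exI conjI) (rule ev_mult_nz[OF 1(1) 2(1)], rule xy, rule v, rule refl)
      then have "\<phi> (x \<oplus>\<^bsub>trunc_ring n F p\<^esub> y) = pairing n v ((f * g' + f' * g) * (h * h'))" by (rule rep)
      also have "\<dots> = pairing n v (f * h + f' * h')"
      proof (rule pairing_cong)
        have "(f * g' + f' * g) * (h * h') - (f * h + f' * h') = - ((1 - g' * h') * (f * h)) + - ((1 - g * h) * (f' * h'))"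
          by (simp add: algebra_simps)
        also have "\<dots> \<in> vanishing (n + 1)" by (intro vanishing_add vanishing_uminus vanishing_mult_any 1(3) 2(3))
        finally show "(f * g' + f' * g) * (h * h') - (f * h + f' * h') \<in> vanishing (n + 1)" .
      qed
      also have "\<dots> = \<phi> x + \<phi> y" unfolding pairing_add
      proof (rule arg_cong2[of _ _ _ _ "(+)"])
        show "pairing n v (f * h) = \<phi> x" by (rule rep[symmetric]) (use 1 in \<open>unfold rep_def, blast\<close>)
        show "pairing n v (f' * h') = \<phi> y" by (rule rep[symmetric]) (use 2 in \<open>unfold rep_def, blast\<close>)
      qed
      finally show "\<phi> (x \<oplus>\<^bsub>trunc_ring n F p\<^esub> y) = \<phi> x + \<phi> y" .
    next
      fix c x assume x: "x \<in> cotangent n F p"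
      obtain f g h where 1: "ev g \<noteq> 0" "x = jet n (frac f g)" "1 - g * h \<in> vanishing (n + 1)" using cot[OF x] by (elim exE conjE)
      have "trunc_class n F p (pconst c) \<otimes>\<^bsub>trunc_ring n F p\<^esub> x = jet n (frac (pconst c * f) (1 * g))"
        unfolding 1(2) trunc_class_jet trunc_ring_simps[OF frac_carrier[OF ev_1] frac_carrier[OF 1(1)]] Rp_mult[OF ev_1 1(1)] ..
      then have "rep (trunc_class n F p (pconst c) \<otimes>\<^bsub>trunc_ring n F p\<^esub> x) (pconst c * f * h)"
        unfolding rep_def mult_1 using 1(1,3) by blast
      then have "\<phi> (trunc_class n F p (pconst c) \<otimes>\<^bsub>trunc_ring n F p\<^esub> x) = c * pairing n v (f * h)"
        using rep by (simp add: mult.assoc pairing_const)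
      also have "pairing n v (f * h) = \<phi> x" by (rule rep[symmetric]) (use 1 in \<open>unfold rep_def, blast\<close>)
      finally show "\<phi> (trunc_class n F p (pconst c) \<otimes>\<^bsub>trunc_ring n F p\<^esub> x) = c * \<phi> x" .
    qed
    moreover have "\<phi> (trunc_class n F p f) = pairing n v f" for f
    proof (rule rep)
      have "1 - 1 * 1 \<in> vanishing (n + 1)" by (simp add: vanishing_def shift_simps)
      then show "rep (trunc_class n F p f) f" unfolding rep_def trunc_class_jet
        by (intro exI[of _ f] exI[of _ 1] conjI) (simp_all add: ev_1)
    qed
    ultimately show ?L by blast
  qed
  show ?thesis unfolding htangent_def taylor_coeff pairing_def[symmetric] dual ..
qed

end

section \<open>The Jacobian matrix at a point\<close>

text \<open>Adding a slack entry turns multi-indices of degree at most \<open>n\<close> into lists of length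
  $s+1$ with sum exactly \<open>n\<close>.\<close>
lemma card_multi_indices: "card {\<alpha> :: 's::{finite,linorder} midx. mdeg \<alpha> \<le> n} = (n + CARD('s)) choose CARD('s)"
proof -
  let ?xs = "sorted_list_of_set (UNIV :: 's set)"
  let ?L = "{l :: nat list. length l = Suc CARD('s) \<and> sum_list l = n}"
  let ?f = "\<lambda>\<alpha> :: 's midx. (n - mdeg \<alpha>) # map (lkp \<alpha>) ?xs"
  have xs: "distinct ?xs" "set ?xs = UNIV" "length ?xs = CARD('s)" by simp_all
  have deg: "mdeg \<alpha> = sum_list (map (lkp \<alpha>) ?xs)" for \<alpha> :: "'s midx"
    unfolding mdeg_def using sum_list_distinct_conv_sum_set[OF xs(1), of "lkp \<alpha>"] xs(2) by simp
  have "bij_betw ?f {\<alpha>. mdeg \<alpha> \<le> n} ?L"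
  proof (rule bij_betw_imageI)
    show "inj_on ?f {\<alpha>. mdeg \<alpha> \<le> n}"
    proof (rule inj_onI)
      fix \<alpha> \<beta> :: "'s midx" assume "?f \<alpha> = ?f \<beta>"
      then have "map (lkp \<alpha>) ?xs = map (lkp \<beta>) ?xs" by (rule list.inject[THEN iffD1, THEN conjunct2])
      then have "\<forall>i\<in>set ?xs. lkp \<alpha> i = lkp \<beta> i" unfolding map_eq_conv .
      then show "\<alpha> = \<beta>" unfolding xs(2) by (intro poly_mapping_eqI) blast
    qed
    show "?f ` {\<alpha>. mdeg \<alpha> \<le> n} = ?L"
    proof (intro equalityI subsetI)
      fix l assume "l \<in> ?f ` {\<alpha>. mdeg \<alpha> \<le> n}"
      then obtain \<alpha> where "mdeg \<alpha> \<le> n" "l = ?f \<alpha>" by blast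
      then show "l \<in> ?L" using xs(3) by (simp add: deg[symmetric])
    next
      fix l assume l: "l \<in> ?L"
      then obtain a l' where l': "l = a # l'" "length l' = CARD('s)" "a + sum_list l' = n" by (cases l) auto
      define \<alpha> :: "'s midx" where "\<alpha> = Abs_poly_mapping (\<lambda>i. the (map_of (zip ?xs l') i))"
      have lk: "lkp \<alpha> i = the (map_of (zip ?xs l') i)" for i unfolding \<alpha>_def by (subst Abs_poly_mapping_inverse) simp_all
      have m: "map (lkp \<alpha>) ?xs = l'"
      proof (rule nth_equalityI)
        fix i assume i: "i < length (map (lkp \<alpha>) ?xs)"
        then have "map_of (zip ?xs l') (?xs ! i) = Some (l' ! i)"
          by (intro map_of_zip_nth xs(1)) (use l'(2) xs(3) in simp_all)
        then show "map (lkp \<alpha>) ?xs ! i = l' ! i" using i by (simp add: lk)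
      qed (use l'(2) xs(3) in simp)
      have "mdeg \<alpha> = sum_list l'" unfolding deg m ..
      then have "mdeg \<alpha> \<le> n" "l = ?f \<alpha>" unfolding m l'(1) using l'(3) by simp_all
      then show "l \<in> ?f ` {\<alpha>. mdeg \<alpha> \<le> n}" by blast
    qed
  qed
  then have "card {\<alpha> :: 's midx. mdeg \<alpha> \<le> n} = card ?L" by (rule bij_betw_same_card)
  also have "\<dots> = (n + CARD('s)) choose n" unfolding card_length_sum_list by simp
  also have "\<dots> = (n + CARD('s)) choose CARD('s)" by (subst binomial_symmetric) simp_all
  finally show ?thesis .
qed

lemma card_row_idx: "n \<ge> 1 \<Longrightarrow> card (row_idx n :: 's::{finite,linorder} midx set) = numM TYPE('s) n"
  unfolding row_idx_def card_multi_indices numM_def by simp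

lemma card_col_idx: "card (col_idx n :: 's::{finite,linorder} midx set) = numN TYPE('s) n - 1"
proof -
  have "col_idx n = {\<alpha> :: 's midx. mdeg \<alpha> \<le> n} - {0}"
    by (rule Set.set_eqI) (unfold col_idx_def mem_Collect_eq Diff_iff singleton_iff mdeg_eq_0[symmetric], presburger)
  then show ?thesis using finite_multi_indices[where n = n and 's = 's] unfolding numN_def card_multi_indices[symmetric]
    by (simp add: card_Diff_singleton)
qed

lemma mdeg_1_single: assumes "mdeg \<gamma> = 1" shows "\<exists>j. \<gamma> = sng j 1"
proof -
  obtain j where j: "lkp \<gamma> j \<noteq> 0"
  proof (rule ccontr)
    assume "\<not> thesis"
    then have "\<And>j. lkp \<gamma> j = 0" using that by blast
    then have "mdeg \<gamma> = 0" by (simp add: mdeg_def)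
    then show False using assms by simp
  qed
  have "mle (sng j 1) \<gamma>" using j by (auto simp: mle_def lookup_single when_def)
  note e = mle_add[OF this]
  have "1 + mdeg (\<gamma> - sng j 1) = 1" using arg_cong[OF e, of mdeg] unfolding mdeg_add mdeg_single assms .
  then have "mdeg (\<gamma> - sng j 1) = 0" by simp
  then have "\<gamma> - sng j 1 = 0" by (simp only: mdeg_eq_0)
  then show ?thesis using e by (intro exI[of _ j]) simp
qed

context hypersurface_point
begin

text \<open>Vanishing outside the index range makes this a candidate for \<open>frames\<close>.\<close>
definition jac_at :: "nat \<Rightarrow> nat \<Rightarrow> 's midx \<Rightarrow> complex" where
  "jac_at n i \<alpha> = (if i < numM TYPE('s) n \<and> \<alpha> \<in> col_idx n then ev (Jac n F i \<alpha>) else 0)"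

lemma ev_pderiv1: "ev (pderiv1 i F) = lkp (shift (vec_nth p) F) (sng i 1)"
  unfolding peval_shift pderiv1_shift[symmetric] lookup_pderiv1 by simp

lemma ev_Delta: assumes "J \<in> Lam n" shows "ev (Delta n F J) = minor (jac_at n) J"
proof -
  have J: "length J = numM TYPE('s) n" "set J \<subseteq> col_idx n" using assms by (simp_all add: Lam_def)
  have "ev (Delta n F J) = Determinant.det (map_mat ev (minor_mat (Jac n F) J))"
    unfolding Delta_def minor_def by (rule comm_ring_hom.hom_det[OF peval_hom, symmetric])
  also have "map_mat ev (minor_mat (Jac n F) J) = minor_mat (jac_at n) J"
  proof (rule eq_matI)
    fix i j assume "i < dim_row (minor_mat (jac_at n) J)" "j < dim_col (minor_mat (jac_at n) J)"
    then have ij: "i < length J" "j < length J" by simp_all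
    then have "J ! j \<in> col_idx n" using J(2) nth_mem by blast
    then show "map_mat ev (minor_mat (Jac n F) J) $$ (i, j) = minor_mat (jac_at n) J $$ (i, j)"
      using ij J(1) by (simp add: jac_at_def)
  qed simp_all
  finally show ?thesis unfolding minor_def .
qed

lemma row_index: assumes n: "n \<ge> 1"
  shows "i < numM TYPE('s) n \<Longrightarrow> grlex_list (row_idx n :: 's midx set) ! i \<in> row_idx n"
    "(\<beta> :: 's midx) \<in> row_idx n \<Longrightarrow> \<exists>i<numM TYPE('s) n. grlex_list (row_idx n) ! i = \<beta>"
    "i < j \<Longrightarrow> j < numM TYPE('s) n \<Longrightarrow> grlex (grlex_list (row_idx n :: 's midx set) ! i) (grlex_list (row_idx n) ! j)"
proof -
  have l: "length (grlex_list (row_idx n :: 's midx set)) = numM TYPE('s) n"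
    unfolding length_grlex_list[OF finite_row_idx] by (rule card_row_idx[OF n])
  note s = grlex_list[OF finite_row_idx[where 'a = 's and n = n]]
  show "i < numM TYPE('s) n \<Longrightarrow> grlex_list (row_idx n :: 's midx set) ! i \<in> row_idx n"
    using s(1) nth_mem[of i "grlex_list (row_idx n :: 's midx set)"] l by simp
  show "\<exists>i<numM TYPE('s) n. grlex_list (row_idx n) ! i = \<beta>" if "(\<beta> :: 's midx) \<in> row_idx n"
  proof -
    have "\<beta> \<in> set (grlex_list (row_idx n))" using that by (simp only: s(1))
    then show ?thesis unfolding in_set_conv_nth l .
  qed
  show "i < j \<Longrightarrow> j < numM TYPE('s) n \<Longrightarrow> grlex (grlex_list (row_idx n :: 's midx set) ! i) (grlex_list (row_idx n) ! j)"
    using sorted_wrt_nth_less[OF s(2)] l by simp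
qed

lemma htangent_perp: assumes n: "n \<ge> 1"
  shows "htangent n F p = perp (col_idx n) (frame_span (numM TYPE('s) n) (jac_at n))"
proof (rule Set.set_eqI)
  fix v :: "'s midx \<Rightarrow> complex"
  let ?M = "numM TYPE('s) n" and ?p = "\<lambda>t. \<Sum>\<alpha>\<in>col_idx n. v \<alpha> * t \<alpha>"
  have row: "?p (jac_at n i) = ?p (\<lambda>\<alpha>. ev (jac_row F (grlex_list (row_idx n) ! i) \<alpha>))" if "i < ?M" for i
    by (rule sum.cong[OF refl]) (simp add: jac_at_def Jac_def that)
  have "(\<forall>\<beta>\<in>row_idx n. ?p (\<lambda>\<alpha>. ev (jac_row F \<beta> \<alpha>)) = 0) \<longleftrightarrow> (\<forall>i<?M. ?p (jac_at n i) = 0)"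
  proof (intro iffI ballI allI impI)
    fix i assume z: "\<forall>\<beta>\<in>row_idx n. ?p (\<lambda>\<alpha>. ev (jac_row F \<beta> \<alpha>)) = 0" and i: "i < ?M"
    show "?p (jac_at n i) = 0" unfolding row[OF i] by (rule bspec[OF z row_index(1)[OF n i]])
  next
    fix \<beta> :: "'s midx" assume z: "\<forall>i<?M. ?p (jac_at n i) = 0" and "\<beta> \<in> row_idx n"
    then obtain i where i: "i < ?M" "grlex_list (row_idx n) ! i = \<beta>" using row_index(2)[OF n] by metis
    have "?p (jac_at n i) = 0" using spec[OF z, of i] i(1) by (rule mp)
    then show "?p (\<lambda>\<alpha>. ev (jac_row F \<beta> \<alpha>)) = 0" unfolding row[OF i(1)] i(2) .
  qed
  moreover have "(\<forall>i<?M. ?p (jac_at n i) = 0) \<longleftrightarrow> (\<forall>t\<in>frame_span ?M (jac_at n). ?p t = 0)"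
  proof (intro iffI ballI allI impI)
    fix t assume z: "\<forall>i<?M. ?p (jac_at n i) = 0" and "t \<in> frame_span ?M (jac_at n)"
    then obtain c where c: "\<And>\<alpha>. t \<alpha> = (\<Sum>k<?M. c k * jac_at n k \<alpha>)" unfolding in_frame_span by blast
    have "?p t = (\<Sum>k<?M. c k * ?p (jac_at n k))" unfolding c sum_distrib_left
      by (subst sum.swap) (simp only: mult.left_commute)
    then show "?p t = 0" using z by simp
  next
    fix i assume z: "\<forall>t\<in>frame_span ?M (jac_at n). ?p t = 0" and i: "i < ?M"
    show "?p (jac_at n i) = 0" by (rule bspec[OF z frame_in_span[OF i]])
  qed
  ultimately show "v \<in> htangent n F p \<longleftrightarrow> v \<in> perp (col_idx n) (frame_span ?M (jac_at n))"
    unfolding htangent_eq perp_def mem_Collect_eq by (simp only:)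
qed

lemma jac_at_entry: assumes "n \<ge> 1" "i < numM TYPE('s) n" "\<alpha> \<in> col_idx n" "\<beta> = grlex_list (row_idx n) ! i"
  shows "jac_at n i \<alpha> = (if mle \<beta> \<alpha> then lkp (shift (vec_nth p) F) (\<alpha> - \<beta>) else 0)"
  using assms(2,3) unfolding jac_at_def Jac_def assms(4) by (simp add: peval_jac_row)

lemma shift_F_0: "lkp (shift (vec_nth p) F) 0 = 0"
  using on_hypersurface by (simp add: peval_shift)

text \<open>A relation between the rows says that a nonzero polynomial \<open>c\<close> of degree below
  \<open>n\<close>, times the expansion of \<open>F\<close> at \<open>p\<close>, has no terms of
  degree \<open>1, ..., n\<close>. But the product of the lowest terms cannot cancel: in graded
  lexicographical order, the lowest term of \<open>c\<close> has degree at most \<open>n -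
  1\<close> and that of the expansion of \<open>F\<close> at a nonsingular point has degree
  \<open>1\<close>.\<close>
lemma jac_at_frame:
  assumes n: "n \<ge> 1" and nonsing: "\<exists>i. ev (pderiv1 i F) \<noteq> 0"
  shows "jac_at n \<in> frames (numM TYPE('s) n) (col_idx n)"
proof -
  let ?M = "numM TYPE('s) n" and ?G = "shift (vec_nth p) F"
  let ?b = "\<lambda>i. grlex_list (row_idx n :: 's midx set) ! i"
  have "row_indep ?M (jac_at n)" unfolding row_indep_def
  proof (intro allI impI, rule ccontr)
    fix c k assume z: "\<forall>\<alpha>. (\<Sum>k<?M. c k * jac_at n k \<alpha>) = 0" and k: "k < ?M" "c k \<noteq> 0"
    define k0 where "k0 = (LEAST k. k < ?M \<and> c k \<noteq> 0)"
    have k0: "k0 < ?M" "c k0 \<noteq> 0" using LeastI[of "\<lambda>k. k < ?M \<and> c k \<noteq> 0", OF conjI[OF k]] unfolding k0_def by blast+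
    have k0_min: "\<not> (k' < ?M \<and> c k' \<noteq> 0)" if "k' < k0" for k' using not_less_Least that unfolding k0_def by blast
    \<comment> \<open>Among monomials of degree \<open>1\<close> the least variable is the least in graded lexicographical order.\<close>
    define S where "S = {i. lkp ?G (sng i 1) \<noteq> 0}"
    have S: "finite S" "S \<noteq> {}" using nonsing unfolding ev_pderiv1 S_def by (simp, blast)
    define i0 where "i0 = Min S"
    have i0: "lkp ?G (sng i0 1) \<noteq> 0" using Min_in[OF S] unfolding i0_def S_def by blast
    have i0_min: "i0 \<le> j" if "lkp ?G (sng j 1) \<noteq> 0" for j unfolding i0_def by (rule Min_le[OF S(1)]) (use that S_def in blast)
    define \<alpha> where "\<alpha> = ?b k0 + sng i0 1"
    have b0: "mdeg (?b k0) \<le> n - 1" using row_index(1)[OF n k0(1)] unfolding row_idx_def by (rule CollectD)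
    have \<alpha>: "mdeg \<alpha> = Suc (mdeg (?b k0))" unfolding \<alpha>_def mdeg_add mdeg_single by simp
    have \<alpha>_col: "\<alpha> \<in> col_idx n" using b0 n \<alpha> by (simp add: col_idx_def)
    have other: "c k * jac_at n k \<alpha> = 0" if k: "k < ?M" "k \<noteq> k0" for k
    proof (rule ccontr)
      assume nz: "c k * jac_at n k \<alpha> \<noteq> 0"
      then have "c k \<noteq> 0" by simp
      then have "\<not> k < k0" using k0_min[of k] k(1) by blast
      then have "k0 < k" using k(2) by simp
      then have lt: "grlex (?b k0) (?b k)" by (rule row_index(3)[OF n _ k(1)])
      have m: "mle (?b k) \<alpha>" "lkp ?G (\<alpha> - ?b k) \<noteq> 0"
        using nz unfolding jac_at_entry[OF n k(1) \<alpha>_col refl] mult_eq_0_iff if_False by (meson)+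
      note e = mle_add[OF m(1)]
      have "\<alpha> - ?b k \<noteq> 0" using m(2) shift_F_0 by metis
      then have "mdeg (\<alpha> - ?b k) \<noteq> 0" by (simp only: mdeg_eq_0 not_False_eq_True)
      moreover have "mdeg (?b k) + mdeg (\<alpha> - ?b k) = Suc (mdeg (?b k0))" using arg_cong[OF e, of mdeg] unfolding mdeg_add \<alpha> .
      moreover have "mdeg (?b k0) \<le> mdeg (?b k)" using lt unfolding grlex_def by linarith
      ultimately have d: "mdeg (\<alpha> - ?b k) = 1" "mdeg (?b k0) = mdeg (?b k)" by linarith+
      obtain j where j: "\<alpha> - ?b k = sng j 1" using mdeg_1_single[OF d(1)] by (elim exE)
      have eq: "?b k + sng j 1 = ?b k0 + sng i0 1" using e unfolding j unfolding \<alpha>_def .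
      have "i0 \<le> j" using i0_min m(2) unfolding j by blast
      have "j \<noteq> i0"
      proof
        assume "j = i0"
        then have "?b k = ?b k0" using eq by simp
        then show False using lt grlex_irrefl by metis
      qed
      then have "i0 < j" using \<open>i0 \<le> j\<close> by simp
      have lk: "lkp (?b k) l + (if j = l then 1 else 0) = lkp (?b k0) l + (if i0 = l then 1 else 0)" for l
        using arg_cong[OF eq, of "\<lambda>m. lkp m l"] unfolding lookup_add lookup_single when_def .
      have "lkp (?b k) j < lkp (?b k0) j" using lk[of j] \<open>j \<noteq> i0\<close>[symmetric] by simp
      moreover have "\<forall>l>j. lkp (?b k) l = lkp (?b k0) l"
      proof (intro allI impI)
        fix l assume "j < l"
        then have "j \<noteq> l" "i0 \<noteq> l" using \<open>i0 < j\<close> by auto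
        then show "lkp (?b k) l = lkp (?b k0) l" using lk[of l] by simp
      qed
      ultimately have "grlex (?b k) (?b k0)" unfolding grlex_def using d(2)[symmetric] by blast
      then show False using grlex_trans[OF lt] grlex_irrefl by blast
    qed
    have "0 = (\<Sum>k<?M. c k * jac_at n k \<alpha>)" using z by simp
    also have "\<dots> = c k0 * jac_at n k0 \<alpha>"
    proof -
      have "(\<Sum>k\<in>{..<?M} - {k0}. c k * jac_at n k \<alpha>) = 0" by (rule sum.neutral) (use other in blast)
      then show ?thesis using sum.remove[of "{..<?M}" k0 "\<lambda>k. c k * jac_at n k \<alpha>"] k0(1) by simp
    qed
    also have "jac_at n k0 \<alpha> = lkp ?G (sng i0 1)"
    proof -
      have "mle (?b k0) \<alpha>" unfolding \<alpha>_def mle_def lookup_add by simp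
      moreover have "\<alpha> - ?b k0 = sng i0 1" unfolding \<alpha>_def by simp
      ultimately show ?thesis unfolding jac_at_entry[OF n k0(1) \<alpha>_col refl] by simp
    qed
    finally show False using k0(2) i0 by simp
  qed
  moreover have "jac_at n k \<in> cspace (col_idx n)" for k by (simp add: cspace_def jac_at_def)
  moreover have "jac_at n k = 0" if "k \<ge> ?M" for k by (rule ext) (use that in \<open>simp add: jac_at_def\<close>)
  ultimately show ?thesis unfolding frames_iff by blast
qed

text \<open>The expansion of \<open>F\<close> at a singular point has no terms of degree below
  \<open>2\<close>. So a row \<open>\<beta>\<close> with degree \<open>n - 1\<close> is zero,
  and every maximal minor contains it.\<close>
lemma Delta_singular:
  assumes n: "n \<ge> 1" and J: "J \<in> Lam n" and sing: "\<And>i. ev (pderiv1 i F) = 0"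
  shows "ev (Delta n F J) = 0"
proof -
  let ?M = "numM TYPE('s) n"
  obtain j0 :: 's where True by simp
  have "sng j0 (n - 1) \<in> row_idx n" by (simp add: row_idx_def)
  then obtain i where i: "i < ?M" "grlex_list (row_idx n) ! i = sng j0 (n - 1)" using row_index(2)[OF n] by blast
  have len: "length J = ?M" "set J \<subseteq> col_idx n" using J by (simp_all add: Lam_def)
  have zero: "jac_at n i \<alpha> = 0" if a: "\<alpha> \<in> col_idx n" for \<alpha>
  proof (cases "mle (sng j0 (n - 1)) \<alpha>")
    case True
    have "mdeg (sng j0 (n - 1)) + mdeg (\<alpha> - sng j0 (n - 1)) = mdeg \<alpha>" using arg_cong[OF mle_add[OF True], of mdeg] unfolding mdeg_add .
    moreover have "mdeg \<alpha> \<le> n" using a by (simp add: col_idx_def)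
    ultimately have "mdeg (\<alpha> - sng j0 (n - 1)) = 0 \<or> mdeg (\<alpha> - sng j0 (n - 1)) = 1" using n unfolding mdeg_single by linarith
    then have "lkp (shift (vec_nth p) F) (\<alpha> - sng j0 (n - 1)) = 0"
    proof
      assume "mdeg (\<alpha> - sng j0 (n - 1)) = 0"
      then have "\<alpha> - sng j0 (n - 1) = 0" by (simp only: mdeg_eq_0)
      then show ?thesis by (simp only: shift_F_0)
    next
      assume "mdeg (\<alpha> - sng j0 (n - 1)) = 1"
      then obtain j where "\<alpha> - sng j0 (n - 1) = sng j 1" using mdeg_1_single by (elim exE[rotated]) blast
      then show ?thesis using sing unfolding ev_pderiv1 by simp
    qed
    then show ?thesis unfolding jac_at_entry[OF n i(1) a i(2)[symmetric]] by simp
  qed (simp add: jac_at_entry[OF n i(1) a i(2)[symmetric]])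
  have "minor (jac_at n) J = (\<Sum>j<?M. minor_mat (jac_at n) J $$ (i, j) * cofactor (minor_mat (jac_at n) J) i j)"
    unfolding minor_def by (rule laplace_expansion_row) (use len i in simp_all)
  also have "\<dots> = 0"
  proof (rule sum.neutral, rule ballI)
    fix j assume "j \<in> {..<?M}"
    then have "minor_mat (jac_at n) J $$ (i, j) = 0" using len i(1) zero[of "J ! j"] nth_mem[of j J] by (simp add: subset_iff)
    then show "minor_mat (jac_at n) J $$ (i, j) * cofactor (minor_mat (jac_at n) J) i j = 0" by simp
  qed
  finally show ?thesis unfolding ev_Delta[OF J] .
qed

end

section \<open>Limits of tangent spaces\<close>

text \<open>Pass to a subsequence along which orthonormal frames of the tangent spaces and of the row spaces
  of the Jacobian matrices converge. Orthogonality of the two passes to the limit, so by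
  dimension the limits \<open>S\<close> and \<open>Q\<close> are complementary. The factors
  \<open>c k\<close> relate the rows of the Jacobian matrix to the orthonormal frame of its row
  space.\<close>
lemma tangent_compactness:
  fixes F :: "'s::{finite,linorder} mpoly" and p :: "nat \<Rightarrow> (complex, 's) Finite_Cartesian_Product.vec" and n :: nat
  defines "I \<equiv> col_idx n :: 's midx set" and "M \<equiv> numM TYPE('s) n" and "d \<equiv> numN TYPE('s) n - numM TYPE('s) n - 1"
  assumes n: "n \<ge> 1" and p: "\<And>k. p k \<in> hypersurface F - sing_locus F"
  obtains r S Q c where "strict_mono (r :: nat \<Rightarrow> nat)" "S \<in> frames d I" "Q \<in> frames M I"
    "perp I (frame_span d S) = frame_span M Q"
    "limitin (Gr_top d I) (\<lambda>k. htangent n F (p (r k))) (frame_span d S) sequentially"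
    "\<And>T. limitin (Gr_top d I) (\<lambda>k. htangent n F (p (r k))) T sequentially \<Longrightarrow> frame_span d S = T"
    "\<And>J. J \<in> Lam n \<Longrightarrow> (\<lambda>k. c k * peval (vec_nth (p (r k))) (Delta n F J)) \<longlonglongrightarrow> minor Q J"
proof -
  have fin: "finite I" unfolding I_def by simp
  have hp: "hypersurface_point F (p k)" for k
    using p[of k] unfolding hypersurface_point_def hypersurface_def by blast
  define R where "R k = hypersurface_point.jac_at F (p k) n" for k
  have "\<exists>i. peval (vec_nth (p k)) (pderiv1 i F) \<noteq> 0" for k using p[of k] unfolding sing_locus_def by blast
  then have R: "R k \<in> frames M I" for k unfolding R_def M_def I_def by (rule hypersurface_point.jac_at_frame[OF hp n])
  have ht: "htangent n F (p k) = perp I (frame_span M (R k))" for k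
    unfolding R_def M_def I_def by (rule hypersurface_point.htangent_perp[OF hp n])
  have RG: "frame_span M (R k) \<in> Gr M I" for k by (rule frame_span_Gr[OF R])
  have card: "card I = numN TYPE('s) n - 1" unfolding I_def by (rule card_col_idx)
  have M: "M \<le> card I" "card I - M = d" "card I - d = M"
    using perp_Gr[OF fin RG[of 0]] card unfolding M_def d_def by auto
  have htG: "htangent n F (p k) \<in> Gr d I" for k
    unfolding ht M(2)[symmetric] using perp_Gr[OF fin RG] by blast
  have "\<forall>k. \<exists>B. orthonormal d I B \<and> frame_span d B = htangent n F (p k)"
  proof
    fix k
    obtain B where "orthonormal d I B" "frame_span d B = htangent n F (p k)" by (rule Gr_orthonormal[OF fin htG])
    then show "\<exists>B. orthonormal d I B \<and> frame_span d B = htangent n F (p k)" by (intro exI conjI)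
  qed
  from choice[OF this] obtain B where B': "\<forall>k. orthonormal d I (B k) \<and> frame_span d (B k) = htangent n F (p k)" by (elim exE)
  note B = spec[OF B', THEN conjunct1] spec[OF B', THEN conjunct2]
  have "\<forall>k. \<exists>C. orthonormal M I C \<and> frame_span M C = frame_span M (R k)"
  proof
    fix k
    obtain C where "orthonormal M I C" "frame_span M C = frame_span M (R k)" by (rule Gr_orthonormal[OF fin RG])
    then show "\<exists>C. orthonormal M I C \<and> frame_span M C = frame_span M (R k)" by (intro exI conjI)
  qed
  from choice[OF this] obtain C where C': "\<forall>k. orthonormal M I (C k) \<and> frame_span M (C k) = frame_span M (R k)" by (elim exE)
  note C = spec[OF C', THEN conjunct1] spec[OF C', THEN conjunct2]
  obtain r1 S where r1: "strict_mono (r1 :: nat \<Rightarrow> nat)" and S: "orthonormal d I S" and limB: "\<forall>j i. (\<lambda>k. B (r1 k) j i) \<longlonglongrightarrow> S j i"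
    using orthonormal_compact[OF fin, where B = B and d = d, OF B(1)] by (elim exE conjE)
  obtain r2 Q where r2: "strict_mono (r2 :: nat \<Rightarrow> nat)" and Q: "orthonormal M I Q" and limC: "\<forall>j i. (\<lambda>k. C (r1 (r2 k)) j i) \<longlonglongrightarrow> Q j i"
    using orthonormal_compact[OF fin, where B = "\<lambda>k. C (r1 k)" and d = M, OF C(1)] by (elim exE conjE)
  define r where "r k = r1 (r2 k)" for k
  have r: "strict_mono r" using strict_mono_o[OF r1 r2] unfolding r_def comp_def .
  have limB': "(\<lambda>k. B (r k) j i) \<longlonglongrightarrow> S j i" for j i
    using LIMSEQ_subseq_LIMSEQ[OF spec[OF spec[OF limB]] r2] unfolding r_def comp_def .
  have limC': "(\<lambda>k. C (r k) j i) \<longlonglongrightarrow> Q j i" for j i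
    using spec[OF spec[OF limC]] unfolding r_def .
  note fS = orthonormal_frame[OF S] and fQ = orthonormal_frame[OF Q] and fB = orthonormal_frame[OF B(1)] and fC = orthonormal_frame[OF C(1)]
  have pair: "(\<Sum>i\<in>I. Q l i * S j i) = 0" if lj: "l < M" "j < d" for l j
  proof -
    have "(\<Sum>i\<in>I. C k l i * B k j i) = 0" for k
    proof -
      have "B k j \<in> perp I (frame_span M (R k))" unfolding ht[symmetric] B(2)[symmetric] by (rule frame_in_span[OF lj(2)])
      then have "\<forall>t\<in>frame_span M (R k). (\<Sum>i\<in>I. B k j i * t i) = 0" unfolding perp_def by blast
      moreover have "C k l \<in> frame_span M (R k)" unfolding C(2)[symmetric] by (rule frame_in_span[OF lj(1)])
      ultimately have "(\<Sum>i\<in>I. B k j i * C k l i) = 0" by (rule bspec)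
      then show ?thesis by (simp only: mult.commute)
    qed
    moreover have "(\<lambda>k. \<Sum>i\<in>I. C (r k) l i * B (r k) j i) \<longlonglongrightarrow> (\<Sum>i\<in>I. Q l i * S j i)"
      by (intro tendsto_intros limB' limC')
    ultimately show ?thesis by (simp only: LIMSEQ_const_iff)
  qed
  have SG: "frame_span d S \<in> Gr d I" by (rule frame_span_Gr[OF fS])
  have in_perp: "Q l \<in> perp I (frame_span d S)" if l: "l < M" for l
    unfolding perp_def mem_Collect_eq
  proof (intro conjI ballI)
    show "Q l \<in> cspace I" using Q l unfolding orthonormal_def by blast
    fix t assume "t \<in> frame_span d S"
    then obtain c where c: "\<And>i. t i = (\<Sum>k<d. c k * S k i)" unfolding in_frame_span by blast
    have "(\<Sum>i\<in>I. Q l i * t i) = (\<Sum>k<d. c k * (\<Sum>i\<in>I. Q l i * S k i))"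
      unfolding c sum_distrib_left by (subst sum.swap) (simp only: mult.left_commute)
    then show "(\<Sum>i\<in>I. Q l i * t i) = 0" using pair[OF l] by simp
  qed
  have sub: "frame_span M Q \<subseteq> perp I (frame_span d S)"
    unfolding frame_span_def[of M] by (rule cv.span_minimal[OF _ subspace_perp]) (use in_perp in blast)
  have pG: "perp I (frame_span d S) \<in> Gr M I" using perp_Gr[OF fin SG] unfolding M(3) by blast
  have perp: "perp I (frame_span d S) = frame_span M Q"
    by (rule Gr_subset_eq[OF fin frame_span_Gr[OF fQ] pG sub, symmetric])
  have "\<forall>k. \<exists>c. \<forall>J. length J = M \<longrightarrow> minor (C k) J = c * minor (R k) J"
  proof
    fix k
    obtain c where "\<forall>J. length J = M \<longrightarrow> minor (C k) J = c * minor (R k) J"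
      using minors_proportional[OF R[of k] fC[of k] C(2)[of k, symmetric]] by (elim exE conjE)
    then show "\<exists>c. \<forall>J. length J = M \<longrightarrow> minor (C k) J = c * minor (R k) J" by (rule exI)
  qed
  from choice[OF this] obtain c where c: "\<forall>k. \<forall>J. length J = M \<longrightarrow> minor (C k) J = c k * minor (R k) J" by (elim exE)
  have D: "(\<lambda>k. c (r k) * peval (vec_nth (p (r k))) (Delta n F J)) \<longlonglongrightarrow> minor Q J" if J: "J \<in> Lam n" for J
  proof -
    have "length J = M" using J by (simp add: Lam_def M_def)
    then have "c k * peval (vec_nth (p k)) (Delta n F J) = minor (C k) J" for k
      using c unfolding hypersurface_point.ev_Delta[OF hp J] R_def by simp
    then show ?thesis using minor_tendsto[of "\<lambda>k. C (r k)" Q sequentially J, OF limC'] by simp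
  qed
  have lim: "limitin (Gr_top d I) (\<lambda>k. htangent n F (p (r k))) (frame_span d S) sequentially"
    unfolding B(2)[symmetric] by (rule frame_span_limit[OF fB fS limB'])
  have uniq: "frame_span d S = T" if T: "limitin (Gr_top d I) (\<lambda>k. htangent n F (p (r k))) T sequentially" for T
    by (rule limit_span_unique[OF fin B(1) S limB']) (use T in \<open>simp only: B(2)\<close>)
  show thesis by (rule that[OF r fS fQ perp lim uniq D])
qed

definition pluecker_vector :: "nat \<Rightarrow> (nat \<Rightarrow> 's::{finite,linorder} midx \<Rightarrow> complex) \<Rightarrow> 's midx list \<Rightarrow> complex" where
  "pluecker_vector n B J = (if J \<in> Lam n then minor B J else 0)"

lemma in_proj_pt: "v \<in> proj_pt u \<longleftrightarrow> (\<exists>c. c \<noteq> 0 \<and> v = csc c u)"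
  unfolding proj_pt_def mem_Collect_eq by (rule ex_cong1) (rule conj_commute)

lemma proj_pt_csc: assumes c: "c \<noteq> 0" shows "proj_pt (csc c u) = proj_pt u"
proof (rule Set.set_eqI, unfold in_proj_pt, rule iffI)
  fix v assume "\<exists>a. a \<noteq> 0 \<and> v = csc a (csc c u)"
  then obtain a where a: "a \<noteq> 0" "v = csc a (csc c u)" by (elim exE conjE)
  have "v = csc (a * c) u" unfolding a(2) by (rule ext) (simp add: mult.assoc)
  then show "\<exists>a. a \<noteq> 0 \<and> v = csc a u" using a(1) c by (intro exI[of _ "a * c"] conjI) simp_all
next
  fix v assume "\<exists>a. a \<noteq> 0 \<and> v = csc a u"
  then obtain a where a: "a \<noteq> 0" "v = csc a u" by (elim exE conjE)
  have "v = csc (a / c) (csc c u)" unfolding a(2) by (rule ext) (use c in simp)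
  then show "\<exists>a. a \<noteq> 0 \<and> v = csc a (csc c u)" using a(1) c by (intro exI[of _ "a / c"] conjI) simp_all
qed

lemma proj_pt_eqD: assumes "proj_pt u = proj_pt u'" shows "\<exists>c. c \<noteq> 0 \<and> u' = csc c u"
proof -
  have "u' = csc 1 u'" by (rule ext) simp
  then have "u' \<in> proj_pt u'" unfolding in_proj_pt by (intro exI[of _ 1] conjI) simp_all
  then show ?thesis unfolding assms[symmetric] in_proj_pt .
qed

text \<open>The frame chosen in \<open>pluecker\<close> has proportional minors.\<close>
lemma pluecker_eq:
  fixes B :: "nat \<Rightarrow> 's::{finite,linorder} midx \<Rightarrow> complex"
  assumes B: "B \<in> frames (numM TYPE('s) n) (col_idx n)"
  shows "pluecker n (frame_span (numM TYPE('s) n) B) = proj_pt (pluecker_vector n B)"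
proof -
  let ?M = "numM TYPE('s) n"
  let ?P = "\<lambda>B'. B' \<in> frames ?M (col_idx n) \<and> frame_span ?M B' = frame_span ?M B"
  define B' where "B' = (SOME B'. ?P B')"
  have B': "?P B'" unfolding B'_def by (rule someI[of ?P B]) (use B in simp)
  obtain c where c: "c \<noteq> 0" "\<forall>J. length J = ?M \<longrightarrow> minor B' J = c * minor B J"
    using minors_proportional[OF B B'[THEN conjunct1] B'[THEN conjunct2, symmetric]] by (elim exE conjE)
  have "pluecker_vector n B' = csc c (pluecker_vector n B)"
    by (rule ext) (use c(2) in \<open>simp add: pluecker_vector_def Lam_def\<close>)
  then have "proj_pt (pluecker_vector n B') = proj_pt (pluecker_vector n B)" using proj_pt_csc[OF c(1)] by simp
  then show ?thesis unfolding pluecker_def Let_def B'_def[symmetric] pluecker_vector_def[abs_def] .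
qed

lemma pluecker_vector_nonzero:
  fixes B :: "nat \<Rightarrow> 's::{finite,linorder} midx \<Rightarrow> complex"
  assumes "B \<in> frames (numM TYPE('s) n) (col_idx n)" shows "pluecker_vector n B \<noteq> 0"
proof
  assume z: "pluecker_vector n B = 0"
  obtain J where "J \<in> Lam n" "minor B J \<noteq> 0" using Lam_nonzero_minor[OF assms] by blast
  then show False using fun_cong[OF z, of J] by (simp add: pluecker_vector_def)
qed

text \<open>Suitable multiples of the minors of the Jacobian matrices along the sequence converge to the
  minors of a frame of the complement.\<close>
lemma limit_space_pluecker:
  fixes F :: "'s::{finite,linorder} mpoly"
  assumes n: "n \<ge> 1" and T: "T \<in> limit_spaces n F"
  obtains Q where "Q \<in> frames (numM TYPE('s) n) (col_idx n)" "perp (col_idx n) T = frame_span (numM TYPE('s) n) Q"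
    "pluecker_vector n Q \<in> limit_variety n F"
proof -
  let ?d = "numN TYPE('s) n - numM TYPE('s) n - 1"
  obtain p where p: "\<forall>k. p k \<in> hypersurface F - sing_locus F" "p \<longlonglongrightarrow> 0"
    "limitin (Gr_top ?d (col_idx n)) (\<lambda>k. htangent n F (p k)) T sequentially"
    using T unfolding limit_spaces_def Let_def mem_Collect_eq by (elim exE conjE)
  obtain r S Q c where r: "strict_mono r" and S: "S \<in> frames ?d (col_idx n)" and Q: "Q \<in> frames (numM TYPE('s) n) (col_idx n)"
    and perp: "perp (col_idx n) (frame_span ?d S) = frame_span (numM TYPE('s) n) Q"
    and limT: "limitin (Gr_top ?d (col_idx n)) (\<lambda>k. htangent n F (p (r k))) (frame_span ?d S) sequentially"
    and uniq: "\<And>T. limitin (Gr_top ?d (col_idx n)) (\<lambda>k. htangent n F (p (r k))) T sequentially \<Longrightarrow> frame_span ?d S = T"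
    and lim: "\<And>J. J \<in> Lam n \<Longrightarrow> (\<lambda>k. c k * peval (vec_nth (p (r k))) (Delta n F J)) \<longlonglongrightarrow> minor Q J"
    by (rule tangent_compactness[OF n spec[OF p(1)]]) (rule that)
  have "frame_span ?d S = T" by (rule uniq) (use limitin_subsequence[OF r p(3)] in \<open>simp only: comp_def\<close>)
  then have "perp (col_idx n) T = frame_span (numM TYPE('s) n) Q" using perp by simp
  moreover have "pluecker_vector n Q \<in> limit_variety n F"
  proof (rule limit_variety_if[where x = "\<lambda>k. vec_nth (p (r k))" and t = c])
    show "pluecker_vector n Q \<in> cspace (Lam n)" unfolding cspace_def pluecker_vector_def by simp
    show "peval (vec_nth (p (r k))) F = 0" for k using spec[OF p(1), of "r k"] unfolding hypersurface_def by blast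
    have "(\<lambda>k. p (r k)) \<longlonglongrightarrow> 0" using LIMSEQ_subseq_LIMSEQ[OF p(2) r] unfolding comp_def .
    from tendsto_vec_nth[OF this] show "(\<lambda>k. p (r k) $ i) \<longlonglongrightarrow> 0" for i by simp
    show "(\<lambda>k. c k * peval (vec_nth (p (r k))) (Delta n F J)) \<longlonglongrightarrow> pluecker_vector n Q J" if J: "J \<in> Lam n" for J
      using lim[OF J] J by (simp add: pluecker_vector_def)
  qed
  ultimately show thesis by (rule that[OF Q])
qed

text \<open>Write \<open>u\<close> as a limit of multiples of minors. Since \<open>u J0 \<noteq> 0\<close>,
  the minors at \<open>J0\<close> are eventually nonzero, so the points are nonsingular. Along a
  subsequence the tangent spaces converge to some \<open>T\<close>, and other multiples of the
  same minors converge to Pluecker coordinates of its complement. Two nonzero limits of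
  multiples of the same vectors are proportional.\<close>
lemma limit_variety_point:
  fixes F :: "'s::{finite,linorder} mpoly"
  assumes n: "n \<ge> 1" and F0: "peval (\<lambda>_. 0) F = 0" and u: "u \<in> limit_variety n F" "u \<noteq> 0"
  obtains T where "T \<in> limit_spaces n F" "pluecker n (perp (col_idx n) T) = proj_pt u"
proof -
  let ?d = "numN TYPE('s) n - numM TYPE('s) n - 1"
  obtain x t where x: "\<forall>k. peval (x k) F = 0" "\<forall>i. (\<lambda>k. x k i) \<longlonglongrightarrow> 0"
    "\<forall>J\<in>Lam n. (\<lambda>k. t k * peval (x k) (Delta n F J)) \<longlonglongrightarrow> u J"
    using limit_variety_only_if[OF u(1) F0] by (elim exE conjE)
  have supp: "u J = 0" if "J \<notin> Lam n" for J using u(1) that unfolding limit_variety_def cspace_def by blast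
  obtain J0 where J0: "u J0 \<noteq> 0" using u(2) by (metis ext zero_fun_apply)
  then have J0L: "J0 \<in> Lam n" using supp by blast
  have "\<forall>\<^sub>F k in sequentially. t k * peval (x k) (Delta n F J0) \<noteq> 0"
    by (rule tendsto_imp_eventually_ne[OF bspec[OF x(3) J0L] J0])
  then obtain N where N: "\<And>k. k \<ge> N \<Longrightarrow> t k * peval (x k) (Delta n F J0) \<noteq> 0" unfolding eventually_sequentially by blast
  define p :: "nat \<Rightarrow> (complex, 's) Finite_Cartesian_Product.vec" where "p k = vec_lambda (x (k + N))" for k
  have px: "vec_nth (p k) = x (k + N)" for k by (rule ext) (simp add: p_def)
  have hp: "hypersurface_point F (p k)" for k unfolding hypersurface_point_def px using x(1) by blast
  have p: "p k \<in> hypersurface F - sing_locus F" for k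
  proof -
    have "p k \<notin> sing_locus F"
    proof
      assume "p k \<in> sing_locus F"
      then have "peval (vec_nth (p k)) (pderiv1 i F) = 0" for i unfolding sing_locus_def by blast
      then have "peval (vec_nth (p k)) (Delta n F J0) = 0" by (rule hypersurface_point.Delta_singular[OF hp n J0L])
      then show False using N[of "k + N"] unfolding px by simp
    qed
    then show ?thesis unfolding hypersurface_def using x(1) by (simp add: px)
  qed
  have shiftN: "(\<lambda>k. f (k + N)) \<longlonglongrightarrow> l" if "f \<longlonglongrightarrow> l" for f and l :: complex using LIMSEQ_ignore_initial_segment[OF that] .
  have p0: "p \<longlonglongrightarrow> 0"
  proof (rule vec_tendstoI)
    show "(\<lambda>k. p k $ i) \<longlonglongrightarrow> 0 $ i" for i unfolding px using shiftN[OF spec[OF x(2)], of i] by simp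
  qed
  obtain r S Q c where r: "strict_mono r" and S: "S \<in> frames ?d (col_idx n)" and Q: "Q \<in> frames (numM TYPE('s) n) (col_idx n)"
    and perp: "perp (col_idx n) (frame_span ?d S) = frame_span (numM TYPE('s) n) Q"
    and limT: "limitin (Gr_top ?d (col_idx n)) (\<lambda>k. htangent n F (p (r k))) (frame_span ?d S) sequentially"
    and uniq: "\<And>T. limitin (Gr_top ?d (col_idx n)) (\<lambda>k. htangent n F (p (r k))) T sequentially \<Longrightarrow> frame_span ?d S = T"
    and lim: "\<And>J. J \<in> Lam n \<Longrightarrow> (\<lambda>k. c k * peval (vec_nth (p (r k))) (Delta n F J)) \<longlonglongrightarrow> minor Q J"
    by (rule tangent_compactness[OF n p]) (rule that)
  have "frame_span ?d S \<in> limit_spaces n F" unfolding limit_spaces_def Let_def mem_Collect_eq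
  proof (intro conjI exI[of _ "\<lambda>k. p (r k)"] allI)
    show "frame_span ?d S \<in> Gr ?d (col_idx n)" by (rule frame_span_Gr[OF S])
    show "p (r k) \<in> hypersurface F - sing_locus F" for k by (rule p)
    show "(\<lambda>k. p (r k)) \<longlonglongrightarrow> 0" using LIMSEQ_subseq_LIMSEQ[OF p0 r] unfolding comp_def .
  qed (rule limT)
  moreover have "pluecker n (perp (col_idx n) (frame_span ?d S)) = proj_pt u"
  proof -
    have lim': "(\<lambda>k. t (r k + N) * peval (vec_nth (p (r k))) (Delta n F J)) \<longlonglongrightarrow> u J" if J: "J \<in> Lam n" for J
      using LIMSEQ_subseq_LIMSEQ[OF shiftN[OF bspec[OF x(3) J]] r] unfolding comp_def px .
    have cross: "minor Q J * u J' = minor Q J' * u J" if J: "J \<in> Lam n" "J' \<in> Lam n" for J J'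
    proof (rule LIMSEQ_unique)
      let ?D = "\<lambda>J k. peval (vec_nth (p (r k))) (Delta n F J)"
      show "(\<lambda>k. (c k * ?D J k) * (t (r k + N) * ?D J' k)) \<longlonglongrightarrow> minor Q J * u J'"
        by (intro tendsto_mult lim lim' J)
      have "(\<lambda>k. (c k * ?D J' k) * (t (r k + N) * ?D J k)) \<longlonglongrightarrow> minor Q J' * u J"
        by (intro tendsto_mult lim lim' J)
      then show "(\<lambda>k. (c k * ?D J k) * (t (r k + N) * ?D J' k)) \<longlonglongrightarrow> minor Q J' * u J"
        by (simp only: mult.commute mult.left_commute mult.assoc)
    qed
    obtain J1 where J1: "J1 \<in> Lam n" "minor Q J1 \<noteq> 0" using Lam_nonzero_minor[OF Q] by blast
    have nz: "minor Q J0 \<noteq> 0" using cross[OF J1(1) J0L] J1(2) J0 by auto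
    have "u = csc (u J0 / minor Q J0) (pluecker_vector n Q)"
    proof
      fix J show "u J = csc (u J0 / minor Q J0) (pluecker_vector n Q) J"
      proof (cases "J \<in> Lam n")
        case True
        then show ?thesis using cross[OF True J0L] nz by (simp add: pluecker_vector_def field_simps)
      next
        case False
        then show ?thesis using supp[OF False] by (simp add: pluecker_vector_def)
      qed
    qed
    then have "proj_pt u = proj_pt (pluecker_vector n Q)"
      using proj_pt_csc[of "u J0 / minor Q J0" "pluecker_vector n Q"] J0 nz by simp
    then show ?thesis unfolding perp pluecker_eq[OF Q] by (rule sym)
  qed
  ultimately show thesis by (rule that)
qed

text \<open>Pluecker coordinates determine the complement, and the complement determines the space.\<close>
lemma inj_on_pluecker_perp:
  fixes F :: "'s::{finite,linorder} mpoly"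
  assumes n: "n \<ge> 1" shows "inj_on (\<lambda>T. pluecker n (perp (col_idx n) T)) (limit_spaces n F)"
proof (rule inj_onI)
  fix T T' assume T: "T \<in> limit_spaces n F" "T' \<in> limit_spaces n F"
    and eq: "pluecker n (perp (col_idx n) T) = pluecker n (perp (col_idx n) T')"
  let ?M = "numM TYPE('s) n" and ?d = "numN TYPE('s) n - numM TYPE('s) n - 1"
  obtain Q where Q: "Q \<in> frames ?M (col_idx n)" "perp (col_idx n) T = frame_span ?M Q" by (rule limit_space_pluecker[OF n T(1)])
  obtain Q' where Q': "Q' \<in> frames ?M (col_idx n)" "perp (col_idx n) T' = frame_span ?M Q'" by (rule limit_space_pluecker[OF n T(2)])
  have "proj_pt (pluecker_vector n Q) = proj_pt (pluecker_vector n Q')" using eq unfolding Q(2) Q'(2) pluecker_eq[OF Q(1)] pluecker_eq[OF Q'(1)] .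
  then obtain c where c: "c \<noteq> 0" "pluecker_vector n Q' = csc c (pluecker_vector n Q)" using proj_pt_eqD by metis
  have "minor Q' J = c * minor Q J" if J: "J \<in> Lam n" for J
    using fun_cong[OF c(2), of J] J by (simp add: pluecker_vector_def)
  then have "frame_span ?M Q = frame_span ?M Q'" by (rule Lam_minors_determine_span[OF finite_col_idx Q(1) Q'(1) c(1)])
  then have perp: "perp (col_idx n) T = perp (col_idx n) T'" unfolding Q(2) Q'(2) .
  have G: "T \<in> Gr ?d (col_idx n)" "T' \<in> Gr ?d (col_idx n)" using T unfolding limit_spaces_def Let_def by blast+
  from perp_perp[OF finite_col_idx G(1)] perp_perp[OF finite_col_idx G(2)]
  show "T = T'" unfolding perp by simp
qed

theorem theorem4p3:
  fixes F :: "'s::{finite,linorder} mpoly" and n :: nat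
  assumes "n \<ge> 1"
    and "squarefree F"
    and "\<nexists>c. F = pconst c"
    and "0 \<in> sing_locus F"
  shows "(\<forall>c. \<forall>u\<in>limit_variety n F. csc c u \<in> limit_variety n F) \<and>
    bij_betw (\<lambda>T. pluecker n (perp (col_idx n) T)) (limit_spaces n F)
      (proj_pt ` (limit_variety n F - {0}))"
proof (intro conjI allI ballI)
  have z: "vec_nth (0 :: (complex, 's) Finite_Cartesian_Product.vec) = (\<lambda>_. 0)" by (rule ext) simp
  have F0: "peval (\<lambda>_. 0) F = 0" using assms(4) unfolding sing_locus_def hypersurface_def z[symmetric] by blast
  show "csc c u \<in> limit_variety n F" if u: "u \<in> limit_variety n F" for c u
  proof -
    obtain x t where x: "\<forall>k. peval (x k) F = 0" "\<forall>i. (\<lambda>k. x k i) \<longlonglongrightarrow> 0"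
      "\<forall>J\<in>Lam n. (\<lambda>k. t k * peval (x k) (Delta n F J)) \<longlonglongrightarrow> u J"
      using limit_variety_only_if[OF u F0] by (elim exE conjE)
    show ?thesis
    proof (rule limit_variety_if[where x = x and t = "\<lambda>k. c * t k"])
      have "u \<in> cspace (Lam n)" using u unfolding limit_variety_def by blast
      then show "csc c u \<in> cspace (Lam n)" unfolding cspace_def by simp
      show "(\<lambda>k. c * t k * peval (x k) (Delta n F J)) \<longlonglongrightarrow> csc c u J" if J: "J \<in> Lam n" for J
        unfolding csc_apply mult.assoc by (rule tendsto_mult_left[OF bspec[OF x(3) J]])
    qed (use x in blast)+
  qed
  show "bij_betw (\<lambda>T. pluecker n (perp (col_idx n) T)) (limit_spaces n F) (proj_pt ` (limit_variety n F - {0}))"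
    unfolding bij_betw_def
  proof (intro conjI equalityI subsetI)
    show "inj_on (\<lambda>T. pluecker n (perp (col_idx n) T)) (limit_spaces n F)" by (rule inj_on_pluecker_perp[OF assms(1)])
    fix y assume "y \<in> (\<lambda>T. pluecker n (perp (col_idx n) T)) ` limit_spaces n F"
    then obtain T where T: "T \<in> limit_spaces n F" "y = pluecker n (perp (col_idx n) T)" by blast
    obtain Q where Q: "Q \<in> frames (numM TYPE('s) n) (col_idx n)" "perp (col_idx n) T = frame_span (numM TYPE('s) n) Q"
      "pluecker_vector n Q \<in> limit_variety n F" by (rule limit_space_pluecker[OF assms(1) T(1)])
    show "y \<in> proj_pt ` (limit_variety n F - {0})"
    proof (rule image_eqI)
      show "y = proj_pt (pluecker_vector n Q)" unfolding T(2) Q(2) by (rule pluecker_eq[OF Q(1)])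
      show "pluecker_vector n Q \<in> limit_variety n F - {0}" using Q(3) pluecker_vector_nonzero[OF Q(1)] by simp
    qed
  next
    fix y assume "y \<in> proj_pt ` (limit_variety n F - {0})"
    then obtain u where u: "y = proj_pt u" "u \<in> limit_variety n F - {0}" by (rule imageE)
    have u': "u \<in> limit_variety n F" "u \<noteq> 0" using u(2) by simp_all
    obtain T where T: "T \<in> limit_spaces n F" "pluecker n (perp (col_idx n) T) = proj_pt u"
      by (rule limit_variety_point[OF assms(1) F0 u'])
    show "y \<in> (\<lambda>T. pluecker n (perp (col_idx n) T)) ` limit_spaces n F"
      unfolding u(1) T(2)[symmetric] by (rule imageI[OF T(1)])
  qed
qed

end
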